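(* Assume $\|\mathrm{div}\,V\|_{L^N(\mathbb{T}^N)}\le\frac1\chi$ and let $u_0:\mathbb{R}^N\to\mathbb{R}$ be bounded and uniformly continuous. For $\varepsilon>0$ let $u_\varepsilon$ be the (unique bounded) viscosity solution of $\partial_t u_\varepsilon(x,t)+H(x/\varepsilon,Du_\varepsilon(x,t))=0$ in $\mathbb{R}^N\times(0,+\infty)$, $u_\varepsilon(\cdot,0)=u_0$ in $\mathbb{R}^N$. Then, as $\varepsilon\to0$, $u_\varepsilon$ converges locally uniformly in $\mathbb{R}^N\times[0,+\infty)$ to the unique viscosity solution $u$ of $\partial_t u(x,t)+\overline H(Du(x,t))=0$ in $\mathbb{R}^N\times(0,+\infty)$, $u(\cdot,0)=u_0$ in $\mathbb{R}^N$.
   Context: $V:\mathbb{R}^N\to\mathbb{R}^N$ is $\mathbb{Z}^N$-periodic and Lipschitz continuous; $\mathbb{T}^N=\mathbb{R}^N/\mathbb{Z}^N$; $\chi$ is the isoperimetric constant of $\mathbb{T}^N$ (smallest constant with $|\Theta|^{1-1/N}\le\chi\,\mathcal{H}^{N-1}(\partial\Theta)$ for all $\Theta\subset\mathbb{T}^N$ with Lipschitz boundary; equal to the relative isoperimetric constant of $(0,1/2)^N$). $H(x,p)=|p|+p\cdot V(x)$. The effective Hamiltonian is $\overline H(P)=\inf\{a\in\mathbb{R}\mid H(x,Du+P)=a$ admits an upper semicontinuous, bounded, $\mathbb{Z}^N$-periodic viscosity subsolution on $\mathbb{R}^N\}$, $P\in\mathbb{R}^N$.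
   Formalization: χ as defined is infinite (the whole torus has empty boundary), so it is taken as the least constant with min(|Θ|,|T^N∖Θ|)^{1-1/N} ≤ χ Per(Θ), for all measurable Θ and with De Giorgi perimeter; uniqueness of u is among bounded continuous solutions. *)

theory Defs
  imports "HOL-Analysis.Analysis"
begin

definition Zlat :: "'a::euclidean_space set" where
  "Zlat = {k. \<forall>b\<in>Basis. k \<bullet> b \<in> \<int>}"

definition Zperiodic :: "('a::euclidean_space \<Rightarrow> 'b) \<Rightarrow> bool" where
  "Zperiodic f \<longleftrightarrow> (\<forall>x. \<forall>k\<in>Zlat. f (x + k) = f x)"

text \<open>Z^N-periodic subsets of R^N, i.e. subsets of the torus T^N.\<close>
definition Zperiodic_set :: "'a::euclidean_space set \<Rightarrow> bool" where
  "Zperiodic_set S \<longleftrightarrow> (\<forall>x. \<forall>k\<in>Zlat. x + k \<in> S \<longleftrightarrow> x \<in> S)"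

definition cell :: "'a::euclidean_space set" where
  "cell = cbox 0 One"

definition Ham :: "('a::euclidean_space \<Rightarrow> 'a) \<Rightarrow> 'a \<Rightarrow> 'a \<Rightarrow> real" where
  "Ham V x p = norm p + p \<bullet> V x"

text \<open>Pointwise divergence (sum of partial derivatives); for Lipschitz V it
  exists a.e. (Rademacher) and coincides with the weak divergence.\<close>
definition divergence :: "('a::euclidean_space \<Rightarrow> 'a) \<Rightarrow> 'a \<Rightarrow> real" where
  "divergence V x = (\<Sum>b\<in>Basis. deriv (\<lambda>h. V (x + h *\<^sub>R b) \<bullet> b) 0)"

definition C1_field :: "('a::euclidean_space \<Rightarrow> 'a) \<Rightarrow> ('a \<Rightarrow> 'a \<Rightarrow> 'a) \<Rightarrow> bool" where
  "C1_field \<phi> D \<longleftrightarrow> (\<forall>y. (\<phi> has_derivative D y) (at y)) \<and>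
      (\<forall>b\<in>Basis. continuous_on UNIV (\<lambda>y. D y b))"

text \<open>Perimeter (De Giorgi) in the torus of a periodic set Theta.\<close>
definition torus_perimeter :: "'a::euclidean_space set \<Rightarrow> ereal" where
  "torus_perimeter \<Theta> = (SUP \<phi>\<in>{\<phi>. Zperiodic \<phi> \<and> (\<forall>y. norm (\<phi> y) \<le> 1) \<and>
        (\<exists>D. C1_field \<phi> D)}.
      ereal (integral (\<Theta> \<inter> cell) (divergence \<phi>)))"

definition iso_const :: "'a::euclidean_space itself \<Rightarrow> real" where
  "iso_const _ = Inf {C::real. C \<ge> 0 \<and>
     (\<forall>\<Theta>::'a set. Zperiodic_set \<Theta> \<and> \<Theta> \<in> sets lebesgue \<longrightarrow>
        ereal ((min (measure lebesgue (\<Theta> \<inter> cell)) (measure lebesgue (cell - \<Theta>)))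
                  powr (1 - 1 / real DIM('a)))
        \<le> ereal C * torus_perimeter \<Theta>)}"

definition usc :: "('a::topological_space \<Rightarrow> real) \<Rightarrow> bool" where
  "usc w \<longleftrightarrow> (\<forall>x c. w x < c \<longrightarrow> eventually (\<lambda>y. w y < c) (at x))"

definition C1_test :: "('a::euclidean_space \<Rightarrow> real) \<Rightarrow> ('a \<Rightarrow> 'a) \<Rightarrow> bool" where
  "C1_test \<phi> g \<longleftrightarrow> (\<forall>y. (\<phi> has_derivative (\<lambda>h. g y \<bullet> h)) (at y)) \<and> continuous_on UNIV g"

definition C1_test_t :: "('a::euclidean_space \<times> real \<Rightarrow> real) \<Rightarrow> ('a \<times> real \<Rightarrow> 'a)
     \<Rightarrow> ('a \<times> real \<Rightarrow> real) \<Rightarrow> bool" where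
  "C1_test_t \<phi> gx gt \<longleftrightarrow>
     (\<forall>z. (\<phi> has_derivative (\<lambda>(h,k). gx z \<bullet> h + gt z * k)) (at z)) \<and>
     continuous_on UNIV gx \<and> continuous_on UNIV gt"

definition loc_max :: "('b::metric_space \<Rightarrow> real) \<Rightarrow> 'b \<Rightarrow> bool" where
  "loc_max f z \<longleftrightarrow> (\<exists>e>0. \<forall>y\<in>ball z e. f y \<le> f z)"

definition loc_min :: "('b::metric_space \<Rightarrow> real) \<Rightarrow> 'b \<Rightarrow> bool" where
  "loc_min f z \<longleftrightarrow> (\<exists>e>0. \<forall>y\<in>ball z e. f z \<le> f y)"

definition stat_visc_sub :: "('a::euclidean_space \<Rightarrow> 'a \<Rightarrow> real) \<Rightarrow> 'a \<Rightarrow> real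
     \<Rightarrow> ('a \<Rightarrow> real) \<Rightarrow> bool" where
  "stat_visc_sub F P a w \<longleftrightarrow> usc w \<and>
     (\<forall>\<phi> g x. C1_test \<phi> g \<and> loc_max (\<lambda>y. w y - \<phi> y) x \<longrightarrow> F x (g x + P) \<le> a)"

definition Hbar :: "('a::euclidean_space \<Rightarrow> 'a) \<Rightarrow> 'a \<Rightarrow> real" where
  "Hbar V P = Inf {a. \<exists>w. stat_visc_sub (Ham V) P a w \<and> bounded (range w) \<and> Zperiodic w}"

definition evol_visc_sub :: "('a::euclidean_space \<Rightarrow> 'a \<Rightarrow> real) \<Rightarrow> ('a \<times> real \<Rightarrow> real) \<Rightarrow> bool" where
  "evol_visc_sub F u \<longleftrightarrow>
     (\<forall>\<phi> gx gt x t. t > 0 \<and> C1_test_t \<phi> gx gt \<and> loc_max (\<lambda>z. u z - \<phi> z) (x, t)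
        \<longrightarrow> gt (x, t) + F x (gx (x, t)) \<le> 0)"

definition evol_visc_super :: "('a::euclidean_space \<Rightarrow> 'a \<Rightarrow> real) \<Rightarrow> ('a \<times> real \<Rightarrow> real) \<Rightarrow> bool" where
  "evol_visc_super F u \<longleftrightarrow>
     (\<forall>\<phi> gx gt x t. t > 0 \<and> C1_test_t \<phi> gx gt \<and> loc_min (\<lambda>z. u z - \<phi> z) (x, t)
        \<longrightarrow> gt (x, t) + F x (gx (x, t)) \<ge> 0)"

definition cauchy_visc_sol :: "('a::euclidean_space \<Rightarrow> 'a \<Rightarrow> real) \<Rightarrow> ('a \<Rightarrow> real)
     \<Rightarrow> ('a \<times> real \<Rightarrow> real) \<Rightarrow> bool" where
  "cauchy_visc_sol F u0 u \<longleftrightarrow> continuous_on (UNIV \<times> {0..}) u \<and>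
     evol_visc_sub F u \<and> evol_visc_super F u \<and> (\<forall>x. u (x, 0) = u0 x)"

end

(*
  Subsolutions of the cell problem satisfy |Dv| + V . Dv <= C, so within time h a sublevel set {v < s}
  is carried into {v < s + C h} by every velocity V + phi with |phi| <= 1. Mollifying the indicator of
  {v < s} and moving it by -h (V + phi) shows that theta(s) = |{v < s}| grows at rate at least
  the integral of div V + div phi over {v < s}, divided by C; the supremum over phi is the De Giorgi
  perimeter. The smallness of div V, used only through its positive or its negative part (which have equal
  integrals), makes the isoperimetric term dominate strictly, so theta fills the torus after a time
  independent of v, which bounds the oscillation of v. Applied to Perron's solution of
  delta v + H(x, P + Dv) = 0 this produces supersolutions of the cell problem with constant arbitrarily
  close to Hbar(P); subsolutions exist by definition of Hbar. The perturbed test function method and the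
  comparison principle for Hbar then identify the half-relaxed limits of u_epsilon.
*)

theory Submission
  imports Defs
begin

section \<open>Upper semicontinuity and half-relaxed limits\<close>

text \<open>The obstacle is the lack of coercivity: V may be longer than 1, so a bound on H(x, P +
  Dv) gives no bound on Dv, and no equi-Lipschitz estimate or continuous corrector is at hand. Hence
  everything is done with semicontinuous functions: half-relaxed limits, the two envelopes in
  Perron's method, and a doubling of variables inside the perturbed test function method. The two
  Perron envelopes are never shown to coincide; the upper one is a subsolution, which controls its
  oscillation and bounds Hbar, and the lower one, lying below it, is a supersolution. The hypothesis
  on div V allows equality, yet a strict gain is required. If one of the two signed parts carried
  the whole L^N norm, the other would vanish, and equality of their integrals would force div V = 0.
  The fill time is independent of v because a growth law theta' >= gamma * theta^(1 - 1/N) leaves 0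
  in finite time, however small the initial measure. The isoperimetric constant is an infimum, so a
  crude inequality with constant 4N comes first, to show that it is taken over a nonempty
  set.\<close>

definition usc_on :: "'b::metric_space set \<Rightarrow> ('b \<Rightarrow> real) \<Rightarrow> bool" where
  "usc_on S f \<longleftrightarrow> (\<forall>z\<in>S. \<forall>c>f z. \<exists>r>0. \<forall>y\<in>S. dist y z < r \<longrightarrow> f y < c)"

lemma usc_iff_usc_on: "usc f \<longleftrightarrow> usc_on UNIV f"
proof
  assume u: "usc f"
  show "usc_on UNIV f" unfolding usc_on_def
  proof (intro ballI allI impI)
    fix z c assume "f z < c"
    then have "eventually (\<lambda>y. f y < c) (at z)" using u by (simp add: usc_def)
    then obtain d where "d > 0" "\<forall>y. y \<noteq> z \<and> dist y z < d \<longrightarrow> f y < c"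
      by (auto simp: eventually_at)
    then show "\<exists>r>0. \<forall>y\<in>UNIV. dist y z < r \<longrightarrow> f y < c" using \<open>f z < c\<close> by metis
  qed
next
  assume u: "usc_on UNIV f"
  show "usc f" unfolding usc_def eventually_at using u unfolding usc_on_def by blast
qed

lemma usc_onD:
  assumes "usc_on S f" "z \<in> S" "f z < c"
  obtains r where "r > 0" "\<And>y. y \<in> S \<Longrightarrow> dist y z < r \<Longrightarrow> f y < c"
  using assms unfolding usc_on_def by metis

lemma usc_on_subset: "usc_on S f \<Longrightarrow> T \<subseteq> S \<Longrightarrow> usc_on T f"
  unfolding usc_on_def by (meson subsetD)

lemma usc_on_continuous:
  assumes "continuous_on S f" shows "usc_on S f"
  unfolding usc_on_def
proof (intro ballI allI impI)
  fix z c assume z: "z \<in> S" "f z < c"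
  then obtain d where "d > 0" "\<forall>y\<in>S. dist y z < d \<longrightarrow> dist (f y) (f z) < c - f z"
    using assms unfolding continuous_on_iff by (metis diff_gt_0_iff_gt)
  then show "\<exists>r>0. \<forall>y\<in>S. dist y z < r \<longrightarrow> f y < c"
    by (intro exI[of _ d]) (force simp: dist_real_def)
qed

lemma usc_on_add:
  assumes "usc_on S f" "usc_on S g" shows "usc_on S (\<lambda>x. f x + g x)"
  unfolding usc_on_def
proof (intro ballI allI impI)
  fix z c assume z: "z \<in> S" "f z + g z < c"
  define e where "e = (c - (f z + g z)) / 2"
  have e: "e > 0" using z by (simp add: e_def)
  obtain r where r: "r > 0" "\<And>y. y \<in> S \<Longrightarrow> dist y z < r \<Longrightarrow> f y < f z + e"
    using usc_onD[OF assms(1) z(1), of "f z + e"] e by auto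
  obtain s where s: "s > 0" "\<And>y. y \<in> S \<Longrightarrow> dist y z < s \<Longrightarrow> g y < g z + e"
    using usc_onD[OF assms(2) z(1), of "g z + e"] e by auto
  have "f y + g y < c" if "y \<in> S" "dist y z < min r s" for y
    using r(2)[of y] s(2)[of y] that by (simp add: e_def field_simps)
  then show "\<exists>r>0. \<forall>y\<in>S. dist y z < r \<longrightarrow> f y + g y < c"
    using r s by (intro exI[of _ "min r s"]) auto
qed

lemma usc_on_diff_continuous:
  assumes "usc_on S f" "continuous_on S g" shows "usc_on S (\<lambda>x. f x - g x)"
  using usc_on_add[OF assms(1) usc_on_continuous[of S "\<lambda>x. - g x"]] assms(2)
  by (simp add: continuous_on_minus)

lemma usc_on_cmult:
  assumes "usc_on S f" "(0::real) < k" shows "usc_on S (\<lambda>x. k * f x)"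
  unfolding usc_on_def
proof (intro ballI allI impI)
  fix z c assume "z \<in> S" "k * f z < c"
  then have "f z < c / k" using assms(2) by (simp add: field_simps)
  then obtain r where "r > 0" "\<And>y. y \<in> S \<Longrightarrow> dist y z < r \<Longrightarrow> f y < c / k"
    using usc_onD[OF assms(1) \<open>z \<in> S\<close>] by metis
  then show "\<exists>r>0. \<forall>y\<in>S. dist y z < r \<longrightarrow> k * f y < c"
    using assms(2) by (intro exI[of _ r]) (auto simp: field_simps)
qed

lemma usc_on_compose:
  assumes "usc_on S f" "continuous_on T g" "\<And>x. x \<in> T \<Longrightarrow> g x \<in> S"
  shows "usc_on T (\<lambda>x. f (g x))"
  unfolding usc_on_def
proof (intro ballI allI impI)
  fix z c assume z: "z \<in> T" "f (g z) < c"
  obtain r where r: "r > 0" "\<And>y. y \<in> S \<Longrightarrow> dist y (g z) < r \<Longrightarrow> f y < c"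
    using usc_onD[OF assms(1) assms(3)[OF z(1)] z(2)] by metis
  obtain d where "d > 0" "\<forall>y\<in>T. dist y z < d \<longrightarrow> dist (g y) (g z) < r"
    using assms(2) z(1) r(1) unfolding continuous_on_iff by metis
  then show "\<exists>r>0. \<forall>y\<in>T. dist y z < r \<longrightarrow> f (g y) < c"
    using r assms(3) by (intro exI[of _ d]) auto
qed

text \<open>Weierstrass for semicontinuous functions. Without a maximum every z is beaten by some
  \<open>Y z\<close>, and semicontinuity keeps \<open>f\<close> below \<open>f (Y z)\<close> on a
  ball around z. Finitely many balls cover \<open>K\<close>, and the largest of their values
  \<open>f (Y z)\<close> would be exceeded by another of them.\<close>

lemma usc_on_attains:
  assumes "compact K" "K \<noteq> {}" "usc_on K f"
  obtains x where "x \<in> K" "\<And>y. y \<in> K \<Longrightarrow> f y \<le> f x"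
proof (rule ccontr)
  assume no: "\<not> thesis"
  have "\<forall>z\<in>K. \<exists>y\<in>K. f z < f y" using no that by (meson not_le)
  then obtain Y where Y: "\<And>z. z \<in> K \<Longrightarrow> Y z \<in> K \<and> f z < f (Y z)" by metis
  have "\<forall>z\<in>K. \<exists>r>0. \<forall>y\<in>K. dist y z < r \<longrightarrow> f y < f (Y z)"
    using assms(3) Y unfolding usc_on_def by blast
  then obtain R where R: "\<And>z. z \<in> K \<Longrightarrow> R z > 0 \<and> (\<forall>y\<in>K. dist y z < R z \<longrightarrow> f y < f (Y z))" by metis
  have "K \<subseteq> (\<Union>z\<in>K. ball z (R z))" using R by force
  then obtain C where C: "C \<subseteq> K" "finite C" "K \<subseteq> (\<Union>z\<in>C. ball z (R z))"
    using compactE_image[OF assms(1), of K "\<lambda>z. ball z (R z)"] by (metis open_ball)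
  have ne: "C \<noteq> {}" using C assms(2) by auto
  define m where "m = Max ((\<lambda>z. f (Y z)) ` C)"
  have "m \<in> (\<lambda>z. f (Y z)) ` C" unfolding m_def using C(2) ne by (intro Max_in) auto
  then obtain z where z: "z \<in> C" "m = f (Y z)" by auto
  have "Y z \<in> K" using z C Y by auto
  then obtain z' where z': "z' \<in> C" "Y z \<in> ball z' (R z')" using C(3) by blast
  then obtain z' where z': "z' \<in> C" "dist z' (Y z) < R z'" using C(3) by (auto simp: subset_eq)
  then have "f (Y z) < f (Y z')" using R[of z'] C(1) \<open>Y z \<in> K\<close> by (auto simp: dist_commute)
  moreover have "f (Y z') \<le> m" unfolding m_def using C(2) z' by (intro Max_ge) auto
  ultimately show False using z by simp
qed

lemma usc_on_seq:
  assumes "usc_on S f" "z \<in> S" "X \<longlonglongrightarrow> z" "\<And>n. X n \<in> S" "f z < c"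
  shows "eventually (\<lambda>n. f (X n) < c) sequentially"
proof -
  obtain r where r: "r > 0" "\<And>y. y \<in> S \<Longrightarrow> dist y z < r \<Longrightarrow> f y < c"
    using usc_onD[OF assms(1,2,5)] by metis
  have "eventually (\<lambda>n. dist (X n) z < r) sequentially" using assms(3) r(1) by (simp add: tendsto_iff)
  then show ?thesis by eventually_elim (use r assms(4) in auto)
qed

text \<open>The upper half-relaxed limit: the limsup of \<open>u e y\<close> as e tends to 0 from
  the right and y tends to z inside \<open>D\<close>, written as the infimum of the eventual upper
  bounds.\<close>

definition upper_lim :: "'b::metric_space set \<Rightarrow> (real \<Rightarrow> 'b \<Rightarrow> real) \<Rightarrow> 'b \<Rightarrow> real" where
  "upper_lim D u z = Inf {c. \<exists>r>0. \<forall>e y. 0 < e \<and> e < r \<and> y \<in> D \<and> dist y z < r \<longrightarrow> u e y \<le> c}"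

context
  fixes D :: "'b::metric_space set" and u :: "real \<Rightarrow> 'b \<Rightarrow> real" and B :: real
  assumes bd: "\<And>e y. e > 0 \<Longrightarrow> y \<in> D \<Longrightarrow> \<bar>u e y\<bar> \<le> B"
begin

lemma upper_lim_set_bound:
  assumes "z \<in> D" "r > 0" "\<forall>e y. 0 < e \<and> e < r \<and> y \<in> D \<and> dist y z < r \<longrightarrow> u e y \<le> c"
  shows "- B \<le> c"
proof -
  have "u (r/2) z \<le> c" using assms by auto
  moreover have "- B \<le> u (r/2) z" using bd[of "r/2" z] assms by (auto simp: abs_le_iff)
  ultimately show ?thesis by simp
qed

lemma upper_lim_bdd:
  assumes "z \<in> D"
  shows "bdd_below {c. \<exists>r>0. \<forall>e y. 0 < e \<and> e < r \<and> y \<in> D \<and> dist y z < r \<longrightarrow> u e y \<le> c}"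
  by (intro bdd_belowI[of _ "-B"]) (auto intro: upper_lim_set_bound[OF assms])

lemma upper_lim_mem: "B \<in> {c. \<exists>r>0. \<forall>e y. 0 < e \<and> e < r \<and> y \<in> D \<and> dist y z < r \<longrightarrow> u e y \<le> c}"
  using bd by (auto intro!: exI[of _ 1] simp: abs_le_iff)

lemma upper_lim_less:
  assumes "z \<in> D" "upper_lim D u z < c"
  obtains r where "r > 0" "\<And>e y. 0 < e \<Longrightarrow> e < r \<Longrightarrow> y \<in> D \<Longrightarrow> dist y z < r \<Longrightarrow> u e y < c"
proof -
  obtain c' where c': "c' < c" "c' \<in> {c. \<exists>r>0. \<forall>e y. 0 < e \<and> e < r \<and> y \<in> D \<and> dist y z < r \<longrightarrow> u e y \<le> c}"
    using cInf_lessD[OF _ assms(2)[unfolded upper_lim_def]] upper_lim_mem[of z] by force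
  then obtain r where "r > 0" "\<forall>e y. 0 < e \<and> e < r \<and> y \<in> D \<and> dist y z < r \<longrightarrow> u e y \<le> c'" by blast
  then show thesis using that c'(1) by (meson le_less_trans)
qed

lemma upper_lim_le:
  assumes "z \<in> D" "r > 0" "\<And>e y. 0 < e \<Longrightarrow> e < r \<Longrightarrow> y \<in> D \<Longrightarrow> dist y z < r \<Longrightarrow> u e y \<le> c"
  shows "upper_lim D u z \<le> c"
  unfolding upper_lim_def
  by (rule cInf_lower[OF _ upper_lim_bdd[OF assms(1)]]) (use assms in blast)

lemma less_upper_lim:
  assumes "z \<in> D" "c < upper_lim D u z" "r > 0"
  obtains e y where "0 < e" "e < r" "y \<in> D" "dist y z < r" "c < u e y"
  using upper_lim_le[OF assms(1,3), of c] assms(2) by (meson not_le)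

lemma upper_lim_abs:
  assumes "z \<in> D" shows "\<bar>upper_lim D u z\<bar> \<le> B"
proof -
  have "upper_lim D u z \<le> B" using upper_lim_le[OF assms, of 1 B] bd by (auto simp: abs_le_iff)
  moreover have "- B \<le> upper_lim D u z" unfolding upper_lim_def
  proof (rule cInf_greatest)
    show "{c. \<exists>r>0. \<forall>e y. 0 < e \<and> e < r \<and> y \<in> D \<and> dist y z < r \<longrightarrow> u e y \<le> c} \<noteq> {}"
      using upper_lim_mem[of z] by blast
  next
    fix c assume "c \<in> {c. \<exists>r>0. \<forall>e y. 0 < e \<and> e < r \<and> y \<in> D \<and> dist y z < r \<longrightarrow> u e y \<le> c}"
    then obtain r where "r > 0" "\<forall>e y. 0 < e \<and> e < r \<and> y \<in> D \<and> dist y z < r \<longrightarrow> u e y \<le> c" by auto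
    then show "- B \<le> c" by (rule upper_lim_set_bound[OF assms])
  qed
  ultimately show ?thesis by simp
qed

lemma usc_on_upper_lim: "usc_on D (upper_lim D u)"
  unfolding usc_on_def
proof (intro ballI allI impI)
  fix z c assume z: "z \<in> D" "upper_lim D u z < c"
  then obtain c' where c': "upper_lim D u z < c'" "c' < c" using dense by blast
  obtain r where r: "r > 0" "\<And>e y. 0 < e \<Longrightarrow> e < r \<Longrightarrow> y \<in> D \<Longrightarrow> dist y z < r \<Longrightarrow> u e y < c'"
    using upper_lim_less[OF z(1) c'(1)] by metis
  have "upper_lim D u y < c" if y: "y \<in> D" "dist y z < r/2" for y
  proof -
    have "upper_lim D u y \<le> c'"
    proof (rule upper_lim_le[OF y(1), of "r/2"])
      fix e y' assume "0 < e" "e < r/2" "y' \<in> D" "dist y' y < r/2"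
      then have "dist y' z < r" using dist_triangle[of y' z y] y by simp
      then show "u e y' \<le> c'" using r \<open>0 < e\<close> \<open>e < r/2\<close> \<open>y' \<in> D\<close> by (simp add: less_imp_le)
    qed (use r in auto)
    then show ?thesis using c' by simp
  qed
  then show "\<exists>r>0. \<forall>y\<in>D. dist y z < r \<longrightarrow> upper_lim D u y < c"
    using r(1) by (intro exI[of _ "r/2"]) auto
qed

text \<open>A pointwise strict inequality against a continuous bound holds on a neighbourhood for a
  common range of e, and finitely many neighbourhoods cover \<open>Q\<close>. This is how equality
  of the relaxed limits becomes uniform convergence.\<close>

lemma upper_lim_compact:
  assumes "compact Q" "Q \<subseteq> D" "continuous_on Q g" "\<And>z. z \<in> Q \<Longrightarrow> upper_lim D u z < g z"
  obtains r where "r > 0" "\<And>e z. 0 < e \<Longrightarrow> e < r \<Longrightarrow> z \<in> Q \<Longrightarrow> u e z < g z"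
proof -
  have "\<exists>r>0. \<forall>e y. 0 < e \<and> e < r \<and> y \<in> Q \<and> dist y z < r \<longrightarrow> u e y < g y" if z: "z \<in> Q" for z
  proof -
    obtain c where c: "upper_lim D u z < c" "c < g z" using assms(4)[OF z] dense by blast
    obtain r where r: "r > 0" "\<And>e y. 0 < e \<Longrightarrow> e < r \<Longrightarrow> y \<in> D \<Longrightarrow> dist y z < r \<Longrightarrow> u e y < c"
      using upper_lim_less c(1) z assms(2) by (metis subsetD)
    have "usc_on Q (\<lambda>y. - g y)" using assms(3) by (intro usc_on_continuous continuous_intros)
    then obtain s where s: "s > 0" "\<And>y. y \<in> Q \<Longrightarrow> dist y z < s \<Longrightarrow> - g y < - c"
      using usc_onD[of Q "\<lambda>y. - g y" z "- c"] z c(2) by auto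
    show ?thesis
    proof (intro exI[of _ "min r s"] conjI allI impI)
      fix e y assume "0 < e \<and> e < min r s \<and> y \<in> Q \<and> dist y z < min r s"
      then show "u e y < g y" using r(2)[of e y] s(2)[of y] assms(2) by auto
    qed (use r s in auto)
  qed
  then obtain R where R: "\<And>z. z \<in> Q \<Longrightarrow> R z > 0 \<and> (\<forall>e y. 0 < e \<and> e < R z \<and> y \<in> Q \<and> dist y z < R z \<longrightarrow> u e y < g y)" by metis
  have "Q \<subseteq> (\<Union>z\<in>Q. ball z (R z))" using R by force
  then obtain C where C: "C \<subseteq> Q" "finite C" "Q \<subseteq> (\<Union>z\<in>C. ball z (R z))"
    using compactE_image[OF assms(1), of Q "\<lambda>z. ball z (R z)"] by (metis open_ball)
  define r where "r = Min (insert 1 (R ` C))"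
  have r: "r > 0" "\<And>z. z \<in> C \<Longrightarrow> r \<le> R z" unfolding r_def using C R by (auto simp: subset_eq)
  show thesis
  proof (rule that[OF r(1)])
    fix e z assume e: "0 < e" "e < r" "z \<in> Q"
    then obtain z' where z': "z' \<in> C" "z \<in> ball z' (R z')" using C(3) by blast
    then have "e < R z'" "dist z z' < R z'" "z' \<in> Q" using e(2) r(2)[of z'] C(1) by (auto simp: dist_commute)
    then show "u e z < g z" using R e by blast
  qed
qed

end

text \<open>The bracket (1 + |x|^2)^(1/2): a C^1 substitute for the norm whose gradient has length
  at most 1. It confines maxima over unbounded sets.\<close>

definition jap :: "'a::real_inner \<Rightarrow> real" where "jap x = sqrt (1 + x \<bullet> x)"

lemma jap_ge: "1 \<le> jap x" "norm x \<le> jap x" "jap x > 0"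
proof -
  show "1 \<le> jap x" by (simp add: jap_def)
  then show "jap x > 0" by simp
  show "norm x \<le> jap x" unfolding jap_def norm_eq_sqrt_inner by simp
qed

lemma C1_test_jap: "C1_test (\<lambda>x::'a::euclidean_space. jap (x - a)) (\<lambda>x. (1 / jap (x - a)) *\<^sub>R (x - a))"
proof -
  have "((\<lambda>x. jap (x - a)) has_derivative (\<lambda>h. ((1 / jap (y - a)) *\<^sub>R (y - a)) \<bullet> h)) (at y)" for y
  proof -
    have p: "0 < 1 + (y - a) \<bullet> (y - a)" by (simp add: add_pos_nonneg)
    have 1: "((\<lambda>x. 1 + (x - a) \<bullet> (x - a)) has_derivative (\<lambda>h. 2 * ((y - a) \<bullet> h))) (at y)"
      by (auto intro!: derivative_eq_intros simp: inner_commute)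
    have 2: "(sqrt has_derivative (*) (inverse (sqrt (1 + (y - a) \<bullet> (y - a))) / 2)) (at (1 + (y - a) \<bullet> (y - a)))"
      using DERIV_real_sqrt[OF p] unfolding has_field_derivative_def .
    let ?s = "sqrt (1 + (y - a) \<bullet> (y - a))"
    have "((\<lambda>x. sqrt (1 + (x - a) \<bullet> (x - a))) has_derivative (\<lambda>h. inverse ?s / 2 * (2 * ((y - a) \<bullet> h)))) (at y)"
      using has_derivative_compose[OF 1 2] .
    moreover have "(\<lambda>h. inverse ?s / 2 * (2 * ((y - a) \<bullet> h))) = (\<lambda>h. ((1 / ?s) *\<^sub>R (y - a)) \<bullet> h)"
      unfolding inner_scaleR_left by (simp add: fun_eq_iff field_simps)
    ultimately show ?thesis by (simp only: jap_def)
  qed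
  moreover have "continuous_on UNIV (\<lambda>x. (1 / jap (x - a)) *\<^sub>R (x - a))"
    unfolding jap_def by (intro continuous_intros) (auto simp: add_nonneg_eq_0_iff)
  ultimately show ?thesis by (auto simp: C1_test_def)
qed

lemma norm_grad_jap: "norm ((1 / jap y) *\<^sub>R y) \<le> 1"
  using jap_ge[of y] by (simp add: divide_le_eq_1)

lemma continuous_on_jap: "continuous_on S f \<Longrightarrow> continuous_on S (\<lambda>x. jap (f x))"
  unfolding jap_def by (intro continuous_intros)

section \<open>Calculus of C^1 test functions\<close>

lemma C1_test_sq: "C1_test (\<lambda>x::'a::euclidean_space. (norm (x - a))\<^sup>2) (\<lambda>x. 2 *\<^sub>R (x - a))"
  unfolding C1_test_def power2_norm_eq_inner
  by (auto intro!: derivative_eq_intros continuous_intros simp: inner_commute inner_diff algebra_simps fun_eq_iff)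

lemma C1_test_add: "C1_test f g \<Longrightarrow> C1_test f' g' \<Longrightarrow> C1_test (\<lambda>x. f x + f' x) (\<lambda>x. g x + g' x)"
  unfolding C1_test_def by (auto intro!: derivative_eq_intros continuous_intros simp: inner_add_left)

lemma C1_test_cmult: "C1_test f g \<Longrightarrow> C1_test (\<lambda>x. k * f x) (\<lambda>x. k *\<^sub>R g x)"
  unfolding C1_test_def by (auto intro!: derivative_eq_intros continuous_intros)

lemma C1_test_minus: "C1_test f g \<Longrightarrow> C1_test (\<lambda>x. - f x) (\<lambda>x. - g x)"
  using C1_test_cmult[of f g "-1"] by simp

lemma C1_test_const: "C1_test (\<lambda>x. k) (\<lambda>x. 0)"
  unfolding C1_test_def by (auto intro!: derivative_eq_intros simp: fun_eq_iff)

lemma C1_test_t_alt: "C1_test_t \<phi> gx gt \<longleftrightarrow>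
     (\<forall>z. (\<phi> has_derivative (\<lambda>w. gx z \<bullet> fst w + gt z * snd w)) (at z)) \<and>
     continuous_on UNIV gx \<and> continuous_on UNIV gt"
  by (simp add: C1_test_t_def case_prod_unfold)

lemma C1_test_t_add: "C1_test_t f gx gt \<Longrightarrow> C1_test_t f' gx' gt' \<Longrightarrow>
    C1_test_t (\<lambda>z. f z + f' z) (\<lambda>z. gx z + gx' z) (\<lambda>z. gt z + gt' z)"
  unfolding C1_test_t_alt by (auto intro!: derivative_eq_intros continuous_intros simp: inner_add_left algebra_simps fun_eq_iff)

lemma C1_test_t_minus: "C1_test_t f gx gt \<Longrightarrow> C1_test_t (\<lambda>z. - f z) (\<lambda>z. - gx z) (\<lambda>z. - gt z)"
  unfolding C1_test_t_alt by (auto intro!: derivative_eq_intros continuous_intros)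

lemma C1_test_t_space:
  assumes "C1_test f g" shows "C1_test_t (\<lambda>z. f (fst z)) (\<lambda>z. g (fst z)) (\<lambda>z. 0)"
  unfolding C1_test_t_alt
proof (intro conjI allI)
  fix z :: "'a \<times> real"
  have "(f has_derivative (\<lambda>h. g (fst z) \<bullet> h)) (at (fst z))" using assms by (auto simp: C1_test_def)
  then show "((\<lambda>z. f (fst z)) has_derivative (\<lambda>w. g (fst z) \<bullet> fst w + 0 * snd w)) (at z)"
    using has_derivative_compose[OF has_derivative_fst[OF has_derivative_ident]] by fastforce
  show "continuous_on UNIV (\<lambda>z::'a \<times> real. g (fst z))"
    using assms unfolding C1_test_def by (auto intro!: continuous_on_compose2[of UNIV g] continuous_intros)
qed auto

lemma C1_test_t_time:
  assumes "\<And>t. (f has_real_derivative f' t) (at t)" "continuous_on UNIV f'"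
  shows "C1_test_t (\<lambda>z. f (snd z)) (\<lambda>z. 0) (\<lambda>z. f' (snd z))"
  unfolding C1_test_t_alt
proof (intro conjI allI)
  fix z :: "'a \<times> real"
  have "(f has_derivative (\<lambda>h. f' (snd z) * h)) (at (snd z))"
    using assms(1) by (simp add: has_field_derivative_def)
  then show "((\<lambda>z. f (snd z)) has_derivative (\<lambda>w. 0 \<bullet> fst w + f' (snd z) * snd w)) (at z)"
    using has_derivative_compose[OF has_derivative_snd[OF has_derivative_ident]] by fastforce
  show "continuous_on UNIV (\<lambda>z::'a \<times> real. f' (snd z))"
    using assms(2) by (auto intro!: continuous_on_compose2[of UNIV f'] continuous_intros)
qed auto

lemma C1_test_t_sq: "C1_test_t (\<lambda>z. k * (snd z - a)\<^sup>2) (\<lambda>z. 0) (\<lambda>z. 2 * k * (snd z - a))"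
  by (rule C1_test_t_time[where f = "\<lambda>t. k * (t - a)\<^sup>2" and f' = "\<lambda>t. 2 * k * (t - a)"])
     (auto intro!: derivative_eq_intros continuous_intros simp: algebra_simps)

lemma C1_test_t_lin: "C1_test_t (\<lambda>z. k * snd z) (\<lambda>z. 0) (\<lambda>z. k)"
  by (rule C1_test_t_time[where f = "\<lambda>t. k * t" and f' = "\<lambda>t. k"])
     (auto intro!: derivative_eq_intros continuous_intros)

lemma C1_test_continuous: "C1_test f g \<Longrightarrow> continuous_on S f"
  unfolding C1_test_def
  by (meson continuous_at_imp_continuous_on has_derivative_continuous)

lemma C1_test_t_continuous: "C1_test_t f g h \<Longrightarrow> continuous_on S f"
  unfolding C1_test_t_def
  by (meson continuous_at_imp_continuous_on has_derivative_continuous)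

text \<open>If $u$ is a supersolution for $F$, then $-u$ is a subsolution for the flipped Hamiltonian; supersolution statements are
  obtained from subsolution statements in this way.\<close>

definition flipH :: "('a::euclidean_space \<Rightarrow> 'a \<Rightarrow> real) \<Rightarrow> 'a \<Rightarrow> 'a \<Rightarrow> real" where
  "flipH F = (\<lambda>x p. - F x (- p))"

definition stat_visc_super :: "('a::euclidean_space \<Rightarrow> 'a \<Rightarrow> real) \<Rightarrow> 'a \<Rightarrow> real
     \<Rightarrow> ('a \<Rightarrow> real) \<Rightarrow> bool" where
  "stat_visc_super F P a w \<longleftrightarrow> stat_visc_sub (flipH F) (- P) (- a) (\<lambda>x. - w x)"

lemma loc_max_minus: "loc_max (\<lambda>z. - u z - \<phi> z) z0 \<longleftrightarrow> loc_min (\<lambda>z. u z - (- \<phi> z)) z0"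
proof -
  have "- u y - \<phi> y \<le> - u z0 - \<phi> z0 \<longleftrightarrow> u z0 - (- \<phi> z0) \<le> u y - (- \<phi> y)" for y by linarith
  then show ?thesis by (simp only: loc_max_def loc_min_def)
qed

lemma evol_visc_super_flip: "evol_visc_super F u \<longleftrightarrow> evol_visc_sub (flipH F) (\<lambda>z. - u z)"
proof
  assume s: "evol_visc_super F u"
  show "evol_visc_sub (flipH F) (\<lambda>z. - u z)" unfolding evol_visc_sub_def
  proof (intro allI impI)
    fix \<phi> gx gt x t assume a: "0 < t \<and> C1_test_t \<phi> gx gt \<and> loc_max (\<lambda>z. - u z - \<phi> z) (x, t)"
    then have "- gt (x,t) + F x (- gx (x,t)) \<ge> 0"
      using s[unfolded evol_visc_super_def, rule_format, of t "\<lambda>z. - \<phi> z" "\<lambda>z. - gx z" "\<lambda>z. - gt z" x]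
        C1_test_t_minus[of \<phi> gx gt] loc_max_minus[of u \<phi> "(x,t)"] by auto
    then show "gt (x, t) + flipH F x (gx (x, t)) \<le> 0" by (simp add: flipH_def)
  qed
next
  assume s: "evol_visc_sub (flipH F) (\<lambda>z. - u z)"
  show "evol_visc_super F u" unfolding evol_visc_super_def
  proof (intro allI impI)
    fix \<phi> gx gt x t assume a: "0 < t \<and> C1_test_t \<phi> gx gt \<and> loc_min (\<lambda>z. u z - \<phi> z) (x, t)"
    then have "- gt (x,t) + flipH F x (- gx (x,t)) \<le> 0"
      using s[unfolded evol_visc_sub_def, rule_format, of t "\<lambda>z. - \<phi> z" "\<lambda>z. - gx z" "\<lambda>z. - gt z" x]
        C1_test_t_minus[of \<phi> gx gt] loc_max_minus[of u "\<lambda>z. - \<phi> z" "(x,t)"] by auto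
    then show "0 \<le> gt (x, t) + F x (gx (x, t))" by (simp add: flipH_def)
  qed
qed

lemma stat_visc_superD:
  assumes "stat_visc_super F P a w" "C1_test \<phi> g" "loc_min (\<lambda>y. w y - \<phi> y) x"
  shows "a \<le> F x (g x + P)"
proof -
  have "flipH F x (- g x + - P) \<le> - a"
    using assms(1)[unfolded stat_visc_super_def stat_visc_sub_def] C1_test_minus[OF assms(2)]
      loc_max_minus[of w "\<lambda>y. - \<phi> y" x] assms(3) by fastforce
  then show ?thesis by (simp add: flipH_def add.commute)
qed

text \<open>Since |F x p| <= K |p|, a function with spatial slope \<open>A\<close> that rises at
  speed \<open>K * A\<close> is a supersolution. The bound depends on \<open>F\<close> only through
  \<open>K\<close>, hence is uniform over the rescaled Hamiltonians.\<close>

lemma barrier_sub: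
  fixes F :: "'a::euclidean_space \<Rightarrow> 'a \<Rightarrow> real" and u :: "'a \<times> real \<Rightarrow> real"
  assumes Fp: "\<And>x p q. \<bar>F x p - F x q\<bar> \<le> K * norm (p - q)" and F0: "\<And>x. F x 0 = 0"
    and K: "K \<ge> 0" and A: "A \<ge> 0"
    and usc: "usc_on (UNIV \<times> {0..}) u" and bd: "\<And>z. z \<in> UNIV \<times> {0..} \<Longrightarrow> \<bar>u z\<bar> \<le> B"
    and sub: "evol_visc_sub F u"
    and init: "\<And>x. u (x, 0) \<le> c + A * (jap (x - x0) - 1)"
    and t1: "t1 \<ge> 0"
  shows "u (x1, t1) \<le> c + A * (jap (x1 - x0) - 1) + K * A * t1"
proof (rule ccontr)
  assume neg: "\<not> ?thesis"
  define d where "d = u (x1, t1) - (c + A * (jap (x1 - x0) - 1) + K * A * t1)"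
  have d: "d > 0" using neg by (simp add: d_def)
  \<comment> \<open>\<open>\<eta>\<close> makes the barrier strict, and \<open>s\<close> makes it
    grow at infinity so that a maximum exists. Both are paid from the excess \<open>d\<close> at
    \<open>(x1, t1)\<close>; \<open>K * s < \<eta>\<close> preserves strictness in spite of the
    additional gradient \<open>s\<close>.\<close>
  define \<eta> where "\<eta> = d / (2 * (t1 + 1))"
  have \<eta>: "\<eta> > 0" "\<eta> * t1 < d / 2" using d t1 by (auto simp: \<eta>_def field_simps)
  define s where "s = min (\<eta> / (2 * (K + 1))) (d / (2 * jap (x1 - x0)))"
  have s: "s > 0" "K * s < \<eta>" "s * jap (x1 - x0) \<le> d / 2"
  proof -
    show "s > 0" using \<eta> d jap_ge[of "x1 - x0"] K by (auto simp: s_def)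
    have "(K + 1) * s \<le> (K + 1) * (\<eta> / (2 * (K + 1)))" using K by (intro mult_left_mono) (auto simp: s_def)
    also have "\<dots> = \<eta> / 2" using K by (simp add: field_simps)
    finally show "K * s < \<eta>" using \<open>s > 0\<close> \<eta>(1) by (simp add: algebra_simps)
    have "s * jap (x1 - x0) \<le> (d / (2 * jap (x1 - x0))) * jap (x1 - x0)"
      using jap_ge[of "x1 - x0"] by (intro mult_right_mono) (auto simp: s_def)
    then show "s * jap (x1 - x0) \<le> d / 2" using jap_ge[of "x1 - x0"] by simp
  qed
  define \<phi> where "\<phi> = (\<lambda>z::'a \<times> real. (A + s) * jap (fst z - x0) + (K * A + \<eta>) * snd z)"
  have \<phi>C1: "C1_test_t \<phi> (\<lambda>z. (A + s) *\<^sub>R ((1 / jap (fst z - x0)) *\<^sub>R (fst z - x0))) (\<lambda>z. K * A + \<eta>)"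
    using C1_test_t_add[OF C1_test_t_space[OF C1_test_cmult[OF C1_test_jap[of x0], of "A + s"]] C1_test_t_lin[of "K * A + \<eta>"]]
    unfolding \<phi>_def by simp
  define \<Psi> where "\<Psi> = (\<lambda>z. u z - \<phi> z)"
  have v1: "\<Psi> (x1, t1) > c - A"
    using s \<eta> unfolding \<Psi>_def \<phi>_def d_def by (simp add: algebra_simps)
  \<comment> \<open>Outside the box of this size one of \<open>s * norm (x - x0)\<close> and
    \<open>\<eta> * t\<close> exceeds \<open>B - c + A\<close>, which pushes \<open>\<Psi>\<close>
    below \<open>c - A\<close>.\<close>
  define R where "R = (B - c + A) / s + (B - c + A) / \<eta> + norm (x1 - x0) + t1"
  have B0: "B - (c - A) \<ge> 0"
  proof -
    have "0 \<le> (A + s) * jap (x1 - x0)" "0 \<le> (K * A + \<eta>) * t1"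
      using A s(1) jap_ge[of "x1 - x0"] K \<eta>(1) t1 by auto
    then have "\<Psi> (x1, t1) \<le> u (x1, t1)" unfolding \<Psi>_def \<phi>_def by simp
    also have "\<dots> \<le> B" using bd[of "(x1,t1)"] t1 by auto
    finally show ?thesis using v1 by simp
  qed
  have "B - c + A \<ge> 0" using B0 by simp
  then have q: "(B - c + A) / s \<ge> 0" "(B - c + A) / \<eta> \<ge> 0" using s(1) \<eta>(1) by auto
  define Kc where "Kc = cball x0 R \<times> {0..R}"
  have cK: "compact Kc" unfolding Kc_def by (intro compact_Times) auto
  have in1: "(x1, t1) \<in> Kc" using q t1 by (auto simp: Kc_def R_def dist_norm norm_minus_commute)
  have "usc_on Kc \<Psi>" unfolding \<Psi>_def
    by (intro usc_on_diff_continuous usc_on_subset[OF usc] C1_test_t_continuous[OF \<phi>C1]) (auto simp: Kc_def)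
  then obtain z where z: "z \<in> Kc" "\<And>y. y \<in> Kc \<Longrightarrow> \<Psi> y \<le> \<Psi> z"
    using usc_on_attains[OF cK] in1 by blast
  have vz: "\<Psi> z > c - A" using z(2)[OF in1] v1 by simp
  have glob: "\<Psi> y \<le> \<Psi> z" if y: "snd y \<ge> 0" for y
  proof (cases "y \<in> Kc")
    case False
    have b: "\<Psi> y \<le> B - s * norm (fst y - x0) - \<eta> * snd y"
    proof -
      have "s * norm (fst y - x0) \<le> (A + s) * jap (fst y - x0)"
        using A s(1) jap_ge[of "fst y - x0"] by (intro mult_mono) auto
      moreover have "\<eta> * snd y \<le> (K * A + \<eta>) * snd y" using K A y by (intro mult_right_mono) auto
      moreover have "u y \<le> B" using bd[of y] y by (cases y) auto
      ultimately show ?thesis unfolding \<Psi>_def \<phi>_def by simp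
    qed
    from False y consider "norm (fst y - x0) > R" | "snd y > R"
      by (cases y) (auto simp: Kc_def dist_norm norm_minus_commute not_le)
    then have "\<Psi> y \<le> c - A"
    proof cases
      case 1
      then have "(B - c + A) / s < norm (fst y - x0)" using q t1 norm_ge_zero[of "x1-x0"] unfolding R_def by linarith
      then have "B - c + A < s * norm (fst y - x0)" using s(1) by (simp add: field_simps)
      then show ?thesis using b y \<eta>(1) by (smt (verit) mult_nonneg_nonneg)
    next
      case 2
      then have "(B - c + A) / \<eta> < snd y" using q t1 norm_ge_zero[of "x1-x0"] unfolding R_def by linarith
      then have "B - c + A < \<eta> * snd y" using \<eta>(1) by (simp add: field_simps)
      then show ?thesis using b y s(1) norm_ge_zero[of "fst y - x0"] by (smt (verit) mult_nonneg_nonneg)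
    qed
    then show ?thesis using vz by simp
  qed (use z in auto)
  obtain xb tb where zb: "z = (xb, tb)" by (cases z)
  have tb: "tb \<ge> 0" using z(1) zb by (auto simp: Kc_def)
  show False
  proof (cases "tb = 0")
    case True
    have "\<Psi> z \<le> c - A - s * jap (xb - x0)" using init[of xb] unfolding \<Psi>_def \<phi>_def zb True by (simp add: algebra_simps)
    then show False using vz s(1) jap_ge[of "xb - x0"] by (smt (verit) mult_nonneg_nonneg)
  next
    case False
    then have tp: "tb > 0" using tb by simp
    have "loc_max (\<lambda>z. u z - \<phi> z) (xb, tb)" unfolding loc_max_def
    proof (intro exI[of _ tb] conjI ballI)
      fix y assume "y \<in> ball (xb, tb) tb"
      then have "dist tb (snd y) < tb" using dist_snd_le[of "(xb,tb)" y] by (auto intro: le_less_trans)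
      then have "snd y \<ge> 0" by (auto simp: dist_real_def abs_less_iff)
      then show "u y - \<phi> y \<le> u (xb, tb) - \<phi> (xb, tb)" using glob[of y] zb by (simp add: \<Psi>_def)
    qed (use tp in auto)
    then have "K * A + \<eta> + F xb ((A + s) *\<^sub>R ((1 / jap (xb - x0)) *\<^sub>R (xb - x0))) \<le> 0"
      using sub[unfolded evol_visc_sub_def, rule_format, of tb \<phi>, OF conjI[OF tp conjI[OF \<phi>C1]]] by simp
    moreover have "\<bar>F xb ((A + s) *\<^sub>R ((1 / jap (xb - x0)) *\<^sub>R (xb - x0)))\<bar> \<le> K * (A + s)"
    proof -
      let ?p = "(A + s) *\<^sub>R ((1 / jap (xb - x0)) *\<^sub>R (xb - x0))"
      have "norm ?p = (A + s) * norm ((1 / jap (xb - x0)) *\<^sub>R (xb - x0))"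
        using A s(1) by simp
      also have "\<dots> \<le> (A + s) * 1" using A s(1) by (intro mult_left_mono norm_grad_jap) auto
      finally have "norm ?p \<le> A + s" by simp
      then have "K * norm ?p \<le> K * (A + s)" using K by (intro mult_left_mono)
      then show ?thesis using Fp[of xb ?p 0] F0[of xb] by simp
    qed
    ultimately show False using s(2) by (simp add: algebra_simps abs_le_iff)
  qed
qed

section \<open>Comparison principle and perturbed test functions\<close>

abbreviation (input) halfsp :: "('a::euclidean_space \<times> real) set" where "halfsp \<equiv> UNIV \<times> {0..}"

text \<open>The equation is tested only at positive times, and a neighbourhood of such a point can
  be shrunk into the half-space; the values that HOL assigns at negative times therefore have no
  influence.\<close>

lemma evol_visc_sub_cong:
  assumes "\<And>z. z \<in> halfsp \<Longrightarrow> u z = v z" "evol_visc_sub F u"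
  shows "evol_visc_sub F v"
  unfolding evol_visc_sub_def
proof (intro allI impI)
  fix \<phi> gx gt x t
  assume a: "0 < t \<and> C1_test_t \<phi> gx gt \<and> loc_max (\<lambda>z. v z - \<phi> z) (x, t)"
  then obtain e where e: "e > 0" "\<And>y. y \<in> ball (x,t) e \<Longrightarrow> v y - \<phi> y \<le> v (x,t) - \<phi> (x,t)"
    by (auto simp: loc_max_def)
  have "loc_max (\<lambda>z. u z - \<phi> z) (x, t)" unfolding loc_max_def
  proof (intro exI[of _ "min e t"] conjI ballI)
    fix y assume y: "y \<in> ball (x, t) (min e t)"
    have "dist t (snd y) < t" using dist_snd_le[of "(x,t)" y] y by (auto intro: le_less_trans)
    then have "y \<in> halfsp" by (cases y) (auto simp: dist_real_def abs_less_iff)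
    then show "u y - \<phi> y \<le> u (x, t) - \<phi> (x, t)" using e(2)[of y] y a assms(1) by auto
  qed (use e a in auto)
  then show "gt (x, t) + F x (gx (x, t)) \<le> 0" using assms(2) a unfolding evol_visc_sub_def by blast
qed

text \<open>Doubling of variables. The Hamiltonian does not see x, so both functions receive the
  same penalty gradient and no modulus in x enters. Only the confining term \<open>s * jap\<close>
  separates the two gradients, at the cost \<open>K * s < \<eta>\<close>.\<close>

lemma comparison_autonomous:
  fixes F :: "'a::euclidean_space \<Rightarrow> real" and u v :: "'a \<times> real \<Rightarrow> real"
  assumes Fl: "\<And>p q. \<bar>F p - F q\<bar> \<le> K * norm (p - q)" and K: "K \<ge> 0"
    and uscu: "usc_on halfsp u" and uscv: "usc_on halfsp (\<lambda>z. - v z)"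
    and bu: "\<And>z. z \<in> halfsp \<Longrightarrow> \<bar>u z\<bar> \<le> B" and bv: "\<And>z. z \<in> halfsp \<Longrightarrow> \<bar>v z\<bar> \<le> B"
    and sub: "evol_visc_sub (\<lambda>x. F) u" and super: "evol_visc_super (\<lambda>x. F) v"
    and init: "\<And>x. u (x, 0) \<le> v (x, 0)" and t1: "t1 \<ge> 0"
  shows "u (x1, t1) \<le> v (x1, t1)"
proof (rule ccontr)
  assume neg: "\<not> ?thesis"
  define d where "d = u (x1, t1) - v (x1, t1)"
  have d: "d > 0" using neg by (simp add: d_def)
  define \<eta> where "\<eta> = d / (4 * (t1 + 1))"
  have \<eta>: "\<eta> > 0" "\<eta> * t1 \<le> d / 4" using d t1 by (auto simp: \<eta>_def field_simps)
  define s where "s = min (\<eta> / (2 * (K + 1))) (d / (4 * jap x1))"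
  have s: "s > 0" "K * s < \<eta>" "s * jap x1 \<le> d / 4"
  proof -
    show "s > 0" using \<eta> d jap_ge[of "x1"] K by (auto simp: s_def)
    have "(K + 1) * s \<le> (K + 1) * (\<eta> / (2 * (K + 1)))" using K by (intro mult_left_mono) (auto simp: s_def)
    also have "\<dots> = \<eta> / 2" using K by (simp add: field_simps)
    finally show "K * s < \<eta>" using \<open>s > 0\<close> \<eta>(1) by (simp add: algebra_simps)
    have "s * jap x1 \<le> (d / (4 * jap x1)) * jap x1"
      using jap_ge[of x1] by (intro mult_right_mono) (auto simp: s_def)
    then show "s * jap x1 \<le> d / 4" using jap_ge[of x1] by simp
  qed
  have B0: "B \<ge> 0" using bu[of "(x1,t1)"] t1 by auto
  define q where "q = (\<lambda>(z::'a\<times>real, z'::'a\<times>real). (norm (fst z - fst z'))\<^sup>2 + (snd z - snd z')\<^sup>2)"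
  have q0: "q w \<ge> 0" for w by (auto simp: q_def case_prod_unfold)
  define \<Phi> where "\<Phi> = (\<lambda>n::nat. \<lambda>w. u (fst w) - v (snd w) - (real (Suc n) * q w + s * jap (fst (fst w)) + \<eta> * snd (fst w)))"
  define R where "R = 2 * B / s + 2 * B / \<eta> + norm x1 + t1"
  define R' where "R' = R + 2 * B + 1"
  define Kc where "Kc = (cball (0::'a) R \<times> {0..R}) \<times> (cball (0::'a) R' \<times> {0..R'})"
  have cK: "compact Kc" unfolding Kc_def by (intro compact_Times) auto
  have pos: "2 * B / s \<ge> 0" "2 * B / \<eta> \<ge> 0" using B0 s \<eta> by auto
  have KcD: "Kc \<subseteq> halfsp \<times> halfsp" by (auto simp: Kc_def)
  have in1: "((x1,t1),(x1,t1)) \<in> Kc" using pos t1 B0 by (auto simp: Kc_def R_def R'_def)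
  have v1: "\<Phi> n ((x1,t1),(x1,t1)) \<ge> d / 2" for n
    using s(3) \<eta>(2) by (simp add: \<Phi>_def q_def d_def)
  have base: "usc_on (halfsp \<times> halfsp) (\<lambda>w. u (fst w) + - v (snd w))"
    by (intro usc_on_add usc_on_compose[OF uscu] usc_on_compose[OF uscv] continuous_intros) auto
  have contq: "continuous_on S q" for S unfolding q_def case_prod_unfold by (intro continuous_intros)
  have "usc_on Kc (\<Phi> n)" for n
  proof -
    have "usc_on (halfsp \<times> halfsp) (\<lambda>w. (u (fst w) + - v (snd w)) - (real (Suc n) * q w + s * jap (fst (fst w)) + \<eta> * snd (fst w)))"
      by (intro usc_on_diff_continuous base continuous_intros contq continuous_on_jap)
    then show ?thesis using usc_on_subset[OF _ KcD] by (simp add: \<Phi>_def)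
  qed
  then have "\<exists>w\<in>Kc. \<forall>y\<in>Kc. \<Phi> n y \<le> \<Phi> n w" for n
    using usc_on_attains[OF cK, of "\<Phi> n"] in1 by (metis empty_iff)
  then obtain Z where Z: "\<And>n. Z n \<in> Kc" "\<And>n y. y \<in> Kc \<Longrightarrow> \<Phi> n y \<le> \<Phi> n (Z n)" by metis
  have vZ: "\<Phi> n (Z n) \<ge> d / 2" for n using Z(2)[OF in1, of n] v1[of n] by linarith
  have upb: "\<Phi> n w \<le> 2 * B - (real (Suc n) * q w + s * jap (fst (fst w)) + \<eta> * snd (fst w))"
    if "w \<in> halfsp \<times> halfsp" for n w
    using bu[of "fst w"] bv[of "snd w"] that by (auto simp: \<Phi>_def abs_le_iff)
  have parts: "q w \<le> 2 * B / real (Suc n)" "s * norm (fst (fst w)) \<le> 2 * B" "\<eta> * snd (fst w) \<le> 2 * B"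
    if w: "w \<in> halfsp \<times> halfsp" "\<Phi> n w > 0" for n w
  proof -
    have a: "real (Suc n) * q w \<ge> 0" using q0[of w] by simp
    have b: "s * norm (fst (fst w)) \<le> s * jap (fst (fst w))" "s * norm (fst (fst w)) \<ge> 0"
      using s(1) jap_ge[of "fst (fst w)"] by (auto intro: mult_left_mono)
    have c: "\<eta> * snd (fst w) \<ge> 0" using \<eta>(1) w(1) by auto
    have e: "real (Suc n) * q w + s * jap (fst (fst w)) + \<eta> * snd (fst w) < 2 * B"
      using upb[OF w(1), of n] w(2) by linarith
    show "s * norm (fst (fst w)) \<le> 2 * B" "\<eta> * snd (fst w) \<le> 2 * B" using a b c e by linarith+
    have "real (Suc n) * q w \<le> 2 * B" using a b c e by linarith
    then show "q w \<le> 2 * B / real (Suc n)" by (simp add: field_simps)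
  qed
  \<comment> \<open>Confinement bounds the first point, and the penalty, whose coefficient is at
    least 1, keeps the second within \<open>2 * B + 1\<close> of it. So the box contains every place
    where \<open>\<Phi>\<close> is positive, and the maximum over the box is global.\<close>
  have inK: "w \<in> Kc" if w: "w \<in> halfsp \<times> halfsp" "\<Phi> n w > 0" for n w
  proof -
    obtain x t y r where we: "w = ((x,t),(y,r))" by (metis prod.collapse)
    have p: "norm x \<le> 2 * B / s" "t \<le> 2 * B / \<eta>"
      using parts(2,3)[OF w] s(1) \<eta>(1) by (auto simp: we field_simps)
    have "2 * B / real (Suc n) \<le> 2 * B / 1" using B0 by (intro divide_left_mono) auto
    then have "(norm (x - y))\<^sup>2 + (t - r)\<^sup>2 \<le> 2 * B" using parts(1)[OF w] by (simp add: we q_def)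
    then have "(norm (x - y))\<^sup>2 \<le> 2 * B" "(t - r)\<^sup>2 \<le> 2 * B" by (smt (verit) zero_le_power2)+
    moreover have "(2 * B + 1)\<^sup>2 = 4 * B\<^sup>2 + 4 * B + 1" by (simp add: power2_eq_square algebra_simps)
    then have "2 * B \<le> (2 * B + 1)\<^sup>2" using B0 zero_le_power2[of B] by linarith
    ultimately have "(norm (x - y))\<^sup>2 \<le> (2 * B + 1)\<^sup>2" "\<bar>t - r\<bar>\<^sup>2 \<le> (2 * B + 1)\<^sup>2"
      by simp_all
    then have n: "norm (x - y) \<le> 2 * B + 1" "\<bar>t - r\<bar> \<le> 2 * B + 1"
      using B0 by (auto intro: power2_le_imp_le)
    have "norm y \<le> norm x + norm (x - y)" by (metis norm_minus_commute norm_triangle_sub)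
    moreover have "norm x \<le> R" "t \<le> R" using p pos t1 norm_ge_zero[of x1] unfolding R_def by linarith+
    moreover from this have "norm y \<le> R'" "r \<le> R'" using n \<open>norm y \<le> norm x + norm (x - y)\<close> unfolding R'_def abs_le_iff by linarith+
    ultimately show ?thesis using w(1) unfolding we Kc_def by auto
  qed
  have glob: "\<Phi> n w \<le> \<Phi> n (Z n)" if "w \<in> halfsp \<times> halfsp" for n w
  proof (cases "\<Phi> n w > 0")
    case True then show ?thesis using Z(2) inK[OF that True] by blast
  next
    case False then show ?thesis using vZ[of n] d by linarith
  qed
  obtain l r where lr: "l \<in> Kc" "strict_mono r" "(Z \<circ> r) \<longlonglongrightarrow> l"
    using cK Z(1) unfolding compact_def by blast
  have lim: "(\<lambda>n. Z (r n)) \<longlonglongrightarrow> l" using lr(3) by (simp add: o_def)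
  have qZ: "q (Z (r n)) \<le> 2 * B / real (Suc n)" for n
  proof -
    have "q (Z (r n)) \<le> 2 * B / real (Suc (r n))"
    proof (rule parts(1))
      show "Z (r n) \<in> halfsp \<times> halfsp" using Z(1) KcD by blast
      show "\<Phi> (r n) (Z (r n)) > 0" using vZ[of "r n"] d by linarith
    qed
    also have "\<dots> \<le> 2 * B / real (Suc n)"
      using B0 seq_suble[OF lr(2), of n] by (intro divide_left_mono) auto
    finally show ?thesis .
  qed
  have "(\<lambda>n. q (Z (r n))) \<longlonglongrightarrow> q l"
    using contq[of UNIV] lim by (metis UNIV_I continuous_on_eq_continuous_at isCont_tendsto_compose open_UNIV)
  moreover have "(\<lambda>n. 2 * B / real (Suc n)) \<longlonglongrightarrow> 0"
    using LIMSEQ_Suc[OF lim_const_over_n[of "2*B"]] by simp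
  ultimately have "q l \<le> 0" using LIMSEQ_le qZ by blast
  then have "q l = 0" using q0[of l] by simp
  obtain x t where l: "l = ((x,t),(x,t))"
  proof -
    have "norm (fst (fst l) - fst (snd l)) = 0 \<and> snd (fst l) - snd (snd l) = 0"
      using \<open>q l = 0\<close> unfolding q_def case_prod_unfold by (simp add: sum_power2_eq_zero_iff add_nonneg_eq_0_iff)
    then show thesis using that by (metis norm_eq_zero prod.collapse right_minus_eq)
  qed
  have t0: "t \<ge> 0" using lr(1) l by (auto simp: Kc_def)
  \<comment> \<open>If the maxima accumulated at time 0, the initial ordering and semicontinuity
    would bring u - v below \<open>d / 2\<close> along the sequence, against the value of
    \<open>\<Phi>\<close> there. So some maximum has both times positive, and both equations can be
    tested.\<close>
  have "t > 0"
  proof (rule ccontr)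
    assume "\<not> t > 0"
    then have "t = 0" using t0 by simp
    then have "u (fst l) + - v (snd l) < d / 2" using init[of x] d l by simp
    then have "eventually (\<lambda>n. u (fst (Z (r n))) + - v (snd (Z (r n))) < d / 2) sequentially"
      using usc_on_seq[OF base _ lim] lr(1) KcD Z(1) by blast
    then obtain n where n: "u (fst (Z (r n))) - v (snd (Z (r n))) < d / 2"
      by (auto simp: eventually_sequentially)
    have "fst (Z (r n)) \<in> halfsp" using Z(1)[of "r n"] KcD by auto
    then have "real (Suc (r n)) * q (Z (r n)) \<ge> 0" "s * jap (fst (fst (Z (r n)))) \<ge> 0" "\<eta> * snd (fst (Z (r n))) \<ge> 0"
      using q0 s(1) \<eta>(1) jap_ge(3)[of "fst (fst (Z (r n)))"] by auto
    then show False using n vZ[of "r n"] unfolding \<Phi>_def by linarith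
  qed
  have "(\<lambda>n. snd (fst (Z (r n)))) \<longlonglongrightarrow> t" "(\<lambda>n. snd (snd (Z (r n)))) \<longlonglongrightarrow> t"
    using tendsto_snd[OF tendsto_fst[OF lim]] tendsto_snd[OF tendsto_snd[OF lim]] l by auto
  then have "eventually (\<lambda>n. snd (fst (Z (r n))) > 0) sequentially" "eventually (\<lambda>n. snd (snd (Z (r n))) > 0) sequentially"
    using \<open>t > 0\<close> by (auto simp: order_tendsto_iff)
  then have "eventually (\<lambda>n. snd (fst (Z (r n))) > 0 \<and> snd (snd (Z (r n))) > 0) sequentially"
    by (rule eventually_conj)
  then obtain m where m: "snd (fst (Z m)) > 0" "snd (snd (Z m)) > 0"
    by (auto simp: eventually_sequentially)
  obtain xb tb yb sb where Zm: "Z m = ((xb,tb),(yb,sb))" by (metis prod.collapse)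
  have tb: "tb > 0" "sb > 0" using m Zm by auto
  define N where "N = real (Suc m)"
  define \<phi> where "\<phi> = (\<lambda>z::'a\<times>real. (N * (norm (fst z - yb))\<^sup>2 + s * jap (fst z - 0)) + (N * (snd z - sb)\<^sup>2 + \<eta> * snd z))"
  define gx where "gx = (\<lambda>z::'a\<times>real. N *\<^sub>R (2 *\<^sub>R (fst z - yb)) + s *\<^sub>R ((1 / jap (fst z - 0)) *\<^sub>R (fst z - 0)))"
  have \<phi>C: "C1_test_t \<phi> gx (\<lambda>z. 2 * N * (snd z - sb) + \<eta>)"
    using C1_test_t_add[OF C1_test_t_space[OF C1_test_add[OF C1_test_cmult[OF C1_test_sq[of yb], of N] C1_test_cmult[OF C1_test_jap[of 0], of s]]]
      C1_test_t_add[OF C1_test_t_sq[of N sb] C1_test_t_lin[of \<eta>]]]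
    unfolding \<phi>_def gx_def by simp
  have "loc_max (\<lambda>z. u z - \<phi> z) (xb, tb)" unfolding loc_max_def
  proof (intro exI[of _ tb] conjI ballI)
    fix y assume "y \<in> ball (xb, tb) tb"
    then have "dist tb (snd y) < tb" using dist_snd_le[of "(xb,tb)" y] by (auto intro: le_less_trans)
    then have "y \<in> halfsp" by (cases y) (auto simp: dist_real_def abs_less_iff)
    then have "\<Phi> m (y, (yb,sb)) \<le> \<Phi> m ((xb,tb),(yb,sb))" using glob[of "(y,(yb,sb))" m] Zm tb by auto
    then show "u y - \<phi> y \<le> u (xb, tb) - \<phi> (xb, tb)"
      by (simp add: \<Phi>_def \<phi>_def q_def N_def algebra_simps)
  qed (use tb in auto)
  then have 1: "2 * N * (tb - sb) + \<eta> + F (gx (xb,tb)) \<le> 0"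
    using sub[unfolded evol_visc_sub_def, rule_format, OF conjI[OF tb(1) conjI[OF \<phi>C]]] by simp
  define \<psi> where "\<psi> = (\<lambda>z::'a\<times>real. - (N * (norm (fst z - xb))\<^sup>2 + N * (snd z - tb)\<^sup>2))"
  have \<psi>C: "C1_test_t \<psi> (\<lambda>z. - (N *\<^sub>R (2 *\<^sub>R (fst z - xb)))) (\<lambda>z. - (2 * N * (snd z - tb)))"
    using C1_test_t_minus[OF C1_test_t_add[OF C1_test_t_space[OF C1_test_cmult[OF C1_test_sq[of xb], of N]] C1_test_t_sq[of N tb]]]
    unfolding \<psi>_def by simp
  have "loc_min (\<lambda>z. v z - \<psi> z) (yb, sb)" unfolding loc_min_def
  proof (intro exI[of _ sb] conjI ballI)
    fix y assume "y \<in> ball (yb, sb) sb"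
    then have "dist sb (snd y) < sb" using dist_snd_le[of "(yb,sb)" y] by (auto intro: le_less_trans)
    then have "y \<in> halfsp" by (cases y) (auto simp: dist_real_def abs_less_iff)
    then have "\<Phi> m ((xb,tb), y) \<le> \<Phi> m ((xb,tb),(yb,sb))" using glob[of "((xb,tb),y)" m] Zm tb by auto
    then show "v (yb, sb) - \<psi> (yb, sb) \<le> v y - \<psi> y"
      by (simp add: \<Phi>_def \<psi>_def q_def N_def norm_minus_commute[of xb] power2_commute[of tb] algebra_simps)
  qed (use tb in auto)
  then have "0 \<le> - (2 * N * (sb - tb)) + F (- (N *\<^sub>R (2 *\<^sub>R (yb - xb))))"
    using super[unfolded evol_visc_super_def, rule_format, OF conjI[OF tb(2) conjI[OF \<psi>C]]] by simp
  moreover have "- (N *\<^sub>R (2 *\<^sub>R (yb - xb))) = N *\<^sub>R (2 *\<^sub>R (xb - yb))" by (simp add: algebra_simps)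
  ultimately have 2: "0 \<le> 2 * N * (tb - sb) + F (N *\<^sub>R (2 *\<^sub>R (xb - yb)))" by (simp add: algebra_simps)
  have "\<bar>F (gx (xb,tb)) - F (N *\<^sub>R (2 *\<^sub>R (xb - yb)))\<bar> \<le> K * norm (s *\<^sub>R ((1 / jap xb) *\<^sub>R xb))"
    using Fl[of "gx (xb,tb)" "N *\<^sub>R (2 *\<^sub>R (xb - yb))"] by (simp add: gx_def)
  also have "\<dots> = K * (s * norm ((1 / jap xb) *\<^sub>R xb))" using s(1) by simp
  also have "\<dots> \<le> K * (s * 1)" using K s(1) by (intro mult_left_mono norm_grad_jap) auto
  finally have "\<bar>F (gx (xb,tb)) - F (N *\<^sub>R (2 *\<^sub>R (xb - yb)))\<bar> < \<eta>" using s(2) by simp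
  then show False using 1 2 by (simp add: abs_less_iff)
qed

text \<open>Perturbed test functions with a corrector that is merely lower semicontinuous:
  \<open>\<phi> + e * w (x / e)\<close> is then no test function. Its spatial variable is separated
  from that of \<open>u e\<close> by a quadratic penalty, with e small but fixed, and the viscosity
  inequalities for \<open>u e\<close> and for \<open>w\<close> are subtracted.\<close>

lemma evol_visc_sub_upper_lim:
  fixes F :: "'a::euclidean_space \<Rightarrow> 'a \<Rightarrow> real" and u :: "real \<Rightarrow> 'a \<times> real \<Rightarrow> real"
  assumes Fp: "\<And>x p q. \<bar>F x p - F x q\<bar> \<le> K * norm (p - q)"
    and Fx: "\<And>x y p. \<bar>F x p - F y p\<bar> \<le> L * norm (x - y) * norm p"
    and K: "K \<ge> 0" and L: "L \<ge> 0"
    and bd: "\<And>e z. e > 0 \<Longrightarrow> z \<in> halfsp \<Longrightarrow> \<bar>u e z\<bar> \<le> B"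
    and usc: "\<And>e. e > 0 \<Longrightarrow> usc_on halfsp (u e)"
    and sub: "\<And>e. e > 0 \<Longrightarrow> evol_visc_sub (\<lambda>x. F ((1 / e) *\<^sub>R x)) (u e)"
    and corr: "stat_visc_super F P lam w" "\<And>x. \<bar>w x\<bar> \<le> W"
    and \<phi>: "C1_test_t \<phi> gx gt" and t0: "t0 > 0"
    and lm: "loc_max (\<lambda>z. upper_lim halfsp u z - \<phi> z) (x0, t0)" and P: "gx (x0, t0) = P"
  shows "gt (x0, t0) + lam \<le> 0"
proof (rule ccontr)
  assume neg: "\<not> ?thesis"
  \<comment> \<open>Three errors of at most \<open>\<tau>\<close> each will be met: the time
    derivative, the spatial gradient of the test function, and the x-dependence of \<open>F\<close>.
    The fourth share is the contradiction.\<close>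
  define \<tau> where "\<tau> = (gt (x0, t0) + lam) / 4"
  have \<tau>: "\<tau> > 0" using neg by (simp add: \<tau>_def)
  define U where "U = upper_lim halfsp u"
  define z0 where "z0 = (x0, t0)"
  \<comment> \<open>The squared distance to \<open>z0\<close> makes the local maximum strict, with a
    loss of \<open>r\<^sup>2\<close> on the sphere of radius \<open>r\<close>.\<close>
  define \<phi>2 where "\<phi>2 = (\<lambda>z. \<phi> z + ((norm (fst z - x0))\<^sup>2 + 1 * (snd z - t0)\<^sup>2))"
  define gx2 where "gx2 = (\<lambda>z. gx z + 2 *\<^sub>R (fst z - x0))"
  define gt2 where "gt2 = (\<lambda>z. gt z + 2 * 1 * (snd z - t0))"
  have \<phi>2C: "C1_test_t \<phi>2 gx2 gt2"
    using C1_test_t_add[OF \<phi> C1_test_t_add[OF C1_test_t_space[OF C1_test_sq[of x0]] C1_test_t_sq[of 1 t0]]]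
    unfolding \<phi>2_def gx2_def gt2_def by simp
  have \<phi>2d: "\<phi>2 z = \<phi> z + (dist z z0)\<^sup>2" for z
    by (cases z) (simp add: \<phi>2_def z0_def dist_prod_def dist_norm)
  have W0: "W \<ge> 0" using corr(2)[of 0] by simp
  have cg: "isCont gt2 z0" "isCont gx2 z0"
    using \<phi>2C unfolding C1_test_t_def by (simp_all add: continuous_on_eq_continuous_at del: split_paired_All)
  obtain e1 where e1: "e1 > 0" "\<And>z. dist z z0 < e1 \<Longrightarrow> dist (gt2 z) (gt2 z0) < \<tau>"
    using cg(1) \<tau> unfolding continuous_at_eps_delta by (metis dist_norm real_norm_def dist_real_def)
  obtain e2 where e2: "e2 > 0" "\<And>z. dist z z0 < e2 \<Longrightarrow> dist (gx2 z) (gx2 z0) < \<tau> / (K + 1)"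
    using cg(2) \<tau> K unfolding continuous_at_eps_delta by (metis add_nonneg_pos divide_pos_pos zero_less_one)
  obtain e3 where e3: "e3 > 0" "\<And>z. z \<in> ball z0 e3 \<Longrightarrow> U z - \<phi> z \<le> U z0 - \<phi> z0"
    using lm unfolding loc_max_def z0_def U_def by auto
  define r where "r = min (min e1 e2) (min e3 t0) / 2"
  have r: "r > 0" "r < e1" "r < e2" "r < e3" "r < t0" using e1 e2 e3 t0 by (auto simp: r_def)
  have cbD: "cball z0 r \<subseteq> halfsp"
  proof
    fix z assume "z \<in> cball z0 r"
    then have "dist t0 (snd z) \<le> r" using dist_snd_le[of z0 z] by (auto simp: z0_def)
    then show "z \<in> halfsp" using r(5) by (cases z) (auto simp: dist_real_def abs_le_iff)
  qed
  have z0D: "z0 \<in> halfsp" using cbD r by auto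
  define m where "m = U z0 - \<phi> z0"
  have c2: "continuous_on S \<phi>2" for S by (rule C1_test_t_continuous[OF \<phi>2C])
  have sph: "U z < m - r\<^sup>2 / 2 + \<phi>2 z" if "z \<in> sphere z0 r" for z
  proof -
    have "dist z z0 = r" using that by (simp add: dist_commute)
    moreover have "U z - \<phi> z \<le> m" unfolding m_def by (rule e3(2)) (use that r in auto)
    moreover have "r\<^sup>2 > 0" using r by simp
    ultimately show ?thesis using \<phi>2d[of z] unfolding \<open>dist z z0 = r\<close> by linarith
  qed
  obtain r1 where r1: "r1 > 0" "\<And>e z. 0 < e \<Longrightarrow> e < r1 \<Longrightarrow> z \<in> sphere z0 r \<Longrightarrow> u e z < m - r\<^sup>2 / 2 + \<phi>2 z"
  proof -
    have "sphere z0 r \<subseteq> halfsp" using cbD sphere_cball by blast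
    moreover have "continuous_on (sphere z0 r) (\<lambda>z. m - r\<^sup>2 / 2 + \<phi>2 z)" by (intro continuous_intros c2)
    ultimately show thesis
      using upper_lim_compact[of halfsp u B "sphere z0 r" "\<lambda>z. m - r\<^sup>2 / 2 + \<phi>2 z"] bd sph that
      unfolding U_def by (metis compact_sphere)
  qed
  have "isCont \<phi>2 z0" using c2[of UNIV] by (simp add: continuous_on_eq_continuous_at del: split_paired_All)
  moreover have "r\<^sup>2 / 16 > 0" using r by simp
  ultimately obtain r2 where r2: "r2 > 0" "\<And>z. dist z z0 < r2 \<Longrightarrow> dist (\<phi>2 z) (\<phi>2 z0) < r\<^sup>2 / 16"
    unfolding continuous_at_eps_delta by metis
  \<comment> \<open>Budget in units of r^2/16: one for the variation of \<open>\<phi>2\<close>, one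
    for missing the value \<open>U z0\<close>, one each time the corrector is estimated. On the
    sphere 8 units are lost, so the maxima found below stay in the open ball.\<close>
  define r3 where "r3 = min (min r1 r) (min r2 (r\<^sup>2 / (16 * (W + 1))))"
  have r3: "r3 > 0" "r3 \<le> r1" "r3 \<le> r" "r3 \<le> r2" "r3 \<le> r\<^sup>2 / (16 * (W + 1))" using r r1 r2 W0 by (auto simp: r3_def)
  obtain e z1 where ez: "0 < e" "e < r3" "z1 \<in> halfsp" "dist z1 z0 < r3" "U z0 - r\<^sup>2 / 16 < u e z1"
    using less_upper_lim[of halfsp u B z0 "U z0 - r\<^sup>2 / 16" r3] bd z0D r3(1) r unfolding U_def
    by (metis diff_less_eq less_add_same_cancel1 zero_less_divide_iff zero_less_numeral zero_less_power)
  have eW: "e * W \<le> r\<^sup>2 / 16"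
  proof -
    have "e * W \<le> e * (W + 1)" using ez by simp
    also have "\<dots> \<le> (r\<^sup>2 / (16 * (W + 1))) * (W + 1)" using ez r3 W0 by (intro mult_right_mono) auto
    also have "\<dots> = r\<^sup>2 / 16" using W0 by (simp add: field_simps)
    finally show ?thesis .
  qed
  have wb: "\<bar>e * w y\<bar> \<le> r\<^sup>2 / 16" for y
  proof -
    have "\<bar>e * w y\<bar> = e * \<bar>w y\<bar>" using ez by (simp add: abs_mult)
    also have "\<dots> \<le> e * W" using ez corr(2) by (intro mult_left_mono) auto
    finally show ?thesis using eW by simp
  qed
  have v1: "u e z1 - \<phi>2 z1 > m - r\<^sup>2 / 8"
  proof -
    have "\<bar>\<phi>2 z1 - \<phi>2 z0\<bar> < r\<^sup>2 / 16" using r2(2)[of z1] ez r3 by (auto simp: dist_real_def)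
    moreover have "\<phi>2 z0 = \<phi> z0" by (simp add: \<phi>2d)
    ultimately show ?thesis using ez(5) unfolding m_def by linarith
  qed
  define Kc where "Kc = cball z0 r \<times> cball x0 (r + 1)"
  have cK: "compact Kc" unfolding Kc_def by (intro compact_Times) auto
  define \<Psi> where "\<Psi> = (\<lambda>k::nat. \<lambda>c::(('a\<times>real)\<times>'a). u e (fst c) - \<phi>2 (fst c) - e * w ((1 / e) *\<^sub>R snd c) - 2 ^ k * (norm (fst (fst c) - snd c))\<^sup>2)"
  define c1 where "c1 = (z1, fst z1)"
  have c1K: "c1 \<in> Kc"
  proof -
    have "dist z1 z0 < r" using ez r3 by simp
    moreover have "dist (fst z1) x0 \<le> dist z1 z0" using dist_fst_le[of z1 z0] by (simp add: z0_def)
    ultimately show ?thesis by (auto simp: c1_def Kc_def dist_commute)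
  qed
  have v1c: "\<Psi> k c1 > m - r\<^sup>2 * 3 / 16" for k
    using v1 wb[of "(1 / e) *\<^sub>R fst z1"] by (simp add: \<Psi>_def c1_def abs_le_iff)
  have uscw: "usc_on UNIV (\<lambda>x. - w x)"
    using corr(1) by (simp add: stat_visc_super_def stat_visc_sub_def usc_iff_usc_on)
  have "usc_on Kc (\<Psi> k)" for k
  proof -
    have "usc_on Kc (\<lambda>c. ((u e (fst c) - \<phi>2 (fst c)) + e * - w ((1 / e) *\<^sub>R snd c)) - 2 ^ k * (norm (fst (fst c) - snd c))\<^sup>2)"
      by (intro usc_on_diff_continuous usc_on_add usc_on_cmult usc_on_compose[OF usc[OF ez(1)]]
            usc_on_compose[OF uscw] continuous_intros continuous_on_compose2[OF c2[of UNIV]])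
         (use ez cbD in \<open>auto simp: Kc_def\<close>)
    then show ?thesis by (simp add: \<Psi>_def)
  qed
  then have "\<exists>c\<in>Kc. \<forall>y\<in>Kc. \<Psi> k y \<le> \<Psi> k c" for k
    using usc_on_attains[OF cK, of "\<Psi> k"] c1K by (metis empty_iff)
  then obtain C where C: "\<And>k. C k \<in> Kc" "\<And>k y. y \<in> Kc \<Longrightarrow> \<Psi> k y \<le> \<Psi> k (C k)" by metis
  define M where "M = (\<lambda>k. \<Psi> k (C k))"
  define N where "N = (\<lambda>k. 2 ^ k * (norm (fst (fst (C (Suc k))) - snd (C (Suc k))))\<^sup>2)"
  have step: "M (Suc k) + N k \<le> M k" for k
    using C(2)[OF C(1)[of "Suc k"], of k] by (simp add: M_def N_def \<Psi>_def)
  have N0: "N k \<ge> 0" for k by (simp add: N_def)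
  have Mlow: "M k \<ge> m - r\<^sup>2 * 3 / 16" for k using C(2)[OF c1K, of k] v1c[of k] by (simp add: M_def)
  (* M is monotone and bounded, so its increments, which dominate the doubling penalty, tend to 0. *)
  have "decseq M" using step N0 by (intro decseq_SucI) (smt (verit))
  then obtain M0 where "M \<longlonglongrightarrow> M0" using decseq_convergent[of M] Mlow by blast
  then have "(\<lambda>k. M k - M (Suc k)) \<longlonglongrightarrow> M0 - M0" by (intro tendsto_diff LIMSEQ_Suc)
  then have dz: "(\<lambda>k. M k - M (Suc k)) \<longlonglongrightarrow> 0" by simp
  have N_lim: "N \<longlonglongrightarrow> 0"
    by (rule tendsto_sandwich[OF _ _ tendsto_const dz]) (use N0 step in \<open>auto simp: algebra_simps\<close>)
  define dd where "dd = (\<lambda>k. norm (fst (fst (C (Suc k))) - snd (C (Suc k))))"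
  have dle: "(dd k)\<^sup>2 \<le> N k" for k
  proof -
    have "1 * (dd k)\<^sup>2 \<le> 2 ^ k * (dd k)\<^sup>2" by (intro mult_right_mono) auto
    then show ?thesis by (simp add: N_def dd_def)
  qed
  have d2: "(\<lambda>k. (dd k)\<^sup>2) \<longlonglongrightarrow> 0"
    by (rule tendsto_sandwich[OF _ _ tendsto_const N_lim]) (use dle in auto)
  then have d_lim: "dd \<longlonglongrightarrow> 0"
    using tendsto_real_sqrt[OF d2] by (simp add: dd_def)
  have "(\<lambda>k. L / e * (dd k * norm P + 4 * N k)) \<longlonglongrightarrow> L / e * (0 * norm P + 4 * 0)"
    by (intro tendsto_intros d_lim N_lim)
  then have "eventually (\<lambda>k. L / e * (dd k * norm P + 4 * N k) < \<tau>) sequentially"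
    using \<tau> by (simp add: order_tendsto_iff)
  moreover have "eventually (\<lambda>k. dd k < 1) sequentially" using d_lim by (simp add: order_tendsto_iff)
  ultimately have "eventually (\<lambda>k. L / e * (dd k * norm P + 4 * N k) < \<tau> \<and> dd k < 1) sequentially"
    by (rule eventually_conj)
  then obtain k where k: "L / e * (dd k * norm P + 4 * N k) < \<tau>" "dd k < 1"
    by (auto simp: eventually_sequentially)
  obtain zb yb where Ck: "C (Suc k) = (zb, yb)" by (cases "C (Suc k)")
  obtain xb tb where zb: "zb = (xb, tb)" by (cases zb)
  define Nn where "Nn = (2::real) ^ Suc k"
  have mx: "u e z - \<phi>2 z - e * w ((1/e) *\<^sub>R y) - Nn * (norm (fst z - y))\<^sup>2
      \<le> u e zb - \<phi>2 zb - e * w ((1/e) *\<^sub>R yb) - Nn * (norm (xb - yb))\<^sup>2"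
    if "z \<in> cball z0 r" "y \<in> cball x0 (r+1)" for z y
    using C(2)[of "(z,y)" "Suc k"] that by (simp add: Ck zb \<Psi>_def Nn_def Kc_def)
  have zbK: "zb \<in> cball z0 r" "yb \<in> cball x0 (r+1)" using C(1)[of "Suc k"] by (auto simp: Ck Kc_def)
  have "zb \<notin> sphere z0 r"
  proof
    assume "zb \<in> sphere z0 r"
    then have "u e zb < m - r\<^sup>2 / 2 + \<phi>2 zb" using r1(2) ez r3 by auto
    moreover have "M (Suc k) \<le> u e zb - \<phi>2 zb + r\<^sup>2 / 16"
      using wb[of "(1/e) *\<^sub>R yb"] by (simp add: M_def Ck \<Psi>_def zb abs_le_iff add_increasing2 add.commute)
         (smt (verit) mult_nonneg_nonneg zero_le_power zero_le_power2)
    moreover have "r\<^sup>2 > 0" using r by simp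
    ultimately show False using Mlow[of "Suc k"] by linarith
  qed
  then have zbi: "dist z0 zb < r" using zbK by auto
  have tbp: "tb > 0"
  proof -
    have "dist t0 tb < r" using dist_snd_le[of z0 zb] zbi by (simp add: z0_def zb)
    then show ?thesis using r by (simp add: dist_real_def abs_less_iff)
  qed
  have ddk: "dd k = norm (xb - yb)" "N k = Nn / 2 * (norm (xb - yb))\<^sup>2"
    by (simp_all add: dd_def N_def Ck zb Nn_def)
  have ybi: "dist x0 yb < r + 1"
  proof -
    have "dist x0 xb < r" using dist_fst_le[of z0 zb] zbi by (simp add: z0_def zb)
    moreover have "dist xb yb < 1" using k(2) ddk by (simp add: dist_norm)
    ultimately show ?thesis using dist_triangle[of x0 yb xb] by simp
  qed
  define p where "p = Nn *\<^sub>R (2 *\<^sub>R (xb - yb))"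
  have 1: "gt2 zb + F ((1/e) *\<^sub>R xb) (gx2 zb + p) \<le> 0"
  proof -
    have T: "C1_test_t (\<lambda>z. \<phi>2 z + Nn * (norm (fst z - yb))\<^sup>2) (\<lambda>z. gx2 z + Nn *\<^sub>R (2 *\<^sub>R (fst z - yb))) (\<lambda>z. gt2 z)"
      using C1_test_t_add[OF \<phi>2C C1_test_t_space[OF C1_test_cmult[OF C1_test_sq[of yb], of Nn]]] by simp
    have "loc_max (\<lambda>z. u e z - (\<phi>2 z + Nn * (norm (fst z - yb))\<^sup>2)) (xb, tb)" unfolding loc_max_def
    proof (intro exI[of _ "r - dist z0 zb"] conjI ballI)
      fix y assume "y \<in> ball (xb,tb) (r - dist z0 zb)"
      then have "y \<in> cball z0 r" using dist_triangle[of z0 y zb] by (auto simp: zb)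
      from mx[OF this zbK(2)] show "u e y - (\<phi>2 y + Nn * (norm (fst y - yb))\<^sup>2) \<le> u e (xb,tb) - (\<phi>2 (xb,tb) + Nn * (norm (fst (xb,tb) - yb))\<^sup>2)"
        by (simp add: zb)
    qed (use zbi in auto)
    then show ?thesis
      using sub[OF ez(1), unfolded evol_visc_sub_def, rule_format, OF conjI[OF tbp conjI[OF T]]]
      by (simp add: zb p_def)
  qed
  have 2: "lam \<le> F ((1/e) *\<^sub>R yb) (p + P)"
  proof -
    \<comment> \<open>The corrector lives in the fast variable y/e. There the penalty, divided by e,
      is again quadratic, with coefficient \<open>Nn * e\<close>.\<close>
    define \<psi> where "\<psi> = (\<lambda>y::'a. - ((Nn * e) * (norm (y - (1/e) *\<^sub>R xb))\<^sup>2))"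
    have T: "C1_test \<psi> (\<lambda>y. - ((Nn * e) *\<^sub>R (2 *\<^sub>R (y - (1/e) *\<^sub>R xb))))"
      unfolding \<psi>_def by (intro C1_test_minus C1_test_cmult C1_test_sq)
    have sc: "e * \<psi> y = - (Nn * (norm (xb - e *\<^sub>R y))\<^sup>2)" for y
    proof -
      have "norm (xb - e *\<^sub>R y) = norm (e *\<^sub>R ((1/e) *\<^sub>R xb - y))" using ez by (simp add: algebra_simps)
      also have "\<dots> = e * norm (y - (1/e) *\<^sub>R xb)" using ez by (simp add: norm_minus_commute)
      finally show ?thesis by (simp add: \<psi>_def power_mult_distrib power2_eq_square)
    qed
    have "loc_min (\<lambda>y. w y - \<psi> y) ((1/e) *\<^sub>R yb)" unfolding loc_min_def
    proof (intro exI[of _ "(r + 1 - dist x0 yb) / e"] conjI ballI)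
      fix y assume y: "y \<in> ball ((1/e) *\<^sub>R yb) ((r + 1 - dist x0 yb) / e)"
      have "dist yb (e *\<^sub>R y) = norm (e *\<^sub>R ((1/e) *\<^sub>R yb - y))" using ez by (simp add: dist_norm algebra_simps)
      also have "\<dots> = e * dist ((1/e) *\<^sub>R yb) y" using ez by (simp add: dist_norm)
      also have "\<dots> < r + 1 - dist x0 yb" using y ez by (simp add: field_simps)
      finally have "e *\<^sub>R y \<in> cball x0 (r+1)" using dist_triangle[of x0 "e *\<^sub>R y" yb] by auto
      from mx[OF zbK(1) this] have "e * w ((1/e) *\<^sub>R yb) + Nn * (norm (xb - yb))\<^sup>2 \<le> e * w y + Nn * (norm (xb - e *\<^sub>R y))\<^sup>2"
        using ez by (simp add: zb)
      then have "e * (w ((1/e) *\<^sub>R yb) - \<psi> ((1/e) *\<^sub>R yb)) \<le> e * (w y - \<psi> y)"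
        using sc[of y] sc[of "(1/e) *\<^sub>R yb"] ez by (simp add: right_diff_distrib)
      then show "w ((1/e) *\<^sub>R yb) - \<psi> ((1/e) *\<^sub>R yb) \<le> w y - \<psi> y" using ez by simp
    qed (use ybi ez in auto)
    from stat_visc_superD[OF corr(1) T this]
    have "lam \<le> F ((1/e) *\<^sub>R yb) (- ((Nn * e) *\<^sub>R (2 *\<^sub>R ((1/e) *\<^sub>R yb - (1/e) *\<^sub>R xb))) + P)" .
    moreover have "- ((Nn * e) *\<^sub>R (2 *\<^sub>R ((1/e) *\<^sub>R yb - (1/e) *\<^sub>R xb))) = p"
    proof -
      have "(1/e) *\<^sub>R yb - (1/e) *\<^sub>R xb = (1/e) *\<^sub>R (yb - xb)" by (simp add: scaleR_diff_right)
      then have "(Nn * e) *\<^sub>R (2 *\<^sub>R ((1/e) *\<^sub>R yb - (1/e) *\<^sub>R xb)) = Nn *\<^sub>R (2 *\<^sub>R (yb - xb))"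
        using ez by simp
      then show ?thesis unfolding p_def by (simp add: algebra_simps)
    qed
    ultimately show ?thesis by (simp only:)
  qed
  have 3: "\<bar>F ((1/e) *\<^sub>R xb) (gx2 zb + p) - F ((1/e) *\<^sub>R xb) (p + P)\<bar> \<le> \<tau>"
  proof -
    have "dist (gx2 zb) (gx2 z0) < \<tau> / (K + 1)" by (rule e2(2)) (use zbi r in \<open>auto simp: dist_commute\<close>)
    moreover have "gx2 z0 = P" using P by (simp add: gx2_def z0_def)
    ultimately have n: "norm (gx2 zb - P) \<le> \<tau> / (K + 1)" by (simp add: dist_norm)
    have "\<bar>F ((1/e) *\<^sub>R xb) (gx2 zb + p) - F ((1/e) *\<^sub>R xb) (p + P)\<bar> \<le> K * norm (gx2 zb - P)"
      using Fp[of "(1/e) *\<^sub>R xb" "gx2 zb + p" "p + P"] by (simp add: algebra_simps)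
    also have "\<dots> \<le> (K + 1) * (\<tau> / (K + 1))" using K n \<tau> by (intro mult_mono) auto
    also have "\<dots> = \<tau>" using K by simp
    finally show ?thesis .
  qed
  \<comment> \<open>The gradient \<open>p\<close> may blow up with the penalty, but it enters only
    through the product |xb - yb| |p|, which equals \<open>4 * N k\<close> and tends to 0 for fixed
    e.\<close>
  have 4: "\<bar>F ((1/e) *\<^sub>R xb) (p + P) - F ((1/e) *\<^sub>R yb) (p + P)\<bar> \<le> \<tau>"
  proof -
    have nx: "norm ((1/e) *\<^sub>R xb - (1/e) *\<^sub>R yb) = dd k / e"
    proof -
      have "(1/e) *\<^sub>R xb - (1/e) *\<^sub>R yb = (1/e) *\<^sub>R (xb - yb)" by (simp add: scaleR_diff_right)
      then show ?thesis unfolding ddk(1) by (simp only: norm_scaleR) (use ez in simp)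
    qed
    have "norm p = 2 * Nn * dd k" by (simp add: p_def ddk Nn_def)
    then have np: "norm (p + P) \<le> 2 * Nn * dd k + norm P" using norm_triangle_ineq[of p P] by simp
    have "\<bar>F ((1/e) *\<^sub>R xb) (p + P) - F ((1/e) *\<^sub>R yb) (p + P)\<bar> \<le> L * (dd k / e) * norm (p + P)"
      using Fx[of "(1/e) *\<^sub>R xb" "p + P" "(1/e) *\<^sub>R yb"] nx by simp
    also have "\<dots> \<le> L * (dd k / e) * (2 * Nn * dd k + norm P)"
      using np L ez by (intro mult_left_mono) (auto simp: dd_def)
    also have "\<dots> = L / e * (dd k * norm P + 4 * N k)"
      using ddk by (simp add: algebra_simps power2_eq_square)
    finally show ?thesis using k(1) by simp
  qed
  have 5: "\<bar>gt2 zb - gt2 z0\<bar> < \<tau>" using e1(2)[of zb] zbi r by (auto simp: dist_commute dist_real_def)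
  have "gt2 z0 = gt (x0,t0)" by (simp add: gt2_def z0_def)
  moreover have "gt (x0,t0) + lam = 4 * \<tau>" by (simp add: \<tau>_def)
  ultimately show False using 1 2 3 4 5 \<tau> by linarith
qed


section \<open>Initial values and the abstract homogenization theorem\<close>

lemma stat_visc_super_flip:
  assumes "stat_visc_sub F P a w" shows "stat_visc_super (flipH F) (- P) (- a) (\<lambda>x. - w x)"
  using assms by (simp add: stat_visc_super_def flipH_def)

lemma jap_minus_one_ge:
  assumes "\<delta> > 0" "\<delta> \<le> norm x" shows "jap x - 1 \<ge> sqrt (1 + \<delta>\<^sup>2) - 1"
proof -
  have "\<delta>\<^sup>2 \<le> (norm x)\<^sup>2" using assms by (intro power_mono) auto
  then show ?thesis by (simp add: jap_def power2_norm_eq_inner)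
qed

text \<open>A barrier above the initial datum that nearly touches it at \<open>x0\<close> dominates
  all \<open>u e\<close> at once, because its speed \<open>K * A\<close> does not depend on e. The
  relaxed limit thus cannot jump at time 0.\<close>

lemma upper_lim_init:
  fixes F :: "'a::euclidean_space \<Rightarrow> 'a \<Rightarrow> real" and u :: "real \<Rightarrow> 'a \<times> real \<Rightarrow> real"
  assumes Fp: "\<And>x p q. \<bar>F x p - F x q\<bar> \<le> K * norm (p - q)" and F0: "\<And>x. F x 0 = 0" and K: "K \<ge> 0"
    and bd: "\<And>e z. e > 0 \<Longrightarrow> z \<in> halfsp \<Longrightarrow> \<bar>u e z\<bar> \<le> B"
    and usc: "\<And>e. e > 0 \<Longrightarrow> usc_on halfsp (u e)"
    and sub: "\<And>e. e > 0 \<Longrightarrow> evol_visc_sub (\<lambda>x. F ((1 / e) *\<^sub>R x)) (u e)"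
    and init: "\<And>e x. e > 0 \<Longrightarrow> u e (x, 0) = u0 x" and u0: "continuous_on UNIV u0"
  shows "upper_lim halfsp u (x0, 0) \<le> u0 x0"
proof (rule dense_ge)
  fix c assume c: "u0 x0 < c"
  define \<gamma> where "\<gamma> = (c - u0 x0) / 2"
  have \<gamma>: "\<gamma> > 0" using c by (simp add: \<gamma>_def)
  obtain \<delta> where \<delta>: "\<delta> > 0" "\<And>x. dist x x0 < \<delta> \<Longrightarrow> dist (u0 x) (u0 x0) < \<gamma>"
    using u0 \<gamma> unfolding continuous_on_iff by blast
  define m where "m = sqrt (1 + \<delta>\<^sup>2) - 1"
  have m: "m > 0" using \<delta>(1) by (simp add: m_def)
  have B0: "B \<ge> 0" using bd[of 1 "(x0,0)"] by auto
  \<comment> \<open>Beyond distance \<open>\<delta>\<close> the bracket term is at least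
    \<open>m\<close>; this slope then raises the barrier by \<open>2 * B\<close>, the largest
    possible oscillation of \<open>u0\<close>.\<close>
  define A where "A = 2 * B / m"
  have A: "A \<ge> 0" using m B0 by (simp add: A_def)
  have ini: "u e (x, 0) \<le> u0 x0 + \<gamma> + A * (jap (x - x0) - 1)" if e: "e > 0" for e x
  proof (cases "dist x x0 < \<delta>")
    case True
    then have "u0 x < u0 x0 + \<gamma>" using \<delta>(2)[OF True] by (simp add: dist_real_def abs_less_iff)
    moreover have "A * (jap (x - x0) - 1) \<ge> 0" using A jap_ge(1)[of "x - x0"] by simp
    ultimately show ?thesis using init[OF e, of x] by simp
  next
    case False
    then have "m \<le> jap (x - x0) - 1" using jap_minus_one_ge[OF \<delta>(1), of "x - x0"] by (simp add: m_def dist_norm)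
    then have "A * m \<le> A * (jap (x - x0) - 1)" using A by (intro mult_left_mono)
    then have "2 * B \<le> A * (jap (x - x0) - 1)" using m by (simp add: A_def)
    moreover have "\<bar>u0 x\<bar> \<le> B" "\<bar>u0 x0\<bar> \<le> B" using bd[OF e, of "(x,0)"] bd[OF e, of "(x0,0)"] init[OF e] by auto
    ultimately show ?thesis using init[OF e, of x] \<gamma> by (simp add: abs_le_iff)
  qed
  define g where "g = (\<lambda>z::'a\<times>real. u0 x0 + \<gamma> + A * (jap (fst z - x0) - 1) + K * A * snd z)"
  have gb: "u e z \<le> g z" if "e > 0" "z \<in> halfsp" for e z
    using barrier_sub[of "\<lambda>x. F ((1 / e) *\<^sub>R x)" K A "u e" B "u0 x0 + \<gamma>" x0 "snd z" "fst z"]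
      Fp F0 K A usc[OF that(1)] bd[OF that(1)] sub[OF that(1)] ini[OF that(1)] that by (auto simp: g_def)
  have "continuous_on UNIV g" unfolding g_def by (intro continuous_intros continuous_on_jap)
  then have "usc_on UNIV g" by (rule usc_on_continuous)
  moreover have "g (x0, 0) < c" using \<gamma> by (simp add: g_def jap_def \<gamma>_def field_simps)
  ultimately obtain r where r: "r > 0" "\<And>z. dist z (x0,0) < r \<Longrightarrow> g z < c" using usc_onD[of UNIV g "(x0,0)" c] by auto
  show "upper_lim halfsp u (x0, 0) \<le> c"
  proof (rule upper_lim_le[of halfsp u B "(x0,0)" r])
    fix e z assume "0 < e" "e < r" "z \<in> halfsp" "dist z (x0, 0) < r"
    then show "u e z \<le> c" using gb[of e z] r(2)[of z] by simp
  qed (use bd r in auto)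
qed

text \<open>Correctors enter only up to an arbitrary \<open>\<eta>\<close>, so the cell problem need
  not have an exact solution. Existence for the limit equation is part of the conclusion: the
  solution is the common value of the two half-relaxed limits.\<close>

theorem homogenization:
  fixes F :: "'a::euclidean_space \<Rightarrow> 'a \<Rightarrow> real" and G u0 :: "'a \<Rightarrow> real" and ue :: "real \<Rightarrow> 'a \<times> real \<Rightarrow> real"
  assumes Fp: "\<And>x p q. \<bar>F x p - F x q\<bar> \<le> K * norm (p - q)"
    and Fx: "\<And>x y p. \<bar>F x p - F y p\<bar> \<le> L * norm (x - y) * norm p" and F0: "\<And>x. F x 0 = 0"
    and Gl: "\<And>p q. \<bar>G p - G q\<bar> \<le> K * norm (p - q)"
    and K: "K \<ge> 0" and L: "L \<ge> 0"
    and sup_corr: "\<And>P \<eta>. \<eta> > 0 \<Longrightarrow> \<exists>w W. stat_visc_super F P (G P - \<eta>) w \<and> (\<forall>x. \<bar>w x\<bar> \<le> W)"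
    and sub_corr: "\<And>P \<eta>. \<eta> > 0 \<Longrightarrow> \<exists>w W. stat_visc_sub F P (G P + \<eta>) w \<and> (\<forall>x. \<bar>w x\<bar> \<le> W)"
    and u0b: "bounded (range u0)" and u0c: "continuous_on UNIV u0"
    and sol: "\<And>e. e > 0 \<Longrightarrow> cauchy_visc_sol (\<lambda>x. F ((1 / e) *\<^sub>R x)) u0 (ue e) \<and> bounded (ue e ` halfsp)"
  shows "\<exists>u. cauchy_visc_sol (\<lambda>x. G) u0 u \<and> bounded (u ` halfsp) \<and>
          (\<forall>v. cauchy_visc_sol (\<lambda>x. G) u0 v \<and> bounded (v ` halfsp)
               \<longrightarrow> (\<forall>x t. t \<ge> 0 \<longrightarrow> v (x, t) = u (x, t))) \<and>
          (\<forall>Q. compact Q \<and> Q \<subseteq> halfsp \<longrightarrow> uniform_limit Q ue u (at_right 0))"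
proof -
  obtain B where B: "\<And>x. \<bar>u0 x\<bar> \<le> B" using u0b by (auto simp: bounded_iff)
  define un where "un = (\<lambda>e z. - ue e z)"
  define F' where "F' = flipH F"
  have F'p: "\<bar>F' x p - F' x q\<bar> \<le> K * norm (p - q)" for x p q
    using Fp[of x "-p" "-q"] by (simp add: F'_def flipH_def norm_minus_commute)
  have F'x: "\<bar>F' x p - F' y p\<bar> \<le> L * norm (x - y) * norm p" for x y p
    using Fx[of x "-p" y] by (simp add: F'_def flipH_def)
  have F'0: "F' x 0 = 0" for x using F0 by (simp add: F'_def flipH_def)
  have sub: "evol_visc_sub (\<lambda>x. F ((1 / e) *\<^sub>R x)) (ue e)"
    and subn: "evol_visc_sub (\<lambda>x. F' ((1 / e) *\<^sub>R x)) (un e)"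
    and cont: "continuous_on halfsp (ue e)" and init: "ue e (x, 0) = u0 x" if "e > 0" for e x
    using sol[OF that] by (auto simp: cauchy_visc_sol_def evol_visc_super_flip F'_def flipH_def un_def)
  have usc: "usc_on halfsp (ue e)" "usc_on halfsp (un e)" if "e > 0" for e
    using cont[OF that] by (auto intro!: usc_on_continuous continuous_on_minus simp: un_def)
  \<comment> \<open>Each \<open>ue e\<close> is assumed bounded by a constant of its own. The flat
    barrier, with slope 0, replaces it by the bound of \<open>u0\<close>, uniformly in e, as the
    relaxed limits require.\<close>
  have bd: "\<bar>ue e z\<bar> \<le> B" if e: "e > 0" and z: "z \<in> halfsp" for e z
  proof -
    obtain x t where xt: "z = (x, t)" "t \<ge> 0" using z by auto
    obtain C where C: "\<And>z. z \<in> halfsp \<Longrightarrow> \<bar>ue e z\<bar> \<le> C" using sol[OF e] by (auto simp: bounded_iff)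
    have "ue e (x, t) \<le> B + 0 * (jap (x - 0) - 1) + K * 0 * t"
      by (rule barrier_sub[of "\<lambda>x. F ((1 / e) *\<^sub>R x)" K 0 "ue e" C])
         (use Fp F0 K usc[OF e] C sub[OF e] init[OF e] B xt in \<open>auto simp: abs_le_iff\<close>)
    moreover have "un e (x, t) \<le> B + 0 * (jap (x - 0) - 1) + K * 0 * t"
      by (rule barrier_sub[of "\<lambda>x. F' ((1 / e) *\<^sub>R x)" K 0 "un e" C])
         (use F'p F'0 K usc[OF e] C subn[OF e] init[OF e] B xt in \<open>auto simp: abs_le_iff un_def\<close>)
    ultimately show ?thesis by (simp add: xt un_def abs_le_iff)
  qed
  have bdn: "\<bar>un e z\<bar> \<le> B" if "e > 0" "z \<in> halfsp" for e z using bd[OF that] by (simp add: un_def)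
  define U where "U = upper_lim halfsp ue"
  \<comment> \<open>\<open>- Ul\<close> is the lower half-relaxed limit of \<open>ue\<close>; its
    properties come from the subsolution results for the flipped Hamiltonian
    \<open>F'\<close>.\<close>
  define Ul where "Ul = upper_lim halfsp un"
  have subU: "evol_visc_sub (\<lambda>x. G) U" unfolding evol_visc_sub_def
  proof (intro allI impI)
    fix \<phi> gx gt x t
    assume a: "0 < t \<and> C1_test_t \<phi> gx gt \<and> loc_max (\<lambda>z. U z - \<phi> z) (x, t)"
    have "gt (x, t) + (G (gx (x,t)) - \<eta>) \<le> 0" if \<eta>: "\<eta> > 0" for \<eta>
    proof -
      obtain w W where w: "stat_visc_super F (gx (x,t)) (G (gx (x,t)) - \<eta>) w" "\<And>x. \<bar>w x\<bar> \<le> W"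
        using sup_corr[OF \<eta>] by blast
      show ?thesis
        by (rule evol_visc_sub_upper_lim[OF Fp Fx K L bd usc(1) sub w, of \<phi> gx gt])
           (use a in \<open>auto simp: U_def\<close>)
    qed
    then show "gt (x, t) + G (gx (x, t)) \<le> 0"
      using field_le_epsilon[of "gt (x, t) + G (gx (x, t))" 0] by (simp add: algebra_simps)
  qed
  have superUn: "evol_visc_sub (\<lambda>x p. - G (- p)) Ul" unfolding evol_visc_sub_def
  proof (intro allI impI)
    fix \<phi> gx gt x t
    assume a: "0 < t \<and> C1_test_t \<phi> gx gt \<and> loc_max (\<lambda>z. Ul z - \<phi> z) (x, t)"
    have "gt (x, t) + (- G (- gx (x,t)) - \<eta>) \<le> 0" if \<eta>: "\<eta> > 0" for \<eta>
    proof -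
      obtain w W where w: "stat_visc_sub F (- gx (x,t)) (G (- gx (x,t)) + \<eta>) w" "\<And>x. \<bar>w x\<bar> \<le> W"
        using sub_corr[OF \<eta>] by blast
      have w': "stat_visc_super F' (gx (x,t)) (- G (- gx (x,t)) - \<eta>) (\<lambda>x. - w x)" "\<And>x. \<bar>- w x\<bar> \<le> W"
        using stat_visc_super_flip[OF w(1)] w(2) by (simp_all add: F'_def)
      show ?thesis
        by (rule evol_visc_sub_upper_lim[OF F'p F'x K L bdn usc(2) subn w', of \<phi> gx gt])
           (use a in \<open>auto simp: Ul_def\<close>)
    qed
    then show "gt (x, t) + - G (- gx (x, t)) \<le> 0"
      using field_le_epsilon[of "gt (x, t) - G (- gx (x, t))" 0] by (simp add: algebra_simps)
  qed
  have superL: "evol_visc_super (\<lambda>x. G) (\<lambda>z. - Ul z)"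
    using superUn by (simp add: evol_visc_super_flip flipH_def)
  have uscU: "usc_on halfsp U" unfolding U_def by (rule usc_on_upper_lim[OF bd])
  have uscUl: "usc_on halfsp Ul" unfolding Ul_def by (rule usc_on_upper_lim[OF bdn])
  have bU: "\<bar>U z\<bar> \<le> B" if "z \<in> halfsp" for z unfolding U_def by (rule upper_lim_abs[OF bd that])
  have bUl: "\<bar>Ul z\<bar> \<le> B" if "z \<in> halfsp" for z unfolding Ul_def by (rule upper_lim_abs[OF bdn that])
  have iU: "U (x, 0) \<le> u0 x" for x unfolding U_def
    by (rule upper_lim_init[OF Fp F0 K bd usc(1) sub init u0c])
  have iUl: "Ul (x, 0) \<le> - u0 x" for x unfolding Ul_def
    by (rule upper_lim_init[OF F'p F'0 K bdn usc(2) subn, of "\<lambda>x. - u0 x"])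
       (use init u0c in \<open>auto simp: un_def intro: continuous_on_minus\<close>)
  have ge: "- Ul z \<le> U z" if z: "z \<in> halfsp" for z
  proof (rule ccontr)
    assume "\<not> - Ul z \<le> U z"
    then obtain m where m: "U z < m" "Ul z < - m" using dense[of "U z" "- Ul z"] by auto
    obtain r1 where r1: "r1 > 0" "\<And>e y. 0 < e \<Longrightarrow> e < r1 \<Longrightarrow> y \<in> halfsp \<Longrightarrow> dist y z < r1 \<Longrightarrow> ue e y < m"
      using upper_lim_less[of halfsp ue B z m] bd z m(1) unfolding U_def by blast
    obtain r2 where r2: "r2 > 0" "\<And>e y. 0 < e \<Longrightarrow> e < r2 \<Longrightarrow> y \<in> halfsp \<Longrightarrow> dist y z < r2 \<Longrightarrow> un e y < - m"
      using upper_lim_less[of halfsp un B z "- m"] bdn z m(2) unfolding Ul_def by blast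
    obtain e where e: "0 < e" "e < r1" "e < r2" using r1(1) r2(1) field_lbound_gt_zero by blast
    show False using r1(2)[OF e(1,2) z] r2(2)[OF e(1,3) z] r1(1) r2(1) by (simp add: un_def)
  qed
  \<comment> \<open>With \<open>ge\<close>, which merely orders a limsup above a liminf, this makes
    the relaxed limits equal. The common value is upper and lower semicontinuous, hence
    continuous.\<close>
  have le: "U z \<le> - Ul z" if z: "z \<in> halfsp" for z
  proof -
    have "U (fst z, snd z) \<le> - Ul (fst z, snd z)"
    proof (rule comparison_autonomous[OF Gl K uscU _ bU _ subU superL])
      show "usc_on halfsp (\<lambda>z. - (- Ul z))" using uscUl by simp
      show "\<bar>- Ul z\<bar> \<le> B" if "z \<in> halfsp" for z using bUl[OF that] by simp
      show "U (x, 0) \<le> - Ul (x, 0)" for x using iU[of x] iUl[of x] by simp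
    qed (use z in auto)
    then show ?thesis by simp
  qed
  have eq: "Ul z = - U z" if "z \<in> halfsp" for z using le[OF that] ge[OF that] by simp
  have cU: "continuous_on halfsp U"
    unfolding continuous_on_iff
  proof (intro ballI allI impI)
    fix z :: "'a \<times> real" and \<epsilon>::real assume z: "z \<in> halfsp" "\<epsilon> > 0"
    obtain r1 where r1: "r1 > 0" "\<And>y. y \<in> halfsp \<Longrightarrow> dist y z < r1 \<Longrightarrow> U y < U z + \<epsilon>"
      using usc_onD[OF uscU z(1), of "U z + \<epsilon>"] z(2) by auto
    obtain r2 where r2: "r2 > 0" "\<And>y. y \<in> halfsp \<Longrightarrow> dist y z < r2 \<Longrightarrow> Ul y < Ul z + \<epsilon>"
      using usc_onD[OF uscUl z(1), of "Ul z + \<epsilon>"] z(2) by auto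
    show "\<exists>d>0. \<forall>y\<in>halfsp. dist y z < d \<longrightarrow> dist (U y) (U z) < \<epsilon>"
    proof (intro exI[of _ "min r1 r2"] conjI ballI impI)
      fix y assume "y \<in> halfsp" "dist y z < min r1 r2"
      then show "dist (U y) (U z) < \<epsilon>" using r1(2)[of y] r2(2)[of y] eq[of y] eq[OF z(1)]
        by (simp add: dist_real_def abs_less_iff)
    qed (use r1 r2 in auto)
  qed
  have superU: "evol_visc_super (\<lambda>x. G) U"
    unfolding evol_visc_super_flip
  proof (rule evol_visc_sub_cong)
    show "Ul z = - U z" if "z \<in> halfsp" for z by (rule eq[OF that])
    show "evol_visc_sub (flipH (\<lambda>x. G)) Ul" using superUn by (simp add: flipH_def)
  qed
  have iUe: "U (x, 0) = u0 x" for x using iU[of x] iUl[of x] eq[of "(x,0)"] by simp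
  have solU: "cauchy_visc_sol (\<lambda>x. G) u0 U" using cU subU superU iUe by (simp add: cauchy_visc_sol_def)
  have uniq: "v (x, t) = U (x, t)"
    if v: "cauchy_visc_sol (\<lambda>x. G) u0 v" "bounded (v ` halfsp)" and t: "t \<ge> 0" for v x t
  proof -
    obtain C where C: "\<And>z. z \<in> halfsp \<Longrightarrow> \<bar>v z\<bar> \<le> C" using v(2) by (auto simp: bounded_iff)
    have C': "\<bar>v z\<bar> \<le> max B C" "\<bar>U z\<bar> \<le> max B C" if "z \<in> halfsp" for z
      using C[OF that] bU[OF that] by auto
    have cv: "continuous_on halfsp v" "evol_visc_sub (\<lambda>x. G) v" "evol_visc_super (\<lambda>x. G) v" "\<And>x. v (x, 0) = u0 x"
      using v(1) by (auto simp: cauchy_visc_sol_def)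
    have "v (x, t) \<le> U (x, t)"
      by (rule comparison_autonomous[OF Gl K _ _ C'(1) C'(2) cv(2) superU])
         (use cv cU iUe t in \<open>auto intro!: usc_on_continuous continuous_on_minus\<close>)
    moreover have "U (x, t) \<le> v (x, t)"
      by (rule comparison_autonomous[OF Gl K _ _ C'(2) C'(1) subU cv(3)])
         (use cv cU iUe t in \<open>auto intro!: usc_on_continuous continuous_on_minus\<close>)
    ultimately show ?thesis by simp
  qed
  have ulim: "uniform_limit Q ue U (at_right 0)" if Q: "compact Q" "Q \<subseteq> halfsp" for Q
    unfolding uniform_limit_iff
  proof (intro allI impI)
    fix \<epsilon>::real assume e: "\<epsilon> > 0"
    have cQ: "continuous_on Q U" using cU Q(2) by (rule continuous_on_subset)
    have "continuous_on Q (\<lambda>z. U z + \<epsilon>)" by (intro continuous_intros cQ)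
    then obtain r1 where r1: "r1 > 0" "\<And>e z. 0 < e \<Longrightarrow> e < r1 \<Longrightarrow> z \<in> Q \<Longrightarrow> ue e z < U z + \<epsilon>"
      using upper_lim_compact[of halfsp ue B Q "\<lambda>z. U z + \<epsilon>"] bd Q e unfolding U_def
      by (metis less_add_same_cancel1)
    have "continuous_on Q (\<lambda>z. - U z + \<epsilon>)" by (intro continuous_intros cQ)
    moreover have "upper_lim halfsp un z < - U z + \<epsilon>" if "z \<in> Q" for z
      using eq[of z] Q(2) that e unfolding Ul_def by auto
    ultimately obtain r2 where r2: "r2 > 0" "\<And>e z. 0 < e \<Longrightarrow> e < r2 \<Longrightarrow> z \<in> Q \<Longrightarrow> un e z < - U z + \<epsilon>"
      using upper_lim_compact[of halfsp un B Q "\<lambda>z. - U z + \<epsilon>"] bdn Q by metis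
    have "\<forall>z\<in>Q. dist (ue e z) (U z) < \<epsilon>" if "e > 0" "e < min r1 r2" for e
    proof
      fix z assume "z \<in> Q"
      then show "dist (ue e z) (U z) < \<epsilon>" using r1(2)[of e z] r2(2)[of e z] that
        by (auto simp: un_def dist_real_def abs_less_iff)
    qed
    then show "\<forall>\<^sub>F e in at_right 0. \<forall>z\<in>Q. dist (ue e z) (U z) < \<epsilon>"
      unfolding eventually_at_right_field using r1(1) r2(1) by (intro exI[of _ "min r1 r2"]) auto
  qed
  have "bounded (U ` halfsp)" unfolding bounded_iff using bU by auto
  then show ?thesis using solU uniq ulim by blast
qed

section \<open>Perron's method for the discounted cell problem\<close>

text \<open>Competitors are not required to be periodic: the class is invariant under lattice translations, so its
  supremum is periodic anyway, and the bump construction need not be periodised.\<close>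

definition disc_sub :: "('a::euclidean_space \<Rightarrow> 'a \<Rightarrow> real) \<Rightarrow> real \<Rightarrow> real \<Rightarrow> ('a \<Rightarrow> real) \<Rightarrow> bool" where
  "disc_sub F \<delta> B w \<longleftrightarrow> usc_on UNIV w \<and> (\<forall>x. \<bar>w x\<bar> \<le> B) \<and>
     (\<forall>\<phi> g x. C1_test \<phi> g \<and> loc_max (\<lambda>y. w y - \<phi> y) x \<longrightarrow> \<delta> * w x + F x (g x) \<le> 0)"

lemma C1_test_loc_max_eq_grad:
  assumes "C1_test \<phi> g" "C1_test \<psi> g'" "loc_max (\<lambda>y. \<psi> y - \<phi> y) x"
  shows "g x = g' x"
proof -
  obtain e where e: "e > 0" "\<And>y. y \<in> ball x e \<Longrightarrow> \<psi> y - \<phi> y \<le> \<psi> x - \<phi> x"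
    using assms(3) by (auto simp: loc_max_def)
  have "((\<lambda>y. \<psi> y - \<phi> y) has_derivative (\<lambda>h. g' x \<bullet> h - g x \<bullet> h)) (at x)"
    using assms(1,2) unfolding C1_test_def by (intro has_derivative_diff) auto
  then have "(\<lambda>h. g' x \<bullet> h - g x \<bullet> h) = (\<lambda>h. 0)"
    using e by (intro differential_zero_maxmin[of x "ball x e" "\<lambda>y. \<psi> y - \<phi> y"]) auto
  then have "(g' x - g x) \<bullet> (g' x - g x) = 0" by (metis inner_diff_left)
  then show ?thesis by simp
qed

lemma C1_test_diff_sq:
  assumes "C1_test \<phi> g"
  shows "C1_test (\<lambda>y. c + (\<phi> y + k * (norm (y - x))\<^sup>2)) (\<lambda>y. g y + k *\<^sub>R (2 *\<^sub>R (y - x)))"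
  using C1_test_add[OF C1_test_const[of c] C1_test_add[OF assms C1_test_cmult[OF C1_test_sq[of x], of k]]] by simp

context
  fixes F :: "'a::euclidean_space \<Rightarrow> 'a \<Rightarrow> real" and \<delta> B :: real
  assumes Fc: "continuous_on UNIV (\<lambda>z. F (fst z) (snd z))" and \<delta>: "\<delta> > 0"
    and lo: "\<And>x. F x 0 \<le> \<delta> * B" and hi: "\<And>x. - (\<delta> * B) \<le> F x 0" and B: "B \<ge> 0"
begin

definition perron_sup :: "'a \<Rightarrow> real" where
  "perron_sup x = Sup {w x |w. disc_sub F \<delta> B w}"

text \<open>The upper and lower semicontinuous envelopes of \<open>perron_sup\<close>, obtained as
  half-relaxed limits of a family that is constant in e.\<close>

abbreviation perron_upper :: "'a \<Rightarrow> real" where "perron_upper \<equiv> upper_lim UNIV (\<lambda>e::real. perron_sup)"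
abbreviation perron_lower :: "'a \<Rightarrow> real" where "perron_lower \<equiv> \<lambda>x. - upper_lim UNIV (\<lambda>e::real. \<lambda>x. - perron_sup x) x"

lemma disc_sub_const: "disc_sub F \<delta> B (\<lambda>x. - B)"
  unfolding disc_sub_def
proof (intro conjI allI impI)
  fix \<phi> g and x :: 'a assume a: "C1_test \<phi> g \<and> loc_max (\<lambda>y. - B - \<phi> y) x"
  then have "g x = 0" using C1_test_loc_max_eq_grad[OF _ C1_test_const[of "-B"], of \<phi> g x] by simp
  then show "\<delta> * - B + F x (g x) \<le> 0" using lo[of x] by simp
qed (use B in \<open>auto intro: usc_on_continuous\<close>)

lemma perron_bdd: "bdd_above {w x |w. disc_sub F \<delta> B w}"
  by (rule bdd_aboveI[of _ B]) (auto simp: disc_sub_def abs_le_iff)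

lemma perron_ge: "disc_sub F \<delta> B w \<Longrightarrow> w x \<le> perron_sup x"
  unfolding perron_sup_def by (rule cSup_upper[OF _ perron_bdd]) auto

lemma perron_abs: "\<bar>perron_sup x\<bar> \<le> B"
proof -
  have "- B \<le> perron_sup x" using perron_ge[OF disc_sub_const, of x] by simp
  moreover have "perron_sup x \<le> B" unfolding perron_sup_def
    by (rule cSup_least) (use disc_sub_const in \<open>auto simp: disc_sub_def abs_le_iff\<close>)
  ultimately show ?thesis by simp
qed

lemma perron_less:
  assumes "c < perron_sup x" obtains w where "disc_sub F \<delta> B w" "c < w x"
  using assms less_cSup_iff[OF _ perron_bdd, of x c] disc_sub_const unfolding perron_sup_def by auto

lemma perron_upper_ge: "perron_sup x \<le> perron_upper x"
proof (rule dense_le)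
  fix c assume c: "c < perron_sup x"
  show "c \<le> perron_upper x"
  proof (rule ccontr)
    assume "\<not> c \<le> perron_upper x"
    then have "perron_upper x < c" by simp
    then obtain r where "r > 0" "\<And>e y. 0 < e \<Longrightarrow> e < r \<Longrightarrow> y \<in> UNIV \<Longrightarrow> dist y x < r \<Longrightarrow> perron_sup y < c"
      using upper_lim_less[of UNIV "\<lambda>e. perron_sup" B x c] perron_abs by auto
    then show False using c by (metis UNIV_I dist_self field_lbound_gt_zero less_asym)
  qed
qed

lemma perron_lower_le: "perron_lower x \<le> perron_sup x"
proof (rule dense_ge)
  fix c assume c: "perron_sup x < c"
  show "perron_lower x \<le> c"
  proof (rule ccontr)
    assume "\<not> perron_lower x \<le> c"
    then have "upper_lim UNIV (\<lambda>e. \<lambda>x. - perron_sup x) x < - c" by simp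
    then obtain r where "r > 0" "\<And>e y. 0 < e \<Longrightarrow> e < r \<Longrightarrow> y \<in> UNIV \<Longrightarrow> dist y x < r \<Longrightarrow> - perron_sup y < - c"
      using upper_lim_less[of UNIV "\<lambda>e x. - perron_sup x" B x "- c"] perron_abs by auto
    then show False using c by (metis UNIV_I dist_self field_lbound_gt_zero less_asym neg_less_iff_less)
  qed
qed

lemma perron_upper_abs: "\<bar>perron_upper x\<bar> \<le> B"
  by (rule upper_lim_abs) (use perron_abs in auto)

lemma perron_lower_abs: "\<bar>perron_lower x\<bar> \<le> B"
  using upper_lim_abs[of UNIV "\<lambda>e x. - perron_sup x" B x] perron_abs by auto

lemma F_near:
  assumes "C1_test \<phi> g" "\<tau> > 0"
  obtains r where "r > 0" "\<And>y. dist y x < r \<Longrightarrow> \<bar>F y (g y) - F x (g x)\<bar> < \<tau>" "\<And>y. dist y x < r \<Longrightarrow> \<bar>\<phi> y - \<phi> x\<bar> < \<tau>"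
proof -
  have "continuous_on UNIV g" using assms(1) by (simp add: C1_test_def)
  then have "continuous_on UNIV (\<lambda>y. F (fst (y, g y)) (snd (y, g y)))"
    by (intro continuous_on_compose2[OF Fc]) (auto intro!: continuous_intros)
  then obtain r1 where r1: "r1 > 0" "\<And>y. dist y x < r1 \<Longrightarrow> dist (F y (g y)) (F x (g x)) < \<tau>"
    using assms(2) unfolding continuous_on_iff by (metis UNIV_I fst_conv snd_conv)
  obtain r2 where r2: "r2 > 0" "\<And>y. dist y x < r2 \<Longrightarrow> dist (\<phi> y) (\<phi> x) < \<tau>"
    using C1_test_continuous[OF assms(1), of UNIV] assms(2) unfolding continuous_on_iff by (metis UNIV_I)
  show thesis by (rule that[of "min r1 r2"]) (use r1 r2 in \<open>auto simp: dist_real_def\<close>)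
qed

text \<open>Near x one competitor \<open>w\<close> almost reaches the envelope. Once the test
  function is made strict by a squared distance, \<open>w\<close> touches it from below close to x,
  and the inequality of \<open>w\<close> there passes to x.\<close>

lemma disc_sub_perron_upper: "disc_sub F \<delta> B perron_upper"
  unfolding disc_sub_def
proof (intro conjI allI impI)
  show "usc_on UNIV perron_upper" by (rule usc_on_upper_lim) (use perron_abs in auto)
  show "\<bar>perron_upper x\<bar> \<le> B" for x by (rule perron_upper_abs)
  fix \<phi> g and x :: 'a assume a: "C1_test \<phi> g \<and> loc_max (\<lambda>y. perron_upper y - \<phi> y) x"
  obtain e where e: "e > 0" "\<And>y. y \<in> ball x e \<Longrightarrow> perron_upper y - \<phi> y \<le> perron_upper x - \<phi> x"
    using a by (auto simp: loc_max_def)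
  show "\<delta> * perron_upper x + F x (g x) \<le> 0"
  proof (rule ccontr)
    assume neg: "\<not> ?thesis"
    \<comment> \<open>The excess is \<open>\<tau> + 3 * \<delta> * \<tau>\<close>. Moving from x to
      the contact point costs \<open>\<tau>\<close> in \<open>F\<close> and
      \<open>2 * \<delta> * \<tau>\<close> in the zeroth-order term, so
      \<open>\<delta> * \<tau>\<close> survives.\<close>
    define \<tau> where "\<tau> = (\<delta> * perron_upper x + F x (g x)) / (1 + 3 * \<delta>)"
    have \<tau>: "\<tau> > 0" using neg \<delta> by (simp add: \<tau>_def)
    have "\<delta> * perron_upper x + F x (g x) = (1 + 3 * \<delta>) * \<tau>" using \<delta> by (simp add: \<tau>_def)
    then have \<tau>e: "\<delta> * perron_upper x + F x (g x) = \<tau> + 3 * \<delta> * \<tau>" by (simp add: algebra_simps)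
    define \<phi>2 where "\<phi>2 = (\<lambda>y. 0 + (\<phi> y + 1 * (norm (y - x))\<^sup>2))"
    define g2 where "g2 = (\<lambda>y. g y + 1 *\<^sub>R (2 *\<^sub>R (y - x)))"
    have C2: "C1_test \<phi>2 g2" using a C1_test_diff_sq[of \<phi> g 0 1 x] by (simp only: \<phi>2_def g2_def)
    have gx: "g2 x = g x" "\<phi>2 x = \<phi> x" by (simp_all add: g2_def \<phi>2_def)
    obtain r0 where r0: "r0 > 0" "\<And>y. dist y x < r0 \<Longrightarrow> \<bar>F y (g2 y) - F x (g2 x)\<bar> < \<tau>" "\<And>y. dist y x < r0 \<Longrightarrow> \<bar>\<phi>2 y - \<phi>2 x\<bar> < \<tau>"
      using F_near[OF C2 \<tau>] by blast
    define r where "r = min e r0 / 2"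
    have r: "r > 0" "r < e" "r < r0" using e r0 by (auto simp: r_def)
    define m where "m = perron_upper x - \<phi> x"
    \<comment> \<open>\<open>w\<close> reaches the maximal value up to \<open>\<kappa>\<close>, so
      the squared distance of its contact point from x is below \<open>\<kappa>\<close>, hence below
      \<open>r\<^sup>2\<close>: the contact point is interior.\<close>
    define \<kappa> where "\<kappa> = min (r\<^sup>2) \<tau>"
    have \<kappa>: "\<kappa> > 0" using r \<tau> by (simp add: \<kappa>_def)
    obtain r1 where r1: "r1 > 0" "\<And>y. dist y x < r1 \<Longrightarrow> \<bar>\<phi>2 y - \<phi>2 x\<bar> < \<kappa> / 2"
      using F_near[OF C2, of "\<kappa>/2" x] \<kappa> by (metis half_gt_zero)
    obtain y1 where y1: "dist y1 x < min r r1" "perron_upper x - \<kappa> / 2 < perron_sup y1"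
    proof -
      have "perron_upper x - \<kappa> / 2 < perron_upper x" "0 < min r r1" using \<kappa> r r1 by auto
      with less_upper_lim[of UNIV "\<lambda>e. perron_sup" B x "perron_upper x - \<kappa> / 2" "min r r1"] perron_abs
      show thesis using that by blast
    qed
    obtain w where w: "disc_sub F \<delta> B w" "perron_upper x - \<kappa> / 2 < w y1" using perron_less[OF y1(2)] by blast
    have wle: "w y \<le> perron_upper y" for y using perron_ge[OF w(1), of y] perron_upper_ge[of y] by simp
    have v1: "w y1 - \<phi>2 y1 > m - \<kappa>"
    proof -
      have "\<bar>\<phi>2 y1 - \<phi>2 x\<bar> < \<kappa> / 2" by (rule r1(2)) (use y1 in simp)
      then show ?thesis using w(2) gx(2) unfolding m_def by linarith
    qed
    have "usc_on (cball x r) (\<lambda>y. w y - \<phi>2 y)"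
      by (rule usc_on_diff_continuous[OF usc_on_subset[of UNIV] C1_test_continuous[OF C2]])
         (use w(1) in \<open>auto simp: disc_sub_def\<close>)
    then obtain z where z: "z \<in> cball x r" "\<And>y. y \<in> cball x r \<Longrightarrow> w y - \<phi>2 y \<le> w z - \<phi>2 z"
      using usc_on_attains[of "cball x r" "\<lambda>y. w y - \<phi>2 y"] r by auto
    have vz: "w z - \<phi>2 z > m - \<kappa>" using z(2)[of y1] v1 y1 by (auto simp: dist_commute)
    have "perron_upper z - \<phi> z \<le> m" unfolding m_def by (rule e(2)) (use z r in auto)
    then have "w z - \<phi>2 z \<le> m - (dist z x)\<^sup>2" using wle[of z] by (simp add: \<phi>2_def dist_norm)
    then have "(dist z x)\<^sup>2 < r\<^sup>2" using vz by (simp add: \<kappa>_def)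
    then have zr: "dist z x < r" using r(1) power2_less_imp_less[of "dist z x" r] by simp
    have "loc_max (\<lambda>y. w y - \<phi>2 y) z" unfolding loc_max_def
    proof (intro exI[of _ "r - dist z x"] conjI ballI)
      fix y assume "y \<in> ball z (r - dist z x)"
      then have "y \<in> cball x r" using dist_triangle[of x y z] by (auto simp: dist_commute)
      then show "w y - \<phi>2 y \<le> w z - \<phi>2 z" by (rule z(2))
    qed (use zr in auto)
    then have 1: "\<delta> * w z + F z (g2 z) \<le> 0" using w(1) C2 unfolding disc_sub_def by blast
    have zr0: "dist z x < r0" using zr r by simp
    have "w z > perron_upper x - 2 * \<tau>"
    proof -
      have "\<phi>2 z > \<phi>2 x - \<tau>" using r0(3)[OF zr0] by (simp add: abs_less_iff)
      moreover have "\<kappa> \<le> \<tau>" by (simp add: \<kappa>_def)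
      ultimately show ?thesis using vz gx by (simp add: m_def)
    qed
    then have "\<delta> * w z > \<delta> * (perron_upper x - 2 * \<tau>)" using \<delta> by simp
    moreover have "F z (g2 z) > F x (g x) - \<tau>" using r0(2)[OF zr0] gx by (simp add: abs_less_iff)
    ultimately have "\<delta> * w z + F z (g2 z) > \<delta> * \<tau>" using \<tau>e by (simp add: algebra_simps)
    then show False using 1 \<delta> \<tau> by (smt (verit) mult_pos_pos)
  qed
qed

text \<open>Bump construction. If the inequality failed at x, the test function, bent down
  quadratically and raised by \<open>\<kappa>\<close>, would be a strict subsolution near x, and its
  maximum with \<open>perron_upper\<close> a competitor lying above \<open>perron_sup\<close> near
  x.\<close>

lemma perron_lower_super:
  assumes C: "C1_test \<phi> g" and lm: "loc_min (\<lambda>y. perron_lower y - \<phi> y) x"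
  shows "\<delta> * perron_lower x + F x (g x) \<ge> 0"
proof (rule ccontr)
  assume neg: "\<not> ?thesis"
  obtain e where e: "e > 0" "\<And>y. y \<in> ball x e \<Longrightarrow> perron_lower x - \<phi> x \<le> perron_lower y - \<phi> y"
    using lm by (auto simp: loc_min_def)
  \<comment> \<open>The bump needs room below the ceiling \<open>B\<close> imposed on competitors.
    If \<open>perron_lower x = B\<close>, then \<open>\<phi>\<close> has a local maximum at x, its
    gradient vanishes, and \<open>hi\<close> yields the inequality directly.\<close>
  have lt: "perron_lower x < B"
  proof (rule ccontr)
    assume "\<not> perron_lower x < B"
    then have eq: "perron_lower x = B" using perron_lower_abs[of x] by (simp add: abs_le_iff)
    have "loc_max (\<lambda>y. \<phi> y - B) x" unfolding loc_max_def
    proof (intro exI[of _ e] conjI ballI)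
      fix y assume "y \<in> ball x e"
      then show "\<phi> y - B \<le> \<phi> x - B" using e(2)[of y] eq perron_lower_abs[of y] by (simp add: abs_le_iff)
    qed (rule e)
    then have "0 = g x" using C1_test_loc_max_eq_grad[OF C1_test_const[of B] C] by simp
    then show False using neg eq hi[of x] by simp
  qed
  \<comment> \<open>The first bound lets the deficit absorb \<open>2 * \<delta> * \<tau>\<close>
    from the value of the bump and \<open>\<tau>\<close> from \<open>F\<close>. The second keeps the
    bump below \<open>B\<close>.\<close>
  define \<tau> where "\<tau> = min (- (\<delta> * perron_lower x + F x (g x)) / (2 * (1 + \<delta>))) ((B - perron_lower x) / 2)"
  have \<tau>: "\<tau> > 0" using neg \<delta> lt by (simp add: \<tau>_def)
  have \<tau>1: "\<delta> * perron_lower x + F x (g x) \<le> - 2 * (1 + \<delta>) * \<tau>"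
  proof -
    have "\<tau> \<le> - (\<delta> * perron_lower x + F x (g x)) / (2 * (1 + \<delta>))" by (simp add: \<tau>_def)
    then have "\<tau> * (2 * (1 + \<delta>)) \<le> - (\<delta> * perron_lower x + F x (g x))"
      using \<delta> by (subst (asm) pos_le_divide_eq) auto
    then show ?thesis by (simp add: algebra_simps)
  qed
  have \<tau>2: "2 * \<tau> \<le> B - perron_lower x"
  proof -
    have "\<tau> \<le> (B - perron_lower x) / 2" unfolding \<tau>_def by (rule min.cobounded2)
    then show ?thesis by simp
  qed
  define \<phi>2 where "\<phi>2 = (\<lambda>y. (perron_lower x - \<phi> x) + (\<phi> y + (-1) * (norm (y - x))\<^sup>2))"
  define g2 where "g2 = (\<lambda>y. g y + (-1) *\<^sub>R (2 *\<^sub>R (y - x)))"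
  have C2: "C1_test \<phi>2 g2" using C1_test_diff_sq[OF C, of "perron_lower x - \<phi> x" "-1" x] by (simp only: \<phi>2_def g2_def)
  have gx: "g2 x = g x" "\<phi>2 x = perron_lower x" by (simp_all add: g2_def \<phi>2_def)
  obtain r0 where r0: "r0 > 0" "\<And>y. dist y x < r0 \<Longrightarrow> \<bar>F y (g2 y) - F x (g2 x)\<bar> < \<tau>" "\<And>y. dist y x < r0 \<Longrightarrow> \<bar>\<phi>2 y - \<phi>2 x\<bar> < \<tau>"
    using F_near[OF C2 \<tau>] by blast
  define r where "r = min e r0 / 2"
  have r: "r > 0" "r < e" "r < r0" using e r0 by (auto simp: r_def)
  \<comment> \<open>At distance r/2 or more the bent test function lies at least r^2/4 below
    \<open>perron_lower\<close>. Even after the lift by \<open>\<kappa>\<close> the maximum in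
    \<open>w\<close> is then \<open>perron_upper\<close>, so the two definitions glue on the
    annulus.\<close>
  define \<kappa> where "\<kappa> = min (r\<^sup>2 / 4) \<tau>"
  have \<kappa>: "\<kappa> > 0" "\<kappa> \<le> r\<^sup>2 / 4" "\<kappa> \<le> \<tau>" using r \<tau> by (auto simp: \<kappa>_def)
  define w where "w = (\<lambda>y. if dist y x < r then max (perron_upper y) (\<phi>2 y + \<kappa>) else perron_upper y)"
  have far: "w y = perron_upper y" if "r / 2 \<le> dist y x" for y
  proof (cases "dist y x < r")
    case True
    have "perron_lower x - \<phi> x \<le> perron_lower y - \<phi> y" by (rule e(2)) (use True r in \<open>auto simp: dist_commute\<close>)
    then have "\<phi>2 y + (dist y x)\<^sup>2 \<le> perron_lower y" by (simp add: \<phi>2_def dist_norm)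
    moreover have "(r/2)\<^sup>2 \<le> (dist y x)\<^sup>2" using that r by (intro power_mono) auto
    moreover have "perron_lower y \<le> perron_upper y" using perron_lower_le[of y] perron_upper_ge[of y] by simp
    ultimately have "\<phi>2 y + \<kappa> \<le> perron_upper y" using \<kappa>(2) by (simp add: power_divide)
    then show ?thesis by (simp add: w_def)
  qed (simp add: w_def)
  have ge: "perron_upper y \<le> w y" for y by (simp add: w_def)
  have sV: "disc_sub F \<delta> B perron_upper" by (rule disc_sub_perron_upper)
  have uV: "usc_on UNIV perron_upper" using sV by (simp add: disc_sub_def)
  have uscw: "usc_on UNIV w" unfolding usc_on_def
  proof (intro ballI allI impI)
    fix z c assume c: "w z < c"
    obtain r1 where r1: "r1 > 0" "\<And>y. dist y z < r1 \<Longrightarrow> perron_upper y < c"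
      using usc_onD[OF uV, of z c] ge[of z] c by auto
    show "\<exists>r>0. \<forall>y\<in>UNIV. dist y z < r \<longrightarrow> w y < c"
    proof (cases "dist z x < r")
      case True
      have "usc_on UNIV (\<lambda>y. \<phi>2 y + \<kappa>)" by (intro usc_on_continuous continuous_intros C1_test_continuous[OF C2])
      moreover have "\<phi>2 z + \<kappa> < c" using c True by (simp add: w_def)
      ultimately obtain r2 where r2: "r2 > 0" "\<And>y. dist y z < r2 \<Longrightarrow> \<phi>2 y + \<kappa> < c"
        using usc_onD[of UNIV "\<lambda>y. \<phi>2 y + \<kappa>" z c] by auto
      show ?thesis by (rule exI[of _ "min r1 r2"]) (use r1 r2 in \<open>auto simp: w_def\<close>)
    next
      case False
      show ?thesis
      proof (intro exI[of _ "min r1 (r/2)"] conjI ballI impI)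
        fix y assume y: "dist y z < min r1 (r/2)"
        have "r / 2 \<le> dist y x" using dist_triangle[of z x y] y False by (simp add: dist_commute)
        then show "w y < c" using far r1(2)[of y] y by simp
      qed (use r1 r in auto)
    qed
  qed
  have near: "\<phi>2 y + \<kappa> \<le> B" if "dist y x < r" for y
    using r0(3)[of y] that r gx \<kappa>(3) \<tau>2 by (simp add: abs_less_iff)
  have bw: "\<bar>w y\<bar> \<le> B" for y
  proof -
    have "w y \<le> B" using near[of y] perron_upper_abs[of y] by (simp add: w_def abs_le_iff)
    moreover have "- B \<le> w y" using ge[of y] perron_upper_abs[of y] by (simp add: abs_le_iff)
    ultimately show ?thesis by simp
  qed
  have "disc_sub F \<delta> B w" unfolding disc_sub_def
  proof (intro conjI allI impI)
    fix \<psi> h z assume a: "C1_test \<psi> h \<and> loc_max (\<lambda>y. w y - \<psi> y) z"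
    obtain d where d: "d > 0" "\<And>y. y \<in> ball z d \<Longrightarrow> w y - \<psi> y \<le> w z - \<psi> z"
      using a by (auto simp: loc_max_def)
    show "\<delta> * w z + F z (h z) \<le> 0"
    proof (cases "w z = perron_upper z")
      case True
      have "loc_max (\<lambda>y. perron_upper y - \<psi> y) z" unfolding loc_max_def
      proof (intro exI[of _ d] conjI ballI)
        fix y assume "y \<in> ball z d"
        then show "perron_upper y - \<psi> y \<le> perron_upper z - \<psi> z" using d(2)[of y] ge[of y] True by simp
      qed (rule d)
      then have "\<delta> * perron_upper z + F z (h z) \<le> 0" using sV a unfolding disc_sub_def by blast
      then show ?thesis using True by simp
    next
      case False
      then have zr: "dist z x < r / 2" using far not_le by blast
      then have wz: "w z = \<phi>2 z + \<kappa>" using False r by (auto simp: w_def max_def split: if_splits)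
      have "loc_max (\<lambda>y. \<phi>2 y - \<psi> y) z" unfolding loc_max_def
      proof (intro exI[of _ "min d (r/2)"] conjI ballI)
        fix y assume y: "y \<in> ball z (min d (r/2))"
        then have "dist y x < r" using dist_triangle[of y x z] zr by (simp add: dist_commute)
        then have "\<phi>2 y + \<kappa> \<le> w y" by (simp add: w_def)
        then show "\<phi>2 y - \<psi> y \<le> \<phi>2 z - \<psi> z" using d(2)[of y] y wz by simp
      qed (use d r in auto)
      then have hz: "h z = g2 z" using C1_test_loc_max_eq_grad[OF _ C2, of \<psi> h z] a by simp
      have zr0: "dist z x < r0" using zr r by simp
      have "\<phi>2 z + \<kappa> \<le> perron_lower x + 2 * \<tau>" using r0(3)[OF zr0] gx \<kappa>(3) by (simp add: abs_less_iff)
      then have "\<delta> * (\<phi>2 z + \<kappa>) \<le> \<delta> * (perron_lower x + 2 * \<tau>)" using \<delta> by simp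
      moreover have "F z (g2 z) \<le> F x (g x) + \<tau>" using r0(2)[OF zr0] gx by (simp add: abs_less_iff)
      ultimately have "\<delta> * w z + F z (h z) \<le> \<delta> * perron_lower x + F x (g x) + 2 * \<delta> * \<tau> + \<tau>"
        unfolding wz hz by (simp add: algebra_simps)
      also have "\<dots> \<le> 0" using \<tau>1 \<tau> by (simp add: algebra_simps)
      finally show ?thesis .
    qed
  qed (use uscw bw in auto)
  then have wS: "w y \<le> perron_sup y" for y by (rule perron_ge)
  obtain r1 where r1: "r1 > 0" "\<And>y. dist y x < r1 \<Longrightarrow> \<bar>\<phi>2 y - \<phi>2 x\<bar> < \<kappa> / 2"
    using F_near[OF C2, of "\<kappa>/2" x] \<kappa>(1) by (metis half_gt_zero)
  \<comment> \<open>All values of \<open>perron_sup\<close> near x are at least those of the bump,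
    which would put the lower envelope at x above itself by \<open>\<kappa> / 2\<close>.\<close>
  have "upper_lim UNIV (\<lambda>e. \<lambda>x. - perron_sup x) x \<le> - (perron_lower x + \<kappa> / 2)"
  proof (rule upper_lim_le[where B = B and r = "min r r1"])
    fix ee :: real and y assume y: "dist y x < min r r1"
    then have "\<phi>2 y + \<kappa> \<le> w y" by (simp add: w_def)
    moreover have "\<bar>\<phi>2 y - \<phi>2 x\<bar> < \<kappa> / 2" by (rule r1(2)) (use y in simp)
    ultimately show "- perron_sup y \<le> - (perron_lower x + \<kappa> / 2)" using wS[of y] gx(2) by linarith
  qed (use perron_abs r r1 in auto)
  then show False using \<kappa>(1) by simp
qed

lemma disc_sub_shift:
  assumes "\<And>x p. F (x + k) p = F x p" "disc_sub F \<delta> B w"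
  shows "disc_sub F \<delta> B (\<lambda>x. w (x + k))"
  unfolding disc_sub_def
proof (intro conjI allI impI)
  have "usc_on UNIV w" using assms(2) by (simp add: disc_sub_def)
  then show "usc_on UNIV (\<lambda>x. w (x + k))"
    by (rule usc_on_compose) (auto intro!: continuous_intros)
  show "\<bar>w (x + k)\<bar> \<le> B" for x using assms(2) by (simp add: disc_sub_def)
  fix \<phi> g x assume a: "C1_test \<phi> g \<and> loc_max (\<lambda>y. w (y + k) - \<phi> y) x"
  have C: "C1_test (\<lambda>y. \<phi> (y - k)) (\<lambda>y. g (y - k))" unfolding C1_test_def
  proof (intro conjI allI)
    fix y
    have "((\<lambda>y. y - k) has_derivative (\<lambda>h. h)) (at y)" by (auto intro!: derivative_eq_intros)
    moreover have "(\<phi> has_derivative (\<lambda>h. g (y - k) \<bullet> h)) (at (y - k))" using a by (simp add: C1_test_def)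
    ultimately show "((\<lambda>y. \<phi> (y - k)) has_derivative (\<lambda>h. g (y - k) \<bullet> h)) (at y)" by (rule has_derivative_compose)
    show "continuous_on UNIV (\<lambda>y. g (y - k))"
      using a unfolding C1_test_def by (auto intro!: continuous_on_compose2[of UNIV g] continuous_intros)
  qed
  obtain e where e: "e > 0" "\<And>y. y \<in> ball x e \<Longrightarrow> w (y + k) - \<phi> y \<le> w (x + k) - \<phi> x"
    using a by (auto simp: loc_max_def)
  have "loc_max (\<lambda>y. w y - \<phi> (y - k)) (x + k)" unfolding loc_max_def
  proof (intro exI[of _ e] conjI ballI)
    fix y assume "y \<in> ball (x + k) e"
    then have "y - k \<in> ball x e" by (simp add: dist_norm algebra_simps)
    from e(2)[OF this] show "w y - \<phi> (y - k) \<le> w (x + k) - \<phi> (x + k - k)" by simp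
  qed (rule e)
  then have "\<delta> * w (x + k) + F (x + k) (g (x + k - k)) \<le> 0"
    using assms(2) C unfolding disc_sub_def by blast
  then show "\<delta> * w (x + k) + F x (g x) \<le> 0" using assms(1) by simp
qed

lemma perron_sup_periodic:
  assumes "\<And>x p. F (x + k) p = F x p" shows "perron_sup (x + k) = perron_sup x"
proof -
  have F': "F (x + - k) p = F x p" for x p using assms[of "x - k" p] by simp
  have "w (x + k) \<le> perron_sup x" if "disc_sub F \<delta> B w" for w
    using perron_ge[OF disc_sub_shift[OF assms that], of x] by simp
  moreover have "w x \<le> perron_sup (x + k)" if "disc_sub F \<delta> B w" for w
    using perron_ge[OF disc_sub_shift[of "- k" w, OF F' that], of "x + k"] by simp
  ultimately show ?thesis
    by (meson perron_less less_le_not_le linorder_not_le order_antisym_conv)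
qed

lemma perron_upper_periodic:
  assumes "\<And>x p. F (x + k) p = F x p" shows "perron_upper (x + k) = perron_upper x"
proof -
  have A: "upper_lim UNIV (\<lambda>e. perron_sup) (x + k) \<le> upper_lim UNIV (\<lambda>e. perron_sup) x"
    if F: "\<And>x p. F (x + k) p = F x p" for x k
  proof (rule dense_ge)
    fix c assume "perron_upper x < c"
    then obtain r where r: "r > 0" "\<And>e y. 0 < e \<Longrightarrow> e < r \<Longrightarrow> y \<in> UNIV \<Longrightarrow> dist y x < r \<Longrightarrow> perron_sup y < c"
      using upper_lim_less[of UNIV "\<lambda>e. perron_sup" B x c] perron_abs by auto
    show "perron_upper (x + k) \<le> c"
    proof (rule upper_lim_le[where B = B and r = r])
      fix e y assume e: "0 < e" "e < r" "dist y (x + k) < r"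
      then have "perron_sup (y - k) < c" using r(2)[of e "y - k"] by (simp add: dist_norm algebra_simps)
      then show "perron_sup y \<le> c" using perron_sup_periodic[of k "y - k"] F by simp
    qed (use perron_abs r in auto)
  qed
  have F': "F (x + - k) p = F x p" for x p using assms[of "x - k" p] by simp
  show ?thesis using A[OF assms, of x] A[of "- k" "x + k"] F' by (simp add: order_antisym)
qed

end

section \<open>Finite speed propagation of sublevel sets\<close>

text \<open>The squared positive part is C^{1,1} with an explicit remainder. It serves twice: as the
  penalty outside a moving ball and as the profile of the mollifier.\<close>

lemma pos_part_sq_taylor: "\<bar>(max 0 t)\<^sup>2 - (max 0 s)\<^sup>2 - 2 * max 0 s * (t - s)\<bar> \<le> (t - s :: real)\<^sup>2"
proof -
  consider "s \<ge> 0" "t \<ge> 0" | "s \<ge> 0" "t < 0" | "s < 0" "t \<ge> 0" | "s < 0" "t < 0" by linarith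
  then show ?thesis
  proof cases
    case 1
    then have "(max 0 t)\<^sup>2 - (max 0 s)\<^sup>2 - 2 * max 0 s * (t - s) = (t - s)\<^sup>2"
      by (simp add: power2_eq_square algebra_simps)
    then show ?thesis by simp
  next
    case 2
    then have "s * t \<le> 0" by (simp add: mult_nonneg_nonpos)
    have "(max 0 t)\<^sup>2 - (max 0 s)\<^sup>2 - 2 * max 0 s * (t - s) = s\<^sup>2 - 2 * (s * t)"
      using 2 by (simp add: power2_eq_square algebra_simps)
    moreover have "(t - s)\<^sup>2 = t\<^sup>2 + s\<^sup>2 - 2 * (s * t)" by (simp add: power2_eq_square algebra_simps)
    ultimately show ?thesis using \<open>s * t \<le> 0\<close> zero_le_power2[of t] zero_le_power2[of s] by linarith
  next
    case 3
    then have "t\<^sup>2 \<le> (t - s)\<^sup>2" by (intro power_mono) auto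
    then show ?thesis using 3 by simp
  qed simp
qed

lemma DERIV_pos_part_sq: "((\<lambda>s::real. (max 0 s)\<^sup>2) has_real_derivative 2 * max 0 s) (at s)"
proof -
  have b: "\<bar>((max 0 (s + h))\<^sup>2 - (max 0 s)\<^sup>2) / h - 2 * max 0 s\<bar> \<le> \<bar>h\<bar>" if "h \<noteq> 0" for h
  proof -
    have "((max 0 (s + h))\<^sup>2 - (max 0 s)\<^sup>2) / h - 2 * max 0 s = ((max 0 (s + h))\<^sup>2 - (max 0 s)\<^sup>2 - 2 * max 0 s * h) / h"
      using that by (simp add: field_simps)
    moreover have "\<bar>((max 0 (s + h))\<^sup>2 - (max 0 s)\<^sup>2 - 2 * max 0 s * h)\<bar> \<le> \<bar>h\<bar> * \<bar>h\<bar>"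
      using pos_part_sq_taylor[of "s + h" s] by (simp add: power2_eq_square)
    ultimately show ?thesis using that by (simp add: abs_divide divide_le_eq)
  qed
  have l0: "((\<lambda>h. ((max 0 (s + h))\<^sup>2 - (max 0 s)\<^sup>2) / h - 2 * max 0 s) \<longlongrightarrow> 0) (at 0)"
  proof (rule Lim_null_comparison)
    show "\<forall>\<^sub>F h in at 0. norm (((max 0 (s + h))\<^sup>2 - (max 0 s)\<^sup>2) / h - 2 * max 0 s) \<le> \<bar>h\<bar>"
      using b by (auto simp: eventually_at_filter)
    show "((\<lambda>h::real. \<bar>h\<bar>) \<longlongrightarrow> 0) (at 0)" by (rule tendsto_rabs_zero) (rule tendsto_ident_at)
  qed
  show ?thesis unfolding DERIV_def using l0 by (simp add: LIM_zero_cancel)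
qed

lemma C1_test_pos_sq:
  fixes a :: "'a::euclidean_space"
  shows "C1_test (\<lambda>y. n * (max 0 ((norm (y - a))\<^sup>2 - R))\<^sup>2) (\<lambda>y. (n * (2 * max 0 ((norm (y - a))\<^sup>2 - R))) *\<^sub>R (2 *\<^sub>R (y - a)))"
proof -
  have "((\<lambda>y. n * (max 0 ((norm (y - a))\<^sup>2 - R))\<^sup>2) has_derivative
      (\<lambda>h. ((n * (2 * max 0 ((norm (y - a))\<^sup>2 - R))) *\<^sub>R (2 *\<^sub>R (y - a))) \<bullet> h)) (at y)" for y
  proof -
    have 1: "((\<lambda>y. (norm (y - a))\<^sup>2 - R) has_derivative (\<lambda>h. (2 *\<^sub>R (y - a)) \<bullet> h)) (at y)"
    proof -
      have "((\<lambda>y. (norm (y - a))\<^sup>2) has_derivative (\<lambda>h. (2 *\<^sub>R (y - a)) \<bullet> h)) (at y)"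
        using C1_test_sq[of a] unfolding C1_test_def by blast
      from has_derivative_diff[OF this has_derivative_const[of R]] show ?thesis by (simp only: diff_0_right)
    qed
    have 2: "((\<lambda>s::real. (max 0 s)\<^sup>2) has_derivative (*) (2 * max 0 ((norm (y - a))\<^sup>2 - R))) (at ((norm (y - a))\<^sup>2 - R))"
      using DERIV_pos_part_sq unfolding has_field_derivative_def .
    from has_derivative_mult_right[OF has_derivative_compose[OF 1 2], of n]
    show ?thesis by (simp only: inner_scaleR_left mult.assoc)
  qed
  moreover have "continuous_on UNIV (\<lambda>y. (n * (2 * max 0 ((norm (y - a))\<^sup>2 - R))) *\<^sub>R (2 *\<^sub>R (y - a)))"
    by (intro continuous_intros)
  ultimately show ?thesis by (simp add: C1_test_def)
qed

text \<open>The maximum may sit at the final time, so it is compared with earlier times only and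
  yields a one-sided condition. The positive slope \<open>k\<close> forces the penalty to be active
  there, i.e. \<open>Q s > 0\<close>.\<close>

lemma deriv_pos_sq_left:
  fixes Q :: "real \<Rightarrow> real"
  assumes Q: "(Q has_real_derivative q) (at s)" and d: "\<delta> > 0" and k: "k > 0"
    and mx: "\<And>t. s - \<delta> < t \<Longrightarrow> t < s \<Longrightarrow> n * (max 0 (Q s))\<^sup>2 + k * s \<le> n * (max 0 (Q t))\<^sup>2 + k * t"
  shows "Q s > 0 \<and> n * (2 * Q s) * q + k \<le> 0"
proof -
  have "((\<lambda>t. (max 0 (Q t))\<^sup>2) has_real_derivative 2 * max 0 (Q s) * q) (at s)"
    using DERIV_chain2[OF DERIV_pos_part_sq Q] .
  then have D: "((\<lambda>t. n * (max 0 (Q t))\<^sup>2 + k * t) has_real_derivative n * (2 * max 0 (Q s) * q) + k * 1) (at s)"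
    by (intro DERIV_add DERIV_cmult DERIV_ident)
  have le: "n * (2 * max 0 (Q s) * q) + k * 1 \<le> 0"
  proof (rule ccontr)
    assume "\<not> ?thesis"
    then obtain d' where d': "d' > 0" "\<And>h. 0 < h \<Longrightarrow> h < d' \<Longrightarrow> n * (max 0 (Q (s - h)))\<^sup>2 + k * (s - h) < n * (max 0 (Q s))\<^sup>2 + k * s"
      using DERIV_pos_inc_left[OF D] by auto
    obtain h where "0 < h" "h < d'" "h < \<delta>" using d'(1) d field_lbound_gt_zero by blast
    then show False using d'(2)[of h] mx[of "s - h"] by simp
  qed
  have "Q s > 0"
  proof (rule ccontr)
    assume "\<not> Q s > 0"
    then have "max 0 (Q s) = 0" by simp
    then show False using le k by simp
  qed
  then show ?thesis using le by (simp add: max_def mult.assoc split: if_splits)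
qed

text \<open>A ball with centre \<open>y0 + s *\<^sub>R V y0\<close> and radius growing at speed 1 -
  \<open>\<kappa>\<close> is followed in time, and \<open>v\<close> is compared with
  \<open>(C + \<eta>) * s\<close> plus a penalty outside the ball. At a maximum the cell inequality
  bounds G (|d| + d . V) by C/2, while the time condition asks for at least (C + \<eta>)/2. The
  margin \<open>\<kappa>\<close> absorbs the change of V during time h.\<close>

lemma sublevel_propagation:
  fixes V :: "'a::euclidean_space \<Rightarrow> 'a"
  assumes Vl: "\<And>x y. norm (V x - V y) \<le> L * norm (x - y)" and L: "L \<ge> 0" and Vb: "\<And>x. norm (V x) \<le> M"
    and sub: "stat_visc_sub (Ham V) 0 C v" and bv: "\<And>x. \<bar>v x\<bar> \<le> B" and C: "C \<ge> 0"
    and h: "h > 0" and \<kappa>: "L * h * (M + 1) < \<kappa>" "\<kappa> < 1" "\<kappa> > 0"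
    and near: "norm (y1 - y0 - h *\<^sub>R V y0) \<le> (1 - \<kappa>) * h"
  shows "v y1 \<le> v y0 + C * h"
proof -
  have uv: "usc_on UNIV v" using sub by (simp add: stat_visc_sub_def usc_iff_usc_on)
  have B0: "B \<ge> 0" using bv[of 0] by simp
  have M0: "M \<ge> 0" using Vb[of 0] norm_ge_zero[of "V 0"] by linarith
  have main: "v y1 \<le> v y0 + \<eta> + (C + \<eta>) * h" if \<eta>: "\<eta> > 0" for \<eta>
  proof (rule ccontr)
    assume neg: "\<not> ?thesis"
    obtain \<rho>0 where \<rho>0: "\<rho>0 > 0" "\<And>y. dist y y0 < \<rho>0 \<Longrightarrow> v y < v y0 + \<eta>"
      using usc_onD[OF uv, of y0 "v y0 + \<eta>"] \<eta> by auto
    \<comment> \<open>The initial radius: within \<open>2 * \<rho>\<close> of \<open>y0\<close> the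
      function stays below \<open>v y0 + \<eta>\<close>, which excludes a maximum at s = 0, and
      thickening the tube keeps the variation of V below \<open>\<kappa>\<close>.\<close>
    define \<rho> where "\<rho> = min (\<rho>0 / 3) ((\<kappa> - L * h * (M + 1)) / (2 * (L + 1)))"
    have \<rho>: "\<rho> > 0" "2 * \<rho> < \<rho>0" "L * (h * (M + 1) + 2 * \<rho>) \<le> \<kappa>"
    proof -
      show "\<rho> > 0" using \<rho>0 \<kappa> L by (auto simp: \<rho>_def)
      have "\<rho> \<le> \<rho>0 / 3" unfolding \<rho>_def by (rule min.cobounded1)
      then show "2 * \<rho> < \<rho>0" using \<rho>0(1) by linarith
      have "\<rho> \<le> (\<kappa> - L * h * (M + 1)) / (2 * (L + 1))" unfolding \<rho>_def by (rule min.cobounded2)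
      then have "\<rho> * (2 * (L + 1)) \<le> \<kappa> - L * h * (M + 1)" using L by (subst (asm) pos_le_divide_eq) auto
      moreover have "L * (2 * \<rho>) \<le> \<rho> * (2 * (L + 1))" using \<open>\<rho> > 0\<close> by (simp add: algebra_simps)
      ultimately show "L * (h * (M + 1) + 2 * \<rho>) \<le> \<kappa>" by (simp add: algebra_simps)
    qed
    define R where "R = (\<lambda>s. (1 - \<kappa>) * s + \<rho>)"
    \<comment> \<open>On the boundary of the tube \<open>Q\<close> is at least
      \<open>\<rho>\<^sup>2\<close>, so the penalty exceeds \<open>2 * B\<close> and the maximum
      lies inside.\<close>
    define n where "n = (2 * B + 1) / (\<rho>\<^sup>2)\<^sup>2"
    have n: "n > 0" "n * (\<rho>\<^sup>2)\<^sup>2 > 2 * B" using B0 \<rho>(1) by (auto simp: n_def)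
    define c where "c = (\<lambda>s. y0 + s *\<^sub>R V y0)"
    define Q where "Q = (\<lambda>y s. (norm (y - c s))\<^sup>2 - (R s)\<^sup>2)"
    define \<Psi> where "\<Psi> = (\<lambda>z. v (fst z) - (n * (max 0 (Q (fst z) (snd z)))\<^sup>2 + (C + \<eta>) * snd z))"
    define Kc where "Kc = {z. 0 \<le> snd z \<and> snd z \<le> h \<and> norm (fst z - c (snd z)) \<le> R (snd z) + \<rho>}"
    have R0: "R s \<ge> \<rho>" if "s \<ge> 0" for s using that \<kappa> by (simp add: R_def)
    have Rh: "R s \<le> h + \<rho>" if "0 \<le> s" "s \<le> h" for s
    proof -
      have "(1 - \<kappa>) * s \<le> 1 * h" using that \<kappa> by (intro mult_mono) auto
      then show ?thesis by (simp add: R_def)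
    qed
    have clos: "norm (y - y0) \<le> h * (M + 1) + 2 * \<rho>" if "0 \<le> s" "s \<le> h" "norm (y - c s) \<le> R s + \<rho>" for y s
    proof -
      have "norm (y - y0) \<le> norm (y - c s) + norm (s *\<^sub>R V y0)"
        using norm_triangle_ineq[of "y - c s" "s *\<^sub>R V y0"] by (simp add: c_def)
      also have "norm (s *\<^sub>R V y0) \<le> h * M" using that Vb[of y0] by (auto intro: mult_mono)
      finally show ?thesis using that(3) Rh[OF that(1,2)] by (simp add: algebra_simps)
    qed
    have cQ: "continuous_on S (\<lambda>z. Q (fst z) (snd z))" for S
      unfolding Q_def c_def R_def by (intro continuous_intros)
    have cK: "compact Kc"
    proof -
      have "closed Kc" unfolding Kc_def c_def R_def
        by (intro closed_Collect_conj closed_Collect_le continuous_intros)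
      moreover have "Kc \<subseteq> cball y0 (h * (M + 1) + 2 * \<rho>) \<times> {0..h}"
        using clos by (auto simp: Kc_def dist_norm norm_minus_commute)
      then have "bounded Kc" by (rule bounded_subset[rotated]) (intro bounded_Times; simp)
      ultimately show ?thesis by (simp add: compact_eq_bounded_closed)
    qed
    have in1: "(y1, h) \<in> Kc" using near \<rho>(1) h by (auto simp: Kc_def c_def R_def algebra_simps)
    have Q1: "Q y1 h \<le> 0"
    proof -
      have "norm (y1 - c h) \<le> R h" using near \<rho>(1) by (simp add: c_def R_def algebra_simps)
      then show ?thesis by (simp add: Q_def power_mono)
    qed
    have v1: "\<Psi> (y1, h) > v y0 + \<eta>" using neg Q1 by (simp add: \<Psi>_def max_def algebra_simps)
    have "usc_on Kc \<Psi>" unfolding \<Psi>_def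
      by (intro usc_on_diff_continuous usc_on_compose[OF uv] continuous_intros cQ) auto
    then obtain z where z: "z \<in> Kc" "\<And>w. w \<in> Kc \<Longrightarrow> \<Psi> w \<le> \<Psi> z"
      using usc_on_attains[OF cK] in1 by blast
    have vz: "\<Psi> z > v y0 + \<eta>" using z(2)[OF in1] v1 by simp
    have out: "\<Psi> (y, s) < - B" if "s \<in> {0..h}" "norm (y - c s) \<ge> R s + \<rho>" for y s
    proof -
      have "R s \<ge> \<rho>" using R0 that by auto
      have "(R s + \<rho>)\<^sup>2 \<le> (norm (y - c s))\<^sup>2" using that \<open>R s \<ge> \<rho>\<close> \<rho>(1) by (intro power_mono) auto
      moreover have "(R s + \<rho>)\<^sup>2 = (R s)\<^sup>2 + 2 * R s * \<rho> + \<rho>\<^sup>2" by (simp add: power2_eq_square algebra_simps)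
      moreover have "2 * R s * \<rho> \<ge> 0" using \<open>R s \<ge> \<rho>\<close> \<rho>(1) by simp
      ultimately have "\<rho>\<^sup>2 \<le> Q y s" unfolding Q_def by linarith
      then have "\<rho>\<^sup>2 \<le> max 0 (Q y s)" by simp
      then have "(\<rho>\<^sup>2)\<^sup>2 \<le> (max 0 (Q y s))\<^sup>2" by (intro power_mono) auto
      then have "n * (\<rho>\<^sup>2)\<^sup>2 \<le> n * (max 0 (Q y s))\<^sup>2" using n(1) by (intro mult_left_mono) auto
      moreover have "(C + \<eta>) * s \<ge> 0" using C \<eta> that by auto
      ultimately show ?thesis using n(2) bv[of y] by (simp add: \<Psi>_def abs_le_iff)
    qed
    obtain yb s where zb: "z = (yb, s)" by (cases z)
    have sI: "0 \<le> s" "s \<le> h" and yK: "norm (yb - c s) \<le> R s + \<rho>" using z(1) by (auto simp: zb Kc_def)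
    have vzB: "\<Psi> (yb, s) \<ge> - B" using vz bv[of y0] \<eta> by (simp add: zb abs_le_iff)
    have yi: "norm (yb - c s) < R s + \<rho>" using out[of s yb] sI vzB by force
    have glob: "\<Psi> (y, t) \<le> \<Psi> (yb, s)" if "0 \<le> t" "t \<le> h" for y t
    proof (cases "(y,t) \<in> Kc")
      case True then show ?thesis using z(2) zb by blast
    next
      case False
      then have "\<Psi> (y, t) < - B" using that by (intro out) (auto simp: Kc_def)
      then show ?thesis using vzB by simp
    qed
    have "s \<noteq> 0"
    proof
      assume s0: "s = 0"
      have "dist yb y0 < \<rho>0" using yi \<rho> by (simp add: s0 c_def R_def dist_norm)
      then have "v yb < v y0 + \<eta>" by (rule \<rho>0)
      moreover have "\<Psi> (yb, s) \<le> v yb" using n(1) by (simp add: \<Psi>_def s0)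
      ultimately show False using vz zb by simp
    qed
    then have sp: "s > 0" using sI by simp
    let ?d = "yb - c s"
    have T: "C1_test (\<lambda>y. n * (max 0 (Q y s))\<^sup>2) (\<lambda>y. (n * (2 * max 0 (Q y s))) *\<^sub>R (2 *\<^sub>R (y - c s)))"
      unfolding Q_def by (rule C1_test_pos_sq)
    have "loc_max (\<lambda>y. v y - n * (max 0 (Q y s))\<^sup>2) yb"
      unfolding loc_max_def using glob[OF sI] by (intro exI[of _ 1]) (auto simp: \<Psi>_def)
    then have e1: "Ham V yb ((n * (2 * max 0 (Q yb s))) *\<^sub>R (2 *\<^sub>R ?d) + 0) \<le> C"
      using sub T unfolding stat_visc_sub_def by blast
    have DQ: "((\<lambda>t. Q yb t) has_real_derivative (- 2 * (?d \<bullet> V y0) - 2 * R s * (1 - \<kappa>))) (at s)"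
      unfolding Q_def R_def c_def power2_norm_eq_inner
      by (auto intro!: derivative_eq_intros has_derivative_imp_has_field_derivative simp: inner_commute algebra_simps power2_eq_square)
    \<comment> \<open>\<open>v\<close> is constant in time, so maximality in t is a statement about
      the barrier alone.\<close>
    have "Q yb s > 0 \<and> n * (2 * Q yb s) * (- 2 * (?d \<bullet> V y0) - 2 * R s * (1 - \<kappa>)) + (C + \<eta>) \<le> 0"
    proof (rule deriv_pos_sq_left[OF DQ sp])
      fix t assume t: "s - s < t" "t < s"
      show "n * (max 0 (Q yb s))\<^sup>2 + (C + \<eta>) * s \<le> n * (max 0 (Q yb t))\<^sup>2 + (C + \<eta>) * t"
        using glob[of t yb] t sI by (simp add: \<Psi>_def)
    qed (use C \<eta> in auto)
    then have Qp: "Q yb s > 0" and e2: "C + \<eta> \<le> n * (2 * Q yb s) * (2 * (?d \<bullet> V y0) + 2 * R s * (1 - \<kappa>))"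
      by (auto simp: algebra_simps)
    define G where "G = n * (2 * Q yb s)"
    have G: "G > 0" using n(1) Qp by (simp add: G_def)
    have "max 0 (Q yb s) = Q yb s" using Qp by simp
    then have e1': "G * (2 * norm ?d) + G * (2 * (?d \<bullet> V yb)) \<le> C"
      using e1 G by (simp add: Ham_def G_def)
    have dR: "R s < norm ?d"
    proof -
      have "(R s)\<^sup>2 < (norm ?d)\<^sup>2" using Qp by (simp add: Q_def)
      then show ?thesis by (rule power2_less_imp_less) simp
    qed
    have "\<bar>?d \<bullet> (V y0 - V yb)\<bar> \<le> norm ?d * norm (V y0 - V yb)" by (rule Cauchy_Schwarz_ineq2)
    also have "norm (V y0 - V yb) \<le> L * norm (y0 - yb)" by (rule Vl)
    also have "\<dots> \<le> L * (h * (M + 1) + 2 * \<rho>)" using clos[OF sI yK] L by (intro mult_left_mono) (auto simp: norm_minus_commute)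
    also have "\<dots> \<le> \<kappa>" by (rule \<rho>(3))
    finally have dV: "\<bar>?d \<bullet> V y0 - ?d \<bullet> V yb\<bar> \<le> norm ?d * \<kappa>" by (simp add: inner_diff_right mult_left_mono)
    have "?d \<bullet> V y0 + R s * (1 - \<kappa>) \<le> norm ?d + ?d \<bullet> V yb"
    proof -
      have "R s * (1 - \<kappa>) \<le> norm ?d * (1 - \<kappa>)" using dR \<kappa> by (intro mult_right_mono) auto
      then show ?thesis using dV by (simp add: algebra_simps)
    qed
    then have "G * (?d \<bullet> V y0 + R s * (1 - \<kappa>)) \<le> G * (norm ?d + ?d \<bullet> V yb)" using G by (intro mult_left_mono) auto
    then have "C + \<eta> \<le> C" using e1' e2 by (simp add: G_def[symmetric] algebra_simps)
    then show False using \<eta> by simp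
  qed
  have "v y1 \<le> v y0 + C * h + e" if e: "e > 0" for e
  proof -
    have "v y1 \<le> v y0 + e / (1 + h) + (C + e / (1 + h)) * h" by (rule main) (use e h in simp)
    also have "\<dots> = v y0 + C * h + (e / (1 + h)) * (1 + h)" by (simp add: algebra_simps add_divide_distrib)
    also have "\<dots> = v y0 + C * h + e" using h by simp
    finally show ?thesis .
  qed
  then show ?thesis by (rule field_le_epsilon)
qed

section \<open>Almost everywhere differentiability of Lipschitz functions\<close>

text \<open>The point x may sit anywhere inside its interval. The covering theorem for balls is used
  with midpoints as centres, which do not have to lie in \<open>S\<close>.\<close>

lemma Vitali_intervals:
  fixes S :: "real set" and I :: "(real \<times> real) set"
  assumes "\<And>x d. x \<in> S \<Longrightarrow> d > 0 \<Longrightarrow> \<exists>(a,b)\<in>I. a < x \<and> x < b \<and> b - a < d"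
  obtains C where "countable C" "C \<subseteq> {(a,b)\<in>I. a < b}" "disjoint_family_on (\<lambda>(a,b). {a<..<b}) C"
    "negligible (S - (\<Union>(a,b)\<in>C. {a<..<b}))"
proof -
  let ?c = "\<lambda>(a,b). (a + b) / 2 :: real" and ?r = "\<lambda>(a,b). (b - a) / 2 :: real"
  have bl: "ball (?c i) (?r i) = (case i of (a,b) \<Rightarrow> {a<..<b})" for i
    by (cases i) (auto simp: ball_eq_greaterThanLessThan field_simps)
  have "\<exists>i. i \<in> {(a,b)\<in>I. a < b} \<and> x \<in> ball (?c i) (?r i) \<and> ?r i < d" if x: "x \<in> S" "d > 0" for x d
  proof -
    obtain a b where "(a,b) \<in> I" "a < x" "x < b" "b - a < d" using assms[OF x] by blast
    then show ?thesis by (intro exI[of _ "(a,b)"]) (auto simp: dist_real_def abs_less_iff field_simps)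
  qed
  then show thesis
  proof (rule Vitali_covering_theorem_balls[of S "{(a,b)\<in>I. a < b}" ?c ?r])
    fix C assume C: "countable C" "C \<subseteq> {(a,b)\<in>I. a < b}"
     "pairwise (\<lambda>i j. disjnt (ball (?c i) (?r i)) (ball (?c j) (?r j))) C"
     "negligible(S - (\<Union>i \<in> C. ball (?c i) (?r i)))"
    show thesis
    proof (rule that[OF C(1,2)])
      show "disjoint_family_on (\<lambda>(a,b). {a<..<b}) C"
        using C(3) unfolding disjoint_family_on_def pairwise_def disjnt_def bl by blast
      show "negligible (S - (\<Union>(a,b)\<in>C. {a<..<b}))" using C(4) unfolding bl .
    qed
  qed
qed

text \<open>A Vitali family of intervals with slope at most the smaller rate is chosen first, then inside it one with slope at least
  the larger one; since $g$ is monotone, the image intervals of the second family are disjoint and contained in those of the first.\<close>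

lemma two_slopes_null:
  fixes g :: "real \<Rightarrow> real"
  assumes g: "mono g" and S: "S \<in> sets borel" "S \<subseteq> {0<..<1}" and ab: "0 \<le> \<alpha>" "\<alpha> < \<beta>"
    and lo: "\<And>x d. x \<in> S \<Longrightarrow> d > 0 \<Longrightarrow> \<exists>a b. a < x \<and> x < b \<and> b - a < d \<and> g b - g a \<le> \<alpha> * (b - a)"
    and hi: "\<And>x d. x \<in> S \<Longrightarrow> d > 0 \<Longrightarrow> \<exists>a b. a < x \<and> x < b \<and> b - a < d \<and> \<beta> * (b - a) \<le> g b - g a"
  shows "emeasure lborel S = 0"
proof -
  define iv where "iv = (\<lambda>(a,b). {a<..<b::real})"
  define J where "J = (\<lambda>(a,b). {g a<..<g b})"
  have Jdisj: "disjoint_family_on J C" if C: "C \<subseteq> {(a,b). a < b}" "disjoint_family_on iv C" for C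
    unfolding disjoint_family_on_def
  proof (intro ballI impI)
    fix i j assume ij: "i \<in> C" "j \<in> C" "i \<noteq> j"
    obtain a b c d where e: "i = (a,b)" "j = (c,d)" by (metis surj_pair)
    have ne: "a < b" "c < d" using C(1) ij e by auto
    have "iv i \<inter> iv j = {}" using C(2) ij unfolding disjoint_family_on_def by blast
    then have "{a<..<b} \<inter> {c<..<d} = {}" by (simp add: e iv_def)
    have "b \<le> c \<or> d \<le> a"
    proof (rule ccontr)
      assume "\<not> (b \<le> c \<or> d \<le> a)"
      then have "max a c < min b d" using ne by auto
      then obtain m where "max a c < m" "m < min b d" using dense by blast
      then show False using \<open>{a<..<b} \<inter> {c<..<d} = {}\<close> by auto
    qed
    then show "J i \<inter> J j = {}" using monoD[OF g] by (force simp: J_def e)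
  qed
  have cb: "emeasure lborel (\<Union>i\<in>C. J i) = (\<integral>\<^sup>+i. ennreal (g (snd i) - g (fst i)) \<partial>count_space C)"
           "emeasure lborel (\<Union>i\<in>C. iv i) = (\<integral>\<^sup>+i. ennreal (snd i - fst i) \<partial>count_space C)"
    if C: "countable C" "C \<subseteq> {(a,b). a < b}" "disjoint_family_on iv C" for C
  proof -
    have "emeasure lborel (\<Union>i\<in>C. J i) = (\<integral>\<^sup>+i. emeasure lborel (J i) \<partial>count_space C)"
      by (rule emeasure_UN_countable) (use C Jdisj in \<open>auto simp: J_def\<close>)
    also have "\<dots> = (\<integral>\<^sup>+i. ennreal (g (snd i) - g (fst i)) \<partial>count_space C)"
      using C(2) monoD[OF g] by (intro nn_integral_cong) (auto simp: J_def less_imp_le)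
    finally show "emeasure lborel (\<Union>i\<in>C. J i) = (\<integral>\<^sup>+i. ennreal (g (snd i) - g (fst i)) \<partial>count_space C)" .
    have "emeasure lborel (\<Union>i\<in>C. iv i) = (\<integral>\<^sup>+i. emeasure lborel (iv i) \<partial>count_space C)"
      by (rule emeasure_UN_countable) (use C in \<open>auto simp: iv_def\<close>)
    also have "\<dots> = (\<integral>\<^sup>+i. ennreal (snd i - fst i) \<partial>count_space C)"
      using C(2) by (intro nn_integral_cong) (auto simp: iv_def less_imp_le)
    finally show "emeasure lborel (\<Union>i\<in>C. iv i) = (\<integral>\<^sup>+i. ennreal (snd i - fst i) \<partial>count_space C)" .
  qed
  \<comment> \<open>As U is arbitrary, outer regularity turns this into \<beta> |S| \<le> \<alpha>
    |S|, and |S| is finite because \<open>S\<close> lies in the unit interval.\<close>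
  have key: "ennreal \<beta> * emeasure lborel S \<le> ennreal \<alpha> * emeasure lborel U" if U: "open U" "S \<subseteq> U" for U
  proof -
    define I1 where "I1 = {(a,b). {a<..<b} \<subseteq> U \<and> g b - g a \<le> \<alpha> * (b - a)}"
    have "\<exists>(a,b)\<in>I1. a < x \<and> x < b \<and> b - a < d" if x: "x \<in> S" "d > 0" for x d
    proof -
      obtain e where e: "e > 0" "ball x e \<subseteq> U" using U x by (meson openE subsetD)
      obtain a b where ab: "a < x" "x < b" "b - a < min d e" "g b - g a \<le> \<alpha> * (b - a)"
        using lo[OF x(1), of "min d e"] e x by auto
      have "{a<..<b} \<subseteq> ball x e" using ab by (auto simp: dist_real_def)
      then show ?thesis using ab e by (intro bexI[of _ "(a,b)"]) (auto simp: I1_def)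
    qed
    then obtain C1 where C1: "countable C1" "C1 \<subseteq> {(a,b)\<in>I1. a < b}" "disjoint_family_on iv C1"
      "negligible (S - (\<Union>i\<in>C1. iv i))"
      by (rule Vitali_intervals[of S I1, folded iv_def])
    define U1 where "U1 = (\<Union>i\<in>C1. iv i)"
    define I2 where "I2 = {(a,b). (\<exists>i\<in>C1. {a<..<b} \<subseteq> iv i) \<and> \<beta> * (b - a) \<le> g b - g a}"
    have "\<exists>(a,b)\<in>I2. a < x \<and> x < b \<and> b - a < d" if x: "x \<in> S \<inter> U1" "d > 0" for x d
    proof -
      obtain i where i: "i \<in> C1" "x \<in> iv i" using x by (auto simp: U1_def)
      have "open (iv i)" by (cases i) (simp add: iv_def)
      then obtain e where e: "e > 0" "ball x e \<subseteq> iv i" using i by (meson openE)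
      obtain a b where ab: "a < x" "x < b" "b - a < min d e" "\<beta> * (b - a) \<le> g b - g a"
        using hi[of x "min d e"] e x by auto
      have "{a<..<b} \<subseteq> ball x e" using ab by (auto simp: dist_real_def)
      then show ?thesis using ab e i by (intro bexI[of _ "(a,b)"]) (auto simp: I2_def)
    qed
    then obtain C2 where C2: "countable C2" "C2 \<subseteq> {(a,b)\<in>I2. a < b}" "disjoint_family_on iv C2"
      "negligible (S \<inter> U1 - (\<Union>i\<in>C2. iv i))"
      by (rule Vitali_intervals[of "S \<inter> U1" I2, folded iv_def])
    define U2 where "U2 = (\<Union>i\<in>C2. iv i)"
    have C1': "C1 \<subseteq> {(a,b). a < b}" and C2': "C2 \<subseteq> {(a,b). a < b}" using C1(2) C2(2) by auto
    have U12: "U1 \<in> sets borel" "U2 \<in> sets borel" "U1 \<subseteq> U"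
      using C1(2) by (auto simp: U1_def U2_def iv_def I1_def intro!: borel_open open_UN)
    have "negligible (S - U2)"
      by (rule negligible_subset[OF negligible_Un[OF C1(4) C2(4)]]) (auto simp: U1_def U2_def)
    then have null: "emeasure lborel (S - U2) = 0"
      using S(1) U12 by (simp add: negligible_iff_emeasure0 emeasure_lborel_cbox_eq[symmetric] sets_completionI_sets)
    have "emeasure lborel S \<le> emeasure lborel (U2 \<union> (S - U2))"
      using S(1) U12 by (intro emeasure_mono) auto
    also have "\<dots> \<le> emeasure lborel U2 + emeasure lborel (S - U2)"
      using S(1) U12 by (intro emeasure_subadditive) auto
    finally have "emeasure lborel S \<le> emeasure lborel U2" using null by simp
    then have "ennreal \<beta> * emeasure lborel S \<le> ennreal \<beta> * emeasure lborel U2" by (intro mult_left_mono) auto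
    also have "\<dots> = (\<integral>\<^sup>+i. ennreal \<beta> * ennreal (snd i - fst i) \<partial>count_space C2)"
      unfolding U2_def cb(2)[OF C2(1) C2' C2(3)] by (rule nn_integral_cmult[symmetric]) auto
    also have "\<dots> \<le> (\<integral>\<^sup>+i. ennreal (g (snd i) - g (fst i)) \<partial>count_space C2)"
    proof (rule nn_integral_mono)
      fix i assume "i \<in> space (count_space C2)"
      then have "fst i < snd i" "\<beta> * (snd i - fst i) \<le> g (snd i) - g (fst i)" using C2(2) by (auto simp: I2_def)
      then show "ennreal \<beta> * ennreal (snd i - fst i) \<le> ennreal (g (snd i) - g (fst i))"
        using ab by (simp add: ennreal_mult[symmetric] ennreal_leI)
    qed
    also have "\<dots> = emeasure lborel (\<Union>i\<in>C2. J i)" by (rule cb(1)[OF C2(1) C2' C2(3), symmetric])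
    also have "\<dots> \<le> emeasure lborel (\<Union>i\<in>C1. J i)"
    proof (rule emeasure_mono)
      show "(\<Union>i\<in>C2. J i) \<subseteq> (\<Union>i\<in>C1. J i)"
      proof
        fix y assume "y \<in> (\<Union>i\<in>C2. J i)"
        then obtain a b where i: "(a,b) \<in> C2" "g a < y" "y < g b" by (auto simp: J_def)
        then obtain c d where j: "(c,d) \<in> C1" "{a<..<b} \<subseteq> {c<..<d}" "a < b" using C2(2) by (auto simp: I2_def iv_def)
        then have "c \<le> a" "b \<le> d" by (auto simp: greaterThanLessThan_subseteq_greaterThanLessThan)
        then have "g c \<le> g a" "g b \<le> g d" using monoD[OF g] by auto
        then have "y \<in> J (c,d)" using i by (simp add: J_def)
        then show "y \<in> (\<Union>i\<in>C1. J i)" using j(1) by blast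
      qed
      show "(\<Union>i\<in>C1. J i) \<in> sets lborel" using C1(1) by (auto simp: J_def intro!: sets.countable_UN')
    qed
    also have "\<dots> = (\<integral>\<^sup>+i. ennreal (g (snd i) - g (fst i)) \<partial>count_space C1)" by (rule cb(1)[OF C1(1) C1' C1(3)])
    also have "\<dots> \<le> (\<integral>\<^sup>+i. ennreal \<alpha> * ennreal (snd i - fst i) \<partial>count_space C1)"
    proof (rule nn_integral_mono)
      fix i assume "i \<in> space (count_space C1)"
      then have "fst i < snd i" "g (snd i) - g (fst i) \<le> \<alpha> * (snd i - fst i)" using C1(2) by (auto simp: I1_def)
      then show "ennreal (g (snd i) - g (fst i)) \<le> ennreal \<alpha> * ennreal (snd i - fst i)"
        using ab by (simp add: ennreal_mult[symmetric] ennreal_leI)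
    qed
    also have "\<dots> = ennreal \<alpha> * emeasure lborel U1"
      unfolding U1_def cb(2)[OF C1(1) C1' C1(3)] by (rule nn_integral_cmult) auto
    also have "\<dots> \<le> ennreal \<alpha> * emeasure lborel U"
      using U12 U by (intro mult_left_mono emeasure_mono) auto
    finally show ?thesis .
  qed
  have fin: "emeasure lborel S \<noteq> \<infinity>"
  proof -
    have "emeasure lborel S \<le> emeasure lborel {0<..<1::real}" using S by (intro emeasure_mono) auto
    then show ?thesis by (auto simp: top_unique)
  qed
  define m where "m = measure lborel S"
  have m: "emeasure lborel S = ennreal m" "m \<ge> 0" unfolding m_def using fin
    by (auto simp: emeasure_eq_ennreal_measure)
  have "\<beta> * m \<le> \<alpha> * m + e" if e: "e > 0" for e
  proof -
    obtain U where U: "open U" "S \<subseteq> U" "emeasure lborel (U - S) < ennreal (e / (\<alpha> + 1))"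
      using outer_regular_lborel[OF S(1), of "e / (\<alpha> + 1)"] e ab by auto
    have "emeasure lborel U \<le> emeasure lborel S + emeasure lborel (U - S)"
      using emeasure_subadditive[of S lborel "U - S"] S(1) U by (simp add: Un_absorb1)
    also have "\<dots> \<le> ennreal m + ennreal (e / (\<alpha> + 1))" using m(1) U(3) by (intro add_mono) auto
    also have "\<dots> = ennreal (m + e / (\<alpha> + 1))" using m(2) e ab by simp
    finally have "ennreal \<alpha> * emeasure lborel U \<le> ennreal \<alpha> * ennreal (m + e / (\<alpha> + 1))" by (intro mult_left_mono) auto
    then have "ennreal \<beta> * ennreal m \<le> ennreal \<alpha> * ennreal (m + e / (\<alpha> + 1))"
      using key[OF U(1,2)] m(1) by (metis order_trans)
    moreover have "0 \<le> m + e / (\<alpha> + 1)" using ab m(2) e by simp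
    ultimately have "\<beta> * m \<le> \<alpha> * (m + e / (\<alpha> + 1))"
      using ab m(2) by (simp add: ennreal_mult[symmetric] del: ennreal_plus)
    also have "\<dots> = \<alpha> * m + e * (\<alpha> / (\<alpha> + 1))" by (simp add: algebra_simps)
    also have "e * (\<alpha> / (\<alpha> + 1)) \<le> e * 1" using ab e by (intro mult_left_mono) auto
    finally show ?thesis by simp
  qed
  then have "\<beta> * m \<le> \<alpha> * m" by (rule field_le_epsilon)
  then have "m = 0" using ab m(2) by (metis linorder_not_less mult_less_cancel_right order_antisym_conv)
  then show ?thesis using m(1) by simp
qed

text \<open>The hypotheses concern only quotients over intervals straddling 0, the ones Vitali
  coverings can handle, and only rational slopes, so that countably many exceptional sets suffice.
  The derivative is the supremum of the rational lower slopes.\<close>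

lemma two_sided_slope_derivative:
  fixes g :: "real \<Rightarrow> real"
  assumes mono: "mono g" and cont: "isCont g 0" and bnd: "\<And>a c. a < c \<Longrightarrow> g c - g a \<le> M * (c - a)"
    and alt: "\<And>\<alpha> \<beta>. \<alpha> \<in> \<rat> \<Longrightarrow> \<beta> \<in> \<rat> \<Longrightarrow> 0 \<le> \<alpha> \<Longrightarrow> \<alpha> < \<beta> \<Longrightarrow>
       (\<exists>\<delta>>0. \<forall>a c. a < 0 \<and> 0 < c \<and> c - a < \<delta> \<longrightarrow> \<alpha> * (c - a) \<le> g c - g a) \<or>
       (\<exists>\<delta>>0. \<forall>a c. a < 0 \<and> 0 < c \<and> c - a < \<delta> \<longrightarrow> g c - g a \<le> \<beta> * (c - a))"
  shows "\<exists>D. (g has_real_derivative D) (at 0)"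
proof -
  define E where "E = {\<alpha>\<in>\<rat>. 0 \<le> \<alpha> \<and> (\<exists>\<delta>>0. \<forall>a c. a < 0 \<and> 0 < c \<and> c - a < \<delta> \<longrightarrow> \<alpha> * (c - a) \<le> g c - g a)}"
  have E0: "0 \<in> E" using monoD[OF mono] by (auto simp: E_def intro!: exI[of _ 1])
  have Eb: "\<alpha> \<le> M" if "\<alpha> \<in> E" for \<alpha>
  proof -
    obtain \<delta> where \<delta>: "\<delta> > 0" "\<And>a c. a < 0 \<Longrightarrow> 0 < c \<Longrightarrow> c - a < \<delta> \<Longrightarrow> \<alpha> * (c - a) \<le> g c - g a"
      using \<open>\<alpha> \<in> E\<close> by (auto simp: E_def)
    have "\<alpha> * (\<delta>/4 - - (\<delta>/4)) \<le> M * (\<delta>/4 - - (\<delta>/4))"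
      by (rule order_trans[OF \<delta>(2) bnd]) (use \<delta>(1) in auto)
    then show ?thesis using \<delta>(1) by simp
  qed
  have bdd: "bdd_above E" using Eb by (meson bdd_aboveI)
  define D where "D = Sup E"
  have D0: "D \<ge> 0" unfolding D_def by (rule cSup_upper[OF E0 bdd])
  have near: "\<exists>\<delta>>0. \<forall>a c. a < 0 \<and> 0 < c \<and> c - a < \<delta> \<longrightarrow> \<bar>g c - g a - D * (c - a)\<bar> \<le> e * (c - a)" if e: "e > 0" for e
  proof -
    obtain \<alpha> where \<alpha>: "\<alpha> \<in> \<rat>" "D < \<alpha>" "\<alpha> < D + e" using Rats_dense_in_real[of D "D + e"] e by auto
    obtain \<beta> where \<beta>: "\<beta> \<in> \<rat>" "\<alpha> < \<beta>" "\<beta> < D + e" using Rats_dense_in_real[of \<alpha> "D + e"] \<alpha> by auto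
    have "\<alpha> \<notin> E" using \<alpha>(2) cSup_upper[OF _ bdd, of \<alpha>] by (auto simp: D_def)
    then obtain \<delta>1 where d1: "\<delta>1 > 0" "\<And>a c. a < 0 \<Longrightarrow> 0 < c \<Longrightarrow> c - a < \<delta>1 \<Longrightarrow> g c - g a \<le> \<beta> * (c - a)"
      using alt[OF \<alpha>(1) \<beta>(1) _ \<beta>(2)] \<alpha> D0 unfolding E_def by auto
    obtain \<gamma> where \<gamma>: "\<gamma> \<in> E" "D - e < \<gamma>" using less_cSupE[of "D - e" E] E0 e by (auto simp: D_def)
    obtain \<delta>2 where d2: "\<delta>2 > 0" "\<And>a c. a < 0 \<Longrightarrow> 0 < c \<Longrightarrow> c - a < \<delta>2 \<Longrightarrow> \<gamma> * (c - a) \<le> g c - g a"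
      using \<gamma>(1) by (auto simp: E_def)
    show ?thesis
    proof (intro exI[of _ "min \<delta>1 \<delta>2"] conjI allI impI)
      fix a c assume ac: "a < 0 \<and> 0 < c \<and> c - a < min \<delta>1 \<delta>2"
      have "g c - g a \<le> \<beta> * (c - a)" "\<gamma> * (c - a) \<le> g c - g a" using d1(2)[of a c] d2(2)[of a c] ac by auto
      moreover have "\<beta> * (c - a) \<le> (D + e) * (c - a)" "(D - e) * (c - a) \<le> \<gamma> * (c - a)"
        using \<beta> \<gamma> ac by (auto intro!: mult_right_mono)
      ultimately show "\<bar>g c - g a - D * (c - a)\<bar> \<le> e * (c - a)" by (simp add: algebra_simps abs_le_iff)
    qed (use d1 d2 in auto)
  qed
  \<comment> \<open>A difference quotient based at 0 is obtained from straddling ones by letting the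
    opposite endpoint tend to 0, with continuity of \<open>g\<close>.\<close>
  have one: "\<exists>\<delta>>0. \<forall>h. h \<noteq> 0 \<and> \<bar>h\<bar> < \<delta> \<longrightarrow> \<bar>g h - g 0 - D * h\<bar> \<le> e * \<bar>h\<bar>" if e: "e > 0" for e
  proof -
    obtain \<delta> where \<delta>: "\<delta> > 0" "\<And>a c. a < 0 \<Longrightarrow> 0 < c \<Longrightarrow> c - a < \<delta> \<Longrightarrow> \<bar>g c - g a - D * (c - a)\<bar> \<le> e * (c - a)"
      using near[OF e] by blast
    have "\<bar>g h - g 0 - D * h\<bar> \<le> e * \<bar>h\<bar>" if h: "h \<noteq> 0" "\<bar>h\<bar> < \<delta>" for h
    proof -
      define s where "s = sgn h"
      have gl: "((\<lambda>t. g (- s * t)) \<longlongrightarrow> g 0) (at_right 0)"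
      proof -
        have "((\<lambda>t. - s * t) \<longlongrightarrow> - s * 0) (at_right 0)" by (intro tendsto_intros)
        then have "((\<lambda>t. - s * t) \<longlongrightarrow> 0) (at_right 0)" by simp
        then show ?thesis by (rule isCont_tendsto_compose[OF cont])
      qed
      have l: "((\<lambda>t. \<bar>g h - g (- s * t) - D * (h + s * t)\<bar>) \<longlongrightarrow> \<bar>g h - g 0 - D * (h + s * 0)\<bar>) (at_right 0)"
        by (intro tendsto_intros gl)
      have r: "((\<lambda>t. e * (\<bar>h\<bar> + t)) \<longlongrightarrow> e * (\<bar>h\<bar> + 0)) (at_right 0)" by (intro tendsto_intros)
      have "\<forall>\<^sub>F t in at_right 0. \<bar>g h - g (- s * t) - D * (h + s * t)\<bar> \<le> e * (\<bar>h\<bar> + t)"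
        unfolding eventually_at_right_field
      proof (intro exI[of _ "\<delta> - \<bar>h\<bar>"] conjI allI impI)
        fix t assume t: "0 < t" "t < \<delta> - \<bar>h\<bar>"
        show "\<bar>g h - g (- s * t) - D * (h + s * t)\<bar> \<le> e * (\<bar>h\<bar> + t)"
        proof (cases "h > 0")
          case True
          then show ?thesis using \<delta>(2)[of "-t" h] t by (simp add: s_def algebra_simps)
        next
          case False
          then have "h < 0" using h by simp
          then show ?thesis using \<delta>(2)[of h t] t by (simp add: s_def algebra_simps abs_minus_commute)
        qed
      qed (use h in auto)
      from tendsto_le[OF _ r l this] show ?thesis by simp
    qed
    then show ?thesis using \<delta>(1) by blast
  qed
  have "((\<lambda>h. (g h - g 0) / h) \<longlongrightarrow> D) (at 0)"
    unfolding tendsto_iff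
  proof (intro allI impI)
    fix e :: real assume e: "e > 0"
    then obtain \<delta> where \<delta>: "\<delta> > 0" "\<And>h. h \<noteq> 0 \<Longrightarrow> \<bar>h\<bar> < \<delta> \<Longrightarrow> \<bar>g h - g 0 - D * h\<bar> \<le> e / 2 * \<bar>h\<bar>"
      using one[of "e/2"] by auto
    show "\<forall>\<^sub>F h in at 0. dist ((g h - g 0) / h) D < e"
      unfolding eventually_at
    proof (intro exI[of _ \<delta>] conjI ballI impI)
      fix h :: real assume h: "h \<noteq> 0 \<and> dist h 0 < \<delta>"
      have "(g h - g 0) / h - D = (g h - g 0 - D * h) / h" using h by (simp add: field_simps)
      then have "\<bar>(g h - g 0) / h - D\<bar> = \<bar>g h - g 0 - D * h\<bar> / \<bar>h\<bar>" by (simp add: abs_divide)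
      also have "\<dots> \<le> e / 2" using \<delta>(2)[of h] h by (simp add: divide_le_eq)
      finally show "dist ((g h - g 0) / h) D < e" using e by (simp add: dist_real_def)
    qed (rule \<delta>)
  qed
  then show ?thesis by (auto simp: DERIV_def intro!: exI[of _ D])
qed

text \<open>Adding \<open>K * t\<close> with K = L |b| makes every restriction to a line monotone,
  which reduces the claim to the null sets of \<open>two_slopes_null\<close>. The linear term is
  removed at the end.\<close>

lemma Lipschitz_AE_directional_derivative:
  fixes f :: "'a::euclidean_space \<Rightarrow> real" and b :: 'a
  assumes lip: "\<And>x y. \<bar>f x - f y\<bar> \<le> L * norm (x - y)"
  shows "AE x in lborel. \<exists>D. ((\<lambda>h. f (x + h *\<^sub>R b)) has_real_derivative D) (at 0)"
proof -
  have L0: "L * norm b \<ge> 0" using lip[of b 0] by (smt (verit) diff_zero)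
  define K where "K = L * norm b"
  define g where "g = (\<lambda>x t. f (x + t *\<^sub>R b) + K * t)"
  have K0: "K \<ge> 0" using L0 by (simp add: K_def)
  have fl: "\<bar>f (x + c *\<^sub>R b) - f (x + a *\<^sub>R b)\<bar> \<le> K * \<bar>c - a\<bar>" for x a c
    using lip[of "x + c *\<^sub>R b" "x + a *\<^sub>R b"] by (simp add: K_def scaleR_left_diff_distrib[symmetric] mult.assoc mult.commute mult.left_commute)
  have gm: "mono (g x)" for x
  proof (rule monoI)
    fix a c :: real assume "a \<le> c"
    then show "g x a \<le> g x c" using fl[of x c a] by (simp add: g_def algebra_simps abs_le_iff)
  qed
  have gb: "g x c - g x a \<le> 2 * K * (c - a)" if "a < c" for x a c
    using fl[of x c a] that by (simp add: g_def algebra_simps abs_le_iff)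
  have fc: "continuous_on UNIV f"
  proof (rule continuous_onI)
    fix x and e :: real assume e: "e > 0"
    show "\<exists>d>0. \<forall>x'\<in>UNIV. dist x' x < d \<longrightarrow> dist (f x') (f x) \<le> e"
    proof (intro exI[of _ "e / (\<bar>L\<bar> + 1)"] conjI ballI impI)
      fix x' assume x': "dist x' x < e / (\<bar>L\<bar> + 1)"
      have "\<bar>f x' - f x\<bar> \<le> (\<bar>L\<bar> + 1) * norm (x' - x)"
        using lip[of x' x] by (smt (verit) mult_right_mono norm_ge_zero)
      also have "\<dots> \<le> (\<bar>L\<bar> + 1) * (e / (\<bar>L\<bar> + 1))" using x' by (intro mult_left_mono) (auto simp: dist_norm)
      finally show "dist (f x') (f x) \<le> e" by (simp add: dist_real_def)
    qed (use e in auto)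
  qed
  have gc: "continuous_on UNIV (\<lambda>x. g x t)" for t
    unfolding g_def by (intro continuous_intros continuous_on_compose2[OF fc]) auto
  \<comment> \<open>A union of open sets over all real pairs is open. So \<open>S\<close> is a
    countable intersection of open sets, hence Borel, although uncountably many intervals occur in
    it.\<close>
  define Ol where "Ol = (\<lambda>\<alpha> n::nat. \<Union>p\<in>{p. fst p < 0 \<and> 0 < snd p \<and> snd p - fst p < 1 / real (Suc n)}.
      {x. g x (snd p) - g x (fst p) < \<alpha> * (snd p - fst p)})"
  define Oh where "Oh = (\<lambda>\<beta> n::nat. \<Union>p\<in>{p. fst p < 0 \<and> 0 < snd p \<and> snd p - fst p < 1 / real (Suc n)}.
      {x. \<beta> * (snd p - fst p) < g x (snd p) - g x (fst p)})"
  define S where "S = (\<lambda>\<alpha> \<beta>. (\<Inter>n. Ol \<alpha> n) \<inter> (\<Inter>n. Oh \<beta> n))"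
  have "open (Ol \<alpha> n)" "open (Oh \<alpha> n)" for \<alpha> n
    unfolding Ol_def Oh_def by (auto intro!: open_UN open_Collect_less continuous_intros gc)
  then have Sb: "S \<alpha> \<beta> \<in> sets borel" for \<alpha> \<beta> unfolding S_def by auto
  have null: "emeasure lborel (S \<alpha> \<beta>) = 0" if ab: "0 \<le> \<alpha>" "\<alpha> < \<beta>" for \<alpha> \<beta>
  proof -
    define T where "T = (\<lambda>y. {t\<in>{0<..<1}. y + t *\<^sub>R b \<in> S \<alpha> \<beta>})"
    have meas: "(\<lambda>(y, t). y + t *\<^sub>R b) \<in> borel_measurable (lborel \<Otimes>\<^sub>M lborel)" by measurable
    have Tb: "T y \<in> sets borel" for y
    proof -
      have "(\<lambda>t. y + t *\<^sub>R b) -` S \<alpha> \<beta> \<inter> space borel \<in> sets borel"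
        by (rule measurable_sets[OF _ Sb]) simp
      moreover have "T y = {0<..<1} \<inter> ((\<lambda>t. y + t *\<^sub>R b) -` S \<alpha> \<beta> \<inter> space borel)" by (auto simp: T_def)
      ultimately show ?thesis by simp
    qed
    have sh: "g (y + t *\<^sub>R b) s = g y (t + s) - K * t" for y t s by (simp add: g_def algebra_simps)
    have T0: "emeasure lborel (T y) = 0" for y
    proof (rule two_slopes_null[OF gm[of y] Tb _ ab])
      fix t d :: real assume t: "t \<in> T y" "d > 0"
      obtain n where n: "1 / real (Suc n) < d" using t(2) nat_approx_posE by metis
      have "y + t *\<^sub>R b \<in> Ol \<alpha> n" "y + t *\<^sub>R b \<in> Oh \<beta> n" using t by (auto simp: T_def S_def)
      then obtain p q where p: "fst p < 0" "0 < snd p" "snd p - fst p < 1 / real (Suc n)"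
          "g (y + t *\<^sub>R b) (snd p) - g (y + t *\<^sub>R b) (fst p) < \<alpha> * (snd p - fst p)"
        and q: "fst q < 0" "0 < snd q" "snd q - fst q < 1 / real (Suc n)"
          "\<beta> * (snd q - fst q) < g (y + t *\<^sub>R b) (snd q) - g (y + t *\<^sub>R b) (fst q)"
        unfolding Ol_def Oh_def by blast
      show "\<exists>a c. a < t \<and> t < c \<and> c - a < d \<and> g y c - g y a \<le> \<alpha> * (c - a)"
        using p n by (intro exI[of _ "t + fst p"] exI[of _ "t + snd p"]) (auto simp: sh)
      show "\<exists>a c. a < t \<and> t < c \<and> c - a < d \<and> \<beta> * (c - a) \<le> g y c - g y a"
        using q n by (intro exI[of _ "t + fst q"] exI[of _ "t + snd q"]) (auto simp: sh)
    qed (auto simp: T_def)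
    \<comment> \<open>Fubini for the map from (y, t) to y + t b: all sections in t are null, while
      for fixed t translation invariance gives the measure of \<open>S\<close>. This treats every
      direction b without changing coordinates.\<close>
    define F :: "'a \<times> real \<Rightarrow> ennreal" where "F = (\<lambda>(y,t). indicator (S \<alpha> \<beta>) (y + t *\<^sub>R b) * indicator {0<..<1} t)"
    have FS: "(\<lambda>(y, t). indicator (S \<alpha> \<beta>) (y + t *\<^sub>R b) :: ennreal) \<in> borel_measurable (lborel \<Otimes>\<^sub>M lborel)"
    proof -
      have "(\<lambda>z. indicator (S \<alpha> \<beta>) ((\<lambda>(y, t). y + t *\<^sub>R b) z) :: ennreal) \<in> borel_measurable (lborel \<Otimes>\<^sub>M lborel)"
        by (rule measurable_compose[OF meas]) (use Sb in simp)
      then show ?thesis by (simp add: case_prod_unfold)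
    qed
    have Fm: "F \<in> borel_measurable (lborel \<Otimes>\<^sub>M lborel)"
    proof -
      have "(\<lambda>z. (case z of (y, t) \<Rightarrow> indicator (S \<alpha> \<beta>) (y + t *\<^sub>R b)) * indicator {0<..<1} (snd z) :: ennreal) \<in> borel_measurable (lborel \<Otimes>\<^sub>M lborel)"
        by (intro borel_measurable_times_ennreal FS) measurable
      then show ?thesis by (simp add: F_def case_prod_unfold)
    qed
    have "(\<integral>\<^sup>+t. (\<integral>\<^sup>+y. F (y,t) \<partial>lborel) \<partial>lborel) = (\<integral>\<^sup>+y. (\<integral>\<^sup>+t. F (y,t) \<partial>lborel) \<partial>lborel)"
      by (rule lborel_pair.Fubini[OF Fm])
    also have "\<dots> = (\<integral>\<^sup>+y. emeasure lborel (T y) \<partial>lborel)"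
    proof (rule nn_integral_cong)
      fix y :: 'a
      have "(\<integral>\<^sup>+t. F (y,t) \<partial>lborel) = (\<integral>\<^sup>+t. indicator (T y) t \<partial>lborel)"
        by (intro nn_integral_cong) (auto simp: F_def T_def indicator_def)
      then show "(\<integral>\<^sup>+t. F (y,t) \<partial>lborel) = emeasure lborel (T y)" using Tb by simp
    qed
    also have "\<dots> = 0" using T0 by simp
    finally have z: "(\<integral>\<^sup>+t. (\<integral>\<^sup>+y. F (y,t) \<partial>lborel) \<partial>lborel) = 0" .
    have inner: "(\<integral>\<^sup>+y. F (y,t) \<partial>lborel) = emeasure lborel (S \<alpha> \<beta>) * indicator {0<..<1} t" for t
    proof -
      have "(\<integral>\<^sup>+y. F (y,t) \<partial>lborel) = (\<integral>\<^sup>+y. indicator (S \<alpha> \<beta>) (y + t *\<^sub>R b) \<partial>lborel) * indicator {0<..<1} t"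
        unfolding F_def prod.case
        by (rule nn_integral_multc) (rule measurable_compose[of _ lborel borel], use Sb in simp_all)
      also have "(\<integral>\<^sup>+y. indicator (S \<alpha> \<beta>) (y + t *\<^sub>R b) \<partial>lborel) = (\<integral>\<^sup>+y. indicator (S \<alpha> \<beta>) y \<partial>distr lborel borel (\<lambda>y. t *\<^sub>R b + y))"
        by (subst nn_integral_distr) (use Sb in \<open>simp_all add: add.commute\<close>)
      also have "distr lborel borel (\<lambda>y. t *\<^sub>R b + y) = lborel" by (rule lborel_distr_plus)
      finally show ?thesis using Sb by simp
    qed
    have "(\<integral>\<^sup>+t. emeasure lborel (S \<alpha> \<beta>) * indicator {0<..<1::real} t \<partial>lborel) = emeasure lborel (S \<alpha> \<beta>) * emeasure lborel {0<..<1::real}"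
      by (rule nn_integral_cmult_indicator) simp
    then show ?thesis using z inner by simp
  qed
  have "AE x in lborel. \<forall>p\<in>{p\<in>\<rat>\<times>\<rat>. 0 \<le> fst p \<and> fst p < snd p}. x \<notin> S (fst p) (snd p)"
  proof (subst AE_ball_countable)
    show "countable {p\<in>\<rat>\<times>\<rat>. (0::real) \<le> fst p \<and> fst p < snd p}"
      by (rule countable_subset[of _ "\<rat> \<times> \<rat>"]) (auto intro: countable_rat)
    show "\<forall>p\<in>{p\<in>\<rat>\<times>\<rat>. 0 \<le> fst p \<and> fst p < snd p}. AE x in lborel. x \<notin> S (fst p) (snd p)"
      using null Sb by (intro ballI AE_not_in) (auto simp: null_sets_def)
  qed
  then show ?thesis
  proof (rule AE_mp, intro AE_I2 impI)
    fix x assume x: "\<forall>p\<in>{p\<in>\<rat>\<times>\<rat>. 0 \<le> fst p \<and> fst p < snd p}. x \<notin> S (fst p) (snd p)"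
    have "\<exists>D. (g x has_real_derivative D) (at 0)"
    proof (rule two_sided_slope_derivative[OF gm[of x] _ gb[of _ _ x]])
      show "isCont (g x) 0" unfolding g_def
        by (intro continuous_intros continuous_on_interior[of UNIV] continuous_on_compose2[OF fc]) auto
      fix \<alpha> \<beta> :: real assume ab: "\<alpha> \<in> \<rat>" "\<beta> \<in> \<rat>" "0 \<le> \<alpha>" "\<alpha> < \<beta>"
      then have "x \<notin> S \<alpha> \<beta>" using x by force
      then consider n where "x \<notin> Ol \<alpha> n" | n where "x \<notin> Oh \<beta> n" by (auto simp: S_def)
      then show "(\<exists>\<delta>>0. \<forall>a c. a < 0 \<and> 0 < c \<and> c - a < \<delta> \<longrightarrow> \<alpha> * (c - a) \<le> g x c - g x a) \<or>
         (\<exists>\<delta>>0. \<forall>a c. a < 0 \<and> 0 < c \<and> c - a < \<delta> \<longrightarrow> g x c - g x a \<le> \<beta> * (c - a))"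
      proof cases
        case 1
        have "\<alpha> * (c - a) \<le> g x c - g x a" if "a < 0 \<and> 0 < c \<and> c - a < 1 / real (Suc n)" for a c
        proof (rule ccontr)
          assume "\<not> ?thesis"
          then have "x \<in> Ol \<alpha> n" unfolding Ol_def using that by (intro UN_I[of "(a,c)"]) auto
          then show False using 1 by simp
        qed
        then show ?thesis by (intro disjI1 exI[of _ "1 / real (Suc n)"] conjI) auto
      next
        case 2
        have "g x c - g x a \<le> \<beta> * (c - a)" if "a < 0 \<and> 0 < c \<and> c - a < 1 / real (Suc n)" for a c
        proof (rule ccontr)
          assume "\<not> ?thesis"
          then have "x \<in> Oh \<beta> n" unfolding Oh_def using that by (intro UN_I[of "(a,c)"]) auto
          then show False using 2 by simp
        qed
        then show ?thesis by (intro disjI2 exI[of _ "1 / real (Suc n)"] conjI) auto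
      qed
    qed
    then obtain D where D: "(g x has_real_derivative D) (at 0)" by blast
    have "((\<lambda>h. g x h - K * h) has_real_derivative D - K * 1) (at 0)"
      by (intro DERIV_diff D DERIV_cmult DERIV_ident)
    then show "\<exists>D. ((\<lambda>h. f (x + h *\<^sub>R b)) has_real_derivative D) (at 0)"
      by (intro exI[of _ "D - K * 1"]) (simp add: g_def)
  qed
qed

section \<open>Integration over the torus\<close>

lemma Zlat_add: "k \<in> Zlat \<Longrightarrow> l \<in> Zlat \<Longrightarrow> k + l \<in> Zlat"
  by (auto simp: Zlat_def inner_add_left)

lemma Zlat_minus: "k \<in> Zlat \<Longrightarrow> - k \<in> Zlat"
  by (auto simp: Zlat_def)

lemma Zlat_Basis: "b \<in> Basis \<Longrightarrow> b \<in> Zlat"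
  by (auto simp: Zlat_def inner_Basis)

lemma Zlat_int_Basis: "b \<in> Basis \<Longrightarrow> of_int n *\<^sub>R b \<in> Zlat"
  by (auto simp: Zlat_def inner_Basis)

lemma Zperiodic_shift: "Zperiodic g \<Longrightarrow> Zperiodic (\<lambda>x. g (x + z))"
proof -
  assume p: "Zperiodic g"
  have "g (x + k + z) = g (x + z)" if "k \<in> Zlat" for x k
  proof -
    have "g ((x + z) + k) = g (x + z)" using p that unfolding Zperiodic_def by blast
    then show ?thesis by (simp add: add_ac)
  qed
  then show ?thesis by (simp add: Zperiodic_def)
qed

lemma countable_Zlat: "countable (Zlat :: 'a::euclidean_space set)"
proof -
  have "(Zlat :: 'a set) \<subseteq> (\<lambda>f. \<Sum>b\<in>Basis. of_int (f b) *\<^sub>R b) ` (Basis \<rightarrow>\<^sub>E (UNIV :: int set))"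
  proof
    fix k :: 'a assume k: "k \<in> Zlat"
    define f where "f = restrict (\<lambda>b. \<lfloor>k \<bullet> b\<rfloor>) Basis"
    have "k = (\<Sum>b\<in>Basis. (k \<bullet> b) *\<^sub>R b)" by (simp add: euclidean_representation)
    also have "\<dots> = (\<Sum>b\<in>Basis. of_int (f b) *\<^sub>R b)"
      using k by (intro sum.cong) (auto simp: f_def Zlat_def Ints_def)
    finally show "k \<in> (\<lambda>f. \<Sum>b\<in>Basis. of_int (f b) *\<^sub>R b) ` (Basis \<rightarrow>\<^sub>E UNIV)"
      by (intro image_eqI[of _ _ f]) (auto simp: f_def)
  qed
  moreover have "countable ((\<lambda>f. \<Sum>b\<in>Basis. of_int (f b) *\<^sub>R b :: 'a) ` (Basis \<rightarrow>\<^sub>E (UNIV :: int set)))"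
    by (intro countable_image countable_PiE) auto
  ultimately show ?thesis by (rule countable_subset)
qed

text \<open>The half-open cube meets each lattice orbit exactly once, so shifted pieces recombine
  without overlap. It differs from the closed \<open>cell\<close> by a null set.\<close>

definition hcell :: "'a::euclidean_space set" where
  "hcell = {x. \<forall>b\<in>Basis. 0 \<le> x \<bullet> b \<and> x \<bullet> b < 1}"

lemma hcell_sets [measurable]: "hcell \<in> sets borel"
  unfolding hcell_def by measurable

lemma cell_sets [measurable]: "cell \<in> sets borel"
  unfolding cell_def by simp

lemma emeasure_cell: "emeasure lborel (cell :: 'a::euclidean_space set) = 1"
  unfolding cell_def by (subst emeasure_lborel_cbox) auto

lemma AE_cell_hcell: "AE x in lborel. (x::'a::euclidean_space) \<in> cell \<longleftrightarrow> x \<in> hcell"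
proof -
  have "(cbox 0 One - box 0 (One::'a)) \<in> null_sets lborel"
    using negligible_frontier_interval[of 0 "One::'a"] by (simp add: negligible_iff_null_sets null_sets_completion_iff)
  then have "AE x in lborel. x \<notin> (cbox 0 One - box 0 (One::'a))" by (rule AE_not_in)
  then show ?thesis
  proof (rule AE_mp, intro AE_I2 impI)
    fix x :: 'a assume a: "x \<notin> cbox 0 One - box 0 One"
    have "x \<in> hcell \<Longrightarrow> x \<in> cell" by (auto simp: hcell_def cell_def mem_box less_imp_le)
    moreover have "x \<in> box 0 One \<Longrightarrow> x \<in> hcell" by (auto simp: hcell_def mem_box less_imp_le)
    ultimately show "(x \<in> cell) = (x \<in> hcell)" using a by (auto simp: cell_def)
  qed
qed

lemma nn_integral_cell_hcell:
  "(\<integral>\<^sup>+x\<in>cell. g x \<partial>lborel) = (\<integral>\<^sup>+x\<in>hcell. g x \<partial>lborel)"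
  by (rule nn_integral_cong_AE) (rule AE_mp[OF AE_cell_hcell], auto simp: indicator_def)

lemma nn_integral_lborel_shift:
  fixes g :: "'a::euclidean_space \<Rightarrow> ennreal"
  assumes "g \<in> borel_measurable borel"
  shows "(\<integral>\<^sup>+x. g (x + z) \<partial>lborel) = (\<integral>\<^sup>+x. g x \<partial>lborel)"
proof -
  have "(\<integral>\<^sup>+x. g x \<partial>lborel) = (\<integral>\<^sup>+x. g x \<partial>distr lborel borel ((+) z))" by (simp add: lborel_distr_plus)
  also have "\<dots> = (\<integral>\<^sup>+x. g (z + x) \<partial>lborel)" by (rule nn_integral_distr) (use assms in auto)
  finally show ?thesis by (simp add: add.commute)
qed

text \<open>The cube shifted by t b is cut where it leaves the original one; the protruding part is
  moved back by the lattice vector b, under which \<open>g\<close> is invariant.\<close>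

lemma nn_integral_cell_shift_Basis:
  fixes g :: "'a::euclidean_space \<Rightarrow> ennreal"
  assumes g: "g \<in> borel_measurable borel" "Zperiodic g" and b: "b \<in> Basis" and t: "0 \<le> t" "t \<le> 1"
  shows "(\<integral>\<^sup>+x\<in>hcell. g (x + t *\<^sub>R b) \<partial>lborel) = (\<integral>\<^sup>+x\<in>hcell. g x \<partial>lborel)"
proof -
  define A where "A = {x\<in>hcell. x \<bullet> b < t}"
  define C where "C = {x\<in>hcell. t \<le> x \<bullet> b}"
  have m [measurable]: "A \<in> sets borel" "C \<in> sets borel" unfolding A_def C_def by measurable
  have mg [measurable]: "g \<in> borel_measurable borel" by (rule g)
  have ind: "indicator hcell x = (indicator C (x + t *\<^sub>R b) + indicator A (x + t *\<^sub>R b - b) :: ennreal)" for x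
  proof -
    have o: "(x + t *\<^sub>R b) \<bullet> c = x \<bullet> c" "(x + t *\<^sub>R b - b) \<bullet> c = x \<bullet> c" if "c \<in> Basis" "c \<noteq> b" for c
      using that b by (auto simp: inner_add_left inner_diff_left inner_Basis)
    have bb: "(x + t *\<^sub>R b) \<bullet> b = x \<bullet> b + t" "(x + t *\<^sub>R b - b) \<bullet> b = x \<bullet> b + t - 1"
      using b by (auto simp: inner_add_left inner_diff_left inner_Basis)
    define R where "R \<longleftrightarrow> (\<forall>c\<in>Basis - {b}. 0 \<le> x \<bullet> c \<and> x \<bullet> c < 1)"
    have h: "y \<in> hcell \<longleftrightarrow> (\<forall>c\<in>Basis - {b}. 0 \<le> y \<bullet> c \<and> y \<bullet> c < 1) \<and> 0 \<le> y \<bullet> b \<and> y \<bullet> b < 1" for y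
      using b by (auto simp: hcell_def)
    have 1: "x \<in> hcell \<longleftrightarrow> R \<and> 0 \<le> x \<bullet> b \<and> x \<bullet> b < 1" by (simp add: h R_def)
    have 2: "x + t *\<^sub>R b \<in> C \<longleftrightarrow> R \<and> 0 \<le> x \<bullet> b \<and> x \<bullet> b + t < 1"
      unfolding C_def mem_Collect_eq h bb R_def using o(1) t by auto
    have 3: "x + t *\<^sub>R b - b \<in> A \<longleftrightarrow> R \<and> 1 \<le> x \<bullet> b + t \<and> x \<bullet> b < 1"
      unfolding A_def mem_Collect_eq h bb R_def using o(2) t by auto
    show ?thesis unfolding indicator_def 1 2 3 using t by auto
  qed
  have per: "g (x - b) = g x" for x
  proof -
    have "g ((x - b) + b) = g (x - b)" using g(2) Zlat_Basis[OF b] unfolding Zperiodic_def by blast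
    then show ?thesis by simp
  qed
  have "(\<integral>\<^sup>+x\<in>hcell. g (x + t *\<^sub>R b) \<partial>lborel)
      = (\<integral>\<^sup>+x. g (x + t *\<^sub>R b) * indicator C (x + t *\<^sub>R b) + g (x + t *\<^sub>R b - b) * indicator A (x + t *\<^sub>R b - b) \<partial>lborel)"
    unfolding ind distrib_left by (simp add: per)
  also have "\<dots> = (\<integral>\<^sup>+x. g (x + t *\<^sub>R b) * indicator C (x + t *\<^sub>R b) \<partial>lborel) + (\<integral>\<^sup>+x. g (x + (t *\<^sub>R b - b)) * indicator A (x + (t *\<^sub>R b - b)) \<partial>lborel)"
    by (subst nn_integral_add) (auto simp: algebra_simps)
  also have "\<dots> = (\<integral>\<^sup>+x. g x * indicator C x \<partial>lborel) + (\<integral>\<^sup>+x. g x * indicator A x \<partial>lborel)"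
    using nn_integral_lborel_shift[of "\<lambda>x. g x * indicator C x" "t *\<^sub>R b"] nn_integral_lborel_shift[of "\<lambda>x. g x * indicator A x" "t *\<^sub>R b - b"]
    by simp
  also have "\<dots> = (\<integral>\<^sup>+x. g x * indicator C x + g x * indicator A x \<partial>lborel)" by (subst nn_integral_add) auto
  also have "\<dots> = (\<integral>\<^sup>+x\<in>hcell. g x \<partial>lborel)"
    by (intro nn_integral_cong) (auto simp: A_def C_def indicator_def)
  finally show ?thesis .
qed

text \<open>The shift is peeled off one coordinate at a time; in each coordinate periodicity reduces
  its size to the fractional part.\<close>

lemma nn_integral_cell_shift:
  fixes g :: "'a::euclidean_space \<Rightarrow> ennreal"
  assumes g: "g \<in> borel_measurable borel" "Zperiodic g"
  shows "(\<integral>\<^sup>+x\<in>cell. g (x + z) \<partial>lborel) = (\<integral>\<^sup>+x\<in>cell. g x \<partial>lborel)"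
proof -
  have one: "(\<integral>\<^sup>+x\<in>hcell. g (x + t *\<^sub>R b) \<partial>lborel) = (\<integral>\<^sup>+x\<in>hcell. g x \<partial>lborel)"
    if g: "g \<in> borel_measurable borel" "Zperiodic g" and b: "b \<in> Basis" for t b and g :: "'a \<Rightarrow> ennreal"
  proof -
    have "g (x + t *\<^sub>R b) = g (x + frac t *\<^sub>R b)" for x
    proof -
      have "g ((x + frac t *\<^sub>R b) + of_int \<lfloor>t\<rfloor> *\<^sub>R b) = g (x + frac t *\<^sub>R b)"
        using g(2) Zlat_int_Basis[OF b] unfolding Zperiodic_def by blast
      moreover have "(x + frac t *\<^sub>R b) + of_int \<lfloor>t\<rfloor> *\<^sub>R b = x + t *\<^sub>R b"
        by (simp add: frac_def scaleR_left_diff_distrib)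
      ultimately show ?thesis by simp
    qed
    then show ?thesis using nn_integral_cell_shift_Basis[OF g b, of "frac t"] by (simp add: frac_ge_0 frac_lt_1 less_imp_le)
  qed
  have "\<forall>g. g \<in> borel_measurable borel \<and> Zperiodic g \<longrightarrow>
      (\<integral>\<^sup>+x\<in>hcell. g (x + (\<Sum>b\<in>B. (z \<bullet> b) *\<^sub>R b)) \<partial>lborel) = (\<integral>\<^sup>+x\<in>hcell. g (x :: 'a) \<partial>lborel)"
    if "finite B" "B \<subseteq> Basis" for B using that
  proof (induction B)
    case (insert c B)
    show ?case
    proof (intro allI impI, elim conjE)
      fix g :: "'a \<Rightarrow> ennreal" assume g: "g \<in> borel_measurable borel" "Zperiodic g"
      have "(\<integral>\<^sup>+x\<in>hcell. g (x + (\<Sum>b\<in>insert c B. (z \<bullet> b) *\<^sub>R b)) \<partial>lborel)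
         = (\<integral>\<^sup>+x\<in>hcell. g ((x + (\<Sum>b\<in>B. (z \<bullet> b) *\<^sub>R b)) + (z \<bullet> c) *\<^sub>R c) \<partial>lborel)"
        using insert by (simp add: add_ac)
      also have "\<dots> = (\<integral>\<^sup>+x\<in>hcell. g (x + (z \<bullet> c) *\<^sub>R c) \<partial>lborel)"
        using insert.IH[THEN spec[of _ "\<lambda>x. g (x + (z \<bullet> c) *\<^sub>R c)"]] insert.prems g Zperiodic_shift[OF g(2)] by auto
      also have "\<dots> = (\<integral>\<^sup>+x\<in>hcell. g x \<partial>lborel)" using one[OF g] insert.prems by auto
      finally show "(\<integral>\<^sup>+x\<in>hcell. g (x + (\<Sum>b\<in>insert c B. (z \<bullet> b) *\<^sub>R b)) \<partial>lborel) = (\<integral>\<^sup>+x\<in>hcell. g x \<partial>lborel)" .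
    qed
  qed simp
  from this[OF finite_Basis subset_refl] g
  show ?thesis by (simp add: euclidean_representation nn_integral_cell_hcell)
qed

section \<open>Integrals of bounded Borel functions over the torus\<close>

definition cint :: "('a::euclidean_space \<Rightarrow> real) \<Rightarrow> real" where
  "cint g = (LINT x:cell|lborel. g x)"

text \<open>Bounded Borel functions are closed under sums, products and shifts and are integrable on
  the cell, so this single predicate discharges all integrability conditions.\<close>

definition bmeas :: "('a::euclidean_space \<Rightarrow> real) \<Rightarrow> bool" where
  "bmeas g \<longleftrightarrow> g \<in> borel_measurable borel \<and> (\<exists>C. \<forall>x. \<bar>g x\<bar> \<le> C)"

lemma bmeasI: "g \<in> borel_measurable borel \<Longrightarrow> (\<And>x. \<bar>g x\<bar> \<le> C) \<Longrightarrow> bmeas g"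
  by (auto simp: bmeas_def)

lemma bmeas_measurable: "bmeas g \<Longrightarrow> g \<in> borel_measurable borel" by (simp add: bmeas_def)

lemma bmeas_add: "bmeas f \<Longrightarrow> bmeas g \<Longrightarrow> bmeas (\<lambda>x. f x + g x)"
  unfolding bmeas_def by (auto, meson abs_triangle_ineq add_mono order_trans)

lemma bmeas_mult: "bmeas f \<Longrightarrow> bmeas g \<Longrightarrow> bmeas (\<lambda>x. f x * g x)"
  unfolding bmeas_def
proof (elim conjE exE, intro conjI)
  fix C D assume "f \<in> borel_measurable borel" "g \<in> borel_measurable borel" "\<forall>x. \<bar>f x\<bar> \<le> C" "\<forall>x. \<bar>g x\<bar> \<le> D"
  then show "(\<lambda>x. f x * g x) \<in> borel_measurable borel" by simp
  have "\<bar>f x * g x\<bar> \<le> C * D" for x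
    using \<open>\<forall>x. \<bar>f x\<bar> \<le> C\<close> \<open>\<forall>x. \<bar>g x\<bar> \<le> D\<close> unfolding abs_mult
    by (intro mult_mono) (auto intro: order_trans[OF abs_ge_zero])
  then show "\<exists>C. \<forall>x. \<bar>f x * g x\<bar> \<le> C" by blast
qed

lemma bmeas_const: "bmeas (\<lambda>x. c)" by (rule bmeasI[of _ "\<bar>c\<bar>"]) auto

lemma bmeas_cmult: "bmeas f \<Longrightarrow> bmeas (\<lambda>x. c * f x)" by (intro bmeas_mult bmeas_const)

lemma bmeas_diff: "bmeas f \<Longrightarrow> bmeas g \<Longrightarrow> bmeas (\<lambda>x. f x - g x)"
  using bmeas_add[of f "\<lambda>x. (-1) * g x"] bmeas_cmult[of g "-1"] by simp

lemma bmeas_sum: "(\<And>i. i \<in> I \<Longrightarrow> bmeas (f i)) \<Longrightarrow> bmeas (\<lambda>x. \<Sum>i\<in>I. f i x)"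
  by (induction I rule: infinite_finite_induct) (auto intro: bmeas_const bmeas_add)

lemma bmeas_indicator: "A \<in> sets borel \<Longrightarrow> bmeas (indicator A)"
  by (rule bmeasI[of _ 1]) (auto simp: indicator_def)

lemma bmeas_abs: "bmeas f \<Longrightarrow> bmeas (\<lambda>x. \<bar>f x\<bar>)"
  unfolding bmeas_def by auto

lemma bmeas_shift: "bmeas f \<Longrightarrow> bmeas (\<lambda>x. f (x + z))"
  unfolding bmeas_def by auto

lemma bmeas_integrable:
  assumes "bmeas g" shows "set_integrable lborel cell g"
proof -
  obtain C where C: "\<And>x. \<bar>g x\<bar> \<le> C" using assms by (auto simp: bmeas_def)
  have "integrable lborel (\<lambda>x. indicator cell x *\<^sub>R g x)"
    by (rule integrableI_bounded_set_indicator[where B = C])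
       (use C bmeas_measurable[OF assms] in \<open>auto simp: emeasure_cell\<close>)
  then show ?thesis by (simp add: set_integrable_def)
qed

lemma cint_add: "bmeas f \<Longrightarrow> bmeas g \<Longrightarrow> cint (\<lambda>x. f x + g x) = cint f + cint g"
  unfolding cint_def by (rule set_integral_add) (auto intro: bmeas_integrable)

lemma cint_diff: "bmeas f \<Longrightarrow> bmeas g \<Longrightarrow> cint (\<lambda>x. f x - g x) = cint f - cint g"
  unfolding cint_def by (rule set_integral_diff) (auto intro: bmeas_integrable)

lemma cint_cmult: "cint (\<lambda>x. c * f x) = c * cint f"
  unfolding cint_def by simp

lemma cint_minus: "cint (\<lambda>x. - f x) = - cint f"
  using cint_cmult[of "-1" f] by simp

lemma cint_const: "cint (\<lambda>x::'a::euclidean_space. c) = c"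
proof -
  have "measure lborel (cell :: 'a set) = 1" by (simp add: measure_def emeasure_cell)
  then show ?thesis unfolding cint_def set_lebesgue_integral_def
    by (simp add: integral_mult_left_zero)
qed

lemma cint_mono: "bmeas f \<Longrightarrow> bmeas g \<Longrightarrow> (\<And>x. f x \<le> g x) \<Longrightarrow> cint f \<le> cint g"
  unfolding cint_def by (rule set_integral_mono) (auto intro: bmeas_integrable)

lemma cint_sum: "(\<And>i. i \<in> I \<Longrightarrow> bmeas (f i)) \<Longrightarrow> cint (\<lambda>x. \<Sum>i\<in>I. f i x) = (\<Sum>i\<in>I. cint (f i))"
proof (induction I rule: infinite_finite_induct)
  case (insert i I)
  then show ?case by (simp add: cint_add bmeas_sum)
qed (simp_all add: cint_const)

lemma cint_nonneg: "bmeas f \<Longrightarrow> (\<And>x. 0 \<le> f x) \<Longrightarrow> 0 \<le> cint f"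
  using cint_mono[OF bmeas_const[of 0], of f] by (simp add: cint_const)

lemma cint_abs: "bmeas f \<Longrightarrow> \<bar>cint f\<bar> \<le> cint (\<lambda>x. \<bar>f x\<bar>)"
  using cint_mono[of f "\<lambda>x. \<bar>f x\<bar>"] cint_mono[of "\<lambda>x. - f x" "\<lambda>x. \<bar>f x\<bar>"] bmeas_abs[of f] bmeas_cmult[of f "-1"]
  by (simp add: cint_minus abs_le_iff)

lemma cint_nn:
  assumes "bmeas f" "\<And>x. 0 \<le> f x"
  shows "ennreal (cint f) = (\<integral>\<^sup>+x\<in>cell. ennreal (f x) \<partial>lborel)"
proof -
  have "(\<integral>\<^sup>+x. ennreal (indicator cell x *\<^sub>R f x) \<partial>lborel) = ennreal (LINT x|lborel. indicator cell x *\<^sub>R f x)"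
    by (rule nn_integral_eq_integral) (use bmeas_integrable[OF assms(1)] assms(2) in \<open>auto simp: set_integrable_def\<close>)
  moreover have "(\<integral>\<^sup>+x. ennreal (indicator cell x *\<^sub>R f x) \<partial>lborel) = (\<integral>\<^sup>+x\<in>cell. ennreal (f x) \<partial>lborel)"
    by (intro nn_integral_cong) (auto simp: indicator_def)
  ultimately show ?thesis by (simp add: cint_def set_lebesgue_integral_def)
qed

lemma cint_shift:
  assumes g: "bmeas g" "Zperiodic g"
  shows "cint (\<lambda>x. g (x + z)) = cint g"
proof -
  obtain C where C: "\<And>x. \<bar>g x\<bar> \<le> C" using g(1) by (auto simp: bmeas_def)
  have C': "0 \<le> g x + C" for x using C[of x] by (simp add: abs_le_iff)
  have b: "bmeas (\<lambda>x. g x + C)" by (intro bmeas_add g bmeas_const)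
  have "ennreal (cint (\<lambda>x. g (x + z) + C)) = (\<integral>\<^sup>+x\<in>cell. ennreal (g (x + z) + C) \<partial>lborel)"
    by (rule cint_nn[OF bmeas_shift[OF b]]) (use C' in auto)
  also have "\<dots> = (\<integral>\<^sup>+x\<in>cell. ennreal (g x + C) \<partial>lborel)"
    by (rule nn_integral_cell_shift[where g = "\<lambda>x. ennreal (g x + C)"])
       (use b g(2) in \<open>auto simp: bmeas_def Zperiodic_def\<close>)
  also have "\<dots> = ennreal (cint (\<lambda>x. g x + C))" by (rule cint_nn[OF b, symmetric]) (use C' in auto)
  finally have "cint (\<lambda>x. g (x + z) + C) = cint (\<lambda>x. g x + C)"
    using cint_nonneg[of "\<lambda>x. g (x + z) + C"] cint_nonneg[OF b] C' bmeas_shift[OF b, of z] by simp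
  then show ?thesis using g(1) bmeas_shift[OF g(1), of z] by (simp add: cint_add bmeas_const)
qed

lemma cint_indicator: "A \<in> sets borel \<Longrightarrow> cint (indicator A) = measure lborel (A \<inter> cell)"
  unfolding cint_def set_lebesgue_integral_def
  by (simp add: indicator_inter_arith[symmetric] Int_commute)

lemma cint_lim:
  assumes m: "\<And>n. f n \<in> borel_measurable borel" "g \<in> borel_measurable borel" and C: "\<And>n x. \<bar>f n x\<bar> \<le> C"
    and lim: "AE x in lborel. (\<lambda>n. f n x) \<longlonglongrightarrow> g x"
  shows "(\<lambda>n. cint (f n)) \<longlonglongrightarrow> cint g"
  unfolding cint_def set_lebesgue_integral_def
proof (rule integral_dominated_convergence[where w = "\<lambda>x. indicator cell x *\<^sub>R C"])
  show "integrable lborel (\<lambda>x::'a. indicator cell x *\<^sub>R C)"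
    using bmeas_integrable[OF bmeas_const[of C]] by (simp add: set_integrable_def)
  show "AE x in lborel. (\<lambda>n. indicator cell x *\<^sub>R f n x) \<longlonglongrightarrow> indicator cell x *\<^sub>R g x"
    using lim by eventually_elim (intro tendsto_intros)
qed (use m C in \<open>auto simp: indicator_def\<close>)

section \<open>Mollification and integration by parts\<close>

text \<open>C^{1,1} regularity as a uniform second-order Taylor bound. In this form it passes
  through the integral defining a mollification, and it implies that \<open>G\<close> is a Lipschitz
  gradient at small scales.\<close>

definition C11 :: "('a::euclidean_space \<Rightarrow> real) \<Rightarrow> ('a \<Rightarrow> 'a) \<Rightarrow> real \<Rightarrow> bool" where
  "C11 f G C \<longleftrightarrow> C \<ge> 0 \<and> (\<forall>x h. norm h \<le> 1 \<longrightarrow> \<bar>f (x + h) - f x - G x \<bullet> h\<bar> \<le> C * (norm h)\<^sup>2)"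

lemma C11D: "C11 f G C \<Longrightarrow> norm h \<le> 1 \<Longrightarrow> \<bar>f (x + h) - f x - G x \<bullet> h\<bar> \<le> C * (norm h)\<^sup>2"
  by (simp add: C11_def)

text \<open>The value at x + d + k is expanded from x directly and by way of x + d, where k has the
  length of d and points along the gradient difference. The three remainders are at most 4C, C and C
  times |d|^2.\<close>

lemma C11_grad_lipschitz:
  assumes "C11 f G C" "norm d \<le> 1 / 2"
  shows "norm (G (x + d) - G x) \<le> 6 * C * norm d"
proof (cases "G (x + d) - G x = 0 \<or> d = 0")
  case True
  then show ?thesis using assms by (auto simp: C11_def)
next
  case False
  define v where "v = G (x + d) - G x"
  define s where "s = norm d"
  define k where "k = (s / norm v) *\<^sub>R v"
  have v: "norm v > 0" and s: "s > 0" "s \<le> 1/2" using False assms by (auto simp: v_def s_def)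
  have k: "norm k = s" "v \<bullet> k = s * norm v"
    using v s by (auto simp: k_def power2_norm_eq_inner[symmetric] power2_eq_square)
  have dk: "norm (d + k) \<le> 2 * s" using norm_triangle_ineq[of d k] k by (simp add: s_def)
  have C: "C \<ge> 0" using assms by (simp add: C11_def)
  have "\<bar>f (x + (d + k)) - f x - G x \<bullet> (d + k)\<bar> \<le> C * (norm (d + k))\<^sup>2"
    by (rule C11D[OF assms(1)]) (use dk s in simp)
  also have "\<dots> \<le> C * (2 * s)\<^sup>2" using dk C by (intro mult_left_mono power_mono) auto
  finally have 1: "\<bar>f (x + (d + k)) - f x - G x \<bullet> (d + k)\<bar> \<le> 4 * C * s\<^sup>2" by (simp add: power2_eq_square)
  have 2: "\<bar>f ((x + d) + k) - f (x + d) - G (x + d) \<bullet> k\<bar> \<le> C * s\<^sup>2"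
    using C11D[OF assms(1), of k "x + d"] k s by simp
  have 3: "\<bar>f (x + d) - f x - G x \<bullet> d\<bar> \<le> C * s\<^sup>2"
    using C11D[OF assms(1), of d x] s by (simp add: s_def)
  have "s * norm v = G (x + d) \<bullet> k - G x \<bullet> k" using k by (simp add: v_def inner_diff_left)
  also have "\<dots> = (f (x + (d + k)) - f x - G x \<bullet> (d + k)) - (f ((x + d) + k) - f (x + d) - G (x + d) \<bullet> k) - (f (x + d) - f x - G x \<bullet> d)"
    by (simp add: inner_add_right add.assoc)
  also have "\<dots> \<le> 4 * C * s\<^sup>2 + C * s\<^sup>2 + C * s\<^sup>2" using 1 2 3 by linarith
  also have "\<dots> = s * (6 * C * s)" by (simp add: power2_eq_square)
  finally have "norm v \<le> 6 * C * s" using s by simp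
  then show ?thesis by (simp add: v_def s_def)
qed

lemma C11_grad_continuous:
  assumes "C11 f G C" shows "continuous_on UNIV G"
proof (rule continuous_onI)
  fix x and e :: real assume e: "e > 0"
  have C: "C \<ge> 0" using assms by (simp add: C11_def)
  show "\<exists>d>0. \<forall>x'\<in>UNIV. dist x' x < d \<longrightarrow> dist (G x') (G x) \<le> e"
  proof (intro exI[of _ "min (1/2) (e / (6 * C + 1))"] conjI ballI impI)
    fix x' assume x': "dist x' x < min (1/2) (e / (6 * C + 1))"
    have "norm (G (x + (x' - x)) - G x) \<le> 6 * C * norm (x' - x)"
      by (rule C11_grad_lipschitz[OF assms]) (use x' in \<open>simp add: dist_norm\<close>)
    also have "\<dots> \<le> (6 * C + 1) * (e / (6 * C + 1))" using x' C by (intro mult_mono) (auto simp: dist_norm)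
    also have "\<dots> = e" using C by simp
    finally show "dist (G x') (G x) \<le> e" by (simp add: dist_norm)
  qed (use e C in auto)
qed

lemma C11_has_derivative:
  assumes "C11 f G C" shows "(f has_derivative (\<lambda>h. G x \<bullet> h)) (at x)"
  unfolding has_derivative_iff_norm
proof (intro conjI bounded_linear_inner_right)
  have C: "C \<ge> 0" using assms by (simp add: C11_def)
  show "((\<lambda>y. norm (f y - f x - G x \<bullet> (y - x)) / norm (y - x)) \<longlongrightarrow> 0) (at x)"
  proof (rule Lim_null_comparison)
    show "\<forall>\<^sub>F y in at x. norm (norm (f y - f x - G x \<bullet> (y - x)) / norm (y - x)) \<le> C * norm (y - x)"
      unfolding eventually_at
    proof (intro exI[of _ 1] conjI ballI impI)
      fix y assume y: "y \<noteq> x \<and> dist y x < 1"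
      have "\<bar>f (x + (y - x)) - f x - G x \<bullet> (y - x)\<bar> \<le> C * (norm (y - x))\<^sup>2"
        by (rule C11D[OF assms]) (use y in \<open>simp add: dist_norm\<close>)
      then show "norm (norm (f y - f x - G x \<bullet> (y - x)) / norm (y - x)) \<le> C * norm (y - x)"
        using y by (simp add: divide_le_eq power2_eq_square mult.assoc)
    qed simp
    have "((\<lambda>y. C * norm (y - x)) \<longlongrightarrow> C * norm (x - x)) (at x)" by (intro tendsto_intros)
    then show "((\<lambda>y. C * norm (y - x)) \<longlongrightarrow> 0) (at x)" by simp
  qed
qed

lemma C11_continuous: "C11 f G C \<Longrightarrow> continuous_on UNIV f"
  using C11_has_derivative by (metis continuous_at_imp_continuous_on has_derivative_continuous)

text \<open>A unit step along the gradient changes f by at most 2B.\<close>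

lemma C11_grad_bound:
  assumes "C11 f G C" "\<And>x. \<bar>f x\<bar> \<le> B" shows "norm (G x) \<le> 2 * B + C"
proof (cases "G x = 0")
  case True
  then show ?thesis using assms(1) assms(2)[of x] by (auto simp: C11_def)
next
  case False
  define h where "h = (1 / norm (G x)) *\<^sub>R G x"
  have h: "norm h = 1" "G x \<bullet> h = norm (G x)"
    using False by (auto simp: h_def power2_norm_eq_inner[symmetric] power2_eq_square)
  have "\<bar>f (x + h) - f x - G x \<bullet> h\<bar> \<le> C" using C11D[OF assms(1), of h x] h by simp
  then show ?thesis using h assms(2)[of x] assms(2)[of "x + h"] by linarith
qed

lemma C11_difference_bound:
  assumes "C11 f G C" "\<And>x. \<bar>f x\<bar> \<le> B" "norm h \<le> 1"
  shows "\<bar>f (x + h) - f x\<bar> \<le> (2 * B + 2 * C) * norm h"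
proof -
  have C: "C \<ge> 0" using assms by (simp add: C11_def)
  have "\<bar>G x \<bullet> h\<bar> \<le> (2 * B + C) * norm h"
    using Cauchy_Schwarz_ineq2[of "G x" h] C11_grad_bound[OF assms(1,2), of x] mult_right_mono[of "norm (G x)" "2 * B + C" "norm h"]
    by simp
  moreover have "C * (norm h)\<^sup>2 \<le> C * norm h"
    using assms(3) C by (intro mult_left_mono) (auto simp: power2_eq_square mult_left_le_one_le)
  ultimately show ?thesis using C11D[OF assms(1,3), of x] by (simp add: algebra_simps)
qed

lemma C11_bmeas: "C11 f G C \<Longrightarrow> (\<And>x. \<bar>f x\<bar> \<le> B) \<Longrightarrow> bmeas f"
  by (rule bmeasI[of _ B]) (auto intro: borel_measurable_continuous_onI C11_continuous)

lemma C11_grad_bmeas: "C11 f G C \<Longrightarrow> (\<And>x. \<bar>f x\<bar> \<le> B) \<Longrightarrow> bmeas (\<lambda>x. G x \<bullet> v)"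
proof (rule bmeasI[of _ "(2 * B + C) * norm v"])
  assume a: "C11 f G C" "\<And>x. \<bar>f x\<bar> \<le> B"
  show "(\<lambda>x. G x \<bullet> v) \<in> borel_measurable borel"
    by (intro borel_measurable_continuous_onI continuous_intros C11_grad_continuous[OF a(1)])
  show "\<bar>G x \<bullet> v\<bar> \<le> (2 * B + C) * norm v" for x
    using Cauchy_Schwarz_ineq2[of "G x" v] C11_grad_bound[OF a, of x] mult_right_mono[of "norm (G x)" "2 * B + C" "norm v"]
    by simp
qed

section \<open>Mollifiers and mollified indicators\<close>

definition mollifier :: "real \<Rightarrow> ('a::euclidean_space \<Rightarrow> real) \<Rightarrow> ('a \<Rightarrow> 'a) \<Rightarrow> real \<Rightarrow> bool" where
  "mollifier \<eta> \<rho> G C \<longleftrightarrow> 0 < \<eta> \<and> C11 \<rho> G C \<and> (\<forall>z. 0 \<le> \<rho> z) \<and> (\<forall>z. \<eta> \<le> norm z \<longrightarrow> \<rho> z = 0 \<and> G z = 0) \<and>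
     (\<integral>\<^sup>+z. ennreal (\<rho> z) \<partial>lborel) = 1"

text \<open>The profile is the squared positive part of \<eta>^2 - |z|^2, divided by its integral.
  For |z| > \<eta> + 1 both ends of a step of length at most 1 lie outside the support, so the
  Taylor bound is needed only on a bounded set.\<close>

lemma mollifier_exists:
  assumes \<eta>: "0 < \<eta>"
  obtains \<rho> :: "'a::euclidean_space \<Rightarrow> real" and G C where "mollifier \<eta> \<rho> G C"
proof -
  define s where "s = (\<lambda>z::'a. \<eta>\<^sup>2 - (norm z)\<^sup>2)"
  define p where "p = (\<lambda>z. (max 0 (s z))\<^sup>2)"
  define G where "G = (\<lambda>z. (- 4 * max 0 (s z)) *\<^sub>R z)"
  \<comment> \<open>The first square bounds the increment of \<open>s\<close> over a step h in the
    region |z| <= \<eta> + 1; the second term comes from the quadratic part of \<open>s\<close>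
    multiplied by its positive part.\<close>
  define C where "C = (2 * \<eta> + 3)\<^sup>2 + 2 * \<eta>\<^sup>2"
  have C: "C \<ge> 0" by (simp add: C_def)
  have s0: "s z \<le> 0" if "\<eta> \<le> norm z" for z using power_mono[OF that, of 2] \<eta> by (simp add: s_def)
  have z0: "p z = 0" "G z = 0" if "\<eta> \<le> norm z" for z using s0[OF that] by (simp_all add: p_def G_def)
  have s1: "max 0 (s z) \<le> \<eta>\<^sup>2" for z by (simp add: s_def)
  have tay: "\<bar>p (z + h) - p z - G z \<bullet> h\<bar> \<le> C * (norm h)\<^sup>2" if h: "norm h \<le> 1" for z h
  proof (cases "norm z \<le> \<eta> + 1")
    case False
    have "norm z \<le> norm (z + h) + norm h" using norm_triangle_ineq[of "z + h" "- h"] by simp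
    then have "\<eta> \<le> norm (z + h)" "\<eta> \<le> norm z" using False h by auto
    then show ?thesis using z0[of z] z0[of "z + h"] C by simp
  next
    case True
    have d: "s (z + h) - s z = - (2 * (z \<bullet> h) + (norm h)\<^sup>2)"
      by (simp add: s_def power2_norm_eq_inner inner_add_left inner_add_right inner_commute)
    have "p (z + h) - p z - G z \<bullet> h = ((max 0 (s (z + h)))\<^sup>2 - (max 0 (s z))\<^sup>2 - 2 * max 0 (s z) * (s (z + h) - s z)) - 2 * max 0 (s z) * (norm h)\<^sup>2"
      unfolding p_def G_def d by (simp add: algebra_simps)
    then have "\<bar>p (z + h) - p z - G z \<bullet> h\<bar> \<le> (s (z + h) - s z)\<^sup>2 + 2 * max 0 (s z) * (norm h)\<^sup>2"
      using pos_part_sq_taylor[of "s (z + h)" "s z"] zero_le_power2[of "norm h"]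
      by (smt (verit) mult_nonneg_nonneg)
    also have "2 * max 0 (s z) * (norm h)\<^sup>2 \<le> 2 * \<eta>\<^sup>2 * (norm h)\<^sup>2"
      using s1[of z] by (intro mult_right_mono) auto
    also have "(s (z + h) - s z)\<^sup>2 \<le> ((2 * \<eta> + 3) * norm h)\<^sup>2"
    proof -
      have "\<bar>2 * (z \<bullet> h) + (norm h)\<^sup>2\<bar> \<le> 2 * (norm z * norm h) + norm h * norm h"
        using Cauchy_Schwarz_ineq2[of z h] zero_le_square[of "norm h"] unfolding power2_eq_square by linarith
      also have "\<dots> \<le> 2 * ((\<eta> + 1) * norm h) + 1 * norm h"
        using True h by (intro add_mono mult_left_mono mult_right_mono) auto
      also have "\<dots> = (2 * \<eta> + 3) * norm h" by (simp add: algebra_simps)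
      finally have "\<bar>s (z + h) - s z\<bar> \<le> (2 * \<eta> + 3) * norm h" unfolding d by simp
      then show ?thesis using abs_le_square_iff[of "s (z+h) - s z" "(2 * \<eta> + 3) * norm h"] \<eta> by simp
    qed
    finally show ?thesis unfolding C_def power_mult_distrib by (simp only: distrib_right)
  qed
  have Cp: "C11 p G C" using tay C by (simp add: C11_def)
  have pm: "p \<in> borel_measurable borel" by (intro borel_measurable_continuous_onI C11_continuous[OF Cp])
  define I where "I = (\<integral>\<^sup>+z. ennreal (p z) \<partial>lborel)"
  have pb: "p z \<le> (\<eta>\<^sup>2)\<^sup>2" for z unfolding p_def using s1[of z] by (intro power_mono) auto
  have "I \<le> (\<integral>\<^sup>+z. ennreal ((\<eta>\<^sup>2)\<^sup>2) * indicator (ball (0::'a) \<eta>) z \<partial>lborel)"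
    unfolding I_def using pb z0(1) by (intro nn_integral_mono) (auto simp: indicator_def ennreal_leI not_less)
  also have "\<dots> = ennreal ((\<eta>\<^sup>2)\<^sup>2) * emeasure lborel (ball (0::'a) \<eta>)" by (simp add: nn_integral_cmult_indicator)
  also have "\<dots> < \<infinity>" using emeasure_lborel_ball_finite[of "0::'a" \<eta>] by (simp add: ennreal_mult_less_top)
  finally have fin: "I < \<infinity>" .
  have pos: "I > 0"
  proof -
    have lo: "(\<eta>\<^sup>2 * 3 / 4)\<^sup>2 \<le> p z" if "norm z < \<eta> / 2" for z
    proof -
      have "(norm z)\<^sup>2 \<le> (\<eta> / 2)\<^sup>2" using that by (intro power_mono) auto
      then have "\<eta>\<^sup>2 * 3 / 4 \<le> s z" by (simp add: s_def power_divide)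
      then have "\<eta>\<^sup>2 * 3 / 4 \<le> max 0 (s z)" by linarith
      then show ?thesis unfolding p_def by (intro power_mono) auto
    qed
    have "emeasure lborel (ball (0::'a) (\<eta>/2)) \<noteq> 0"
    proof
      assume "emeasure lborel (ball (0::'a) (\<eta>/2)) = 0"
      then have "negligible (ball (0::'a) (\<eta>/2))" by (simp add: negligible_iff_null_sets null_sets_completion_iff null_sets_def)
      then show False using open_not_negligible[of "ball (0::'a) (\<eta>/2)"] \<eta> by auto
    qed
    then have "0 < ennreal ((\<eta>\<^sup>2 * 3 / 4)\<^sup>2) * emeasure lborel (ball (0::'a) (\<eta>/2))"
      using \<eta> by (simp add: ennreal_zero_less_mult_iff zero_less_iff_neq_zero)
    also have "\<dots> = (\<integral>\<^sup>+z. ennreal ((\<eta>\<^sup>2 * 3 / 4)\<^sup>2) * indicator (ball (0::'a) (\<eta>/2)) z \<partial>lborel)"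
      by (simp add: nn_integral_cmult_indicator)
    also have "\<dots> \<le> I" unfolding I_def using lo by (intro nn_integral_mono) (auto simp: indicator_def ennreal_leI)
    finally show ?thesis .
  qed
  define c where "c = enn2real I"
  have c: "I = ennreal c" "c > 0" using fin pos unfolding c_def
    by (auto simp: enn2real_positive_iff less_top)
  have "mollifier \<eta> (\<lambda>z. p z / c) (\<lambda>z. (1 / c) *\<^sub>R G z) (C / c)"
    unfolding mollifier_def
  proof (intro conjI allI impI)
    show "C11 (\<lambda>z. p z / c) (\<lambda>z. (1 / c) *\<^sub>R G z) (C / c)" unfolding C11_def
    proof (intro conjI allI impI)
      show "0 \<le> C / c" using C c by simp
      fix x h :: 'a assume "norm h \<le> 1"
      have "p (x + h) / c - p x / c - ((1 / c) *\<^sub>R G x) \<bullet> h = (p (x + h) - p x - G x \<bullet> h) / c"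
        by (simp add: diff_divide_distrib)
      then have "\<bar>p (x + h) / c - p x / c - ((1 / c) *\<^sub>R G x) \<bullet> h\<bar> = \<bar>p (x + h) - p x - G x \<bullet> h\<bar> / c"
        using c by (simp add: abs_divide)
      also have "\<dots> \<le> C * (norm h)\<^sup>2 / c" using tay[OF \<open>norm h \<le> 1\<close>, of x] c by (intro divide_right_mono) auto
      finally show "\<bar>p (x + h) / c - p x / c - ((1 / c) *\<^sub>R G x) \<bullet> h\<bar> \<le> C / c * (norm h)\<^sup>2" by simp
    qed
    have "(\<integral>\<^sup>+z. ennreal (p z / c) \<partial>lborel) = (\<integral>\<^sup>+z. ennreal (1 / c) * ennreal (p z) \<partial>lborel)"
      using c by (intro nn_integral_cong) (simp add: ennreal_mult[symmetric] p_def)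
    also have "\<dots> = ennreal (1 / c) * I" unfolding I_def using pm by (intro nn_integral_cmult) auto
    also have "\<dots> = 1" using c by (simp add: ennreal_mult[symmetric])
    finally show "(\<integral>\<^sup>+z. ennreal (p z / c) \<partial>lborel) = 1" .
  qed (use \<eta> c z0 in \<open>auto simp: p_def\<close>)
  then show thesis by (rule that)
qed

text \<open>An average of the indicator at x + z with weight \<open>\<rho> z\<close>. Since x enters
  through \<open>\<rho> (w - x)\<close>, differentiation falls on \<open>\<rho>\<close> with a minus
  sign, which is the sign in \<open>molD\<close>.\<close>

definition mol :: "('a::euclidean_space \<Rightarrow> real) \<Rightarrow> 'a set \<Rightarrow> 'a \<Rightarrow> real" where
  "mol \<rho> A x = (LINT w|lborel. \<rho> (w - x) * indicator A w)"

definition molD :: "('a::euclidean_space \<Rightarrow> 'a) \<Rightarrow> 'a set \<Rightarrow> 'a \<Rightarrow> 'a" where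
  "molD G A x = - (LINT w|lborel. indicator A w *\<^sub>R G (w - x))"

context
  fixes \<eta> C :: real and \<rho> :: "'a::euclidean_space \<Rightarrow> real" and G
  assumes M: "mollifier \<eta> \<rho> G C"
begin

lemma mol_facts:
  shows mol_eta: "0 < \<eta>" and mol_C11: "C11 \<rho> G C" and mol_nonneg: "0 \<le> \<rho> z"
    and mol_supp: "\<eta> \<le> norm z \<Longrightarrow> \<rho> z = 0" "\<eta> \<le> norm z \<Longrightarrow> G z = 0"
    and mol_nn: "(\<integral>\<^sup>+z. ennreal (\<rho> z) \<partial>lborel) = 1"
  using M by (auto simp: mollifier_def)

lemma mol_meas [measurable]: "\<rho> \<in> borel_measurable borel"
  by (intro borel_measurable_continuous_onI C11_continuous[OF mol_C11])

lemma molG_meas [measurable]: "G \<in> borel_measurable borel"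
  by (intro borel_measurable_continuous_onI C11_grad_continuous[OF mol_C11])

lemma mol_nn_eq:
  assumes A [measurable]: "A \<in> sets borel"
  shows "ennreal (mol \<rho> A x) = (\<integral>\<^sup>+w. ennreal (\<rho> w) * indicator A (x + w) \<partial>lborel)" "integrable lborel (\<lambda>w. \<rho> (w - x) * indicator A w)"
proof -
  have e: "ennreal (\<rho> (w - x) * indicator A w) = ennreal (\<rho> (w + - x)) * indicator A (x + (w + - x))" for w
    using mol_nonneg by (auto simp: indicator_def)
  have "(\<integral>\<^sup>+w. ennreal (\<rho> (w - x) * indicator A w) \<partial>lborel) = (\<integral>\<^sup>+w. ennreal (\<rho> w) * indicator A (x + w) \<partial>lborel)"
    unfolding e by (rule nn_integral_lborel_shift[where g = "\<lambda>w. ennreal (\<rho> w) * indicator A (x + w)"]) measurable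
  moreover have "(\<integral>\<^sup>+w. ennreal (\<rho> w) * indicator A (x + w) \<partial>lborel) \<le> (\<integral>\<^sup>+w. ennreal (\<rho> w) \<partial>lborel)"
    by (intro nn_integral_mono) (auto simp: indicator_def)
  ultimately have le: "(\<integral>\<^sup>+w. ennreal (\<rho> (w - x) * indicator A w) \<partial>lborel) \<le> 1" by (simp add: mol_nn)
  show i: "integrable lborel (\<lambda>w. \<rho> (w - x) * indicator A w)"
    by (rule integrableI_nonneg) (use le mol_nonneg in \<open>auto simp: less_top[symmetric] top_unique\<close>)
  show "ennreal (mol \<rho> A x) = (\<integral>\<^sup>+w. ennreal (\<rho> w) * indicator A (x + w) \<partial>lborel)"
    unfolding mol_def nn_integral_eq_integral[OF i, symmetric, unfolded AE_I2] using mol_nonneg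
    \<open>(\<integral>\<^sup>+w. ennreal (\<rho> (w - x) * indicator A w) \<partial>lborel) = (\<integral>\<^sup>+w. ennreal (\<rho> w) * indicator A (x + w) \<partial>lborel)\<close>
    nn_integral_eq_integral[OF i] by simp
qed

lemma mol_range:
  assumes A: "A \<in> sets borel" shows "0 \<le> mol \<rho> A x" "mol \<rho> A x \<le> 1"
proof -
  show n: "0 \<le> mol \<rho> A x" unfolding mol_def by (intro integral_nonneg_AE) (use mol_nonneg in auto)
  have "(\<integral>\<^sup>+w. ennreal (\<rho> w) * indicator A (x + w) \<partial>lborel) \<le> (\<integral>\<^sup>+w. ennreal (\<rho> w) \<partial>lborel)"
    by (intro nn_integral_mono) (auto simp: indicator_def)
  then have "ennreal (mol \<rho> A x) \<le> 1" by (simp add: mol_nn_eq(1)[OF A] mol_nn)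
  then show "mol \<rho> A x \<le> 1" by simp
qed

text \<open>Two sets and two points are compared at once: this is how a pointwise inclusion between
  sublevel sets at different places is carried over to mollified indicators.\<close>

lemma mol_mono:
  assumes "A \<in> sets borel" "A' \<in> sets borel" "\<And>w. norm w < \<eta> \<Longrightarrow> x + w \<in> A \<Longrightarrow> x' + w \<in> A'"
  shows "mol \<rho> A x \<le> mol \<rho> A' x'"
proof -
  have "ennreal (mol \<rho> A x) \<le> ennreal (mol \<rho> A' x')"
    unfolding mol_nn_eq(1)[OF assms(1)] mol_nn_eq(1)[OF assms(2)]
  proof (rule nn_integral_mono)
    fix w :: 'a
    show "ennreal (\<rho> w) * indicator A (x + w) \<le> ennreal (\<rho> w) * indicator A' (x' + w)"
      using assms(3)[of w] mol_supp(1)[of w] by (cases "norm w < \<eta>") (auto simp: indicator_def)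
  qed
  then show ?thesis using mol_range(1)[OF assms(2)] by simp
qed

lemma mol_periodic:
  assumes "A \<in> sets borel" "Zperiodic_set A" shows "Zperiodic (mol \<rho> A)"
  unfolding Zperiodic_def
proof (intro allI ballI order_antisym)
  fix x k :: 'a assume k: "k \<in> Zlat"
  have e: "x + k + w \<in> A \<longleftrightarrow> x + w \<in> A" for w
    using assms(2) k unfolding Zperiodic_set_def by (metis add.assoc add.commute)
  show "mol \<rho> A (x + k) \<le> mol \<rho> A x" by (rule mol_mono) (use assms e in auto)
  show "mol \<rho> A x \<le> mol \<rho> A (x + k)" by (rule mol_mono) (use assms e in auto)
qed

text \<open>The Taylor remainder of \<open>\<rho>\<close> is integrated over \<open>A\<close>. For
  |h| \<le> 1 it vanishes off a ball of radius \<eta> + 1, so the constant is multiplied by the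
  volume of that ball.\<close>

lemma mol_C11_mol:
  assumes A [measurable]: "A \<in> sets borel"
  obtains C' where "C11 (mol \<rho> A) (molD G A) C'"
proof -
  define V where "V = measure lborel (ball (0::'a) (\<eta> + 1))"
  have C: "C \<ge> 0" using mol_C11 by (simp add: C11_def)
  have "compact (G ` cball 0 \<eta>)"
    by (intro compact_continuous_image continuous_on_subset[OF C11_grad_continuous[OF mol_C11]]) auto
  then obtain B where B: "\<And>z. z \<in> cball 0 \<eta> \<Longrightarrow> norm (G z) \<le> B" by (meson bounded_iff compact_imp_bounded image_eqI)
  have B0: "0 \<le> B" using B[of 0] mol_eta norm_ge_zero[of "G 0"] order_trans[of 0 "norm (G 0)" B] by simp
  have iG: "integrable lborel (\<lambda>w. indicator A w *\<^sub>R G (w - x))" for x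
  proof (rule integrableI_bounded_set[where A = "ball x \<eta>" and B = B])
    show "emeasure lborel (ball x \<eta>) < \<infinity>" using emeasure_lborel_ball_finite[of x \<eta>] by simp
    show "AE w in lborel. w \<in> ball x \<eta> \<longrightarrow> norm (indicator A w *\<^sub>R G (w - x)) \<le> B"
      using B B0
      by (intro AE_I2) (auto simp: indicator_def dist_norm norm_minus_commute)
    show "AE w in lborel. w \<notin> ball x \<eta> \<longrightarrow> indicator A w *\<^sub>R G (w - x) = 0"
      using mol_supp(2) by (intro AE_I2) (auto simp: dist_norm norm_minus_commute not_less)
  qed auto
  have "\<bar>mol \<rho> A (x + h) - mol \<rho> A x - molD G A x \<bullet> h\<bar> \<le> (C * V) * (norm h)\<^sup>2" if h: "norm h \<le> 1" for x h
  proof -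
    define R where "R = (\<lambda>w. \<rho> (w - (x + h)) * indicator A w - \<rho> (w - x) * indicator A w + (indicator A w *\<^sub>R G (w - x)) \<bullet> h)"
    have iR: "integrable lborel R" unfolding R_def
      by (intro Bochner_Integration.integrable_add Bochner_Integration.integrable_diff mol_nn_eq(2)[OF A] integrable_inner_left iG)
    have "(LINT w|lborel. R w) = mol \<rho> A (x + h) - mol \<rho> A x + (LINT w|lborel. (indicator A w *\<^sub>R G (w - x)) \<bullet> h)"
      unfolding R_def mol_def
      by (subst Bochner_Integration.integral_add, intro Bochner_Integration.integrable_diff mol_nn_eq(2)[OF A], intro integrable_inner_left iG,
          subst Bochner_Integration.integral_diff) (auto intro: mol_nn_eq(2)[OF A])
    also have "(LINT w|lborel. (indicator A w *\<^sub>R G (w - x)) \<bullet> h) = - (molD G A x \<bullet> h)"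
      unfolding molD_def using integral_inner_left[of h lborel, OF iG] by simp
    finally have e: "(LINT w|lborel. R w) = mol \<rho> A (x + h) - mol \<rho> A x - molD G A x \<bullet> h" by simp
    have Rb: "\<bar>R w\<bar> \<le> C * (norm h)\<^sup>2 * indicator (ball 0 (\<eta> + 1)) (w + - x)" for w
    proof -
      have R: "R w = indicator A w * (\<rho> ((w - x) + - h) - \<rho> (w - x) - G (w - x) \<bullet> - h)"
        unfolding R_def by (simp add: algebra_simps diff_diff_eq)
      have 1: "\<bar>\<rho> ((w - x) + - h) - \<rho> (w - x) - G (w - x) \<bullet> - h\<bar> \<le> C * (norm h)\<^sup>2"
        using C11D[OF mol_C11, of "- h" "w - x"] h by simp
      show ?thesis
      proof (cases "norm (w - x) < \<eta> + 1")
        case True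
        then show ?thesis using 1 C unfolding R by (auto simp: indicator_def abs_mult)
      next
        case False
        have "norm (w - x) \<le> norm ((w - x) + - h) + norm h" using norm_triangle_ineq[of "(w - x) + - h" h] by simp
        then have "\<eta> \<le> norm ((w - x) + - h)" "\<eta> \<le> norm (w - x)" using False h by auto
        then show ?thesis unfolding R using mol_supp[of "w - x"] mol_supp[of "w - x + - h"] C by simp
      qed
    qed
    have "(\<integral>\<^sup>+w. ennreal \<bar>R w\<bar> \<partial>lborel) \<le> (\<integral>\<^sup>+w. ennreal (C * (norm h)\<^sup>2) * indicator (ball 0 (\<eta> + 1)) (w + - x) \<partial>lborel)"
    proof (rule nn_integral_mono)
      fix w :: 'a
      show "ennreal \<bar>R w\<bar> \<le> ennreal (C * (norm h)\<^sup>2) * indicator (ball 0 (\<eta> + 1)) (w + - x)"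
        using Rb[of w] by (cases "norm (w - x) < \<eta> + 1") (auto simp: indicator_def ennreal_leI)
    qed
    also have "\<dots> = (\<integral>\<^sup>+w. ennreal (C * (norm h)\<^sup>2) * indicator (ball (0::'a) (\<eta> + 1)) w \<partial>lborel)"
      by (rule nn_integral_lborel_shift[where g = "\<lambda>w. ennreal (C * (norm h)\<^sup>2) * indicator (ball 0 (\<eta> + 1)) w"]) (intro borel_measurable_times_ennreal borel_measurable_const borel_measurable_indicator, simp)
    also have "\<dots> = ennreal (C * (norm h)\<^sup>2) * emeasure lborel (ball (0::'a) (\<eta> + 1))" by (simp add: nn_integral_cmult_indicator)
    also have "\<dots> = ennreal (C * (norm h)\<^sup>2) * ennreal V" unfolding V_def
      using emeasure_lborel_ball_finite[of "0::'a" "\<eta> + 1"] by (subst emeasure_eq_ennreal_measure) auto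
    also have "\<dots> = ennreal (C * (norm h)\<^sup>2 * V)" using C by (simp add: ennreal_mult V_def)
    finally have "ennreal (LINT w|lborel. \<bar>R w\<bar>) \<le> ennreal (C * (norm h)\<^sup>2 * V)"
      using nn_integral_eq_integral[of lborel "\<lambda>w. \<bar>R w\<bar>"] iR by simp
    then have "(LINT w|lborel. \<bar>R w\<bar>) \<le> C * (norm h)\<^sup>2 * V" using C by (simp add: V_def)
    then have "\<bar>LINT w|lborel. R w\<bar> \<le> C * (norm h)\<^sup>2 * V" using integral_abs_bound[of lborel R] by linarith
    then show ?thesis unfolding e by (simp add: mult_ac)
  qed
  then have "C11 (mol \<rho> A) (molD G A) (C * V)" using C by (simp add: C11_def V_def)
  then show thesis by (rule that)
qed

lemma mol_bmeas:
  assumes "A \<in> sets borel" shows "bmeas (mol \<rho> A)"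
proof -
  obtain C' where "C11 (mol \<rho> A) (molD G A) C'" using mol_C11_mol[OF assms] .
  then show ?thesis
  proof (rule C11_bmeas[of _ _ _ 1])
    show "\<bar>mol \<rho> A x\<bar> \<le> 1" for x using mol_range[OF assms, of x] by simp
  qed
qed

text \<open>Tonelli: the weighted average over w of the overlap of \<open>B\<close> with the
  translate of \<open>A\<close> by -w. Preservation of volume and the L^1 error of mollification
  both come from this formula.\<close>

lemma cint_ind_mol:
  assumes A [measurable]: "A \<in> sets borel" and B [measurable]: "B \<in> sets borel"
  shows "ennreal (cint (\<lambda>x. indicator B x * mol \<rho> A x)) = (\<integral>\<^sup>+w. ennreal (\<rho> w) * emeasure lborel {x\<in>cell \<inter> B. x + w \<in> A} \<partial>lborel)"
proof -
  define F :: "'a \<times> 'a \<Rightarrow> ennreal" where "F = (\<lambda>(w,x). ennreal (\<rho> w) * (indicator A (x + w) * (indicator cell x * indicator B x)))"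
  have FA: "(\<lambda>z. indicator A ((\<lambda>(w, x). x + w) z) :: ennreal) \<in> borel_measurable (lborel \<Otimes>\<^sub>M lborel)"
    by (rule measurable_compose[of _ _ borel]) simp_all
  have Fm: "F \<in> borel_measurable (lborel \<Otimes>\<^sub>M lborel)"
  proof -
    have "(\<lambda>z. ennreal (\<rho> (fst z)) * (indicator A ((\<lambda>(w, x). x + w) z) * (indicator cell (snd z) * indicator B (snd z)))) \<in> borel_measurable (lborel \<Otimes>\<^sub>M lborel)"
      by (intro borel_measurable_times_ennreal FA) measurable
    then show ?thesis by (simp add: F_def case_prod_unfold)
  qed
  have "ennreal (cint (\<lambda>x. indicator B x * mol \<rho> A x)) = (\<integral>\<^sup>+x\<in>cell. ennreal (indicator B x * mol \<rho> A x) \<partial>lborel)"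
    by (rule cint_nn[OF bmeas_mult[OF bmeas_indicator[OF B] mol_bmeas[OF A]]]) (use mol_range[OF A] in auto)
  also have "\<dots> = (\<integral>\<^sup>+x. (\<integral>\<^sup>+w. F (w,x) \<partial>lborel) \<partial>lborel)"
  proof (rule nn_integral_cong)
    fix x :: 'a
    have "(\<integral>\<^sup>+w. F (w,x) \<partial>lborel) = (\<integral>\<^sup>+w. (ennreal (\<rho> w) * indicator A (x + w)) * (indicator cell x * indicator B x) \<partial>lborel)"
      by (intro nn_integral_cong) (simp add: F_def mult.assoc)
    also have "\<dots> = ennreal (mol \<rho> A x) * (indicator cell x * indicator B x)"
      unfolding mol_nn_eq(1)[OF A] by (rule nn_integral_multc) measurable
    finally show "ennreal (indicator B x * mol \<rho> A x) * indicator cell x = (\<integral>\<^sup>+w. F (w,x) \<partial>lborel)"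
      by (auto simp: indicator_def)
  qed
  also have "\<dots> = (\<integral>\<^sup>+w. (\<integral>\<^sup>+x. F (w,x) \<partial>lborel) \<partial>lborel)" by (rule lborel_pair.Fubini[OF Fm])
  also have "\<dots> = (\<integral>\<^sup>+w. ennreal (\<rho> w) * emeasure lborel {x\<in>cell \<inter> B. x + w \<in> A} \<partial>lborel)"
  proof (rule nn_integral_cong)
    fix w :: 'a
    have s: "{x\<in>cell \<inter> B. x + w \<in> A} \<in> sets borel"
    proof -
      have "(\<lambda>x. x + w) -` A \<inter> space borel \<in> sets borel" by (rule measurable_sets[OF _ A]) simp
      moreover have "{x\<in>cell \<inter> B. x + w \<in> A} = (cell \<inter> B) \<inter> ((\<lambda>x. x + w) -` A \<inter> space borel)" by auto
      ultimately show ?thesis by simp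
    qed
    have "(\<integral>\<^sup>+x. F (w,x) \<partial>lborel) = (\<integral>\<^sup>+x. ennreal (\<rho> w) * indicator {x\<in>cell \<inter> B. x + w \<in> A} x \<partial>lborel)"
      by (intro nn_integral_cong) (auto simp: F_def indicator_def)
    then show "(\<integral>\<^sup>+x. F (w,x) \<partial>lborel) = ennreal (\<rho> w) * emeasure lborel {x\<in>cell \<inter> B. x + w \<in> A}"
      using s by (simp add: nn_integral_cmult_indicator)
  qed
  finally show ?thesis .
qed

lemma cint_mol:
  assumes A [measurable]: "A \<in> sets borel" and p: "Zperiodic_set A"
  shows "cint (mol \<rho> A) = measure lborel (A \<inter> cell)"
proof -
  have e: "emeasure lborel {x\<in>cell \<inter> UNIV. x + w \<in> A} = emeasure lborel (A \<inter> cell)" for w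
  proof -
    have s: "{x\<in>cell \<inter> UNIV. x + w \<in> A} \<in> sets borel"
    proof -
      have "(\<lambda>x. x + w) -` A \<inter> space borel \<in> sets borel" by (rule measurable_sets[OF _ A]) simp
      moreover have "{x\<in>cell \<inter> UNIV. x + w \<in> A} = cell \<inter> ((\<lambda>x. x + w) -` A \<inter> space borel)" by auto
      ultimately show ?thesis by simp
    qed
    have "emeasure lborel {x\<in>cell \<inter> UNIV. x + w \<in> A} = (\<integral>\<^sup>+x. indicator {x\<in>cell \<inter> UNIV. x + w \<in> A} x \<partial>lborel)"
      using s by simp
    also have "\<dots> = (\<integral>\<^sup>+x\<in>cell. indicator A (x + w) \<partial>lborel)" by (intro nn_integral_cong) (auto simp: indicator_def)
    also have "\<dots> = (\<integral>\<^sup>+x\<in>cell. indicator A x \<partial>lborel)"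
      by (rule nn_integral_cell_shift) (use p in \<open>auto simp: Zperiodic_def Zperiodic_set_def indicator_def\<close>)
    also have "\<dots> = emeasure lborel (A \<inter> cell)" by (simp add: indicator_inter_arith[symmetric])
    finally show ?thesis .
  qed
  have fin: "emeasure lborel (A \<inter> cell) = ennreal (measure lborel (A \<inter> cell))"
    by (rule emeasure_eq_ennreal_measure)
       (use emeasure_mono[of "A \<inter> cell" cell lborel] in \<open>auto simp: emeasure_cell top_unique\<close>)
  have "ennreal (cint (\<lambda>x. indicator UNIV x * mol \<rho> A x)) = emeasure lborel (A \<inter> cell)"
  proof -
    have "ennreal (cint (\<lambda>x. indicator UNIV x * mol \<rho> A x)) = (\<integral>\<^sup>+w. ennreal (\<rho> w) * emeasure lborel {x\<in>cell \<inter> UNIV. x + w \<in> A} \<partial>lborel)"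
      by (rule cint_ind_mol) auto
    also have "\<dots> = emeasure lborel (A \<inter> cell)"
      unfolding e by (subst nn_integral_multc) (auto simp: mol_nn)
    finally show ?thesis .
  qed
  then show ?thesis using fin cint_nonneg[OF mol_bmeas[OF A]] mol_range[OF A] by simp
qed

text \<open>For f with values in [0, 1] one has |f - 1_A| = 1_A + f - 2 f 1_A pointwise. Since f and
  1_A have the same integral, the L^1 error is twice the defect of their overlap.\<close>

lemma cint_mol_diff:
  assumes A [measurable]: "A \<in> sets borel" and p: "Zperiodic_set A"
    and ov: "\<And>w. norm w < \<eta> \<Longrightarrow> measure lborel (A \<inter> cell) - e \<le> measure lborel {x\<in>cell \<inter> A. x + w \<in> A}"
  shows "cint (\<lambda>x. \<bar>mol \<rho> A x - indicator A x\<bar>) \<le> 2 * e" "measure lborel (A \<inter> cell) - e \<le> cint (\<lambda>x. indicator A x * mol \<rho> A x)"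
proof -
  have c0: "0 \<le> cint (\<lambda>x. indicator A x * mol \<rho> A x)"
    by (intro cint_nonneg bmeas_mult bmeas_indicator mol_bmeas A) (use mol_range[OF A] in auto)
  show 1: "measure lborel (A \<inter> cell) - e \<le> cint (\<lambda>x. indicator A x * mol \<rho> A x)"
  proof -
    have "ennreal (measure lborel (A \<inter> cell) - e) = (\<integral>\<^sup>+w. ennreal (\<rho> w) * ennreal (measure lborel (A \<inter> cell) - e) \<partial>lborel)"
      by (subst nn_integral_multc) (auto simp: mol_nn)
    also have "\<dots> \<le> (\<integral>\<^sup>+w. ennreal (\<rho> w) * emeasure lborel {x\<in>cell \<inter> A. x + w \<in> A} \<partial>lborel)"
    proof (rule nn_integral_mono)
      fix w :: 'a
      show "ennreal (\<rho> w) * ennreal (measure lborel (A \<inter> cell) - e) \<le> ennreal (\<rho> w) * emeasure lborel {x\<in>cell \<inter> A. x + w \<in> A}"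
      proof (cases "norm w < \<eta>")
        case True
        have "emeasure lborel {x\<in>cell \<inter> A. x + w \<in> A} \<le> emeasure lborel (cell :: 'a set)" by (intro emeasure_mono) auto
        then have "emeasure lborel {x\<in>cell \<inter> A. x + w \<in> A} = ennreal (measure lborel {x\<in>cell \<inter> A. x + w \<in> A})"
          by (intro emeasure_eq_ennreal_measure) (auto simp: emeasure_cell top_unique)
        then show ?thesis using ov[OF True] by (intro mult_left_mono) (auto simp: ennreal_leI)
      next
        case False
        then show ?thesis using mol_supp(1)[of w] by simp
      qed
    qed
    also have "\<dots> = ennreal (cint (\<lambda>x. indicator A x * mol \<rho> A x))" by (rule cint_ind_mol[symmetric]) (rule A)+
    finally show ?thesis using c0 by simp
  qed
  have "cint (\<lambda>x. \<bar>mol \<rho> A x - indicator A x\<bar>) = cint (\<lambda>x. (indicator A x + mol \<rho> A x) - 2 * (indicator A x * mol \<rho> A x))"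
  proof (rule arg_cong[where f = cint], rule ext)
    fix x
    show "\<bar>mol \<rho> A x - indicator A x\<bar> = (indicator A x + mol \<rho> A x) - 2 * (indicator A x * mol \<rho> A x)"
      using mol_range[OF A, of x] by (cases "x \<in> A") auto
  qed
  also have "\<dots> = measure lborel (A \<inter> cell) + measure lborel (A \<inter> cell) - 2 * cint (\<lambda>x. indicator A x * mol \<rho> A x)"
    by (subst cint_diff, (intro bmeas_add bmeas_mult bmeas_const bmeas_indicator mol_bmeas A)+, subst cint_add,
        (intro bmeas_indicator mol_bmeas A)+, subst cint_cmult) (simp add: cint_indicator[OF A] cint_mol[OF A p])
  finally show "cint (\<lambda>x. \<bar>mol \<rho> A x - indicator A x\<bar>) \<le> 2 * e" using 1 by simp
qed

end

declare mol_meas [measurable del] molG_meas [measurable del]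

text \<open>Continuity of translations in measure. \<open>A\<close> is approximated in the cell by a
  compact \<open>T\<close>, and \<open>T\<close> from outside by an open \<open>U\<close>; points of
  \<open>T\<close> that a small shift moves out of \<open>T\<close> land in \<open>U - T\<close>.
  The two approximations cost e/2 each.\<close>

lemma translation_overlap:
  fixes A :: "'a::euclidean_space set"
  assumes A [measurable]: "A \<in> sets borel" and e: "e > 0"
  obtains d where "d > 0" "\<And>w. norm w < d \<Longrightarrow> measure lborel (A \<inter> cell) - e \<le> measure lborel {x\<in>cell \<inter> A. x + w \<in> A}"
proof -
  define E where "E = A \<inter> cell"
  have Eb [measurable]: "E \<in> sets borel" by (simp add: E_def)
  have fin: "emeasure lborel S \<noteq> \<infinity>" if "S \<subseteq> E" "S \<in> sets borel" for S
    using emeasure_mono[of S cell lborel] that by (auto simp: emeasure_cell top_unique E_def)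
  obtain T where T: "closed T" "T \<subseteq> E" "E - T \<in> lmeasurable" "emeasure lebesgue (E - T) < ennreal (e/2)"
    using sets_lebesgue_inner_closed[of E "e/2"] e Eb by auto
  have Tb [measurable]: "T \<in> sets borel" using T by simp
  have "bounded T" using T(2) by (rule bounded_subset[rotated]) (rule bounded_subset[of cell], auto simp: E_def cell_def)
  then have cT: "compact T" using T(1) by (simp add: compact_eq_bounded_closed)
  obtain U where U: "open U" "T \<subseteq> U" "emeasure lborel (U - T) < ennreal (e/2)"
    using outer_regular_lborel[OF Tb, of "e/2"] e by auto
  obtain d where d: "d > 0" "(\<Union>x\<in>T. ball x d) \<subseteq> U"
    using compact_subset_open_imp_ball_epsilon_subset[OF cT U(1,2)] by blast
  show thesis
  proof (rule that[OF d(1)])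
    fix w :: 'a assume w: "norm w < d"
    define N where "N = {x\<in>T. x + w \<notin> T}"
    have Nb [measurable]: "N \<in> sets borel"
    proof -
      have "(\<lambda>x. x + w) -` (- T) \<inter> space borel \<in> sets borel" by (rule measurable_sets[of _ borel borel]) auto
      moreover have "N = T \<inter> ((\<lambda>x. x + w) -` (- T) \<inter> space borel)" by (auto simp: N_def)
      ultimately show ?thesis by simp
    qed
    have "emeasure lborel N \<le> (\<integral>\<^sup>+x. indicator (U - T) (x + w) \<partial>lborel)"
    proof -
      have "x + w \<in> U - T" if "x \<in> N" for x
        using that d(2) w by (auto simp: N_def subset_eq dist_norm)
      then have "(\<integral>\<^sup>+x. indicator N x \<partial>lborel) \<le> (\<integral>\<^sup>+x. indicator (U - T) (x + w) \<partial>lborel)"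
        by (intro nn_integral_mono) (auto simp: indicator_def)
      then show ?thesis by simp
    qed
    also have "\<dots> = (\<integral>\<^sup>+x. indicator (U - T) x \<partial>lborel)"
      by (rule nn_integral_lborel_shift) (use U(1) Tb in \<open>intro borel_measurable_indicator sets.Diff, auto\<close>)
    also have "\<dots> = emeasure lborel (U - T)" using U by simp
    finally have N: "emeasure lborel N < ennreal (e/2)" using U(3) by (rule le_less_trans)
    then have N': "measure lborel N \<le> e / 2" unfolding measure_def using e by (intro enn2real_leI) auto
    have "emeasure lborel (E - T) = emeasure lebesgue (E - T)" by simp
    then have ET: "measure lborel (E - T) \<le> e / 2"
      unfolding measure_def using T(4) e by (intro enn2real_leI) auto
    have sub: "T - N \<subseteq> {x\<in>cell \<inter> A. x + w \<in> A}" using T(2) by (auto simp: N_def E_def)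
    have sb: "{x\<in>cell \<inter> A. x + w \<in> A} \<in> sets borel"
    proof -
      have "(\<lambda>x. x + w) -` A \<inter> space borel \<in> sets borel" by (rule measurable_sets[OF _ A]) simp
      moreover have "{x\<in>cell \<inter> A. x + w \<in> A} = (cell \<inter> A) \<inter> ((\<lambda>x. x + w) -` A \<inter> space borel)" by auto
      ultimately show ?thesis by simp
    qed
    have "measure lborel E \<le> measure lborel (T - N) + measure lborel N + measure lborel (E - T)"
    proof -
      have "measure lborel E = measure lborel (T \<union> (E - T))" using T(2) by (simp add: Un_absorb1)
      also have "\<dots> = measure lborel T + measure lborel (E - T)"
        using fin[of T] fin[of "E - T"] T(2) by (intro measure_Union) auto
      also have "measure lborel T = measure lborel ((T - N) \<union> N)" by (rule arg_cong[where f = "measure lborel"]) (auto simp: N_def)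
      also have "\<dots> = measure lborel (T - N) + measure lborel N"
        using fin[of "T - N"] fin[of N] T(2) by (intro measure_Union) (auto simp: N_def)
      finally show ?thesis by simp
    qed
    moreover have "measure lborel (T - N) \<le> measure lborel {x\<in>cell \<inter> A. x + w \<in> A}"
      using sub sb fin[of "{x\<in>cell \<inter> A. x + w \<in> A}"] by (intro measure_mono_fmeasurable) (auto simp: fmeasurable_def E_def less_top)
    ultimately show "measure lborel (A \<inter> cell) - e \<le> measure lborel {x\<in>cell \<inter> A. x + w \<in> A}"
      using N' ET unfolding E_def by linarith
  qed
qed

text \<open>On the torus a difference quotient moves from \<open>W\<close> to \<open>g\<close>
  exactly, by shift invariance; bounded convergence then lets the step tend to 0. For Lipschitz
  \<open>W\<close> the derivative is taken almost everywhere.\<close>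

lemma cint_by_parts:
  fixes g W w :: "'a::euclidean_space \<Rightarrow> real"
  assumes g: "C11 g G C" "\<And>x. \<bar>g x\<bar> \<le> B" "Zperiodic g" and b: "norm b = 1"
    and W: "\<And>x y. \<bar>W x - W y\<bar> \<le> L * norm (x - y)" "\<And>x. \<bar>W x\<bar> \<le> B'" "Zperiodic W"
    and w: "w \<in> borel_measurable borel" "AE x in lborel. ((\<lambda>t. W (x + t *\<^sub>R b)) has_real_derivative w x) (at 0)"
  shows "cint (\<lambda>x. g x * w x) = - cint (\<lambda>x. (G x \<bullet> b) * W x)"
proof -
  define t where "t = (\<lambda>n. 1 / real (Suc n))"
  have t: "t n > 0" "t n \<le> 1" "t n \<noteq> 0" for n by (auto simp: t_def)
  have tl: "t \<longlonglongrightarrow> 0" unfolding t_def by (rule LIMSEQ_Suc[OF lim_1_over_n])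
  have tl0: "filterlim t (at 0) sequentially" using tl t(3) by (simp add: filterlim_at)
  have C: "C \<ge> 0" using g(1) by (simp add: C11_def)
  have Wc: "continuous_on UNIV W"
  proof (rule continuous_onI)
    fix x and e :: real assume e: "e > 0"
    show "\<exists>d>0. \<forall>x'\<in>UNIV. dist x' x < d \<longrightarrow> dist (W x') (W x) \<le> e"
    proof (intro exI[of _ "e / (\<bar>L\<bar> + 1)"] conjI ballI impI)
      fix x' assume x': "dist x' x < e / (\<bar>L\<bar> + 1)"
      have "\<bar>W x' - W x\<bar> \<le> (\<bar>L\<bar> + 1) * norm (x' - x)"
        using W(1)[of x' x] by (smt (verit) mult_right_mono norm_ge_zero)
      also have "\<dots> \<le> (\<bar>L\<bar> + 1) * (e / (\<bar>L\<bar> + 1))" using x' by (intro mult_left_mono) (auto simp: dist_norm)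
      finally show "dist (W x') (W x) \<le> e" by (simp add: dist_real_def)
    qed (use e in auto)
  qed
  have Wm [measurable]: "W \<in> borel_measurable borel" by (rule borel_measurable_continuous_onI[OF Wc])
  have gm [measurable]: "g \<in> borel_measurable borel" by (rule borel_measurable_continuous_onI[OF C11_continuous[OF g(1)]])
  have gB: "bmeas g" by (rule C11_bmeas[OF g(1,2)])
  have WB: "bmeas W" by (rule bmeasI[OF Wm W(2)])
  have GB: "bmeas (\<lambda>x. G x \<bullet> b)" by (rule C11_grad_bmeas[OF g(1,2)])
  have eq: "cint (\<lambda>x. g x * ((W (x + t n *\<^sub>R b) - W x) / t n)) = cint (\<lambda>x. ((g (x + - (t n *\<^sub>R b)) - g x) / t n) * W x)" for n
  proof -
    have p: "Zperiodic (\<lambda>x. g x * W (x + t n *\<^sub>R b))" using g(3) Zperiodic_shift[OF W(3)] by (simp add: Zperiodic_def)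
    have bm: "bmeas (\<lambda>x. g x * W (x + t n *\<^sub>R b))" by (rule bmeas_mult[OF gB bmeas_shift[OF WB]])
    have bm2: "bmeas (\<lambda>x. g (x + - (t n *\<^sub>R b)) * W x)" by (rule bmeas_mult[OF bmeas_shift[OF gB] WB])
    have bm3: "bmeas (\<lambda>x. g x * W x)" by (rule bmeas_mult[OF gB WB])
    have s: "cint (\<lambda>x. g (x + - (t n *\<^sub>R b)) * W x) = cint (\<lambda>x. g x * W (x + t n *\<^sub>R b))"
      using cint_shift[OF bm p, of "- (t n *\<^sub>R b)"] by simp
    have "cint (\<lambda>x. g x * ((W (x + t n *\<^sub>R b) - W x) / t n)) = cint (\<lambda>x. (1 / t n) * (g x * W (x + t n *\<^sub>R b) - g x * W x))"
      by (rule arg_cong[where f = cint]) (simp add: fun_eq_iff field_simps)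
    also have "\<dots> = (1 / t n) * (cint (\<lambda>x. g x * W (x + t n *\<^sub>R b)) - cint (\<lambda>x. g x * W x))"
      unfolding cint_cmult cint_diff[OF bm bm3] ..
    also have "\<dots> = (1 / t n) * (cint (\<lambda>x. g (x + - (t n *\<^sub>R b)) * W x) - cint (\<lambda>x. g x * W x))" unfolding s ..
    also have "\<dots> = cint (\<lambda>x. (1 / t n) * (g (x + - (t n *\<^sub>R b)) * W x - g x * W x))"
      unfolding cint_cmult cint_diff[OF bm2 bm3] ..
    also have "\<dots> = cint (\<lambda>x. ((g (x + - (t n *\<^sub>R b)) - g x) / t n) * W x)"
      by (rule arg_cong[where f = cint]) (simp add: fun_eq_iff field_simps)
    finally show ?thesis .
  qed
  have B0: "B \<ge> 0" "B' \<ge> 0" using g(2)[of 0] W(2)[of 0] by auto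
  have l1: "(\<lambda>n. cint (\<lambda>x. g x * ((W (x + t n *\<^sub>R b) - W x) / t n))) \<longlonglongrightarrow> cint (\<lambda>x. g x * w x)"
  proof (rule cint_lim[where C = "B * \<bar>L\<bar>"])
    fix n x
    have "\<bar>W (x + t n *\<^sub>R b) - W x\<bar> \<le> \<bar>L\<bar> * t n"
      using W(1)[of "x + t n *\<^sub>R b" x] b t[of n] by (simp add: order_trans[OF _ mult_right_mono[OF abs_ge_self]])
    then have "\<bar>(W (x + t n *\<^sub>R b) - W x) / t n\<bar> \<le> \<bar>L\<bar>" using t[of n] by (simp add: abs_divide divide_le_eq)
    then show "\<bar>g x * ((W (x + t n *\<^sub>R b) - W x) / t n)\<bar> \<le> B * \<bar>L\<bar>"
      unfolding abs_mult using g(2)[of x] B0 by (intro mult_mono) auto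
  next
    show "AE x in lborel. (\<lambda>n. g x * ((W (x + t n *\<^sub>R b) - W x) / t n)) \<longlonglongrightarrow> g x * w x"
      using w(2)
    proof eventually_elim
      case (elim x)
      then have "((\<lambda>h. (W (x + h *\<^sub>R b) - W x) / h) \<longlongrightarrow> w x) (at 0)" by (simp add: DERIV_def)
      from filterlim_compose[OF this tl0] show ?case by (intro tendsto_intros)
    qed
  qed (use w(1) in measurable)
  have l2: "(\<lambda>n. cint (\<lambda>x. ((g (x + - (t n *\<^sub>R b)) - g x) / t n) * W x)) \<longlonglongrightarrow> cint (\<lambda>x. - (G x \<bullet> b) * W x)"
  proof (rule cint_lim[where C = "(2 * B + 2 * C) * B'"])
    fix n x
    have "\<bar>g (x + - (t n *\<^sub>R b)) - g x\<bar> \<le> (2 * B + 2 * C) * t n"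
      using C11_difference_bound[OF g(1,2), of "- (t n *\<^sub>R b)" x] b t[of n] by simp
    then have "\<bar>(g (x + - (t n *\<^sub>R b)) - g x) / t n\<bar> \<le> 2 * B + 2 * C" using t[of n] by (simp add: abs_divide divide_le_eq)
    then show "\<bar>((g (x + - (t n *\<^sub>R b)) - g x) / t n) * W x\<bar> \<le> (2 * B + 2 * C) * B'"
      unfolding abs_mult using W(2)[of x] B0 C by (intro mult_mono) auto
  next
    show "AE x in lborel. (\<lambda>n. ((g (x + - (t n *\<^sub>R b)) - g x) / t n) * W x) \<longlonglongrightarrow> - (G x \<bullet> b) * W x"
    proof (intro AE_I2 tendsto_mult tendsto_const)
      fix x
      show "(\<lambda>n. (g (x + - (t n *\<^sub>R b)) - g x) / t n) \<longlonglongrightarrow> - (G x \<bullet> b)"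
      proof (rule LIM_zero_cancel, rule Lim_null_comparison)
        show "\<forall>\<^sub>F n in sequentially. norm ((g (x + - (t n *\<^sub>R b)) - g x) / t n - - (G x \<bullet> b)) \<le> C * t n"
        proof (intro always_eventually allI)
          fix n
          have "\<bar>g (x + - (t n *\<^sub>R b)) - g x - G x \<bullet> (- (t n *\<^sub>R b))\<bar> \<le> C * (t n)\<^sup>2"
            using C11D[OF g(1), of "- (t n *\<^sub>R b)" x] b t[of n] by simp
          moreover have "(g (x + - (t n *\<^sub>R b)) - g x) / t n - - (G x \<bullet> b) = (g (x + - (t n *\<^sub>R b)) - g x - G x \<bullet> (- (t n *\<^sub>R b))) / t n"
            using t[of n] by (simp add: field_simps)
          ultimately show "norm ((g (x + - (t n *\<^sub>R b)) - g x) / t n - - (G x \<bullet> b)) \<le> C * t n"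
            using t[of n] by (simp add: abs_divide divide_le_eq power2_eq_square mult.assoc)
        qed
        show "(\<lambda>n. C * t n) \<longlonglongrightarrow> 0" using tendsto_mult_left[OF tl, of C] by simp
      qed
    qed
  next
    show "(\<lambda>x. - (G x \<bullet> b) * W x) \<in> borel_measurable borel"
      using bmeas_measurable[OF GB] by simp
  qed measurable
  have "cint (\<lambda>x. g x * w x) = cint (\<lambda>x. - (G x \<bullet> b) * W x)"
    using LIMSEQ_unique[OF l1] l2 eq by simp
  then show ?thesis using cint_minus[of "\<lambda>x. (G x \<bullet> b) * W x"] by simp
qed

section \<open>Perimeter and isoperimetry on the torus\<close>

lemma Zperiodic_cell_rep: "\<exists>k\<in>Zlat. x + k \<in> (cell :: 'a::euclidean_space set)"
proof -
  define k where "k = (\<Sum>b\<in>Basis. of_int (- \<lfloor>x \<bullet> b\<rfloor>) *\<^sub>R (b :: 'a))"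
  have kb: "k \<bullet> b = of_int (- \<lfloor>x \<bullet> b\<rfloor>)" if "b \<in> Basis" for b
    unfolding k_def by (rule inner_sum_left_Basis[OF that])
  have "k \<in> Zlat" using kb by (simp add: Zlat_def)
  moreover have "x + k \<in> cell" unfolding cell_def mem_box
  proof (intro ballI)
    fix b :: 'a assume b: "b \<in> Basis"
    have "(x + k) \<bullet> b = frac (x \<bullet> b)" using kb[OF b] by (simp add: inner_add_left frac_def)
    then show "0 \<bullet> b \<le> (x + k) \<bullet> b \<and> (x + k) \<bullet> b \<le> One \<bullet> b"
      using b by (simp add: frac_ge_0 frac_lt_1 less_imp_le)
  qed
  ultimately show ?thesis by blast
qed

lemma Zperiodic_continuous_bounded:
  fixes f :: "'a::euclidean_space \<Rightarrow> 'b::real_normed_vector"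
  assumes "Zperiodic f" "continuous_on UNIV f"
  obtains B where "\<And>x. norm (f x) \<le> B"
proof -
  have "compact (cell :: 'a set)" by (simp add: cell_def)
  then have "compact (f ` cell)" using assms(2) by (intro compact_continuous_image) (auto intro: continuous_on_subset)
  then obtain B where B: "\<And>x. x \<in> cell \<Longrightarrow> norm (f x) \<le> B" by (meson bounded_iff compact_imp_bounded image_eqI)
  have "norm (f x) \<le> B" for x
  proof -
    obtain k where "k \<in> Zlat" "x + k \<in> cell" using Zperiodic_cell_rep[of x] by blast
    moreover from this have "f (x + k) = f x" using assms(1) by (auto simp: Zperiodic_def)
    ultimately show ?thesis using B[of "x + k"] by simp
  qed
  then show thesis by (rule that)
qed

lemma C1_field_directional:
  assumes "C1_field \<phi> D" "b \<in> Basis"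
  shows "((\<lambda>h. \<phi> (x + h *\<^sub>R b) \<bullet> b) has_real_derivative D x b \<bullet> b) (at 0)"
proof -
  have "(\<phi> has_derivative D x) (at (x + 0 *\<^sub>R b))" using assms(1) by (simp add: C1_field_def)
  moreover have "((\<lambda>h. x + h *\<^sub>R b) has_derivative (\<lambda>h. h *\<^sub>R b)) (at 0)" by (auto intro!: derivative_eq_intros)
  ultimately have "((\<lambda>h. \<phi> (x + h *\<^sub>R b)) has_derivative (\<lambda>h. D x (h *\<^sub>R b))) (at 0)"
    using has_derivative_compose[of "\<lambda>h. x + h *\<^sub>R b" "\<lambda>h. h *\<^sub>R b" 0 UNIV \<phi> "D x"] by simp
  then have "((\<lambda>h. \<phi> (x + h *\<^sub>R b) \<bullet> b) has_derivative (\<lambda>h. D x (h *\<^sub>R b) \<bullet> b)) (at 0)"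
    by (rule has_derivative_inner_left)
  moreover have "linear (D x)" using assms(1) unfolding C1_field_def by (meson has_derivative_linear)
  then have "(\<lambda>h. D x (h *\<^sub>R b) \<bullet> b) = (*) (D x b \<bullet> b)" by (simp add: linear_cmul fun_eq_iff)
  ultimately show ?thesis by (simp add: has_field_derivative_def)
qed

lemma C1_field_divergence:
  assumes "C1_field \<phi> D" shows "divergence \<phi> x = (\<Sum>b\<in>Basis. D x b \<bullet> b)"
  unfolding divergence_def by (intro sum.cong refl DERIV_imp_deriv C1_field_directional[OF assms])

lemma C1_field_D_periodic:
  assumes "C1_field \<phi> D" "Zperiodic \<phi>" shows "Zperiodic (\<lambda>x. D x v)"
  unfolding Zperiodic_def
proof (intro allI ballI)
  fix x k :: 'a assume k: "k \<in> Zlat"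
  have 1: "((\<lambda>y. y + k) has_derivative (\<lambda>h. h)) (at x)" by (auto intro!: derivative_eq_intros)
  have "(\<phi> has_derivative D (x + k)) (at (x + k))" using assms(1) by (simp add: C1_field_def)
  from has_derivative_compose[OF 1 this] have "((\<lambda>y. \<phi> (y + k)) has_derivative D (x + k)) (at x)" .
  moreover have "(\<lambda>y. \<phi> (y + k)) = \<phi>" using assms(2) k by (auto simp: Zperiodic_def)
  ultimately have "(\<phi> has_derivative D (x + k)) (at x)" by simp
  moreover have "(\<phi> has_derivative D x) (at x)" using assms(1) by (simp add: C1_field_def)
  ultimately show "D (x + k) v = D x v" by (metis has_derivative_unique)
qed

lemma C1_field_lipschitz:
  fixes \<phi> :: "'a::euclidean_space \<Rightarrow> 'a"
  assumes \<phi>: "C1_field \<phi> D" "Zperiodic \<phi>"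
  obtains L where "L \<ge> 0" "\<And>x y. norm (\<phi> x - \<phi> y) \<le> L * norm (x - y)"
proof -
  have "\<exists>B. \<forall>x. norm (D x b) \<le> B" if "b \<in> Basis" for b
    using Zperiodic_continuous_bounded[of "\<lambda>x. D x b"] C1_field_D_periodic[OF \<phi>] \<phi>(1) that
    unfolding C1_field_def by metis
  then obtain B where B: "\<And>b x. b \<in> Basis \<Longrightarrow> norm (D x b) \<le> B b" by metis
  define L where "L = (\<Sum>b\<in>Basis. B b)"
  have B0: "B b \<ge> 0" if "b \<in> Basis" for b using B[OF that, of 0] norm_ge_zero order_trans by blast
  have "norm (D x v) \<le> L * norm v" for x v
  proof -
    have lin: "linear (D x)" using \<phi>(1) unfolding C1_field_def by (meson has_derivative_linear)
    have "D x v = D x (\<Sum>b\<in>Basis. (v \<bullet> b) *\<^sub>R b)" by (simp add: euclidean_representation)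
    also have "\<dots> = (\<Sum>b\<in>Basis. (v \<bullet> b) *\<^sub>R D x b)" using lin by (simp add: linear_sum linear_cmul)
    finally have "norm (D x v) \<le> (\<Sum>b\<in>Basis. norm ((v \<bullet> b) *\<^sub>R D x b))" using norm_sum by metis
    also have "\<dots> \<le> (\<Sum>b\<in>Basis. B b * norm v)"
      using B B0 by (intro sum_mono) (simp add: mult.commute[of _ "norm v"] mult_mono Basis_le_norm)
    finally show ?thesis by (simp add: L_def sum_distrib_right)
  qed
  then have "onorm (D x) \<le> L" for x by (rule onorm_bound[rotated]) (simp add: L_def B0 sum_nonneg)
  then have "norm (\<phi> x - \<phi> y) \<le> L * norm (x - y)" for x y
    using differentiable_bound[of UNIV \<phi> D L] \<phi>(1) unfolding C1_field_def by auto
  moreover have "L \<ge> 0" by (simp add: L_def B0 sum_nonneg)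
  ultimately show thesis using that by blast
qed

lemma C1_field_div_bmeas:
  assumes "C1_field \<phi> D" "Zperiodic \<phi>" shows "bmeas (divergence \<phi>)"
proof -
  have "bmeas (\<lambda>x. \<Sum>b\<in>Basis. D x b \<bullet> b)"
  proof (rule bmeas_sum)
    fix b :: 'a assume b: "b \<in> Basis"
    have c: "continuous_on UNIV (\<lambda>x. D x b)" using assms(1) b by (simp add: C1_field_def)
    obtain B where B: "\<And>x. norm (D x b) \<le> B"
      using Zperiodic_continuous_bounded[OF C1_field_D_periodic[OF assms] c] by blast
    show "bmeas (\<lambda>x. D x b \<bullet> b)"
    proof (rule bmeasI[of _ B])
      show "(\<lambda>x. D x b \<bullet> b) \<in> borel_measurable borel" using c by (intro borel_measurable_continuous_onI continuous_intros)
      show "\<bar>D x b \<bullet> b\<bar> \<le> B" for x using B[of x] Basis_le_norm[OF b, of "D x b"] by simp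
    qed
  qed
  then show ?thesis by (simp add: C1_field_divergence[OF assms(1)] cong: bmeas_def)
     (simp add: C1_field_divergence[OF assms(1)] fun_eq_iff[symmetric] ext[of "divergence \<phi>"])
qed

lemma C1_field_D_bmeas:
  assumes "C1_field \<phi> D" "b \<in> Basis" shows "(\<lambda>x. D x b \<bullet> b) \<in> borel_measurable borel"
  using assms by (intro borel_measurable_continuous_onI continuous_intros) (simp add: C1_field_def)

lemma cint_C11_divergence:
  assumes g: "C11 g G C" "\<And>x. \<bar>g x\<bar> \<le> B" "Zperiodic g"
    and \<phi>: "C1_field \<phi> D" "Zperiodic \<phi>" "\<And>x. norm (\<phi> x) \<le> B'"
  shows "cint (\<lambda>x. g x * divergence \<phi> x) = - cint (\<lambda>x. G x \<bullet> \<phi> x)"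
proof -
  obtain L where L: "L \<ge> 0" "\<And>x y. norm (\<phi> x - \<phi> y) \<le> L * norm (x - y)" using C1_field_lipschitz[OF \<phi>(1,2)] by blast
  have gB: "bmeas g" by (rule C11_bmeas[OF g(1,2)])
  have Db: "bmeas (\<lambda>x. D x b \<bullet> b)" if b: "b \<in> Basis" for b
  proof -
    obtain B where B: "\<And>x. norm (D x b) \<le> B"
      using Zperiodic_continuous_bounded[OF C1_field_D_periodic[OF \<phi>(1,2)], of b] \<phi>(1) b unfolding C1_field_def by blast
    show ?thesis
    proof (rule bmeasI[OF C1_field_D_bmeas[OF \<phi>(1) b], of B])
      show "\<bar>D x b \<bullet> b\<bar> \<le> B" for x using B[of x] Basis_le_norm[OF b, of "D x b"] by simp
    qed
  qed
  have \<phi>b: "\<bar>\<phi> x \<bullet> b\<bar> \<le> B'" if "b \<in> Basis" for b x using \<phi>(3)[of x] Basis_le_norm[OF that, of "\<phi> x"] by simp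
  have \<phi>l: "\<bar>\<phi> x \<bullet> b - \<phi> y \<bullet> b\<bar> \<le> L * norm (x - y)" if "b \<in> Basis" for b x y
    using L(2)[of x y] Basis_le_norm[OF that, of "\<phi> x - \<phi> y"] by (simp add: inner_diff_left)
  have \<phi>m: "bmeas (\<lambda>x. \<phi> x \<bullet> b)" if b: "b \<in> Basis" for b
  proof (rule bmeasI[OF _ \<phi>b[OF b]])
    have "continuous_on UNIV \<phi>" using \<phi>(1) unfolding C1_field_def
      by (meson continuous_at_imp_continuous_on has_derivative_continuous)
    then show "(\<lambda>x. \<phi> x \<bullet> b) \<in> borel_measurable borel" by (intro borel_measurable_continuous_onI continuous_intros)
  qed
  have "cint (\<lambda>x. g x * divergence \<phi> x) = cint (\<lambda>x. \<Sum>b\<in>Basis. g x * (D x b \<bullet> b))"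
    by (simp add: C1_field_divergence[OF \<phi>(1)] sum_distrib_left)
  also have "\<dots> = (\<Sum>b\<in>Basis. cint (\<lambda>x. g x * (D x b \<bullet> b)))"
    by (intro cint_sum bmeas_mult gB Db)
  also have "\<dots> = (\<Sum>b\<in>Basis. - cint (\<lambda>x. (G x \<bullet> b) * (\<phi> x \<bullet> b)))"
  proof (rule sum.cong[OF refl])
    fix b :: 'a assume b: "b \<in> Basis"
    have "Zperiodic (\<lambda>x. \<phi> x \<bullet> b)" using \<phi>(2) by (simp add: Zperiodic_def)
    from cint_by_parts[OF g _ \<phi>l[OF b] \<phi>b[OF b] this C1_field_D_bmeas[OF \<phi>(1) b]] C1_field_directional[OF \<phi>(1) b] b
    show "cint (\<lambda>x. g x * (D x b \<bullet> b)) = - cint (\<lambda>x. (G x \<bullet> b) * (\<phi> x \<bullet> b))" by simp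
  qed
  also have "\<dots> = - cint (\<lambda>x. \<Sum>b\<in>Basis. (G x \<bullet> b) * (\<phi> x \<bullet> b))"
    by (subst cint_sum, intro bmeas_mult C11_grad_bmeas[OF g(1,2)] \<phi>m) (auto simp: sum_negf)
  also have "\<dots> = - cint (\<lambda>x. G x \<bullet> \<phi> x)" by (simp add: euclidean_inner[symmetric])
  finally show ?thesis .
qed

lemma C11_const: "C11 (\<lambda>x. c) (\<lambda>x. 0) 0" by (simp add: C11_def)

lemma cint_divergence_zero:
  assumes "C1_field \<phi> D" "Zperiodic \<phi>" "\<And>x. norm (\<phi> x) \<le> B'"
  shows "cint (divergence \<phi>) = 0"
  using cint_C11_divergence[OF C11_const[of 1] _ _ assms, of 1] by (simp add: Zperiodic_def cint_const)

lemma integral_cell_eq_cint: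
  assumes "A \<in> sets borel" "bmeas g"
  shows "integral (A \<inter> cell) g = cint (\<lambda>x. indicator A x * g x)"
proof -
  have "set_integrable lborel cell (\<lambda>x. indicator A x * g x)"
    by (rule bmeas_integrable[OF bmeas_mult[OF bmeas_indicator[OF assms(1)] assms(2)]])
  moreover have e: "(\<lambda>x. indicator cell x *\<^sub>R (indicator A x * g x)) = (\<lambda>x. indicator (A \<inter> cell) x *\<^sub>R g x)"
    by (auto simp: indicator_def)
  ultimately have "set_integrable lborel (A \<inter> cell) g" unfolding set_integrable_def by simp
  from set_borel_integral_eq_integral(2)[OF this] show ?thesis
    unfolding cint_def set_lebesgue_integral_def e by simp
qed

section \<open>The De Giorgi perimeter and translations\<close>

lemma perimeter_ge:
  assumes "A \<in> sets borel" "Zperiodic \<phi>" "\<And>y. norm (\<phi> y) \<le> 1" "C1_field \<phi> D"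
  shows "ereal (cint (\<lambda>x. indicator A x * divergence \<phi> x)) \<le> torus_perimeter A"
  unfolding integral_cell_eq_cint[OF assms(1) C1_field_div_bmeas[OF assms(4,2)], symmetric] torus_perimeter_def
  by (rule SUP_upper) (use assms in auto)

lemma perimeter_nonneg:
  assumes A: "A \<in> sets borel" shows "0 \<le> torus_perimeter (A :: 'a::euclidean_space set)"
proof -
  have "C1_field (\<lambda>x::'a. 0::'a) (\<lambda>x h. 0)" by (simp add: C1_field_def)
  from perimeter_ge[OF A _ _ this] show ?thesis
    by (simp add: Zperiodic_def divergence_def cint_const zero_ereal_def)
qed

lemma perimeter_less:
  assumes "A \<in> sets borel" "ereal c < torus_perimeter A"
  obtains \<phi> D where "Zperiodic \<phi>" "\<And>y. norm (\<phi> y) \<le> 1" "C1_field \<phi> D" "c < cint (\<lambda>x. indicator A x * divergence \<phi> x)"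
proof -
  obtain \<phi> D where "Zperiodic \<phi>" "\<forall>y. norm (\<phi> y) \<le> 1" "C1_field \<phi> D" "ereal c < ereal (integral (A \<inter> cell) (divergence \<phi>))"
    using assms(2) unfolding torus_perimeter_def less_SUP_iff by auto
  then show thesis using that integral_cell_eq_cint[OF assms(1) C1_field_div_bmeas] by auto
qed

lemma C1_field_minus: "C1_field \<phi> D \<Longrightarrow> C1_field (\<lambda>x. - \<phi> x) (\<lambda>x h. - D x h)"
  unfolding C1_field_def by (auto intro!: derivative_eq_intros continuous_intros)

text \<open>A periodic field has divergence of mean zero, so a test field for the complement is, up
  to sign, a test field for the set with the same value.\<close>

lemma perimeter_Compl:
  assumes A: "A \<in> sets borel" shows "torus_perimeter (- A) \<le> torus_perimeter A"
proof (rule ccontr)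
  assume n: "\<not> ?thesis"
  have "torus_perimeter A < torus_perimeter (- A)" using n by (simp add: not_le)
  then obtain c where "torus_perimeter A < ereal c" and c2: "ereal c < torus_perimeter (- A)"
    using ereal_dense2 by blast
  then have c: "torus_perimeter A \<le> ereal c" "ereal c < torus_perimeter (- A)" by (simp_all add: less_imp_le)
  obtain \<phi> D where \<phi>: "Zperiodic \<phi>" "\<And>y. norm (\<phi> y) \<le> 1" "C1_field \<phi> D" "c < cint (\<lambda>x. indicator (- A) x * divergence \<phi> x)"
    using perimeter_less[OF _ c(2)] A by auto
  have db: "bmeas (divergence \<phi>)" by (rule C1_field_div_bmeas[OF \<phi>(3,1)])
  have "cint (\<lambda>x. indicator (- A) x * divergence \<phi> x) = cint (\<lambda>x. divergence \<phi> x - indicator A x * divergence \<phi> x)"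
    by (rule arg_cong[where f = cint]) (auto simp: indicator_def fun_eq_iff)
  also have "\<dots> = - cint (\<lambda>x. indicator A x * divergence \<phi> x)"
    using cint_diff[OF db bmeas_mult[OF bmeas_indicator[OF A] db]] cint_divergence_zero[OF \<phi>(3,1,2)] by simp
  also have "\<dots> = cint (\<lambda>x. indicator A x * divergence (\<lambda>x. - \<phi> x) x)"
    by (simp add: C1_field_divergence[OF C1_field_minus[OF \<phi>(3)]] C1_field_divergence[OF \<phi>(3)] sum_negf cint_minus)
  finally have "ereal c < ereal (cint (\<lambda>x. indicator A x * divergence (\<lambda>x. - \<phi> x) x))" using \<phi>(4) by simp
  also have "\<dots> \<le> torus_perimeter A"
    by (rule perimeter_ge[OF A _ _ C1_field_minus[OF \<phi>(3)]]) (use \<phi> in \<open>auto simp: Zperiodic_def\<close>)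
  finally show False using c(1) by simp
qed

text \<open>A set of perimeter p loses at most |z| p of its overlap when shifted by z. The overlap
  of \<open>A\<close> with the shifted mollified indicator is differentiated along the segment from
  0 to z, and its derivative is bounded by testing the perimeter.\<close>

lemma perimeter_translation:
  assumes M: "mollifier \<eta> \<rho> G C" and A: "A \<in> sets borel" "Zperiodic_set A" and p: "torus_perimeter A \<le> ereal p"
  shows "cint (\<lambda>x. indicator A x * mol \<rho> A x) - norm z * p \<le> cint (\<lambda>x. indicator A x * mol \<rho> A (x + z))"
proof (cases "z = 0")
  case False
  obtain C' where C': "C11 (mol \<rho> A) (molD G A) C'" using mol_C11_mol[OF M A(1)] .
  have per: "Zperiodic (mol \<rho> A)" by (rule mol_periodic[OF M A])
  have b1: "\<bar>mol \<rho> A x\<bar> \<le> 1" for x using mol_range[OF M A(1), of x] by simp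
  have mb: "bmeas (mol \<rho> A)" by (rule mol_bmeas[OF M A(1)])
  have ib: "bmeas (indicator A)" by (rule bmeas_indicator[OF A(1)])
  define F where "F = (\<lambda>s. cint (\<lambda>x. indicator A x * mol \<rho> A (x + s *\<^sub>R z)))"
  define F' where "F' = (\<lambda>s. cint (\<lambda>x. indicator A x * (molD G A (x + s *\<^sub>R z) \<bullet> z)))"
  have gb: "bmeas (\<lambda>x. molD G A x \<bullet> z)" by (rule C11_grad_bmeas[OF C' b1])
  have tay: "\<bar>F (s + t) - F s - t * F' s\<bar> \<le> C' * (norm z)\<^sup>2 * t\<^sup>2" if t: "norm (t *\<^sub>R z) \<le> 1" for s t
  proof -
    have i1: "bmeas (\<lambda>x. indicator A x * mol \<rho> A (x + (s + t) *\<^sub>R z))" by (rule bmeas_mult[OF ib bmeas_shift[OF mb]])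
    have i2: "bmeas (\<lambda>x. indicator A x * mol \<rho> A (x + s *\<^sub>R z))" by (rule bmeas_mult[OF ib bmeas_shift[OF mb]])
    have i3: "bmeas (\<lambda>x. indicator A x * (molD G A (x + s *\<^sub>R z) \<bullet> z))" by (rule bmeas_mult[OF ib bmeas_shift[OF gb]])
    define R where "R = (\<lambda>x. (indicator A x * mol \<rho> A (x + (s + t) *\<^sub>R z) - indicator A x * mol \<rho> A (x + s *\<^sub>R z)) - t * (indicator A x * (molD G A (x + s *\<^sub>R z) \<bullet> z)))"
    have Rb: "bmeas R" unfolding R_def by (intro bmeas_diff i1 i2 bmeas_cmult i3)
    have "cint R = F (s + t) - F s - t * F' s"
      unfolding R_def F_def F'_def
      by (subst cint_diff[OF bmeas_diff[OF i1 i2] bmeas_cmult[OF i3]], subst cint_diff[OF i1 i2], subst cint_cmult) simp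
    moreover have "\<bar>R x\<bar> \<le> C' * (norm z)\<^sup>2 * t\<^sup>2" for x
    proof -
      have "\<bar>mol \<rho> A ((x + s *\<^sub>R z) + t *\<^sub>R z) - mol \<rho> A (x + s *\<^sub>R z) - molD G A (x + s *\<^sub>R z) \<bullet> (t *\<^sub>R z)\<bar> \<le> C' * (norm (t *\<^sub>R z))\<^sup>2"
        by (rule C11D[OF C' t])
      moreover have "C' \<ge> 0" using C' by (simp add: C11_def)
      ultimately show ?thesis unfolding R_def
        by (auto simp: indicator_def algebra_simps power_mult_distrib)
    qed
    then have "cint (\<lambda>x. \<bar>R x\<bar>) \<le> C' * (norm z)\<^sup>2 * t\<^sup>2"
      using cint_mono[OF bmeas_abs[OF Rb] bmeas_const[of "C' * (norm z)\<^sup>2 * t\<^sup>2"]] by (simp add: cint_const)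
    ultimately show ?thesis using cint_abs[OF Rb] by simp
  qed
  have der: "(F has_real_derivative F' s) (at s)" for s
    unfolding DERIV_def
  proof (rule LIM_zero_cancel, rule Lim_null_comparison)
    show "\<forall>\<^sub>F t in at 0. norm ((F (s + t) - F s) / t - F' s) \<le> C' * (norm z)\<^sup>2 * \<bar>t\<bar>"
      unfolding eventually_at
    proof (intro exI[of _ "1 / norm z"] conjI ballI impI)
      fix t :: real assume t: "t \<noteq> 0 \<and> dist t 0 < 1 / norm z"
      then have "norm (t *\<^sub>R z) \<le> 1" using False by (simp add: field_simps)
      from tay[OF this, of s] have "\<bar>F (s + t) - F s - t * F' s\<bar> / \<bar>t\<bar> \<le> C' * (norm z)\<^sup>2 * t\<^sup>2 / \<bar>t\<bar>" by (rule divide_right_mono) simp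
      also have "\<dots> = C' * (norm z)\<^sup>2 * \<bar>t\<bar>" using t by (simp add: power2_eq_square abs_if)
      finally show "norm ((F (s + t) - F s) / t - F' s) \<le> C' * (norm z)\<^sup>2 * \<bar>t\<bar>"
        using t by (simp add: abs_divide[symmetric] diff_divide_distrib)
    qed (use False in auto)
    have "((\<lambda>t. C' * (norm z)\<^sup>2 * \<bar>t\<bar>) \<longlongrightarrow> C' * (norm z)\<^sup>2 * \<bar>0\<bar>) (at 0)" by (intro tendsto_intros)
    then show "((\<lambda>t. C' * (norm z)\<^sup>2 * \<bar>t\<bar>) \<longlongrightarrow> 0) (at 0)" by simp
  qed
  have low: "- (norm z * p) \<le> F' s" for s
  proof -
    define u where "u = (1 / norm z) *\<^sub>R z"
    have nu: "norm u = 1" using False by (simp add: u_def)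
    \<comment> \<open>The mollified indicator lies in [0, 1] and \<open>u\<close> is a unit vector,
      so the field is admissible; its divergence is minus the derivative of the mollified indicator
      in the direction \<open>u\<close>.\<close>
    define \<phi> where "\<phi> = (\<lambda>x. (- mol \<rho> A (x + s *\<^sub>R z)) *\<^sub>R u)"
    define D where "D = (\<lambda>x h. (- (molD G A (x + s *\<^sub>R z) \<bullet> h)) *\<^sub>R u)"
    have "(\<phi> has_derivative D y) (at y)" for y
    proof -
      have 1: "((\<lambda>x. x + s *\<^sub>R z) has_derivative (\<lambda>h. h)) (at y)" by (auto intro!: derivative_eq_intros)
      have "((\<lambda>x. mol \<rho> A (x + s *\<^sub>R z)) has_derivative (\<lambda>h. molD G A (y + s *\<^sub>R z) \<bullet> h)) (at y)"
        by (rule has_derivative_compose[OF 1 C11_has_derivative[OF C']])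
      then show ?thesis unfolding \<phi>_def D_def by (intro has_derivative_scaleR_left has_derivative_minus)
    qed
    moreover have "continuous_on UNIV (\<lambda>y. D y b)" for b
      unfolding D_def by (intro continuous_intros continuous_on_compose2[OF C11_grad_continuous[OF C']]) auto
    ultimately have C1: "C1_field \<phi> D" by (simp add: C1_field_def)
    have dv: "divergence \<phi> x = - (molD G A (x + s *\<^sub>R z) \<bullet> u)" for x
    proof -
      have "divergence \<phi> x = (\<Sum>b\<in>Basis. - ((molD G A (x + s *\<^sub>R z) \<bullet> b) * (u \<bullet> b)))"
        by (simp add: C1_field_divergence[OF C1] D_def)
      then show ?thesis by (simp add: sum_negf euclidean_inner[symmetric])
    qed
    have "ereal (cint (\<lambda>x. indicator A x * divergence \<phi> x)) \<le> torus_perimeter A"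
    proof (rule perimeter_ge[OF A(1) _ _ C1])
      show "Zperiodic \<phi>" using Zperiodic_shift[OF per] by (simp add: \<phi>_def Zperiodic_def)
      show "norm (\<phi> y) \<le> 1" for y using b1 nu by (simp add: \<phi>_def)
    qed
    from order_trans[OF this p] have "cint (\<lambda>x. indicator A x * divergence \<phi> x) \<le> p" by simp
    moreover have "cint (\<lambda>x. indicator A x * divergence \<phi> x) = cint (\<lambda>x. (- (1 / norm z)) * (indicator A x * (molD G A (x + s *\<^sub>R z) \<bullet> z)))"
      by (rule arg_cong[where f = cint]) (simp add: dv u_def fun_eq_iff)
    ultimately have "- (1 / norm z) * F' s \<le> p" unfolding F'_def cint_cmult by simp
    then show ?thesis using False by (simp add: field_simps)
  qed
  obtain c where "F 1 - F 0 = (1 - 0) * F' c" using MVT2[of 0 1 F F'] der by auto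
  then have "F 0 - norm z * p \<le> F 1" using low[of c] by simp
  then show ?thesis by (simp add: F_def)
qed simp

text \<open>The translation estimate is averaged over z in a cube of side r, where |z| <= r N.
  Exchanging the integrals bounds the total overlap by \<theta>^2, since for each x in
  \<open>A\<close> the inner integral is at most the measure of \<open>A\<close> in the
  torus.\<close>

lemma isoperimetric_small:
  fixes A :: "'a::euclidean_space set" and p \<theta> r :: real
  assumes A: "A \<in> sets borel" "Zperiodic_set A" and p: "torus_perimeter A \<le> ereal p"
    and \<theta>: "\<theta> = measure lborel (A \<inter> cell)" and r: "0 < r" "r \<le> 1"
  shows "(\<theta> - r * DIM('a) * p) * r ^ DIM('a) \<le> \<theta>\<^sup>2"
proof -
  have main: "(\<theta> - e - r * DIM('a) * p) * r ^ DIM('a) \<le> \<theta>\<^sup>2" if e: "e > 0" for e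
  proof (cases "\<theta> - e - r * DIM('a) * p \<le> 0")
    case True
    then have "(\<theta> - e - r * DIM('a) * p) * r ^ DIM('a) \<le> 0" using r by (intro mult_nonpos_nonneg) auto
    then show ?thesis using zero_le_power2[of \<theta>] by linarith
  next
    case False
    define c where "c = \<theta> - e - r * DIM('a) * p"
    have c: "c > 0" using False by (simp add: c_def)
    obtain d where d: "d > 0" "\<And>w. norm w < d \<Longrightarrow> measure lborel (A \<inter> cell) - e \<le> measure lborel {x\<in>cell \<inter> A. x + w \<in> A}"
      using translation_overlap[OF A(1) e] by blast
    obtain \<rho> :: "'a \<Rightarrow> real" and G C where M: "mollifier d \<rho> G C" using mollifier_exists[OF d(1)] by blast
    have p0: "p \<ge> 0" using order_trans[OF perimeter_nonneg[OF A(1)] p] by simp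
    define Q where "Q = cbox 0 (r *\<^sub>R (One::'a))"
    have Qb [measurable]: "Q \<in> sets borel" by (simp add: Q_def)
    have Qc: "Q \<subseteq> cell" unfolding Q_def cell_def using r by (force simp: mem_box)
    have mb: "bmeas (mol \<rho> A)" by (rule mol_bmeas[OF M A(1)])
    have mm [measurable]: "mol \<rho> A \<in> borel_measurable borel" by (rule bmeas_measurable[OF mb])
    have Ab [measurable]: "A \<in> sets borel" by (rule A)
    have ib: "bmeas (indicator A)" by (rule bmeas_indicator[OF A(1)])
    have rng: "0 \<le> mol \<rho> A x" for x using mol_range[OF M A(1)] by blast
    have low: "c \<le> cint (\<lambda>x. indicator A x * mol \<rho> A (x + z))" if z: "z \<in> Q" for z
    proof -
      have "norm z \<le> (\<Sum>b\<in>Basis. \<bar>z \<bullet> b\<bar>)" by (rule norm_le_l1)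
      also have "\<dots> \<le> (\<Sum>b\<in>(Basis::'a set). r)" using z by (intro sum_mono) (auto simp: Q_def mem_box)
      finally have "norm z * p \<le> r * DIM('a) * p" using p0 by (intro mult_right_mono) (auto simp: mult.commute)
      then show ?thesis using perimeter_translation[OF M A p, of z] cint_mol_diff(2)[OF M A d(2)]
        unfolding c_def \<theta> by linarith
    qed
    define F :: "'a \<times> 'a \<Rightarrow> ennreal" where
      "F = (\<lambda>(z,x). indicator Q z * (ennreal (mol \<rho> A (x + z)) * (indicator A x * indicator cell x)))"
    have Fm: "F \<in> borel_measurable (lborel \<Otimes>\<^sub>M lborel)"
    proof -
      have "(\<lambda>y. mol \<rho> A ((\<lambda>(z, x). x + z) y)) \<in> borel_measurable (lborel \<Otimes>\<^sub>M lborel)"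
        by (rule measurable_compose[OF _ mm]) simp
      then have "(\<lambda>y. indicator Q (fst y) * (ennreal (mol \<rho> A ((\<lambda>(z, x). x + z) y)) * (indicator A (snd y) * indicator cell (snd y)))) \<in> borel_measurable (lborel \<Otimes>\<^sub>M lborel)"
        by measurable
      then show ?thesis by (simp add: F_def case_prod_unfold)
    qed
    have vol: "emeasure lborel Q = ennreal (r ^ DIM('a))"
      unfolding Q_def using r by (subst emeasure_lborel_cbox) (auto simp: inner_diff_left)
    have "ennreal (c * r ^ DIM('a)) = (\<integral>\<^sup>+z. ennreal c * indicator Q z \<partial>lborel)"
      using c r by (subst nn_integral_cmult_indicator) (auto simp: vol ennreal_mult)
    also have "\<dots> \<le> (\<integral>\<^sup>+z. (\<integral>\<^sup>+x. F (z,x) \<partial>lborel) \<partial>lborel)"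
    proof (rule nn_integral_mono)
      fix z :: 'a
      have i: "bmeas (\<lambda>x. indicator A x * mol \<rho> A (x + z))" by (rule bmeas_mult[OF ib bmeas_shift[OF mb]])
      have "(\<integral>\<^sup>+x. F (z,x) \<partial>lborel) = indicator Q z * (\<integral>\<^sup>+x. ennreal (mol \<rho> A (x + z)) * (indicator A x * indicator cell x) \<partial>lborel)"
        unfolding F_def prod.case by (rule nn_integral_cmult) measurable
      also have "(\<integral>\<^sup>+x. ennreal (mol \<rho> A (x + z)) * (indicator A x * indicator cell x) \<partial>lborel) = (\<integral>\<^sup>+x\<in>cell. ennreal (indicator A x * mol \<rho> A (x + z)) \<partial>lborel)"
        by (intro nn_integral_cong) (auto simp: indicator_def)
      also have "\<dots> = ennreal (cint (\<lambda>x. indicator A x * mol \<rho> A (x + z)))"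
        by (rule cint_nn[OF i, symmetric]) (use rng in auto)
      finally show "ennreal c * indicator Q z \<le> (\<integral>\<^sup>+x. F (z,x) \<partial>lborel)"
        using low[of z] by (auto simp: indicator_def ennreal_leI)
    qed
    also have "\<dots> = (\<integral>\<^sup>+x. (\<integral>\<^sup>+z. F (z,x) \<partial>lborel) \<partial>lborel)" by (rule lborel_pair.Fubini[OF Fm, symmetric])
    also have "\<dots> \<le> (\<integral>\<^sup>+x. ennreal \<theta> * indicator (A \<inter> cell) x \<partial>lborel)"
    proof (rule nn_integral_mono)
      fix x :: 'a
      have "(\<integral>\<^sup>+z. F (z,x) \<partial>lborel) = (\<integral>\<^sup>+z. (ennreal (mol \<rho> A (z + x)) * indicator Q z) * indicator (A \<inter> cell) x \<partial>lborel)"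
        by (intro nn_integral_cong) (auto simp: F_def indicator_def add.commute)
      also have "\<dots> = (\<integral>\<^sup>+z. ennreal (mol \<rho> A (z + x)) * indicator Q z \<partial>lborel) * indicator (A \<inter> cell) x"
        by (rule nn_integral_multc) measurable
      also have "(\<integral>\<^sup>+z. ennreal (mol \<rho> A (z + x)) * indicator Q z \<partial>lborel) \<le> (\<integral>\<^sup>+z\<in>cell. ennreal (mol \<rho> A (z + x)) \<partial>lborel)"
        using Qc by (intro nn_integral_mono) (auto simp: indicator_def)
      also have "\<dots> = (\<integral>\<^sup>+z\<in>cell. ennreal (mol \<rho> A z) \<partial>lborel)"
        by (rule nn_integral_cell_shift[where g = "\<lambda>z. ennreal (mol \<rho> A z)"]) (use mol_periodic[OF M A] in \<open>auto simp: Zperiodic_def\<close>)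
      also have "\<dots> = ennreal \<theta>" using cint_nn[OF mb rng] cint_mol[OF M A] \<theta> by simp
      finally show "(\<integral>\<^sup>+z. F (z,x) \<partial>lborel) \<le> ennreal \<theta> * indicator (A \<inter> cell) x"
        by (auto simp: mult_right_mono)
    qed
    also have "\<dots> = ennreal \<theta> * emeasure lborel (A \<inter> cell)" by (rule nn_integral_cmult_indicator) simp
    also have "emeasure lborel (A \<inter> cell) = ennreal \<theta>" unfolding \<theta>
      by (rule emeasure_eq_ennreal_measure)
         (use emeasure_mono[of "A \<inter> cell" cell lborel] in \<open>auto simp: emeasure_cell top_unique\<close>)
    also have "ennreal \<theta> * ennreal \<theta> = ennreal (\<theta>\<^sup>2)" by (simp add: \<theta> ennreal_mult power2_eq_square)
    finally show ?thesis by (simp add: c_def)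
  qed
  have "(\<theta> - r * DIM('a) * p) * r ^ DIM('a) \<le> \<theta>\<^sup>2 + e" if e: "e > 0" for e
  proof -
    have "(\<theta> - r * DIM('a) * p) * r ^ DIM('a) = (\<theta> - e - r * DIM('a) * p) * r ^ DIM('a) + e * r ^ DIM('a)" by (simp add: algebra_simps)
    moreover have "e * r ^ DIM('a) \<le> e * 1" using e r by (intro mult_left_mono) (auto simp: power_le_one)
    ultimately show ?thesis using main[OF e] by simp
  qed
  then show ?thesis by (rule field_le_epsilon)
qed

text \<open>The side is chosen with r^N = 2 \<theta>, admissible because \<theta> \<le> 1/2. The
  right-hand side then takes up only half of \<theta>, and the other half is at most r N p with r
  \<le> 2 \<theta>^(1/N); hence the constant 4N.\<close>

lemma isoperimetric_half:
  fixes A :: "'a::euclidean_space set" and p :: real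
  assumes A: "A \<in> sets borel" "Zperiodic_set A" and p: "torus_perimeter A \<le> ereal p"
    and half: "measure lborel (A \<inter> cell) \<le> 1 / 2"
  shows "measure lborel (A \<inter> cell) powr (1 - 1 / DIM('a)) \<le> 4 * DIM('a) * p"
proof (cases "measure lborel (A \<inter> cell) = 0")
  case True
  have "p \<ge> 0" using order_trans[OF perimeter_nonneg[OF A(1)] p] by simp
  then show ?thesis using True by simp
next
  case False
  define \<theta> where "\<theta> = measure lborel (A \<inter> cell)"
  define N where "N = real DIM('a)"
  have N: "N \<ge> 1" unfolding N_def using DIM_positive[where 'a='a] by (simp add: Suc_leI)
  have \<theta>: "\<theta> > 0" "\<theta> \<le> 1/2" using False half unfolding \<theta>_def by (auto simp: less_le)
  define r where "r = (2 * \<theta>) powr (1 / N)"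
  have r: "r > 0" "r \<le> 1" using \<theta> N by (auto simp: r_def powr_le1)
  have rN: "r ^ DIM('a) = 2 * \<theta>"
    unfolding r_def using \<theta> N by (simp add: powr_realpow[symmetric] powr_powr N_def)
  have "(\<theta> - r * N * p) * (2 * \<theta>) \<le> \<theta>\<^sup>2"
    using isoperimetric_small[OF A p \<theta>_def r] by (simp add: rN N_def)
  then have "\<theta> * (2 * (\<theta> - r * N * p)) \<le> \<theta> * \<theta>" by (simp add: power2_eq_square mult_ac)
  then have "2 * (\<theta> - r * N * p) \<le> \<theta>" using \<theta> by (simp add: mult_le_cancel_left)
  then have 1: "\<theta> \<le> 2 * N * p * r" by (simp add: algebra_simps)
  have "r = 2 powr (1 / N) * \<theta> powr (1 / N)" unfolding r_def using \<theta> by (simp add: powr_mult)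
  moreover have "2 powr (1 / N) \<le> 2 powr (1::real)" using N by (intro powr_mono) auto
  ultimately have "r \<le> 2 * \<theta> powr (1 / N)" by (simp add: mult_right_mono)
  moreover have "p \<ge> 0"
  proof (rule ccontr)
    assume "\<not> p \<ge> 0"
    then have "2 * N * p * r \<le> 0" using N r by (simp add: mult_nonneg_nonpos mult_nonpos_nonneg)
    then show False using 1 \<theta> by simp
  qed
  ultimately have "2 * N * p * r \<le> 2 * N * p * (2 * \<theta> powr (1 / N))" using N by (intro mult_left_mono) auto
  then have 2: "\<theta> \<le> 4 * N * p * \<theta> powr (1 / N)" using 1 by simp
  have "\<theta> powr (1 - 1 / N) = \<theta> / \<theta> powr (1 / N)" using \<theta> by (simp add: powr_diff)
  also have "\<dots> \<le> 4 * N * p" using 2 \<theta> by (simp add: divide_le_eq)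
  finally show ?thesis by (simp add: \<theta>_def N_def)
qed

text \<open>A Borel part of full measure is replaced by the union of its lattice translates: still
  Borel because the lattice is countable, and still inside the set by periodicity.\<close>

lemma lebesgue_periodic_borel:
  fixes \<Theta> :: "'a::euclidean_space set"
  assumes "\<Theta> \<in> sets lebesgue" "Zperiodic_set \<Theta>"
  obtains A where "A \<in> sets borel" "Zperiodic_set A" "A \<subseteq> \<Theta>" "negligible (\<Theta> - A)"
proof -
  obtain B N where B: "B \<in> sets borel" "negligible N" "B \<union> N = \<Theta>"
    using sets_lebesgue_almost_borel[OF assms(1)] by blast
  define A where "A = (\<Union>k\<in>Zlat. (\<lambda>x. x + k) -` B)"
  have Bk: "(\<lambda>x. x + k) -` B \<in> sets borel" for k
    using measurable_sets[of "\<lambda>x. x + k" borel borel B] B(1) by simp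
  have z: "(0::'a) \<in> Zlat" by (simp add: Zlat_def)
  show thesis
  proof (rule that)
    show "A \<in> sets borel" unfolding A_def using Bk countable_Zlat by (intro sets.countable_UN') auto
    show "Zperiodic_set A" unfolding Zperiodic_set_def
    proof (intro allI ballI)
      fix x k :: 'a assume k: "k \<in> Zlat"
      show "x + k \<in> A \<longleftrightarrow> x \<in> A"
      proof
        assume "x + k \<in> A"
        then obtain l where "l \<in> Zlat" "x + k + l \<in> B" by (auto simp: A_def)
        then show "x \<in> A" unfolding A_def using Zlat_add[OF k] by (intro UN_I[of "k + l"]) (auto simp: add.assoc)
      next
        assume "x \<in> A"
        then obtain l where "l \<in> Zlat" "x + l \<in> B" by (auto simp: A_def)
        then show "x + k \<in> A" unfolding A_def using Zlat_add[OF Zlat_minus[OF k]]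
          by (intro UN_I[of "- k + l"]) (auto simp: add.assoc)
      qed
    qed
    show "A \<subseteq> \<Theta>"
    proof
      fix x assume "x \<in> A"
      then obtain l where "l \<in> Zlat" "x + l \<in> B" by (auto simp: A_def)
      then have "x + l \<in> \<Theta>" using B(3) by blast
      then show "x \<in> \<Theta>" using assms(2) \<open>l \<in> Zlat\<close> by (auto simp: Zperiodic_set_def)
    qed
    have "B \<subseteq> A" using z by (force simp: A_def)
    then show "negligible (\<Theta> - A)" using B by (intro negligible_subset[OF B(2)]) auto
  qed
qed

lemma torus_perimeter_negligible:
  assumes "A \<subseteq> \<Theta>" "negligible (\<Theta> - A)"
  shows "torus_perimeter \<Theta> = torus_perimeter A"
proof -
  have "integral (\<Theta> \<inter> cell) f = integral (A \<inter> cell) f" for f :: "'a \<Rightarrow> real"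
    by (rule integral_spike_set; rule negligible_subset[OF assms(2)]) (use assms(1) in auto)
  then show ?thesis by (simp add: torus_perimeter_def)
qed

lemma measure_cell_Compl:
  assumes [measurable]: "A \<in> sets borel"
  shows "measure lborel (- A \<inter> cell) = 1 - measure lborel (A \<inter> (cell :: 'a::euclidean_space set))"
proof -
  have "measure lborel (cell - A \<inter> cell) = measure lborel (cell :: 'a set) - measure lborel (A \<inter> cell)"
    by (rule measure_Diff) (auto simp: emeasure_cell)
  moreover have "cell - A \<inter> cell = - A \<inter> cell" by auto
  moreover have "measure lborel (cell :: 'a set) = 1" by (simp add: measure_def emeasure_cell)
  ultimately show ?thesis by simp
qed

lemma Zperiodic_set_Compl: "Zperiodic_set A \<Longrightarrow> Zperiodic_set (- A)"
  by (auto simp: Zperiodic_set_def)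

text \<open>It shows that the set in the definition of \<open>iso_const\<close> is nonempty; the
  value of \<open>Inf\<close> on an empty set of reals would carry no information.\<close>

lemma isoperimetric_rough:
  fixes \<Theta> :: "'a::euclidean_space set"
  assumes "Zperiodic_set \<Theta>" "\<Theta> \<in> sets lebesgue"
  shows "ereal ((min (measure lebesgue (\<Theta> \<inter> cell)) (measure lebesgue (cell - \<Theta>))) powr (1 - 1 / real DIM('a)))
     \<le> ereal (4 * DIM('a)) * torus_perimeter \<Theta>"
proof -
  obtain A where A: "A \<in> sets borel" "Zperiodic_set A" "A \<subseteq> \<Theta>" "negligible (\<Theta> - A)"
    using lebesgue_periodic_borel[OF assms(2,1)] by blast
  note per = torus_perimeter_negligible[OF A(3,4)]
  define \<theta> where "\<theta> = measure lborel (A \<inter> cell)"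
  have lm: "A \<inter> cell \<in> lmeasurable" "cell - A \<in> lmeasurable"
    using A(1) emeasure_mono[of "A \<inter> cell" cell lborel] emeasure_mono[of "cell - A" cell lborel]
    by (auto simp: fmeasurable_def emeasure_cell intro: le_less_trans)
  have "measure lebesgue (\<Theta> \<inter> cell) = measure lebesgue (A \<inter> cell)"
    by (rule measure_negligible_symdiff[OF lm(1)]) (rule negligible_subset[OF A(4)], use A(3) in auto)
  then have m1: "measure lebesgue (\<Theta> \<inter> cell) = \<theta>" using A(1) by (simp add: \<theta>_def measure_completion)
  have "measure lebesgue (cell - \<Theta>) = measure lebesgue (cell - A)"
    by (rule measure_negligible_symdiff[OF lm(2)]) (rule negligible_subset[OF A(4)], use A(3) in auto)
  moreover have "cell - A = - A \<inter> cell" by auto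
  ultimately have m2: "measure lebesgue (cell - \<Theta>) = 1 - \<theta>"
    using A(1) measure_cell_Compl[OF A(1)] by (simp add: \<theta>_def measure_completion)
  show ?thesis
  proof (cases "torus_perimeter A")
    case (real p)
    have "min \<theta> (1 - \<theta>) powr (1 - 1 / real DIM('a)) \<le> 4 * DIM('a) * p"
    proof (cases "\<theta> \<le> 1/2")
      case True
      then show ?thesis using isoperimetric_half[OF A(1,2), of p] real by (simp add: \<theta>_def min_absorb1)
    next
      case False
      have c: "- A \<in> sets borel" using A(1) by auto
      have "torus_perimeter (- A) \<le> ereal p" using perimeter_Compl[OF A(1)] real by simp
      from isoperimetric_half[OF c Zperiodic_set_Compl[OF A(2)] this] False
      show ?thesis unfolding measure_cell_Compl[OF A(1)] by (simp add: \<theta>_def min_absorb2)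
    qed
    then show ?thesis unfolding m1 m2 per real by simp
  next
    case PInf
    have "0 < DIM('a)" by simp
    then show ?thesis unfolding per PInf by simp
  next
    case MInf
    then show ?thesis using perimeter_nonneg[OF A(1)] by simp
  qed
qed

text \<open>For a vanishing isoperimetric constant any positive value works, and the hypothesis on the divergence reads
  $1/0 = 0$.\<close>

definition iso_K :: "'a::euclidean_space itself \<Rightarrow> real" where
  "iso_K t = (if iso_const t = 0 then 1 else 1 / iso_const t)"

text \<open>In dimension 1 the exponent is 0. As \<open>0 powr 0 = 0\<close>, the profile is then 1
  inside (0, 1) and 0 at both ends, as it should be for the circle.\<close>

definition iso_profile :: "'a::euclidean_space itself \<Rightarrow> real \<Rightarrow> real" where
  "iso_profile t a = min a (1 - a) powr (1 - 1 / real DIM('a))"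

text \<open>For positive finite perimeter the inequality can be divided by p and passed to the
  infimum. For p = 0 any single admissible constant already gives a profile of at most 0.\<close>

lemma iso_const_attained:
  fixes A :: "'a::euclidean_space set"
  shows "0 \<le> iso_const TYPE('a)"
    and "A \<in> sets borel \<Longrightarrow> Zperiodic_set A \<Longrightarrow> torus_perimeter A \<le> ereal p \<Longrightarrow>
      iso_profile TYPE('a) (measure lborel (A \<inter> cell)) \<le> iso_const TYPE('a) * p"
proof -
  define S where "S = {C::real. C \<ge> 0 \<and>
     (\<forall>\<Theta>::'a set. Zperiodic_set \<Theta> \<and> \<Theta> \<in> sets lebesgue \<longrightarrow>
        ereal ((min (measure lebesgue (\<Theta> \<inter> cell)) (measure lebesgue (cell - \<Theta>)))
                  powr (1 - 1 / real DIM('a)))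
        \<le> ereal C * torus_perimeter \<Theta>)}"
  have iS: "iso_const TYPE('a) = Inf S" by (simp add: iso_const_def S_def)
  have ne: "4 * real DIM('a) \<in> S" using isoperimetric_rough unfolding S_def by auto
  show "0 \<le> iso_const TYPE('a)" unfolding iS
  proof (rule cInf_greatest)
    show "S \<noteq> {}" using ne by blast
    show "0 \<le> C" if "C \<in> S" for C using that by (simp add: S_def)
  qed
  assume A: "A \<in> sets borel" "Zperiodic_set A" "torus_perimeter A \<le> ereal p"
  define m where "m = iso_profile TYPE('a) (measure lborel (A \<inter> cell))"
  have p0: "p \<ge> 0" using order_trans[OF perimeter_nonneg[OF A(1)] A(3)] by simp
  have *: "m \<le> C * p" if C: "C \<in> S" for C
  proof -
    have "cell - A = - A \<inter> cell" by auto
    then have "ereal m \<le> ereal C * torus_perimeter A"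
      using C A(1,2) measure_cell_Compl[OF A(1)] unfolding S_def m_def iso_profile_def
      by (auto simp: measure_completion dest!: spec[of _ A])
    also have "\<dots> \<le> ereal C * ereal p" using C A(3) by (intro ereal_mult_left_mono) (auto simp: S_def)
    finally show ?thesis by simp
  qed
  show "m \<le> iso_const TYPE('a) * p"
  proof (cases "p = 0")
    case True
    then show ?thesis using *[OF ne] by simp
  next
    case False
    then have p: "p > 0" using p0 by simp
    have "m / p \<le> Inf S"
    proof (rule cInf_greatest)
      show "S \<noteq> {}" using ne by blast
      show "m / p \<le> C" if "C \<in> S" for C using *[OF that] p by (simp add: divide_le_eq)
    qed
    then show ?thesis using p by (simp add: iS divide_le_eq)
  qed
qed

lemma iso_K_pos: "iso_K TYPE('a::euclidean_space) > 0"
  using iso_const_attained(1)[where 'a='a] by (simp add: iso_K_def)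

text \<open>Stated as a strict lower bound, so that \<open>perimeter_less\<close> can extract a test
  field from it; sets of infinite perimeter are covered as well.\<close>

lemma iso_K_perimeter:
  fixes A :: "'a::euclidean_space set"
  assumes "A \<in> sets borel" "Zperiodic_set A" "c < iso_K TYPE('a) * iso_profile TYPE('a) (measure lborel (A \<inter> cell))"
  shows "ereal c < torus_perimeter A"
proof (rule ccontr)
  assume "\<not> ?thesis"
  then have p: "torus_perimeter A \<le> ereal c" by simp
  have c0: "c \<ge> 0" using order_trans[OF perimeter_nonneg[OF assms(1)] p] by simp
  define c0i where "c0i = iso_const TYPE('a)"
  define m where "m = iso_profile TYPE('a) (measure lborel (A \<inter> cell))"
  have m: "m \<le> c0i * c" using iso_const_attained(2)[OF assms(1,2) p] by (simp add: c0i_def m_def)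
  have c0i: "c0i \<ge> 0" unfolding c0i_def by (rule iso_const_attained(1))
  have "iso_K TYPE('a) * m \<le> c"
  proof (cases "c0i = 0")
    case True
    then show ?thesis using m c0 by (simp add: iso_K_def c0i_def[symmetric])
  next
    case False
    then show ?thesis using m c0i by (simp add: iso_K_def c0i_def[symmetric] divide_le_eq mult.commute)
  qed
  then show False using assms(3) by (simp add: m_def)
qed

text \<open>\<open>divergence\<close> uses \<open>deriv\<close>, whose value is arbitrary where the
  derivative fails to exist. It is exchanged, almost everywhere, for a sum of bounded Borel
  functions.\<close>

lemma Lipschitz_divergence_AE:
  fixes V :: "'a::euclidean_space \<Rightarrow> 'a"
  assumes lip: "\<And>x y. norm (V x - V y) \<le> L * norm (x - y)" and L: "L \<ge> 0"
  obtains w where "\<And>b. b \<in> Basis \<Longrightarrow> bmeas (w b)"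
    "\<And>b. b \<in> Basis \<Longrightarrow> AE x in lborel. ((\<lambda>h. V (x + h *\<^sub>R b) \<bullet> b) has_real_derivative w b x) (at 0)"
    "AE x in lborel. divergence V x = (\<Sum>b\<in>Basis. w b x)"
proof -
  define q where "q = (\<lambda>b n x. (V (x + (1 / real (Suc n)) *\<^sub>R b) \<bullet> b - V x \<bullet> b) / (1 / real (Suc n)))"
  \<comment> \<open>\<open>lim\<close> is unspecified where the quotients diverge; truncation at the
    Lipschitz constant keeps the function bounded there and changes nothing where the derivative
    exists.\<close>
  define w where "w = (\<lambda>b x. max (- L) (min L (lim (\<lambda>n. q b n x))))"
  have Vc: "continuous_on UNIV V"
    using lip L by (intro lipschitz_on_continuous_on[of L] lipschitz_onI) (auto simp: dist_norm)
  have qm: "q b n \<in> borel_measurable borel" for b n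
    unfolding q_def by (intro borel_measurable_continuous_onI continuous_intros continuous_on_compose2[OF Vc] Vc) auto
  have 1: "bmeas (w b)" if "b \<in> Basis" for b
  proof (rule bmeasI[of _ L])
    have "(\<lambda>x. lim (\<lambda>n. q b n x)) \<in> borel_measurable borel" by (rule borel_measurable_lim_metric) (rule qm)
    then show "w b \<in> borel_measurable borel" unfolding w_def by measurable
  qed (use L in \<open>auto simp: w_def\<close>)
  have 2: "AE x in lborel. ((\<lambda>h. V (x + h *\<^sub>R b) \<bullet> b) has_real_derivative w b x) (at 0)" if b: "b \<in> Basis" for b
  proof -
    have l: "\<bar>V x \<bullet> b - V y \<bullet> b\<bar> \<le> L * norm (x - y)" for x y
      using lip[of x y] Basis_le_norm[OF b, of "V x - V y"] by (simp add: inner_diff_left)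
    have "AE x in lborel. \<exists>D. ((\<lambda>h. V (x + h *\<^sub>R b) \<bullet> b) has_real_derivative D) (at 0)"
      by (rule Lipschitz_AE_directional_derivative[where f = "\<lambda>x. V x \<bullet> b", OF l])
    then show ?thesis
    proof eventually_elim
      case (elim x)
      then obtain D where D: "((\<lambda>h. V (x + h *\<^sub>R b) \<bullet> b) has_real_derivative D) (at 0)" by blast
      have D1: "((\<lambda>h. (V (x + h *\<^sub>R b) \<bullet> b - V x \<bullet> b) / h) \<longlongrightarrow> D) (at 0)" using D by (simp add: DERIV_def)
      have "filterlim (\<lambda>n. 1 / real (Suc n)) (at 0) sequentially"
        using LIMSEQ_Suc[OF lim_1_over_n] by (simp add: filterlim_at)
      from filterlim_compose[OF D1 this] have lim: "(\<lambda>n. q b n x) \<longlonglongrightarrow> D" by (simp add: q_def)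
      have qb: "\<bar>q b n x\<bar> \<le> L" for n
      proof -
        have "\<bar>V (x + (1 / real (Suc n)) *\<^sub>R b) \<bullet> b - V x \<bullet> b\<bar> \<le> L * (1 / real (Suc n))"
          using l[of "x + (1 / real (Suc n)) *\<^sub>R b" x] b by simp
        then show ?thesis unfolding q_def by (simp add: abs_divide divide_le_eq abs_mult del: of_nat_Suc)
            (simp add: field_simps)
      qed
      have "\<bar>D\<bar> \<le> L" by (rule LIMSEQ_le_const2[OF tendsto_rabs[OF lim]]) (use qb in auto)
      then have "w b x = D" unfolding w_def limI[OF lim] by (simp add: abs_le_iff)
      then show ?case using D by simp
    qed
  qed
  have "AE x in lborel. \<forall>b\<in>Basis. ((\<lambda>h. V (x + h *\<^sub>R b) \<bullet> b) has_real_derivative w b x) (at 0)"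
    using 2 by (subst AE_finite_all) auto
  then have 3: "AE x in lborel. divergence V x = (\<Sum>b\<in>Basis. w b x)"
  proof eventually_elim
    case (elim x)
    then show ?case unfolding divergence_def by (intro sum.cong refl DERIV_imp_deriv) auto
  qed
  show thesis using that 1 2 3 by blast
qed

section \<open>Hoelder's inequality and the divergence deficit\<close>

lemma cint_zero_iff:
  assumes "bmeas f" "\<And>x. 0 \<le> f x"
  shows "cint f = 0 \<longleftrightarrow> (AE x in lborel. x \<in> cell \<longrightarrow> f x = 0)"
proof -
  have "cint f = 0 \<longleftrightarrow> ennreal (cint f) = 0" using cint_nonneg[OF assms] by auto
  also have "\<dots> \<longleftrightarrow> (AE x in lborel. ennreal (f x) * indicator cell x = 0)"
    unfolding cint_nn[OF assms] by (rule nn_integral_0_iff_AE) (use bmeas_measurable[OF assms(1)] in measurable)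
  also have "\<dots> \<longleftrightarrow> (AE x in lborel. x \<in> cell \<longrightarrow> f x = 0)"
    using assms(2) by (intro AE_cong) (auto simp: indicator_def order_antisym)
  finally show ?thesis .
qed

lemma bmeas_power: "bmeas f \<Longrightarrow> bmeas (\<lambda>x. f x ^ n)"
  by (induction n) (auto intro: bmeas_const bmeas_mult)

lemma cint_power_zero_iff:
  assumes "bmeas f" "\<And>x. 0 \<le> f x" "n > 0"
  shows "cint (\<lambda>x. f x ^ n) = 0 \<longleftrightarrow> cint f = 0"
  using cint_zero_iff[OF assms(1,2)] cint_zero_iff[OF bmeas_power[OF assms(1)], of n] assms(2,3) by simp

lemma bmeas_max0: "bmeas f \<Longrightarrow> bmeas (\<lambda>x. max 0 (f x))"
proof -
  assume f: "bmeas f"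
  then obtain C where C: "\<And>x. \<bar>f x\<bar> \<le> C" by (auto simp: bmeas_def)
  show ?thesis
  proof (rule bmeasI[of _ C])
    show "(\<lambda>x. max 0 (f x)) \<in> borel_measurable borel" using bmeas_measurable[OF f] by simp
    show "\<bar>max 0 (f x)\<bar> \<le> C" for x using C[of x] by linarith
  qed
qed

text \<open>Hoelder's inequality against an indicator, from the scalar bound y \<le> y^N / N + 1 -
  1/N. That bound is Bernoulli's inequality and includes the case N = 1.\<close>

lemma cint_Hoelder_indicator:
  fixes f :: "'a::euclidean_space \<Rightarrow> real" and N :: nat
  assumes f: "bmeas f" "\<And>x. 0 \<le> f x" and A: "A \<in> sets borel" and \<beta>: "\<beta> > 0" "cint (\<lambda>x. f x ^ N) \<le> \<beta> ^ N" and N: "N \<ge> 1"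
  shows "cint (\<lambda>x. indicator A x * f x) \<le> \<beta> * measure lborel (A \<inter> cell) powr (1 - 1 / real N)"
proof -
  define a where "a = measure lborel (A \<inter> cell)"
  have ca: "cint (indicator A) = a" using cint_indicator[OF A] by (simp add: a_def)
  have ib: "bmeas (indicator A)" by (rule bmeas_indicator[OF A])
  have a0: "a \<ge> 0" by (simp add: a_def)
  obtain B where B: "\<And>x. \<bar>f x\<bar> \<le> B" using f(1) by (auto simp: bmeas_def)
  show ?thesis
  proof (cases "a = 0")
    case True
    have "cint (\<lambda>x. indicator A x * f x) \<le> cint (\<lambda>x. B * indicator A x)"
      by (rule cint_mono[OF bmeas_mult[OF ib f(1)] bmeas_cmult[OF ib]])
         (use B in \<open>auto simp: indicator_def abs_le_iff\<close>)
    then show ?thesis using True by (simp add: cint_cmult ca a_def)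
  next
    case False
    then have ap: "a > 0" using a0 by simp
    \<comment> \<open>The scale balances the two terms of the scalar inequality:
      \<open>\<mu> ^ N * a = \<beta> ^ N\<close>, and together they give
      \<open>\<mu> * a\<close>.\<close>
    define \<mu> where "\<mu> = \<beta> / a powr (1 / N)"
    have \<mu>: "\<mu> > 0" using \<beta>(1) ap by (simp add: \<mu>_def)
    have \<mu>N: "\<mu> ^ N * a = \<beta> ^ N"
    proof -
      have "(a powr (1 / N)) ^ N = a" using ap N by (simp add: powr_realpow[symmetric] powr_powr)
      then show ?thesis using ap by (simp add: \<mu>_def power_divide)
    qed
    have yng: "f x \<le> \<mu> * ((f x / \<mu>) ^ N / N + (1 - 1 / N))" for x
    proof -
      define y where "y = f x / \<mu>"
      have y: "y \<ge> 0" using f(2) \<mu> by (simp add: y_def)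
      have "1 + real N * (y - 1) \<le> (1 + (y - 1)) ^ N" by (rule Bernoulli_inequality) (use y in simp)
      then have "(1 + real N * (y - 1)) / N \<le> y ^ N / N" by (intro divide_right_mono) auto
      moreover have "(1 + real N * (y - 1)) / N = 1 / N + (y - 1)" using N by (simp add: add_divide_distrib)
      ultimately have "y \<le> y ^ N / N + (1 - 1 / N)" by simp
      then have "\<mu> * y \<le> \<mu> * (y ^ N / N + (1 - 1 / N))" using \<mu> by (intro mult_left_mono) auto
      then show ?thesis using \<mu> by (simp add: y_def)
    qed
    have N1: "1 - 1 / real N \<ge> 0" using N by simp
    define c where "c = \<mu> / (\<mu> ^ N * N)"
    have c: "c \<ge> 0" using \<mu> by (simp add: c_def)
    have pw: "indicator A x * f x \<le> c * f x ^ N + (\<mu> * (1 - 1 / N)) * indicator A x" for x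
    proof (cases "x \<in> A")
      case True
      have "\<mu> * ((f x / \<mu>) ^ N / N + (1 - 1 / N)) = c * f x ^ N + \<mu> * (1 - 1 / N)"
        by (simp add: c_def power_divide algebra_simps)
      then show ?thesis using yng[of x] True by simp
    next
      case False
      then show ?thesis using c f(2)[of x] by simp
    qed
    have "cint (\<lambda>x. indicator A x * f x) \<le> cint (\<lambda>x. c * f x ^ N + (\<mu> * (1 - 1 / N)) * indicator A x)"
      by (rule cint_mono[OF bmeas_mult[OF ib f(1)] bmeas_add[OF bmeas_cmult[OF bmeas_power[OF f(1)]] bmeas_cmult[OF ib]] pw])
    also have "\<dots> = c * cint (\<lambda>x. f x ^ N) + \<mu> * (1 - 1 / N) * a"
      by (subst cint_add[OF bmeas_cmult[OF bmeas_power[OF f(1)]] bmeas_cmult[OF ib]]) (simp add: cint_cmult ca)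
    also have "\<dots> \<le> c * (\<mu> ^ N * a) + \<mu> * (1 - 1 / N) * a"
      using \<beta>(2) c \<mu>N by (intro add_right_mono mult_left_mono) auto
    also have "c * (\<mu> ^ N * a) = \<mu> * a / N" using \<mu> by (simp add: c_def)
    also have "\<mu> * a / N + \<mu> * (1 - 1 / N) * a = \<mu> * a" by (simp add: algebra_simps)
    also have "\<mu> * a = \<beta> * a powr (1 - 1 / N)" using ap by (simp add: \<mu>_def powr_diff)
    finally show ?thesis by (simp add: a_def)
  qed
qed

text \<open>A set of measure at most 1/2 is estimated with the negative part of \<open>d\<close>.
  For a larger set one passes to the complement, where the integral of \<open>d\<close> changes sign
  and the positive part takes over; this matches the two branches of the profile.\<close>

lemma divergence_deficit:
  fixes d :: "'a::euclidean_space \<Rightarrow> real"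
  assumes d: "bmeas d" "cint d = 0" and K: "K > 0" "cint (\<lambda>x. \<bar>d x\<bar> ^ DIM('a)) \<le> K ^ DIM('a)"
  obtains \<beta> where "\<beta> < K" "\<And>A. A \<in> sets borel \<Longrightarrow>
    - (\<beta> * iso_profile TYPE('a) (measure lborel (A \<inter> cell))) \<le> cint (\<lambda>x. indicator A x * d x)"
proof -
  define N where "N = DIM('a)"
  have N: "N \<ge> 1" "N > 0" unfolding N_def using DIM_positive[where 'a='a] by (simp_all add: Suc_leI)
  define p where "p = (\<lambda>x. max 0 (d x))"
  define n where "n = (\<lambda>x. max 0 (- d x))"
  have md: "bmeas (\<lambda>x. - d x)" using bmeas_cmult[OF d(1), of "-1"] by simp
  have pb: "bmeas p" "\<And>x. p x \<ge> 0" and nb: "bmeas n" "\<And>x. n x \<ge> 0"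
    using bmeas_max0[OF d(1)] bmeas_max0[OF md] by (auto simp: p_def n_def)
  define I where "I = cint (\<lambda>x. p x ^ N)"
  define J where "J = cint (\<lambda>x. n x ^ N)"
  have I0: "I \<ge> 0" "J \<ge> 0" unfolding I_def J_def by (intro cint_nonneg bmeas_power pb nb zero_le_power)+
  have "(\<lambda>x. \<bar>d x\<bar> ^ N) = (\<lambda>x. p x ^ N + n x ^ N)" using N(2) by (auto simp: p_def n_def fun_eq_iff max_def power_0_left)
  then have IJ: "I + J \<le> K ^ N" using K(2) cint_add[OF bmeas_power[OF pb(1)] bmeas_power[OF nb(1)], of N N]
    by (simp add: I_def J_def N_def)
  have "d = (\<lambda>x. p x - n x)" by (auto simp: p_def n_def)
  then have eq: "cint p = cint n" using d(2) cint_diff[OF pb(1) nb(1)] by simp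
  have z: "I = 0 \<longleftrightarrow> J = 0" unfolding I_def J_def
    using cint_power_zero_iff[OF pb N(2)] cint_power_zero_iff[OF nb N(2)] eq by simp
  have KN: "K ^ N > 0" using K(1) by simp
  have lt: "I < K ^ N" "J < K ^ N" using IJ I0 z KN by linarith+
  define \<beta>0 where "\<beta>0 = root N (max I J)"
  have \<beta>0: "\<beta>0 \<ge> 0" "\<beta>0 < K" "\<beta>0 ^ N = max I J"
  proof -
    show "\<beta>0 \<ge> 0" using I0 N by (simp add: \<beta>0_def)
    have "root N (max I J) < root N (K ^ N)" using lt N by (intro real_root_less_mono) auto
    then show "\<beta>0 < K" using K(1) N by (simp add: \<beta>0_def real_root_power_cancel)
    show "\<beta>0 ^ N = max I J" unfolding \<beta>0_def using I0 N by (intro real_root_pow_pos2) auto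
  qed
  \<comment> \<open>The midpoint, not \<open>\<beta>0\<close> itself: \<open>\<beta>0\<close> is 0
    when \<open>d\<close> vanishes almost everywhere, and the Hoelder bound asks for a positive
    constant.\<close>
  define \<beta> where "\<beta> = (\<beta>0 + K) / 2"
  have \<beta>: "\<beta> > 0" "\<beta> < K" "\<beta>0 \<le> \<beta>" using \<beta>0 K by (auto simp: \<beta>_def)
  have "max I J \<le> \<beta> ^ N" using power_mono[OF \<beta>(3) \<beta>0(1), of N] \<beta>0(3) by simp
  then have IJb: "I \<le> \<beta> ^ N" "J \<le> \<beta> ^ N" by auto
  show thesis
  proof (rule that[OF \<beta>(2)])
    fix A :: "'a set" assume A: "A \<in> sets borel"
    have ib: "bmeas (indicator A)" by (rule bmeas_indicator[OF A])
    define a where "a = measure lborel (A \<inter> cell)"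
    show "- (\<beta> * iso_profile TYPE('a) (measure lborel (A \<inter> cell))) \<le> cint (\<lambda>x. indicator A x * d x)"
    proof (cases "a \<le> 1 / 2")
      case True
      have "cint (\<lambda>x. indicator A x * n x) \<le> \<beta> * a powr (1 - 1 / real N)"
        unfolding a_def by (rule cint_Hoelder_indicator[OF nb A \<beta>(1) IJb(2)[unfolded J_def] N(1)])
      moreover have "cint (\<lambda>x. (-1) * (indicator A x * n x)) \<le> cint (\<lambda>x. indicator A x * d x)"
        by (rule cint_mono[OF bmeas_cmult[OF bmeas_mult[OF ib nb(1)]] bmeas_mult[OF ib d(1)]])
           (auto simp: indicator_def n_def)
      moreover have "iso_profile TYPE('a) a = a powr (1 - 1 / real N)" using True by (simp add: iso_profile_def N_def min_absorb1)
      ultimately show ?thesis unfolding cint_cmult by (simp add: a_def)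
    next
      case False
      have A': "- A \<in> sets borel" using A by auto
      have ib': "bmeas (indicator (- A))" by (rule bmeas_indicator[OF A'])
      have m: "measure lborel (- A \<inter> cell) = 1 - a" using measure_cell_Compl[OF A] by (simp add: a_def)
      have "cint (\<lambda>x. indicator (- A) x * p x) \<le> \<beta> * (1 - a) powr (1 - 1 / real N)"
        using cint_Hoelder_indicator[OF pb A' \<beta>(1) IJb(1)[unfolded I_def] N(1)] by (simp add: m)
      moreover have "cint (\<lambda>x. indicator (- A) x * d x) \<le> cint (\<lambda>x. indicator (- A) x * p x)"
        by (rule cint_mono[OF bmeas_mult[OF ib' d(1)] bmeas_mult[OF ib' pb(1)]])
           (auto simp: indicator_def p_def)
      moreover have "cint (\<lambda>x. indicator (- A) x * d x) = - cint (\<lambda>x. indicator A x * d x)"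
      proof -
        have "(\<lambda>x. indicator (- A) x * d x) = (\<lambda>x. d x - indicator A x * d x)" by (auto simp: indicator_def)
        then show ?thesis using cint_diff[OF d(1) bmeas_mult[OF ib d(1)]] d(2) by simp
      qed
      moreover have "iso_profile TYPE('a) a = (1 - a) powr (1 - 1 / real N)" using False by (simp add: iso_profile_def N_def min_absorb2)
      ultimately show ?thesis by (simp add: a_def)
    qed
  qed
qed

section \<open>Growth of sublevel sets and oscillation of subsolutions\<close>

text \<open>\<open>\<Theta>\<close> may be discontinuous, but it jumps only upwards. At the last
  time where y \<le> \<Theta>, a strict inequality persists by continuity of y, and at a contact the
  strictly faster growth of \<Theta> takes over. Hence the rate is requested at contact times
  only.\<close>

lemma barrier_below:
  fixes \<Theta> y :: "real \<Rightarrow> real"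
  assumes mono: "\<And>s t. s \<le> t \<Longrightarrow> \<Theta> s \<le> \<Theta> t"
    and der: "\<And>t. (y has_real_derivative y' t) (at t)" and start: "y p \<le> \<Theta> p" and pq: "p \<le> q"
    and rate: "\<And>t. p \<le> t \<Longrightarrow> t < q \<Longrightarrow> \<Theta> t = y t \<Longrightarrow> \<exists>\<rho>>y' t. \<exists>h0>0. \<forall>h. 0 < h \<and> h < h0 \<longrightarrow> \<Theta> t + h * \<rho> \<le> \<Theta> (t + h)"
  shows "y q \<le> \<Theta> q"
proof (rule ccontr)
  assume neg: "\<not> ?thesis"
  define X where "X = {t. p \<le> t \<and> t \<le> q \<and> y t \<le> \<Theta> t}"
  have pX: "p \<in> X" using start pq by (simp add: X_def)
  have bX: "bdd_above X" by (rule bdd_aboveI[of _ q]) (simp add: X_def)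
  define S where "S = Sup X"
  have Sp: "p \<le> S" unfolding S_def by (rule cSup_upper[OF pX bX])
  have Sq: "S \<le> q" unfolding S_def by (rule cSup_least) (use pX in \<open>auto simp: X_def\<close>)
  have cy: "isCont y t" for t using der DERIV_isCont by blast
  have yS: "y S \<le> \<Theta> S"
  proof (rule ccontr)
    assume "\<not> y S \<le> \<Theta> S"
    then have "\<Theta> S < y S" by simp
    then obtain d where d: "d > 0" "\<And>t. dist t S < d \<Longrightarrow> dist (y t) (y S) < y S - \<Theta> S"
      using cy[of S] unfolding continuous_at_eps_delta by (metis diff_gt_0_iff_gt)
    obtain t where t: "t \<in> X" "S - d < t" using less_cSupE[of "S - d" X] pX d(1) unfolding S_def by (metis diff_less_eq empty_iff less_add_same_cancel1)
    have tS: "t \<le> S" unfolding S_def by (rule cSup_upper[OF t(1) bX])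
    have "\<bar>y t - y S\<bar> < y S - \<Theta> S" using d(2)[of t] t tS by (simp add: dist_real_def)
    moreover have "y t \<le> \<Theta> t" "\<Theta> t \<le> \<Theta> S" using t(1) mono[OF tS] by (auto simp: X_def)
    ultimately show False by linarith
  qed
  then have Sq': "S < q" using neg Sq by (cases "S = q") auto
  have bad: False if "S < t" "t \<le> q" "y t \<le> \<Theta> t" for t
  proof -
    have "t \<in> X" using that Sp by (simp add: X_def)
    then have "t \<le> S" unfolding S_def by (rule cSup_upper[OF _ bX])
    then show False using that(1) by simp
  qed
  show False
  proof (cases "\<Theta> S = y S")
    case False
    then have lt: "y S < \<Theta> S" using yS by simp
    then obtain d where d: "d > 0" "\<And>t. dist t S < d \<Longrightarrow> dist (y t) (y S) < \<Theta> S - y S"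
      using cy[of S] unfolding continuous_at_eps_delta by (metis diff_gt_0_iff_gt)
    obtain h where h: "0 < h" "h < d" "h < q - S" using field_lbound_gt_zero[of d "q - S"] d(1) Sq' by auto
    have "\<bar>y (S + h) - y S\<bar> < \<Theta> S - y S" using d(2)[of "S + h"] h by (simp add: dist_real_def)
    moreover have "\<Theta> S \<le> \<Theta> (S + h)" using h by (intro mono) simp
    ultimately have "y (S + h) \<le> \<Theta> (S + h)" by linarith
    then show False using bad[of "S + h"] h by simp
  next
    case True
    obtain \<rho> h0 where \<rho>: "\<rho> > y' S" "h0 > 0" "\<And>h. 0 < h \<Longrightarrow> h < h0 \<Longrightarrow> \<Theta> S + h * \<rho> \<le> \<Theta> (S + h)"
      using rate[OF Sp Sq' True] by blast
    have "((\<lambda>t. \<rho> * t - y t) has_real_derivative \<rho> * 1 - y' S) (at S)" by (intro DERIV_diff DERIV_cmult DERIV_ident der)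
    moreover have "0 < \<rho> * 1 - y' S" using \<rho>(1) by simp
    ultimately obtain d where d: "d > 0" "\<And>h. 0 < h \<Longrightarrow> h < d \<Longrightarrow> \<rho> * S - y S < \<rho> * (S + h) - y (S + h)"
      using DERIV_pos_inc_right by blast
    obtain h where h: "0 < h" "h < d" "h < h0" "h < q - S"
      using field_lbound_gt_zero[of "min d h0" "q - S"] d(1) \<rho>(2) Sq' by auto
    have "y (S + h) < y S + h * \<rho>" using d(2)[OF h(1,2)] by (simp add: algebra_simps)
    also have "\<dots> \<le> \<Theta> (S + h)" using \<rho>(3)[OF h(1,3)] True by simp
    finally show False using bad[of "S + h"] h by simp
  qed
qed

text \<open>The ball may lie across the boundary of the cell or outside it; a shift moves its centre
  to the centre of the cell without changing the torus integral.\<close>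

lemma periodic_open_positive_measure:
  fixes A :: "'a::euclidean_space set"
  assumes A [measurable]: "A \<in> sets borel" and per: "Zperiodic_set A" and ball: "r > 0" "ball y r \<subseteq> A"
  shows "0 < measure lborel (A \<inter> cell)"
proof (rule ccontr)
  assume "\<not> ?thesis"
  then have "measure lborel (A \<inter> cell) = 0" using measure_nonneg[of lborel "A \<inter> cell"] by linarith
  then have z: "cint (indicator A) = 0" using cint_indicator[OF A] by simp
  have ib: "bmeas (indicator A :: 'a \<Rightarrow> real)" by (rule bmeas_indicator[OF A])
  define c where "c = (1/2) *\<^sub>R (One :: 'a)"
  have "Zperiodic (indicator A :: 'a \<Rightarrow> real)" using per by (auto simp: Zperiodic_def Zperiodic_set_def indicator_def)
  from cint_shift[OF ib this, of "y - c"] have z2: "cint (\<lambda>x. indicator A (x + (y - c))) = 0" using z by simp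
  define s where "s = min r (1/2)"
  have s: "s > 0" "s \<le> r" "s \<le> 1/2" using ball by (auto simp: s_def)
  have sub: "ball c s \<subseteq> cell"
  proof
    fix x assume x: "x \<in> ball c s"
    show "x \<in> cell" unfolding cell_def mem_box
    proof
      fix b :: 'a assume b: "b \<in> Basis"
      have "\<bar>(x - c) \<bullet> b\<bar> < 1/2" using Basis_le_norm[OF b, of "x - c"] x s(3) by (simp add: dist_norm norm_minus_commute)
      moreover have "c \<bullet> b = 1/2" using b by (simp add: c_def)
      ultimately have "0 \<le> x \<bullet> b" "x \<bullet> b \<le> 1" unfolding inner_diff_left by linarith+
      then show "0 \<bullet> b \<le> x \<bullet> b \<and> x \<bullet> b \<le> One \<bullet> b" using b by simp
    qed
  qed
  have sA: "indicator (ball c s) x \<le> (indicator A (x + (y - c)) :: real)" for x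
  proof (cases "x \<in> ball c s")
    case True
    then have "x + (y - c) \<in> ball y r" using s(2) by (simp add: dist_norm norm_minus_commute algebra_simps)
    then have "x + (y - c) \<in> A" using ball by blast
    then show ?thesis by simp
  qed simp
  have "cint (indicator (ball c s)) \<le> cint (\<lambda>x. indicator A (x + (y - c)))"
    by (rule cint_mono[OF bmeas_indicator bmeas_shift[OF ib] sA]) simp
  then have "measure lborel (ball c s \<inter> cell) \<le> 0" using z2 cint_indicator[of "ball c s"] by simp
  moreover have "ball c s \<inter> cell = ball c s" using sub by blast
  ultimately have "measure lborel (ball c s) = 0" using measure_nonneg[of lborel "ball c s"] by (metis order_antisym)
  moreover have "emeasure lborel (ball c s) = ennreal (measure lborel (ball c s))"
    by (rule emeasure_eq_ennreal_measure) (use emeasure_lborel_ball_finite[of c s] in auto)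
  ultimately have "emeasure lborel (ball c s) = 0" by (metis ennreal_0)
  then have "negligible (ball c s)" by (simp add: negligible_iff_null_sets null_sets_completion_iff null_sets_def)
  then show False using open_not_negligible[of "ball c s"] s by auto
qed

section \<open>Growth of sublevel sets under a Lipschitz drift\<close>

locale drift =
  fixes V :: "'a::euclidean_space \<Rightarrow> 'a" and L M :: real
  assumes V_per: "Zperiodic V"
    and V_lip: "\<And>x y. norm (V x - V y) \<le> L * norm (x - y)" and L: "L \<ge> 0"
    and V_bd: "\<And>x. norm (V x) \<le> M"
begin

lemma M0: "M \<ge> 0" using V_bd[of 0] norm_ge_zero[of "V 0"] by linarith

lemma V_cont: "continuous_on S V"
  using V_lip L by (intro lipschitz_on_continuous_on[of L] lipschitz_onI) (auto simp: dist_norm)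

text \<open>The divergence theorem for V, which is only Lipschitz: its partial derivatives are the
  almost everywhere derivatives \<open>w b\<close>.\<close>

lemma cint_C11_drift:
  assumes g: "C11 g G C" "\<And>x. \<bar>g x\<bar> \<le> B" "Zperiodic g"
    and w: "\<And>b. b \<in> Basis \<Longrightarrow> bmeas (w b)"
    "\<And>b. b \<in> Basis \<Longrightarrow> AE x in lborel. ((\<lambda>h. V (x + h *\<^sub>R b) \<bullet> b) has_real_derivative w b x) (at 0)"
  shows "cint (\<lambda>x. g x * (\<Sum>b\<in>Basis. w b x)) = - cint (\<lambda>x. G x \<bullet> V x)"
proof -
  have gB: "bmeas g" by (rule C11_bmeas[OF g(1,2)])
  have Vb: "\<bar>V x \<bullet> b\<bar> \<le> M" if "b \<in> Basis" for b x using V_bd[of x] Basis_le_norm[OF that, of "V x"] by simp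
  have Vl: "\<bar>V x \<bullet> b - V y \<bullet> b\<bar> \<le> L * norm (x - y)" if "b \<in> Basis" for b x y
    using V_lip[of x y] Basis_le_norm[OF that, of "V x - V y"] by (simp add: inner_diff_left)
  have Vm: "bmeas (\<lambda>x. V x \<bullet> b)" if b: "b \<in> Basis" for b
    by (rule bmeasI[OF _ Vb[OF b]]) (intro borel_measurable_continuous_onI continuous_intros V_cont)
  have "cint (\<lambda>x. g x * (\<Sum>b\<in>Basis. w b x)) = cint (\<lambda>x. \<Sum>b\<in>Basis. g x * w b x)"
    by (simp add: sum_distrib_left)
  also have "\<dots> = (\<Sum>b\<in>Basis. cint (\<lambda>x. g x * w b x))" by (intro cint_sum bmeas_mult gB w(1))
  also have "\<dots> = (\<Sum>b\<in>Basis. - cint (\<lambda>x. (G x \<bullet> b) * (V x \<bullet> b)))"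
  proof (rule sum.cong[OF refl])
    fix b :: 'a assume b: "b \<in> Basis"
    have "Zperiodic (\<lambda>x. V x \<bullet> b)" using V_per by (simp add: Zperiodic_def)
    from cint_by_parts[OF g _ Vl[OF b] Vb[OF b] this bmeas_measurable[OF w(1)[OF b]] w(2)[OF b]] b
    show "cint (\<lambda>x. g x * w b x) = - cint (\<lambda>x. (G x \<bullet> b) * (V x \<bullet> b))" by simp
  qed
  also have "\<dots> = - cint (\<lambda>x. \<Sum>b\<in>Basis. (G x \<bullet> b) * (V x \<bullet> b))"
    by (subst cint_sum, intro bmeas_mult C11_grad_bmeas[OF g(1,2)] Vm) (auto simp: sum_negf)
  also have "\<dots> = - cint (\<lambda>x. G x \<bullet> V x)" by (simp add: euclidean_inner[symmetric])
  finally show ?thesis .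
qed

text \<open>The test field is shortened by the factor 1 - \<tau>, because propagation tolerates only
  velocities with a margin. Constants are fixed in the order \<open>e1\<close>,
  \<open>\<eta>\<close>, \<open>\<tau>\<close>, mollifier, \<open>h0\<close>; only the last may
  depend on the Taylor constant of the mollified indicator.\<close>

lemma sublevel_growth:
  assumes w: "\<And>b. b \<in> Basis \<Longrightarrow> bmeas (w b)"
    "\<And>b. b \<in> Basis \<Longrightarrow> AE x in lborel. ((\<lambda>h. V (x + h *\<^sub>R b) \<bullet> b) has_real_derivative w b x) (at 0)"
    and v: "stat_visc_sub (Ham V) 0 C v" "\<And>x. \<bar>v x\<bar> \<le> Bv" "C \<ge> 0"
    and A [measurable]: "\<And>s. {x. v x < s} \<in> sets borel" and Aper: "\<And>s. Zperiodic_set {x. v x < s}"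
    and \<phi>: "C1_field \<phi> D" "Zperiodic \<phi>" "\<And>x. norm (\<phi> x) \<le> 1" and e: "e > 0"
  shows "\<exists>h0>0. \<forall>h. 0 < h \<and> h < h0 \<longrightarrow>
    measure lborel ({x. v x < s} \<inter> cell) + h * (cint (\<lambda>x. indicator {x. v x < s} x * (\<Sum>b\<in>Basis. w b x))
      + cint (\<lambda>x. indicator {x. v x < s} x * divergence \<phi> x) - e) \<le> measure lborel ({x. v x < s + C * h} \<inter> cell)"
proof -
  define dV where "dV = (\<lambda>x. \<Sum>b\<in>Basis. w b x)"
  define d\<phi> where "d\<phi> = divergence \<phi>"
  have dVb: "bmeas dV" unfolding dV_def by (rule bmeas_sum[OF w(1)])
  have d\<phi>b: "bmeas d\<phi>" unfolding d\<phi>_def by (rule C1_field_div_bmeas[OF \<phi>(1,2)])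
  obtain B1 where B1: "\<And>x. \<bar>dV x\<bar> \<le> B1" using dVb by (auto simp: bmeas_def)
  obtain B2 where B2: "\<And>x. \<bar>d\<phi> x\<bar> \<le> B2" using d\<phi>b by (auto simp: bmeas_def)
  have B0: "B1 \<ge> 0" "B2 \<ge> 0" using B1[of 0] B2[of 0] by auto
  define S where "S = {x. v x < s}"
  have Sb [measurable]: "S \<in> sets borel" unfolding S_def by (rule A)
  have Sper: "Zperiodic_set S" unfolding S_def by (rule Aper)
  have iS: "bmeas (indicator S :: 'a \<Rightarrow> real)" by (rule bmeas_indicator[OF Sb])
  \<comment> \<open>Budget for e: a quarter for replacing the mollified function by the indicator,
    at L^1 distance \<open>2 * e1\<close>; a quarter for the factor 1 - \<tau>; a quarter for the
    Taylor remainder in h.\<close>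
  define e1 where "e1 = e / (8 * (B1 + B2 + 1))"
  have e1: "e1 > 0" "(B1 + B2) * (2 * e1) \<le> e / 4"
  proof -
    show "e1 > 0" using e B0 by (simp add: e1_def)
    then have "(B1 + B2) * (2 * e1) \<le> (B1 + B2 + 1) * (2 * e1)" by (intro mult_right_mono) auto
    also have "\<dots> = e / 4" using B0 by (simp add: e1_def field_simps)
    finally show "(B1 + B2) * (2 * e1) \<le> e / 4" .
  qed
  obtain d where d: "d > 0" "\<And>w. norm w < d \<Longrightarrow> measure lborel (S \<inter> cell) - e1 \<le> measure lborel {x\<in>cell \<inter> S. x + w \<in> S}"
    using translation_overlap[OF Sb e1(1)] by blast
  \<comment> \<open>The first bound puts the mollification within L^1 distance \<open>2 * e1\<close>
    of the indicator. The others give \<tau> < 1 and \<tau> B2 \<le> e/4 for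
    \<open>\<tau> = 4 * (L + 1) * \<eta>\<close>.\<close>
  define \<eta> where "\<eta> = min (d / 2) (min (1 / (8 * (L + 1))) (e / (16 * (L + 1) * (B2 + 1))))"
  have \<eta>: "\<eta> > 0" "\<eta> < d" "4 * (L + 1) * \<eta> < 1" "4 * (L + 1) * \<eta> * B2 \<le> e / 4"
  proof -
    show \<eta>0: "\<eta> > 0" using d(1) L e B0 by (simp add: \<eta>_def)
    have "\<eta> \<le> d / 2" unfolding \<eta>_def by linarith
    then show "\<eta> < d" using d(1) by linarith
    have "\<eta> \<le> 1 / (8 * (L + 1))" unfolding \<eta>_def by linarith
    then have "(L + 1) * \<eta> \<le> (L + 1) * (1 / (8 * (L + 1)))" using L by (intro mult_left_mono) auto
    also have "\<dots> = 1 / 8" using L by (simp add: field_simps)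
    finally show "4 * (L + 1) * \<eta> < 1" unfolding mult.assoc by linarith
    have "\<eta> \<le> e / (16 * (L + 1) * (B2 + 1))" unfolding \<eta>_def by linarith
    then have "4 * (L + 1) * (B2 + 1) * \<eta> \<le> 4 * (L + 1) * (B2 + 1) * (e / (16 * (L + 1) * (B2 + 1)))"
      using L B0 by (intro mult_left_mono) auto
    also have "\<dots> = e / 4"
    proof -
      define a where "a = (L + 1) * (B2 + 1)"
      have a: "a > 0" using L B0 by (simp add: a_def add_nonneg_pos)
      have "4 * (L + 1) * (B2 + 1) = 4 * a" "16 * (L + 1) * (B2 + 1) = 16 * a" by (simp_all only: a_def mult.assoc)
      then show ?thesis using a by simp
    qed
    finally have "4 * (L + 1) * \<eta> * (B2 + 1) \<le> e / 4" by (simp add: mult_ac)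
    moreover have "4 * (L + 1) * \<eta> * B2 \<le> 4 * (L + 1) * \<eta> * (B2 + 1)" using L \<eta>0 by (intro mult_left_mono) auto
    ultimately show "4 * (L + 1) * \<eta> * B2 \<le> e / 4" by linarith
  qed
  define \<tau> where "\<tau> = 4 * (L + 1) * \<eta>"
  have \<tau>: "\<tau> > 0" "\<tau> < 1" "\<tau> * B2 \<le> e / 4" using \<eta> L by (auto simp: \<tau>_def)
  obtain \<rho> :: "'a \<Rightarrow> real" and G CG where Mo: "mollifier \<eta> \<rho> G CG" using mollifier_exists[OF \<eta>(1)] by blast
  define f where "f = mol \<rho> S"
  define Df where "Df = molD G S"
  obtain C' where C': "C11 f Df C'" using mol_C11_mol[OF Mo Sb] unfolding f_def Df_def by blast
  have C'0: "C' \<ge> 0" using C' by (simp add: C11_def)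
  have fr: "0 \<le> f x" "f x \<le> 1" "\<bar>f x\<bar> \<le> 1" for x using mol_range[OF Mo Sb, of x] by (auto simp: f_def)
  have fb: "bmeas f" unfolding f_def by (rule mol_bmeas[OF Mo Sb])
  have fper: "Zperiodic f" unfolding f_def by (rule mol_periodic[OF Mo Sb Sper])
  define W where "W = (\<lambda>x. V x + (1 - \<tau>) *\<^sub>R \<phi> x)"
  have \<phi>c: "continuous_on UNIV \<phi>" using \<phi>(1) unfolding C1_field_def
    by (meson continuous_at_imp_continuous_on has_derivative_continuous)
  have Wc: "continuous_on UNIV W" unfolding W_def by (intro continuous_intros V_cont \<phi>c)
  have n\<phi>: "norm ((1 - \<tau>) *\<^sub>R \<phi> x) \<le> 1 - \<tau>" for x
    using \<phi>(3)[of x] \<tau> by (simp add: mult_left_le)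
  have Wb: "norm (W x) \<le> M + 1" for x
    unfolding W_def using norm_triangle_ineq[of "V x" "(1 - \<tau>) *\<^sub>R \<phi> x"] V_bd[of x] n\<phi>[of x] \<tau> by linarith
  \<comment> \<open>The displacement h |W| has to stay below \<open>\<eta>\<close>, so that the
    drift error is of the order of the mollification radius, and below 1 for the Taylor bound. The
    last entry controls the remainder.\<close>
  define h0 where "h0 = min (min (\<eta> / (M + 1)) (1 / (M + 1))) (e / (4 * (C' * (M + 1)\<^sup>2 + 1)))"
  have h0: "h0 > 0" using \<eta> M0 e C'0 by (simp add: h0_def add_nonneg_pos)
  show ?thesis
  proof (intro exI[of _ h0] conjI allI impI)
    fix h assume "0 < h \<and> h < h0"
    then have h: "h > 0" "h * (M + 1) \<le> \<eta>" "h * (M + 1) \<le> 1" "C' * (M + 1)\<^sup>2 * h \<le> e / 4"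
    proof -
      assume a: "0 < h \<and> h < h0"
      show "h > 0" using a by simp
      have "h \<le> \<eta> / (M + 1)" "h \<le> 1 / (M + 1)" "h \<le> e / (4 * (C' * (M + 1)\<^sup>2 + 1))" using a unfolding h0_def by linarith+
      then show "h * (M + 1) \<le> \<eta>" "h * (M + 1) \<le> 1" using M0 by (simp_all add: le_divide_eq)
      have p: "C' * (M + 1)\<^sup>2 + 1 > 0" using C'0 by (simp add: add_nonneg_pos)
      then have "h * (4 * (C' * (M + 1)\<^sup>2 + 1)) \<le> e" using \<open>h \<le> e / (4 * (C' * (M + 1)\<^sup>2 + 1))\<close> by (simp add: le_divide_eq)
      then show "C' * (M + 1)\<^sup>2 * h \<le> e / 4" using \<open>h > 0\<close> by (simp add: algebra_simps)
    qed
    define S' where "S' = {x. v x < s + C * h}"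
    have S'b [measurable]: "S' \<in> sets borel" unfolding S'_def by (rule A)
    have S'per: "Zperiodic_set S'" unfolding S'_def by (rule Aper)
    \<comment> \<open>Of the shortening \<tau>, one half pays for the change of V between y and
      \<open>y0\<close>; the other half is the margin required by propagation.\<close>
    define \<kappa> where "\<kappa> = \<tau> / 2"
    have LhM: "L * h * (M + 1) \<le> (L + 1) * \<eta>"
    proof -
      have "L * (h * (M + 1)) \<le> (L + 1) * \<eta>" using L h \<eta> M0 by (intro mult_mono) auto
      then show ?thesis by (simp add: mult.assoc)
    qed
    have \<kappa>: "L * h * (M + 1) < \<kappa>" "\<kappa> < 1" "\<kappa> > 0"
    proof -
      have "0 < (L + 1) * \<eta>" using L \<eta>(1) by simp
      moreover have "\<kappa> = 2 * ((L + 1) * \<eta>)" by (simp add: \<kappa>_def \<tau>_def)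
      ultimately show "L * h * (M + 1) < \<kappa>" "\<kappa> > 0" using LhM by linarith+
      show "\<kappa> < 1" using \<tau> by (simp add: \<kappa>_def)
    qed
    have pt: "f (y - h *\<^sub>R W y) \<le> mol \<rho> S' y" for y
      unfolding f_def
    proof (rule mol_mono[OF Mo Sb S'b])
      fix z assume z: "norm z < \<eta>" "y - h *\<^sub>R W y + z \<in> S"
      define y0 where "y0 = y - h *\<^sub>R W y + z"
      have "y + z - y0 - h *\<^sub>R V y0 = h *\<^sub>R (V y - V y0) + h *\<^sub>R ((1 - \<tau>) *\<^sub>R \<phi> y)"
        by (simp add: y0_def W_def algebra_simps)
      then have "norm (y + z - y0 - h *\<^sub>R V y0) \<le> norm (h *\<^sub>R (V y - V y0)) + norm (h *\<^sub>R ((1 - \<tau>) *\<^sub>R \<phi> y))"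
        by (metis norm_triangle_ineq)
      also have "\<dots> = h * norm (V y - V y0) + h * norm ((1 - \<tau>) *\<^sub>R \<phi> y)"
        by (simp only: norm_scaleR abs_of_pos[OF h(1)])
      also have "\<dots> \<le> h * (L * norm (y - y0)) + h * (1 - \<tau>)"
        using V_lip[of y y0] n\<phi>[of y] h by (intro add_mono mult_left_mono) auto
      also have "norm (y - y0) \<le> h * (M + 1) + \<eta>"
      proof -
        have "y - y0 = h *\<^sub>R W y - z" by (simp add: y0_def)
        then have "norm (y - y0) \<le> norm (h *\<^sub>R W y) + norm z" using norm_triangle_ineq4 by metis
        moreover have "norm (h *\<^sub>R W y) \<le> h * (M + 1)" using Wb[of y] h by simp
        ultimately show ?thesis using z(1) by linarith
      qed
      then have "h * (L * norm (y - y0)) \<le> h * (L * (h * (M + 1) + \<eta>))" using L h by (intro mult_left_mono) auto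
      also have "\<dots> \<le> h * (\<tau> / 2)"
      proof -
        have "L * (h * (M + 1) + \<eta>) \<le> (L + 1) * \<eta> + (L + 1) * \<eta>"
          using LhM \<eta>(1) by (simp add: algebra_simps)
        moreover have "\<tau> / 2 = (L + 1) * \<eta> + (L + 1) * \<eta>" by (simp add: \<tau>_def)
        ultimately have "L * (h * (M + 1) + \<eta>) \<le> \<tau> / 2" by linarith
        then show ?thesis by (rule mult_left_mono) (use h in simp)
      qed
      finally have near: "norm (y + z - y0 - h *\<^sub>R V y0) \<le> (1 - \<kappa>) * h" by (simp add: \<kappa>_def algebra_simps)
      have "v (y + z) \<le> v y0 + C * h"
        by (rule sublevel_propagation[OF V_lip L V_bd v(1,2,3) h(1) \<kappa> near])
      moreover have "v y0 < s" using z(2) by (simp add: S_def y0_def)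
      ultimately show "y + z \<in> S'" by (simp add: S'_def)
    qed
    \<comment> \<open>The composition with y - h W(y) is expanded to first order, and integration by
      parts turns the linear term into the divergence of W. This takes the place of a change of
      variables.\<close>
    have low: "f y - h * (Df y \<bullet> W y) - C' * (h * (M + 1))\<^sup>2 \<le> f (y - h *\<^sub>R W y)" for y
    proof -
      have n: "norm (- (h *\<^sub>R W y)) \<le> h * (M + 1)" using Wb[of y] h by simp
      have "\<bar>f (y + - (h *\<^sub>R W y)) - f y - Df y \<bullet> (- (h *\<^sub>R W y))\<bar> \<le> C' * (norm (- (h *\<^sub>R W y)))\<^sup>2"
        by (rule C11D[OF C']) (use n h in linarith)
      also have "\<dots> \<le> C' * (h * (M + 1))\<^sup>2" using n C'0 by (intro mult_left_mono power_mono) auto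
      finally show ?thesis by (simp add: abs_le_iff)
    qed
    have DV: "bmeas (\<lambda>x. Df x \<bullet> V x)" and D\<phi>: "bmeas (\<lambda>x. Df x \<bullet> \<phi> x)"
    proof -
      have nD: "norm (Df x) \<le> 2 * 1 + C'" for x by (rule C11_grad_bound[OF C']) (rule fr(3))
      have cD: "continuous_on UNIV Df" by (rule C11_grad_continuous[OF C'])
      have bnd: "\<bar>Df x \<bullet> u\<bar> \<le> (2 + C') * k" if "norm u \<le> k" for x u k
      proof -
        have "\<bar>Df x \<bullet> u\<bar> \<le> norm (Df x) * norm u" by (rule Cauchy_Schwarz_ineq2)
        also have "\<dots> \<le> (2 + C') * k" using nD[of x] that C'0 by (intro mult_mono) auto
        finally show ?thesis .
      qed
      show "bmeas (\<lambda>x. Df x \<bullet> V x)"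
        by (rule bmeasI[OF _ bnd[OF V_bd]]) (intro borel_measurable_continuous_onI continuous_intros cD V_cont)
      show "bmeas (\<lambda>x. Df x \<bullet> \<phi> x)"
        by (rule bmeasI[OF _ bnd[OF \<phi>(3)]]) (intro borel_measurable_continuous_onI continuous_intros cD \<phi>c)
    qed
    have DWe: "(\<lambda>x. Df x \<bullet> W x) = (\<lambda>x. Df x \<bullet> V x + (1 - \<tau>) * (Df x \<bullet> \<phi> x))"
      by (simp add: W_def inner_add_right fun_eq_iff)
    have DW: "bmeas (\<lambda>x. Df x \<bullet> W x)" unfolding DWe by (intro bmeas_add DV bmeas_cmult D\<phi>)
    have fW: "bmeas (\<lambda>y. f (y - h *\<^sub>R W y))"
    proof (rule bmeasI[of _ 1])
      show "(\<lambda>y. f (y - h *\<^sub>R W y)) \<in> borel_measurable borel"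
        by (intro borel_measurable_continuous_onI continuous_on_compose2[OF C11_continuous[OF C']] continuous_intros Wc) auto
    qed (rule fr)
    have i1: "cint (\<lambda>x. f x * dV x) = - cint (\<lambda>x. Df x \<bullet> V x)"
      unfolding dV_def by (rule cint_C11_drift[OF C' fr(3) fper w])
    have i2: "cint (\<lambda>x. f x * d\<phi> x) = - cint (\<lambda>x. Df x \<bullet> \<phi> x)"
      unfolding d\<phi>_def by (rule cint_C11_divergence[OF C' fr(3) fper \<phi>])
    have lowb: "bmeas (\<lambda>y. f y - h * (Df y \<bullet> W y))" by (intro bmeas_diff fb bmeas_cmult DW)
    have "cint (\<lambda>y. (f y - h * (Df y \<bullet> W y)) - C' * (h * (M + 1))\<^sup>2) \<le> cint (\<lambda>y. f (y - h *\<^sub>R W y))"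
      by (rule cint_mono[OF bmeas_diff[OF lowb bmeas_const] fW low])
    also have "\<dots> \<le> cint (mol \<rho> S')" by (rule cint_mono[OF fW mol_bmeas[OF Mo S'b] pt])
    also have "\<dots> = measure lborel (S' \<inter> cell)" by (rule cint_mol[OF Mo S'b S'per])
    also have "cint (\<lambda>y. (f y - h * (Df y \<bullet> W y)) - C' * (h * (M + 1))\<^sup>2) = measure lborel (S \<inter> cell) - h * cint (\<lambda>x. Df x \<bullet> W x) - C' * (h * (M + 1))\<^sup>2"
      by (subst cint_diff[OF lowb bmeas_const], subst cint_diff[OF fb bmeas_cmult[OF DW]])
         (simp add: cint_const cint_cmult f_def cint_mol[OF Mo Sb Sper])
    also have "cint (\<lambda>x. Df x \<bullet> W x) = - cint (\<lambda>x. f x * dV x) - (1 - \<tau>) * cint (\<lambda>x. f x * d\<phi> x)"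
      unfolding DWe cint_add[OF DV bmeas_cmult[OF D\<phi>]] cint_cmult by (simp add: i1 i2)
    finally have est: "measure lborel (S \<inter> cell) + h * (cint (\<lambda>x. f x * dV x) + (1 - \<tau>) * cint (\<lambda>x. f x * d\<phi> x)) - C' * (h * (M + 1))\<^sup>2 \<le> measure lborel (S' \<inter> cell)"
      by (simp add: algebra_simps)
    have dif: "cint (\<lambda>x. \<bar>f x - indicator S x\<bar>) \<le> 2 * e1"
      unfolding f_def by (rule cint_mol_diff(1)[OF Mo Sb Sper]) (use d(2) \<eta>(2) in auto)
    have cmp: "cint (\<lambda>x. indicator S x * g x) - B * (2 * e1) \<le> cint (\<lambda>x. f x * g x)"
      if g: "bmeas g" "\<And>x. \<bar>g x\<bar> \<le> B" for g B
    proof -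
      have B: "B \<ge> 0" using g(2)[of 0] by simp
      have fi: "bmeas (\<lambda>x. \<bar>f x - indicator S x\<bar>)" by (intro bmeas_abs bmeas_diff fb iS)
      have "cint (\<lambda>x. indicator S x * g x - f x * g x) \<le> cint (\<lambda>x. B * \<bar>f x - indicator S x\<bar>)"
      proof (rule cint_mono[OF bmeas_diff[OF bmeas_mult[OF iS g(1)] bmeas_mult[OF fb g(1)]] bmeas_cmult[OF fi]])
        fix x
        have "indicator S x * g x - f x * g x = (indicator S x - f x) * g x" by (simp add: algebra_simps)
        also have "\<dots> \<le> \<bar>indicator S x - f x\<bar> * \<bar>g x\<bar>" by (metis abs_ge_self abs_mult)
        also have "\<dots> \<le> \<bar>indicator S x - f x\<bar> * B" using g(2)[of x] by (intro mult_left_mono) auto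
        finally show "indicator S x * g x - f x * g x \<le> B * \<bar>f x - indicator S x\<bar>" by (simp add: abs_minus_commute mult.commute)
      qed
      also have "\<dots> \<le> B * (2 * e1)" unfolding cint_cmult using dif B by (intro mult_left_mono)
      finally show ?thesis unfolding cint_diff[OF bmeas_mult[OF iS g(1)] bmeas_mult[OF fb g(1)]] by simp
    qed
    have X: "\<bar>cint (\<lambda>x. f x * d\<phi> x)\<bar> \<le> B2"
    proof -
      have "\<bar>cint (\<lambda>x. f x * d\<phi> x)\<bar> \<le> cint (\<lambda>x. \<bar>f x * d\<phi> x\<bar>)" by (rule cint_abs[OF bmeas_mult[OF fb d\<phi>b]])
      also have "\<dots> \<le> cint (\<lambda>x::'a. B2)"
      proof (rule cint_mono[OF bmeas_abs[OF bmeas_mult[OF fb d\<phi>b]] bmeas_const])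
        fix x
        have "\<bar>f x\<bar> * \<bar>d\<phi> x\<bar> \<le> 1 * B2" using fr(3)[of x] B2[of x] by (intro mult_mono) auto
        then show "\<bar>f x * d\<phi> x\<bar> \<le> B2" by (simp add: abs_mult)
      qed
      finally show ?thesis by (simp add: cint_const)
    qed
    have "\<tau> * cint (\<lambda>x. f x * d\<phi> x) \<le> e / 4"
    proof -
      have "\<tau> * cint (\<lambda>x. f x * d\<phi> x) \<le> \<tau> * B2" using X \<tau> by (intro mult_left_mono) auto
      then show ?thesis using \<tau>(3) by simp
    qed
    moreover have "cint (\<lambda>x. indicator S x * dV x) - B1 * (2 * e1) \<le> cint (\<lambda>x. f x * dV x)" by (rule cmp[OF dVb B1])
    moreover have "cint (\<lambda>x. indicator S x * d\<phi> x) - B2 * (2 * e1) \<le> cint (\<lambda>x. f x * d\<phi> x)" by (rule cmp[OF d\<phi>b B2])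
    ultimately have "cint (\<lambda>x. indicator S x * dV x) + cint (\<lambda>x. indicator S x * d\<phi> x) - e / 2
        \<le> cint (\<lambda>x. f x * dV x) + (1 - \<tau>) * cint (\<lambda>x. f x * d\<phi> x)"
      using e1(2) by (simp add: algebra_simps)
    then have "h * (cint (\<lambda>x. indicator S x * dV x) + cint (\<lambda>x. indicator S x * d\<phi> x) - e / 2)
        \<le> h * (cint (\<lambda>x. f x * dV x) + (1 - \<tau>) * cint (\<lambda>x. f x * d\<phi> x))" using h by (intro mult_left_mono) auto
    moreover have "C' * (h * (M + 1))\<^sup>2 \<le> h * (e / 4)"
    proof -
      have "C' * (h * (M + 1))\<^sup>2 = h * (C' * (M + 1)\<^sup>2 * h)" by (simp add: power_mult_distrib power2_eq_square mult_ac)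
      also have "\<dots> \<le> h * (e / 4)" using h by (intro mult_left_mono) auto
      finally show ?thesis .
    qed
    moreover have "h * (e / 4) + h * (cint (\<lambda>x. indicator S x * dV x) + cint (\<lambda>x. indicator S x * d\<phi> x) - e)
      \<le> h * (cint (\<lambda>x. indicator S x * dV x) + cint (\<lambda>x. indicator S x * d\<phi> x) - e / 2)"
      using h e by (simp add: algebra_simps)
    ultimately have "measure lborel (S \<inter> cell) + h * (cint (\<lambda>x. indicator S x * dV x) + cint (\<lambda>x. indicator S x * d\<phi> x) - e) \<le> measure lborel (S' \<inter> cell)"
      using est by linarith
    then show "measure lborel ({x. v x < s} \<inter> cell) + h * (cint (\<lambda>x. indicator {x. v x < s} x * (\<Sum>b\<in>Basis. w b x))
      + cint (\<lambda>x. indicator {x. v x < s} x * divergence \<phi> x) - e) \<le> measure lborel ({x. v x < s + C * h} \<inter> cell)"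
      by (simp add: S_def S'_def dV_def d\<phi>_def)
  qed (rule h0)
qed

text \<open>The field is chosen with flux within e/2 of the isoperimetric bound; the loss from div V
  is at most \<beta> times the same profile, so the difference of the two constants is the growth
  rate.\<close>

lemma sublevel_growth_rate:
  assumes w: "\<And>b. b \<in> Basis \<Longrightarrow> bmeas (w b)"
    "\<And>b. b \<in> Basis \<Longrightarrow> AE x in lborel. ((\<lambda>h. V (x + h *\<^sub>R b) \<bullet> b) has_real_derivative w b x) (at 0)"
    and \<beta>: "\<And>A. A \<in> sets borel \<Longrightarrow>
      - (\<beta> * iso_profile TYPE('a) (measure lborel (A \<inter> cell))) \<le> cint (\<lambda>x. indicator A x * (\<Sum>b\<in>Basis. w b x))"
    and v: "stat_visc_sub (Ham V) 0 C v" "\<And>x. \<bar>v x\<bar> \<le> Bv" "C \<ge> 0"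
    and A [measurable]: "\<And>s. {x. v x < s} \<in> sets borel" and Aper: "\<And>s. Zperiodic_set {x. v x < s}" and e: "e > 0"
  shows "\<exists>h0>0. \<forall>h. 0 < h \<and> h < h0 \<longrightarrow>
    measure lborel ({x. v x < s} \<inter> cell) + h * ((iso_K TYPE('a) - \<beta>) * iso_profile TYPE('a) (measure lborel ({x. v x < s} \<inter> cell)) - e)
      \<le> measure lborel ({x. v x < s + C * h} \<inter> cell)"
proof -
  define S where "S = {x. v x < s}"
  define m where "m = iso_profile TYPE('a) (measure lborel (S \<inter> cell))"
  have Sb: "S \<in> sets borel" "Zperiodic_set S" unfolding S_def by (rule A Aper)+
  have "ereal (iso_K TYPE('a) * m - e / 2) < torus_perimeter S"
    by (rule iso_K_perimeter[OF Sb]) (use e in \<open>simp add: m_def\<close>)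
  then obtain \<phi> D where \<phi>: "Zperiodic \<phi>" "\<And>y. norm (\<phi> y) \<le> 1" "C1_field \<phi> D"
    "iso_K TYPE('a) * m - e / 2 < cint (\<lambda>x. indicator S x * divergence \<phi> x)"
    using perimeter_less[OF Sb(1)] by blast
  have "0 < e / 2" using e by simp
  from sublevel_growth[OF w v A Aper \<phi>(3,1,2) this, of s]
  obtain h0 where h0: "h0 > 0" "\<And>h. 0 < h \<Longrightarrow> h < h0 \<Longrightarrow>
    measure lborel (S \<inter> cell) + h * (cint (\<lambda>x. indicator S x * (\<Sum>b\<in>Basis. w b x))
      + cint (\<lambda>x. indicator S x * divergence \<phi> x) - e / 2) \<le> measure lborel ({x. v x < s + C * h} \<inter> cell)"
    unfolding S_def by blast
  show ?thesis
  proof (intro exI[of _ h0] conjI allI impI)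
    fix h assume h: "0 < h \<and> h < h0"
    have "- (\<beta> * m) \<le> cint (\<lambda>x. indicator S x * (\<Sum>b\<in>Basis. w b x))" unfolding m_def by (rule \<beta>[OF Sb(1)])
    then have "(iso_K TYPE('a) - \<beta>) * m - e \<le> cint (\<lambda>x. indicator S x * (\<Sum>b\<in>Basis. w b x))
      + cint (\<lambda>x. indicator S x * divergence \<phi> x) - e / 2" using \<phi>(4) by (simp add: algebra_simps)
    then have "h * ((iso_K TYPE('a) - \<beta>) * m - e) \<le> h * (cint (\<lambda>x. indicator S x * (\<Sum>b\<in>Basis. w b x))
      + cint (\<lambda>x. indicator S x * divergence \<phi> x) - e / 2)" using h by (intro mult_left_mono) auto
    then show "measure lborel ({x. v x < s} \<inter> cell) + h * ((iso_K TYPE('a) - \<beta>) * iso_profile TYPE('a) (measure lborel ({x. v x < s} \<inter> cell)) - e)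
      \<le> measure lborel ({x. v x < s + C * h} \<inter> cell)"
      using h0(2)[of h] h unfolding m_def S_def by linarith
  qed (rule h0)
qed

end

text \<open>In the variable x with \<theta> = x^N, or 1 - \<theta> = x^N, the profile is a power of
  x, so solutions of the growth law are N-th powers of affine functions of time.\<close>

lemma iso_profile_power:
  assumes x: "0 < x" "x ^ DIM('a::euclidean_space) \<le> 1 / 2"
  shows "iso_profile TYPE('a) (x ^ DIM('a)) = x ^ (DIM('a) - 1)" "iso_profile TYPE('a) (1 - x ^ DIM('a)) = x ^ (DIM('a) - 1)"
proof -
  have N: "DIM('a) \<ge> 1" using DIM_positive[where 'a='a] by (simp add: Suc_leI)
  have "(x ^ DIM('a)) powr (1 - 1 / real DIM('a)) = x powr (real DIM('a) * (1 - 1 / real DIM('a)))"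
    using x by (simp add: powr_realpow[symmetric] powr_powr)
  also have "real DIM('a) * (1 - 1 / real DIM('a)) = real (DIM('a) - 1)" using N by (simp add: algebra_simps of_nat_diff)
  also have "x powr real (DIM('a) - 1) = x ^ (DIM('a) - 1)" using x(1) by (rule powr_realpow)
  finally have p: "(x ^ DIM('a)) powr (1 - 1 / real DIM('a)) = x ^ (DIM('a) - 1)" .
  have m: "min (x ^ DIM('a)) (1 - x ^ DIM('a)) = x ^ DIM('a)" "min (1 - x ^ DIM('a)) (1 - (1 - x ^ DIM('a))) = x ^ DIM('a)"
    using x(2) by auto
  show "iso_profile TYPE('a) (x ^ DIM('a)) = x ^ (DIM('a) - 1)" "iso_profile TYPE('a) (1 - x ^ DIM('a)) = x ^ (DIM('a) - 1)"
    unfolding iso_profile_def m p by simp_all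
qed

text \<open>Two explicit barriers: \<open>(g * t) ^ N\<close> up to the value 1/2, then one minus
  such a power running down to 0. The first starts from 0, below any positive initial value, which
  makes the total time \<open>2 * q\<close> universal.\<close>

lemma isoperimetric_growth_fills:
  fixes \<Theta> :: "real \<Rightarrow> real" and \<gamma> :: real
  assumes mono: "\<And>s t. s \<le> t \<Longrightarrow> \<Theta> s \<le> \<Theta> t" and \<gamma>: "\<gamma> > 0" and start: "\<Theta> 0 > 0"
    and rate: "\<And>t e. 0 < \<Theta> t \<Longrightarrow> \<Theta> t < 1 \<Longrightarrow> e > 0 \<Longrightarrow> \<exists>h0>0. \<forall>h. 0 < h \<and> h < h0 \<longrightarrow>
      \<Theta> t + h * (\<gamma> * iso_profile TYPE('a::euclidean_space) (\<Theta> t) - e) \<le> \<Theta> (t + h)"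
  shows "1 \<le> \<Theta> (4 * real DIM('a) * (1 / 2) powr (1 / real DIM('a)) / \<gamma>)"
proof -
  define N where "N = DIM('a)"
  have N: "N \<ge> 1" unfolding N_def using DIM_positive[where 'a='a] by (simp add: Suc_leI)
  \<comment> \<open>With this speed the barriers grow at half the guaranteed rate; an error of a
    quarter of the rate still leaves the strict inequality that \<open>barrier_below\<close> asks
    for.\<close>
  define g where "g = \<gamma> / (2 * real N)"
  have g: "g > 0" using \<gamma> N by (simp add: g_def)
  define u where "u = (1 / 2 :: real) powr (1 / real N)"
  have u: "u > 0" "u ^ N = 1 / 2" using N by (simp_all add: u_def powr_realpow[symmetric] powr_powr)
  define q where "q = u / g"
  have q: "q > 0" "g * q = u" using u g by (simp_all add: q_def)
  have uN: "x ^ N \<le> 1/2" if "0 < x" "x \<le> u" for x using power_mono[OF that(2), of N] that u(2) by simp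
  have rt: "\<exists>\<rho>>real N * x ^ (N - 1) * g. \<exists>h0>0. \<forall>h. 0 < h \<and> h < h0 \<longrightarrow> \<Theta> t + h * \<rho> \<le> \<Theta> (t + h)"
    if t: "0 < \<Theta> t" "\<Theta> t < 1" "iso_profile TYPE('a) (\<Theta> t) = x ^ (N - 1)" "x > 0" for t x
  proof -
    define m where "m = x ^ (N - 1)"
    have m: "m > 0" using t(4) by (simp add: m_def)
    have e: "\<gamma> * m / 4 > 0" using \<gamma> m by simp
    have "real N * m * g = \<gamma> * m / 2" using N by (simp add: g_def)
    then have "real N * m * g < \<gamma> * m - \<gamma> * m / 4" using e by linarith
    then show ?thesis using rate[OF t(1,2) e] unfolding t(3) m_def by blast
  qed
  have half: "1 / 2 \<le> \<Theta> q"
  proof -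
    have "(g * q) ^ N \<le> \<Theta> q"
    proof (rule barrier_below[where y = "\<lambda>t. (g * t) ^ N" and y' = "\<lambda>t. real N * (g * t) ^ (N - 1) * g" and p = 0])
      show "((\<lambda>t. (g * t) ^ N) has_real_derivative real N * (g * t) ^ (N - 1) * g) (at t)" for t
        by (rule derivative_eq_intros refl | simp)+
      show "(g * 0) ^ N \<le> \<Theta> 0" using N start by (simp add: power_0_left)
      fix t assume t: "0 \<le> t" "t < q" "\<Theta> t = (g * t) ^ N"
      have \<Theta>t: "0 < \<Theta> t" using mono[OF t(1)] start by simp
      have "t \<noteq> 0" using \<Theta>t t(3) N by (auto simp: power_0_left)
      then have x: "0 < g * t" "g * t \<le> u" using t g q mult_left_mono[of t q g] by auto
      have le: "(g * t) ^ N \<le> 1 / 2" by (rule uN[OF x])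
      show "\<exists>\<rho>>real N * (g * t) ^ (N - 1) * g. \<exists>h0>0. \<forall>h. 0 < h \<and> h < h0 \<longrightarrow> \<Theta> t + h * \<rho> \<le> \<Theta> (t + h)"
        by (rule rt[OF \<Theta>t _ _ x(1)]) (use le t(3) iso_profile_power(1)[where 'a='a, OF x(1)] in \<open>simp_all add: N_def\<close>)
    qed (use mono q in auto)
    then show ?thesis using q u by simp
  qed
  have "1 - (u - g * (2 * q - q)) ^ N \<le> \<Theta> (2 * q)"
  proof (rule barrier_below[where y = "\<lambda>t. 1 - (u - g * (t - q)) ^ N" and y' = "\<lambda>t. real N * (u - g * (t - q)) ^ (N - 1) * g" and p = q])
    show "((\<lambda>t. 1 - (u - g * (t - q)) ^ N) has_real_derivative real N * (u - g * (t - q)) ^ (N - 1) * g) (at t)" for t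
      by (rule derivative_eq_intros refl | simp)+
    show "1 - (u - g * (q - q)) ^ N \<le> \<Theta> q" using half u by simp
    fix t assume t: "q \<le> t" "t < 2 * q" "\<Theta> t = 1 - (u - g * (t - q)) ^ N"
    define x where "x = u - g * (t - q)"
    have "g * (t - q) < g * q" using t g by (intro mult_strict_left_mono) auto
    then have x: "0 < x" "x \<le> u" using q t g by (auto simp: x_def)
    have le: "x ^ N \<le> 1 / 2" by (rule uN[OF x])
    have xp: "x ^ N > 0" using x by simp
    have \<Theta>t: "0 < \<Theta> t" "\<Theta> t < 1" using le xp t(3) by (simp_all add: x_def[symmetric])
    show "\<exists>\<rho>>real N * (u - g * (t - q)) ^ (N - 1) * g. \<exists>h0>0. \<forall>h. 0 < h \<and> h < h0 \<longrightarrow> \<Theta> t + h * \<rho> \<le> \<Theta> (t + h)"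
      unfolding x_def[symmetric]
      by (rule rt[OF \<Theta>t _ x(1)]) (use le t(3) iso_profile_power(2)[where 'a='a, OF x(1)] in \<open>simp add: N_def x_def[symmetric]\<close>)
  qed (use mono q in auto)
  moreover have "u - g * (2 * q - q) = 0" using q by simp
  moreover have "2 * q = 4 * real DIM('a) * (1 / 2) powr (1 / real DIM('a)) / \<gamma>"
    using \<gamma> N by (simp add: q_def u_def g_def N_def field_simps)
  ultimately show ?thesis using N by (simp add: power_0_left)
qed

context drift begin

text \<open>T depends on V alone. The constant C only rescales the levels: along
  \<open>s0 + C * t\<close> the measure of the sublevel sets grows at a rate free of C.\<close>

lemma subsolution_oscillation:
  assumes div_small: "(\<integral>\<^sup>+ x\<in>cell. ennreal (\<bar>divergence V x\<bar> ^ DIM('a)) \<partial>lborel)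
                      \<le> ennreal ((1 / iso_const TYPE('a)) ^ DIM('a))"
  obtains T where "T \<ge> 0" "\<And>C v x y. C > 0 \<Longrightarrow> stat_visc_sub (Ham V) 0 C v \<Longrightarrow> bounded (range v) \<Longrightarrow> Zperiodic v \<Longrightarrow> v x \<le> v y + C * T"
proof -
  obtain w where w: "\<And>b. b \<in> Basis \<Longrightarrow> bmeas (w b)"
    "\<And>b. b \<in> Basis \<Longrightarrow> AE x in lborel. ((\<lambda>h. V (x + h *\<^sub>R b) \<bullet> b) has_real_derivative w b x) (at 0)"
    "AE x in lborel. divergence V x = (\<Sum>b\<in>Basis. w b x)"
    using Lipschitz_divergence_AE[OF V_lip L] by blast
  define d where "d = (\<lambda>x. \<Sum>b\<in>Basis. w b x)"
  have db: "bmeas d" unfolding d_def by (rule bmeas_sum[OF w(1)])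
  have d0: "cint d = 0"
    using cint_C11_drift[OF C11_const[of 1] _ _ w(1,2), of 1] by (simp add: Zperiodic_def cint_const d_def)
  define K where "K = iso_K TYPE('a)"
  have K: "K > 0" unfolding K_def by (rule iso_K_pos)
  have pow: "cint (\<lambda>x. \<bar>d x\<bar> ^ DIM('a)) \<le> K ^ DIM('a)"
  proof -
    have "ennreal (cint (\<lambda>x. \<bar>d x\<bar> ^ DIM('a))) = (\<integral>\<^sup>+ x\<in>cell. ennreal (\<bar>d x\<bar> ^ DIM('a)) \<partial>lborel)"
      by (rule cint_nn[OF bmeas_power[OF bmeas_abs[OF db]]]) simp
    also have "\<dots> = (\<integral>\<^sup>+ x\<in>cell. ennreal (\<bar>divergence V x\<bar> ^ DIM('a)) \<partial>lborel)"
      by (rule nn_integral_cong_AE) (use w(3) in eventually_elim, simp add: d_def)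
    also have "\<dots> \<le> ennreal ((1 / iso_const TYPE('a)) ^ DIM('a))" by (rule div_small)
    also have "\<dots> \<le> ennreal (K ^ DIM('a))"
      using iso_const_attained(1)[where 'a='a] by (intro ennreal_leI power_mono) (auto simp: K_def iso_K_def)
    finally show ?thesis using K by simp
  qed
  obtain \<beta> where \<beta>: "\<beta> < K" "\<And>A. A \<in> sets borel \<Longrightarrow>
    - (\<beta> * iso_profile TYPE('a) (measure lborel (A \<inter> cell))) \<le> cint (\<lambda>x. indicator A x * d x)"
    using divergence_deficit[OF db d0 K pow] by blast
  define T where "T = 4 * real DIM('a) * (1 / 2) powr (1 / real DIM('a)) / (K - \<beta>)"
  have T0: "T \<ge> 0" using \<beta>(1) by (simp add: T_def)
  show thesis
  proof (rule that[OF T0])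
    fix C v x y assume C: "C > 0" and v: "stat_visc_sub (Ham V) 0 C v" "bounded (range v)" "Zperiodic v"
    obtain Bv where Bv: "\<And>x. \<bar>v x\<bar> \<le> Bv" using v(2) by (auto simp: bounded_iff)
    have uv: "usc_on UNIV v" using v(1) by (simp add: stat_visc_sub_def usc_iff_usc_on)
    have op: "open {x. v x < s}" for s
    proof (rule openI)
      fix z assume "z \<in> {x. v x < s}"
      then obtain r where "r > 0" "\<And>y. dist y z < r \<Longrightarrow> v y < s" using usc_onD[OF uv, of z s] by auto
      then show "\<exists>e>0. ball z e \<subseteq> {x. v x < s}" by (intro exI[of _ r]) (auto simp: dist_commute)
    qed
    have A: "{x. v x < s} \<in> sets borel" for s using op by simp
    have Aper: "Zperiodic_set {x. v x < s}" for s using v(3) by (auto simp: Zperiodic_set_def Zperiodic_def)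
    define \<theta> where "\<theta> = (\<lambda>s. measure lborel ({x. v x < s} \<inter> cell))"
    have \<theta>mono: "\<theta> s \<le> \<theta> t" if "s \<le> t" for s t
    proof -
      have "emeasure lborel ({x. v x < t} \<inter> (cell :: 'a set)) \<le> emeasure lborel (cell :: 'a set)" using A by (intro emeasure_mono) auto
      then show ?thesis unfolding \<theta>_def using A that
        by (intro measure_mono_fmeasurable) (auto simp: fmeasurable_def emeasure_cell intro: le_less_trans)
    qed
    have key: "v x \<le> s0 + C * T" if s0: "v y < s0" for s0
    proof -
      define \<Theta> where "\<Theta> = (\<lambda>t. \<theta> (s0 + C * t))"
      have "1 \<le> \<Theta> T" unfolding T_def
      proof (rule isoperimetric_growth_fills)
        show "\<Theta> s \<le> \<Theta> t" if "s \<le> t" for s t unfolding \<Theta>_def using C that by (intro \<theta>mono) simp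
        show "K - \<beta> > 0" using \<beta>(1) by simp
        obtain r where r: "r > 0" "ball y r \<subseteq> {x. v x < s0}" using op[of s0] s0 by (meson mem_Collect_eq openE)
        show "0 < \<Theta> 0" using periodic_open_positive_measure[OF A Aper r] by (simp add: \<Theta>_def \<theta>_def)
        fix t e :: real assume e: "e > 0"
        show "\<exists>h0>0. \<forall>h. 0 < h \<and> h < h0 \<longrightarrow> \<Theta> t + h * ((K - \<beta>) * iso_profile TYPE('a) (\<Theta> t) - e) \<le> \<Theta> (t + h)"
          using sublevel_growth_rate[OF w(1,2) \<beta>(2)[unfolded d_def] v(1) Bv _ A Aper e, of "s0 + C * t"] C
          by (simp add: \<Theta>_def \<theta>_def K_def algebra_simps)
      qed
      define S where "S = {x. v x < s0 + C * T}"
      have full: "measure lborel (- S \<inter> cell) = 0"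
        using \<open>1 \<le> \<Theta> T\<close> measure_cell_Compl[OF A[of "s0 + C * T"]] measure_nonneg[of lborel "- S \<inter> cell"]
        by (simp add: \<Theta>_def \<theta>_def S_def)
      have hit: "\<exists>y0\<in>ball z r. y0 \<in> S" if r: "r > 0" for z r
      proof (rule ccontr)
        assume "\<not> ?thesis"
        then have "ball z r \<subseteq> - S" by auto
        moreover have "- S \<in> sets borel" "Zperiodic_set (- S)" using A Zperiodic_set_Compl[OF Aper] by (auto simp: S_def)
        ultimately show False using periodic_open_positive_measure[of "- S" r z] r full by simp
      qed
      \<comment> \<open>Full measure only makes \<open>S\<close> dense. One further propagation step
        of duration h, with margin 1/2, reaches x itself from a point of \<open>S\<close> near x - h
        V(x).\<close>
      have step: "v x \<le> s0 + C * T + C * h" if h: "0 < h" "L * h * (M + 1) \<le> 1 / 8" for h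
      proof -
        obtain y0 where y0: "y0 \<in> ball (x - h *\<^sub>R V x) (h / 8)" "y0 \<in> S" using hit[of "h / 8" "x - h *\<^sub>R V x"] h by auto
        define \<xi> where "\<xi> = x - h *\<^sub>R V x - y0"
        have \<xi>: "norm \<xi> < h / 8" using y0(1) by (simp add: \<xi>_def dist_norm)
        have Lh: "L * h \<le> 1 / 8" "L * h \<ge> 0" "L * h * M \<le> 1/8"
        proof -
          show "L * h \<ge> 0" using L h by simp
          then have "L * h * M \<ge> 0" using M0 by simp
          then show "L * h \<le> 1 / 8" "L * h * M \<le> 1/8" using h(2) \<open>L * h \<ge> 0\<close> by (simp_all add: distrib_left)
        qed
        have "x - y0 - h *\<^sub>R V y0 = \<xi> + h *\<^sub>R (V x - V y0)" by (simp add: \<xi>_def algebra_simps)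
        then have "norm (x - y0 - h *\<^sub>R V y0) \<le> norm \<xi> + norm (h *\<^sub>R (V x - V y0))" by (metis norm_triangle_ineq)
        also have "norm (h *\<^sub>R (V x - V y0)) \<le> h * (L * norm (x - y0))" using V_lip[of x y0] h by simp
        also have "norm (x - y0) \<le> h * M + h / 8"
        proof -
          have "x - y0 = \<xi> + h *\<^sub>R V x" by (simp add: \<xi>_def)
          then have "norm (x - y0) \<le> norm \<xi> + norm (h *\<^sub>R V x)" by (metis norm_triangle_ineq)
          moreover have "norm (h *\<^sub>R V x) \<le> h * M" using V_bd[of x] h by simp
          ultimately show ?thesis using \<xi> by linarith
        qed
        then have "h * (L * norm (x - y0)) \<le> h * (L * (h * M + h / 8))" using L h by (intro mult_left_mono) auto
        also have "\<dots> = h * (L * h * M + (L * h) / 8)" by (simp add: algebra_simps)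
        also have "\<dots> \<le> h * (1 / 8 + 1 / 8)" using Lh h by (intro mult_left_mono) auto
        finally have near: "norm (x - y0 - h *\<^sub>R V y0) \<le> (1 - 1/2) * h" using \<xi> h(1) by simp
        have "v x \<le> v y0 + C * h"
          by (rule sublevel_propagation[OF V_lip L V_bd v(1) Bv _ h(1) _ _ _ near]) (use C h in auto)
        then show ?thesis using y0(2) by (simp add: S_def)
      qed
      have "v x \<le> s0 + C * T + e" if e: "e > 0" for e
      proof -
        define h where "h = min (e / C) (1 / (8 * (L * (M + 1) + 1)))"
        have LM: "L * (M + 1) + 1 > 0" using L M0 by (simp add: add_nonneg_pos)
        have h: "h > 0" using e C LM by (simp add: h_def)
        have "h \<le> 1 / (8 * (L * (M + 1) + 1))" unfolding h_def by linarith
        then have "h * (8 * (L * (M + 1) + 1)) \<le> 1" using LM by (simp add: le_divide_eq)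
        then have "L * h * (M + 1) \<le> 1 / 8" using h by (simp add: algebra_simps)
        from step[OF h this] have "v x \<le> s0 + C * T + C * h" .
        moreover have "h \<le> e / C" unfolding h_def by linarith
        then have "C * h \<le> e" using C by (simp add: le_divide_eq mult.commute)
        ultimately show ?thesis by linarith
      qed
      then show ?thesis by (rule field_le_epsilon)
    qed
    have "v x - C * T \<le> v y"
    proof (rule dense_ge)
      fix s assume "v y < s"
      then have "v x \<le> s + C * T" by (rule key)
      then show "v x - C * T \<le> s" by linarith
    qed
    then show "v x \<le> v y + C * T" by simp
  qed
qed

end

section \<open>The effective Hamiltonian and its correctors\<close>

context drift begin

lemma Ham_lip_p: "\<bar>Ham V x p - Ham V x q\<bar> \<le> (1 + M) * norm (p - q)"
proof -
  have "Ham V x p - Ham V x q = (norm p - norm q) + (p - q) \<bullet> V x" by (simp add: Ham_def inner_diff_left)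
  moreover have "\<bar>norm p - norm q\<bar> \<le> norm (p - q)" by (rule norm_triangle_ineq3)
  moreover have "\<bar>(p - q) \<bullet> V x\<bar> \<le> norm (p - q) * M"
    using Cauchy_Schwarz_ineq2[of "p - q" "V x"] mult_left_mono[OF V_bd[of x], of "norm (p - q)"] by simp
  ultimately show ?thesis by (simp add: algebra_simps)
qed

lemma Ham_lip_x: "\<bar>Ham V x p - Ham V y p\<bar> \<le> L * norm (x - y) * norm p"
proof -
  have "Ham V x p - Ham V y p = p \<bullet> (V x - V y)" by (simp add: Ham_def inner_diff_right)
  then have "\<bar>Ham V x p - Ham V y p\<bar> \<le> norm p * norm (V x - V y)" using Cauchy_Schwarz_ineq2 by metis
  also have "\<dots> \<le> norm p * (L * norm (x - y))" using V_lip[of x y] by (intro mult_left_mono) auto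
  finally show ?thesis by (simp add: mult_ac)
qed

lemma Ham_0: "Ham V x 0 = 0" by (simp add: Ham_def)

lemma Ham_abs: "\<bar>Ham V x p\<bar> \<le> (1 + M) * norm p" using Ham_lip_p[of x p 0] by (simp add: Ham_0)

section \<open>Levels with bounded periodic subsolutions\<close>

definition levels :: "'a \<Rightarrow> real set" where
  "levels P = {a. \<exists>w. stat_visc_sub (Ham V) P a w \<and> bounded (range w) \<and> Zperiodic w}"

lemma Hbar_levels: "Hbar V P = Inf (levels P)" by (simp add: Hbar_def levels_def)

lemma levels_ne: "(1 + M) * norm P \<in> levels P"
proof -
  have "stat_visc_sub (Ham V) P ((1 + M) * norm P) (\<lambda>x. 0)" unfolding stat_visc_sub_def
  proof (intro conjI allI impI)
    fix \<phi> g x assume "C1_test \<phi> g \<and> loc_max (\<lambda>y::'a. 0 - \<phi> y) x"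
    then have "g x = 0" using C1_test_loc_max_eq_grad[OF _ C1_test_const[of 0], of \<phi> g x] by simp
    then show "Ham V x (g x + P) \<le> (1 + M) * norm P" using Ham_abs[of x P] by simp
  qed (simp add: usc_def)
  then show ?thesis by (auto simp: levels_def Zperiodic_def intro!: exI[of _ "\<lambda>x. 0"])
qed

text \<open>At a global maximum of w, which exists by semicontinuity and periodicity, a constant
  serves as test function. So the infimum defining Hbar is taken over a set bounded below.\<close>

lemma levels_lower:
  assumes "a \<in> levels P" shows "- ((1 + M) * norm P) \<le> a"
proof -
  obtain w where w: "stat_visc_sub (Ham V) P a w" "Zperiodic w" using assms by (auto simp: levels_def)
  have "usc_on UNIV w" using w(1) by (simp add: stat_visc_sub_def usc_iff_usc_on)
  then have "usc_on cell w" by (rule usc_on_subset) simp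
  moreover have "compact (cell :: 'a set)" "cell \<noteq> ({} :: 'a set)"
    using Zperiodic_cell_rep[of "0::'a"] by (auto simp: cell_def)
  ultimately obtain x where x: "\<And>y. y \<in> cell \<Longrightarrow> w y \<le> w x" using usc_on_attains by blast
  have "w y \<le> w x" for y
  proof -
    obtain k where "k \<in> Zlat" "y + k \<in> cell" using Zperiodic_cell_rep[of y] by blast
    then show ?thesis using x[of "y + k"] w(2) by (auto simp: Zperiodic_def)
  qed
  then have "loc_max (\<lambda>y. w y - 0) x" unfolding loc_max_def by (intro exI[of _ 1]) simp
  then have "Ham V x (0 + P) \<le> a" using w(1) C1_test_const[of 0] unfolding stat_visc_sub_def by blast
  then show ?thesis using Ham_abs[of x P] by (simp add: abs_le_iff)
qed

lemma levels_bdd: "bdd_below (levels P)"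
  using levels_lower by (meson bdd_belowI)

lemma Hbar_le: "a \<in> levels P \<Longrightarrow> Hbar V P \<le> a"
  unfolding Hbar_levels by (rule cInf_lower[OF _ levels_bdd])

lemma stat_visc_sub_mono: "stat_visc_sub F P a w \<Longrightarrow> a \<le> b \<Longrightarrow> stat_visc_sub F P b w"
  unfolding stat_visc_sub_def by (meson order_trans)

text \<open>The same function serves for another momentum, at a higher level. This gives the
  Lipschitz bound for Hbar and brings the discounted solution to momentum 0, where the oscillation
  bound is stated.\<close>

lemma stat_visc_sub_change:
  assumes "stat_visc_sub (Ham V) P a w" shows "stat_visc_sub (Ham V) Q (a + (1 + M) * norm (P - Q)) w"
  unfolding stat_visc_sub_def
proof (intro conjI allI impI)
  show "usc w" using assms by (simp add: stat_visc_sub_def)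
  fix \<phi> g x assume "C1_test \<phi> g \<and> loc_max (\<lambda>y. w y - \<phi> y) x"
  then have "Ham V x (g x + P) \<le> a" using assms unfolding stat_visc_sub_def by blast
  moreover have "\<bar>Ham V x (g x + Q) - Ham V x (g x + P)\<bar> \<le> (1 + M) * norm (P - Q)"
    using Ham_lip_p[of x "g x + Q" "g x + P"] by (simp add: norm_minus_commute)
  ultimately show "Ham V x (g x + Q) \<le> a + (1 + M) * norm (P - Q)" by (simp add: abs_le_iff)
qed

lemma Hbar_lip1: "Hbar V Q \<le> Hbar V P + (1 + M) * norm (P - Q)"
proof -
  have "Hbar V Q - (1 + M) * norm (P - Q) \<le> Inf (levels P)"
  proof (rule cInf_greatest)
    show "levels P \<noteq> {}" using levels_ne by blast
    fix a assume "a \<in> levels P"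
    then have "a + (1 + M) * norm (P - Q) \<in> levels Q" using stat_visc_sub_change unfolding levels_def by blast
    then show "Hbar V Q - (1 + M) * norm (P - Q) \<le> a" using Hbar_le by fastforce
  qed
  then show ?thesis by (simp add: Hbar_levels)
qed

lemma Hbar_lip: "\<bar>Hbar V P - Hbar V Q\<bar> \<le> (1 + M) * norm (P - Q)"
  using Hbar_lip1[of P Q] Hbar_lip1[of Q P] by (simp add: norm_minus_commute abs_le_iff)

lemma sub_corrector:
  assumes "\<eta> > 0" shows "\<exists>w W. stat_visc_sub (Ham V) P (Hbar V P + \<eta>) w \<and> (\<forall>x. \<bar>w x\<bar> \<le> W)"
proof -
  have "levels P \<noteq> {}" using levels_ne by blast
  moreover have "Inf (levels P) < Hbar V P + \<eta>" using assms by (simp add: Hbar_levels)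
  ultimately obtain a where a: "a \<in> levels P" "a < Hbar V P + \<eta>" by (meson cInf_lessD)
  then obtain w where w: "stat_visc_sub (Ham V) P a w" "bounded (range w)" by (auto simp: levels_def)
  obtain W where "\<And>x. \<bar>w x\<bar> \<le> W" using w(2) by (auto simp: bounded_iff)
  then show ?thesis using stat_visc_sub_mono[OF w(1), of "Hbar V P + \<eta>"] a by (auto intro!: exI[of _ w])
qed

text \<open>Vanishing discount. The oscillation of the upper envelope is bounded by
  \<open>C1 * T\<close> independently of \<delta>, so \<delta> times it is nearly constant. That
  constant is at most about -Hbar because the envelope is an admissible subsolution, and the lower
  envelope inherits the bound.\<close>

lemma super_corrector:
  assumes div_small: "(\<integral>\<^sup>+ x\<in>cell. ennreal (\<bar>divergence V x\<bar> ^ DIM('a)) \<partial>lborel)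
                      \<le> ennreal ((1 / iso_const TYPE('a)) ^ DIM('a))" and \<eta>: "\<eta> > 0"
  shows "\<exists>w W. stat_visc_super (Ham V) P (Hbar V P - \<eta>) w \<and> (\<forall>x. \<bar>w x\<bar> \<le> W)"
proof -
  obtain T where T: "T \<ge> 0" "\<And>C v x y. C > 0 \<Longrightarrow> stat_visc_sub (Ham V) 0 C v \<Longrightarrow> bounded (range v) \<Longrightarrow> Zperiodic v \<Longrightarrow> v x \<le> v y + C * T"
    using subsolution_oscillation[OF div_small] by blast
  \<comment> \<open>The summand 1 keeps \<open>C1\<close> positive for P = 0, as the oscillation
    bound requires.\<close>
  define C0 where "C0 = (1 + M) * norm P + 1"
  define C1 where "C1 = C0 + (1 + M) * norm P"
  have C0: "C0 > 0" "C1 > 0" using M0 by (auto simp: C0_def C1_def add_nonneg_pos add_pos_nonneg)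
  \<comment> \<open>Two oscillations are lost: one in bounding Hbar by the value of
    \<open>V1\<close> at 0, one in passing from there to \<open>V2 x\<close>.\<close>
  define \<delta> where "\<delta> = \<eta> / (2 * (C1 * T + 1))"
  have C1T: "C1 * T + 1 > 0" using C0 T by (simp add: add_nonneg_pos)
  have \<delta>: "\<delta> > 0" "2 * \<delta> * (C1 * T) \<le> \<eta>"
  proof -
    show "\<delta> > 0" using \<eta> C1T by (simp add: \<delta>_def)
    then have "2 * \<delta> * (C1 * T) \<le> 2 * \<delta> * (C1 * T + 1)" by simp
    also have "\<dots> = \<eta>"
    proof -
      have "2 * (\<eta> / (2 * a)) * a = \<eta>" if "a \<noteq> 0" for a using that by simp
      then show ?thesis using C1T unfolding \<delta>_def by (metis less_irrefl)
    qed
    finally show "2 * \<delta> * (C1 * T) \<le> \<eta>" .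
  qed
  define F where "F = (\<lambda>x p. Ham V x (p + P))"
  \<comment> \<open>With this \<open>B\<close> the constants -B and B are a sub- and a
    supersolution, and \<open>\<delta> * B = C0\<close> bounds \<delta> times the solution
    independently of \<delta>.\<close>
  define B where "B = C0 / \<delta>"
  have \<delta>B: "\<delta> * B = C0" using \<delta> by (simp add: B_def)
  have Fc: "continuous_on UNIV (\<lambda>z. F (fst z) (snd z))"
    unfolding F_def Ham_def by (intro continuous_intros continuous_on_compose2[OF V_cont[of UNIV]]) auto
  have lo: "F x 0 \<le> \<delta> * B" and hi: "- (\<delta> * B) \<le> F x 0" for x
    using Ham_abs[of x P] by (auto simp: \<delta>B F_def C0_def abs_le_iff)
  have B: "B \<ge> 0" using C0 \<delta> by (simp add: B_def)
  note P = Fc \<delta>(1) lo hi B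
  define V1 where "V1 = upper_lim UNIV (\<lambda>e::real. perron_sup F \<delta> B)"
  define V2 where "V2 = (\<lambda>x. - upper_lim UNIV (\<lambda>e::real. \<lambda>x. - perron_sup F \<delta> B x) x)"
  have D1: "disc_sub F \<delta> B V1" unfolding V1_def by (rule disc_sub_perron_upper[OF P])
  have b1: "\<bar>V1 x\<bar> \<le> B" for x using D1 by (simp add: disc_sub_def)
  have per1: "Zperiodic V1" unfolding Zperiodic_def
  proof (intro allI ballI)
    fix x k :: 'a assume "k \<in> Zlat"
    then have "F (x + k) p = F x p" for x p using V_per by (simp add: F_def Ham_def Zperiodic_def)
    then show "V1 (x + k) = V1 x" unfolding V1_def by (rule perron_upper_periodic[OF P])
  qed
  have bdd1: "bounded (range V1)" using b1 by (auto simp: bounded_iff)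
  have sub1: "stat_visc_sub (Ham V) P a V1" if "\<And>x. - (\<delta> * V1 x) \<le> a" for a
    unfolding stat_visc_sub_def
  proof (intro conjI allI impI)
    show "usc V1" using D1 by (simp add: disc_sub_def usc_iff_usc_on)
    fix \<phi> g x assume "C1_test \<phi> g \<and> loc_max (\<lambda>y. V1 y - \<phi> y) x"
    then have "\<delta> * V1 x + F x (g x) \<le> 0" using D1 unfolding disc_sub_def by blast
    then show "Ham V x (g x + P) \<le> a" using that[of x] by (simp add: F_def)
  qed
  have "- (\<delta> * V1 x) \<le> C0" for x
    using mult_left_mono[of "- V1 x" B \<delta>] b1[of x] \<delta> \<delta>B by (simp add: abs_le_iff)
  \<comment> \<open>Removing the momentum P raises the level from \<open>C0\<close> to
    \<open>C1\<close>, which does not involve \<delta>.\<close>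
  from stat_visc_sub_change[OF sub1[OF this], of 0]
  have "stat_visc_sub (Ham V) 0 C1 V1" by (simp add: C1_def)
  then have osc: "V1 x \<le> V1 y + C1 * T" for x y by (rule T(2)[OF C0(2) _ bdd1 per1])
  have "- (\<delta> * V1 x) \<le> - (\<delta> * (V1 0 - C1 * T))" for x
    using mult_left_mono[of "V1 0 - C1 * T" "V1 x" \<delta>] osc[of 0 x] \<delta> by simp
  from sub1[OF this] have "- (\<delta> * (V1 0 - C1 * T)) \<in> levels P"
    using bdd1 per1 by (auto simp: levels_def)
  then have H: "Hbar V P \<le> - (\<delta> * (V1 0 - C1 * T))" by (rule Hbar_le)
  have V21: "V2 x \<le> V1 x" for x
    unfolding V1_def V2_def using order_trans[OF perron_lower_le[OF P] perron_upper_ge[OF P]] .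
  have V2b: "\<bar>V2 x\<bar> \<le> B" for x unfolding V2_def by (rule perron_lower_abs[OF P])
  \<comment> \<open>The discount term evaluated at the lower envelope becomes the constant
    right-hand side of the cell problem.\<close>
  have lev: "Hbar V P - \<eta> \<le> - (\<delta> * V2 x)" for x
  proof -
    have "\<delta> * V2 x \<le> \<delta> * (V1 0 + C1 * T)" using V21[of x] osc[of x 0] \<delta> by (intro mult_left_mono) auto
    then show ?thesis using H \<delta>(2) by (simp add: algebra_simps)
  qed
  have "stat_visc_super (Ham V) P (Hbar V P - \<eta>) V2"
    unfolding stat_visc_super_def stat_visc_sub_def
  proof (intro conjI allI impI)
    have "usc_on UNIV (upper_lim UNIV (\<lambda>e::real. \<lambda>x. - perron_sup F \<delta> B x))"
      by (rule usc_on_upper_lim[where B = B]) (use perron_abs[OF P] in simp)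
    then show "usc (\<lambda>x. - V2 x)" by (simp add: V2_def usc_iff_usc_on)
    fix \<phi> g x assume a: "C1_test \<phi> g \<and> loc_max (\<lambda>y. - V2 y - \<phi> y) x"
    then have "loc_min (\<lambda>y. V2 y - (- \<phi> y)) x" by (simp only: loc_max_minus)
    then have "\<delta> * V2 x + F x (- g x) \<ge> 0"
      using perron_lower_super[OF P, of "\<lambda>y. - \<phi> y" "\<lambda>y. - g y" x] C1_test_minus[of \<phi> g] a by (simp add: V2_def)
    then show "flipH (Ham V) x (g x + - P) \<le> - (Hbar V P - \<eta>)"
      using lev[of x] by (simp add: flipH_def F_def)
  qed
  then show ?thesis using V2b by blast
qed

end

theorem theorem6p12:
  fixes V :: "'a::euclidean_space \<Rightarrow> 'a"
    and u0 :: "'a \<Rightarrow> real"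
    and ue :: "real \<Rightarrow> 'a \<times> real \<Rightarrow> real"
  assumes V_per: "Zperiodic V"
    and V_lip: "\<exists>L. L-lipschitz_on UNIV V"
    and div_small: "(\<integral>\<^sup>+ x\<in>cell. ennreal (\<bar>divergence V x\<bar> ^ DIM('a)) \<partial>lborel)
                      \<le> ennreal ((1 / iso_const TYPE('a)) ^ DIM('a))"
    and u0_bdd: "bounded (range u0)"
    and u0_uc: "uniformly_continuous_on UNIV u0"
    and ue_sol: "\<And>\<epsilon>. \<epsilon> > 0 \<Longrightarrow>
        cauchy_visc_sol (\<lambda>x p. Ham V ((1 / \<epsilon>) *\<^sub>R x) p) u0 (ue \<epsilon>) \<and>
        bounded (ue \<epsilon> ` (UNIV \<times> {0..}))"
  shows "\<exists>u. cauchy_visc_sol (\<lambda>x p. Hbar V p) u0 u \<and> bounded (u ` (UNIV \<times> {0..})) \<and>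
          (\<forall>v. cauchy_visc_sol (\<lambda>x p. Hbar V p) u0 v \<and> bounded (v ` (UNIV \<times> {0..}))
               \<longrightarrow> (\<forall>x t. t \<ge> 0 \<longrightarrow> v (x, t) = u (x, t))) \<and>
          (\<forall>K. compact K \<and> K \<subseteq> UNIV \<times> {0..} \<longrightarrow> uniform_limit K ue u (at_right 0))"
proof -
  obtain L where L: "L-lipschitz_on UNIV V" using V_lip by blast
  have L0: "L \<ge> 0" using L by (rule lipschitz_on_nonneg)
  have Vl: "norm (V x - V y) \<le> L * norm (x - y)" for x y
    using lipschitz_onD[OF L, of x y] by (simp add: dist_norm)
  obtain M where M: "\<And>x. norm (V x) \<le> M"
    using Zperiodic_continuous_bounded[OF V_per lipschitz_on_continuous_on[OF L]] by blast
  interpret drift V L M by unfold_locales (use V_per Vl L0 M in auto)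
  show ?thesis
  proof (rule homogenization[where F = "Ham V" and G = "Hbar V" and K = "1 + M" and L = L])
    show "\<exists>w W. stat_visc_super (Ham V) P (Hbar V P - \<eta>) w \<and> (\<forall>x. \<bar>w x\<bar> \<le> W)" if "\<eta> > 0" for P \<eta>
      by (rule super_corrector[OF div_small that])
    show "\<exists>w W. stat_visc_sub (Ham V) P (Hbar V P + \<eta>) w \<and> (\<forall>x. \<bar>w x\<bar> \<le> W)" if "\<eta> > 0" for P \<eta>
      by (rule sub_corrector[OF that])
    show "continuous_on UNIV u0" using u0_uc by (rule uniformly_continuous_imp_continuous)
  qed (use Ham_lip_p Ham_lip_x Ham_0 Hbar_lip M0 L0 u0_bdd ue_sol in auto)
qed

end
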